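(* Let $n\ge 1$ and $\alpha>n/2$, and let $\mu\in\{1,-1\}$. Suppose $\Gamma_0=\{\gamma^{(k)}_0\}_{k\ge1}\in\mathcal H^\alpha_\xi$ for some $0<\xi<1$. Then there is a constant $C=C_{\alpha,n}>0$ depending only on $n$ and $\alpha$ such that, for fixed $0<T<\xi/C$ and $\eta=\xi-CT$, the following hold. (i) There exists a mild solution $\Gamma_t=\{\gamma^{(k)}_t\}_{k\ge1}\in C([0,T],\mathcal H^\alpha_\eta)$ of the cubic Gross–Pitaevskii hierarchy with initial data $\Gamma_0$, satisfying $$\sup_{t\in[0,T]}\|\Gamma_t\|_{\mathcal H^\alpha_\eta}\le \frac{\eta}{\xi}\,\|\Gamma_0\|_{\mathcal H^\alpha_\xi}.$$ (ii) For $T=\xi/(5C)$ (so $\eta=4\xi/5$), if $\Gamma_t,\Gamma'_t\in C([0,T],\mathcal H^\alpha_\eta)$ are two mild solutions of the cubic GP hierarchy with initial data $\Gamma_0,\Gamma'_0\in\mathcal H^\alpha_\xi$ respectively, then $$\sup_{t\in[0,T]}\|\Gamma_t-\Gamma'_t\|_{\mathcal H^\alpha_\eta}\le\frac45\,\|\Gamma_0-\Gamma'_0\|_{\mathcal H^\alpha_\xi}.$$ Consequently, the mild solution with initial data in $\mathcal H^\alpha_\xi$ is unique in $C([0,T],\mathcal H^\alpha_\eta)$ for any $0<T<\xi/C$.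
   Context: Notation: $\langle p\rangle=(1+|p|^2)^{1/2}$. For $k\ge1$, $\mathbf x_k=(x_1,\dots,x_k)\in\mathbb R^{kn}$. For $\alpha>0$, $\mathrm H^\alpha_k$ is the Hilbert space of $\gamma^{(k)}=\gamma^{(k)}(\mathbf x_k;\mathbf x'_k)\in L^2(\mathbb R^{kn}\times\mathbb R^{kn})$ with finite norm $\|\gamma^{(k)}\|_{\mathrm H^\alpha_k}=\|S^{(k,\alpha)}\gamma^{(k)}\|_{L^2}$, where $S^{(k,\alpha)}=\prod_{j=1}^k(1-\Delta_{x_j})^{\alpha/2}(1-\Delta_{x'_j})^{\alpha/2}$. For $0<\xi<1$, $\mathcal H^\alpha_\xi$ is the Banach space of sequences $\Gamma=\{\gamma^{(k)}\}_{k\ge1}$ with $\gamma^{(k)}\in\mathrm H^\alpha_k$ and $\|\Gamma\|_{\mathcal H^\alpha_\xi}=\sum_{k\ge1}\xi^k\|\gamma^{(k)}\|_{\mathrm H^\alpha_k}<\infty$. Free evolution: $\mathcal U^{(k)}_0(t)\gamma^{(k)}=e^{it\Delta^{(k)}}\gamma^{(k)}e^{-it\Delta^{(k)}}$ with $\Delta^{(k)}=\sum_{j=1}^k\Delta_{x_j}$ (on kernels: $e^{it\sum_j(\Delta_{x_j}-\Delta_{x'_j})}\gamma^{(k)}(\mathbf x_k;\mathbf x'_k)$); it is an isometry of $\mathrm H^\alpha_k$. Interaction operator: for Schwartz $\gamma^{(k+1)}$ on $\mathbb R^{(k+1)n}\times\mathbb R^{(k+1)n}$ and $1\le j\le k$,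 $(B^1_{j,k}\gamma^{(k+1)})(\mathbf x_k;\mathbf x'_k)=\gamma^{(k+1)}(x_1,\dots,x_k,x_j;x'_1,\dots,x'_k,x_j)$ and $(B^2_{j,k}\gamma^{(k+1)})(\mathbf x_k;\mathbf x'_k)=\gamma^{(k+1)}(x_1,\dots,x_k,x'_j;x'_1,\dots,x'_k,x'_j)$, and $B^{(k)}=\sum_{j=1}^k(B^1_{j,k}-B^2_{j,k})$ (formally $B^{(k)}\gamma^{(k+1)}=\sum_j\mathrm{tr}_{k+1}[\delta(x_j-x_{k+1}),\gamma^{(k+1)}]$). For $\alpha>n/2$, $B^{(k)}$ extends to a bounded operator $\mathrm H^\alpha_{k+1}\to\mathrm H^\alpha_k$ with norm at most $C_{\alpha,n}k$ (Lemma 3.2), and this extension is used below. Mild solution: for $T>0$, $\Gamma_t=\{\gamma^{(k)}_t\}\in C([0,T],\mathcal H^\alpha_\xi)$ is a (mild) solution of the cubic GP hierarchy $i\partial_t\gamma^{(k)}_t=[-\Delta^{(k)},\gamma^{(k)}_t]+\mu B^{(k)}\gamma^{(k+1)}_t$ with initial data $\Gamma_0$ if for every $k\ge1$ and $t\in[0,T]$, $\gamma^{(k)}_t=\mathcal U^{(k)}_0(t)\gamma^{(k)}_0+\int_0^t\mathcal U^{(k)}_0(t-s)\tilde B^{(k)}\gamma^{(k+1)}_s\,ds$ in $\mathrm H^\alpha_k$, where $\tilde B^{(k)}=-i\mu B^{(k)}$. *)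

theory Defs
  imports "HOL-Analysis.Analysis"
begin

text \<open>Configurations of k particles in R^n: functions nat => real^n, only the
  coordinates 0..k-1 are relevant (extensional, as in the product measure PiM).
  A k-particle kernel gamma(x_k; x'_k) is a complex function of a pair of
  configurations.  Indices are 0-based: particle j of the paper is index j-1,
  particle k+1 is index k.\<close>

type_synonym 'n cfg = "nat \<Rightarrow> real^'n"
type_synonym 'n kernel = "'n cfg \<times> 'n cfg \<Rightarrow> complex"

definition Mk :: "nat \<Rightarrow> ('n::finite cfg \<times> 'n cfg) measure" where
  "Mk k = (PiM {..<k} (\<lambda>_. lborel)) \<Otimes>\<^sub>M (PiM {..<k} (\<lambda>_. lborel))"

definition L2 :: "nat \<Rightarrow> 'n::finite kernel \<Rightarrow> bool" where
  "L2 k f \<longleftrightarrow> f \<in> borel_measurable (Mk k) \<and> integrable (Mk k) (\<lambda>z. (cmod (f z))^2)"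

definition dotk :: "nat \<Rightarrow> 'n::finite cfg \<times> 'n cfg \<Rightarrow> 'n cfg \<times> 'n cfg \<Rightarrow> real" where
  "dotk k z w = (\<Sum>j<k. fst z j \<bullet> fst w j + snd z j \<bullet> snd w j)"

definition FT :: "nat \<Rightarrow> 'n::finite kernel \<Rightarrow> 'n kernel" where
  "FT k \<phi> w = (LINT z|Mk k. cis (- dotk k z w) * \<phi> z)"

text \<open>g is the (Plancherel) L^2 Fourier transform of f: the distributional
  characterisation by the multiplication formula against all test functions
  in L^1 \<inter> L^2 (this determines g uniquely a.e.).\<close>
definition is_FT :: "nat \<Rightarrow> 'n::finite kernel \<Rightarrow> 'n kernel \<Rightarrow> bool" where
  "is_FT k f g \<longleftrightarrow> L2 k g \<and>
     (\<forall>\<phi>. \<phi> \<in> borel_measurable (Mk k) \<and> integrable (Mk k) \<phi> \<and> L2 k \<phi> \<longrightarrow>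
        (LINT w|Mk k. g w * \<phi> w) = (LINT z|Mk k. f z * FT k \<phi> z))"

definition jbr :: "real^'n::finite \<Rightarrow> real" where
  "jbr p = sqrt (1 + (norm p)^2)"

definition wS :: "real \<Rightarrow> nat \<Rightarrow> 'n::finite cfg \<times> 'n cfg \<Rightarrow> real" where
  "wS \<alpha> k w = (\<Prod>j<k. jbr (fst w j) powr \<alpha> * jbr (snd w j) powr \<alpha>)"

definition is_S :: "real \<Rightarrow> nat \<Rightarrow> 'n::finite kernel \<Rightarrow> 'n kernel \<Rightarrow> bool" where
  "is_S \<alpha> k \<gamma> h \<longleftrightarrow> L2 k h \<and> (\<exists>g. is_FT k \<gamma> g \<and> is_FT k h (\<lambda>w. of_real (wS \<alpha> k w) * g w))"

definition inH :: "real \<Rightarrow> nat \<Rightarrow> 'n::finite kernel \<Rightarrow> bool" where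
  "inH \<alpha> k \<gamma> \<longleftrightarrow> L2 k \<gamma> \<and> (\<exists>h. is_S \<alpha> k \<gamma> h)"

definition Sop :: "real \<Rightarrow> nat \<Rightarrow> 'n::finite kernel \<Rightarrow> 'n kernel" where
  "Sop \<alpha> k \<gamma> = (SOME h. is_S \<alpha> k \<gamma> h)"

definition Hnorm :: "real \<Rightarrow> nat \<Rightarrow> 'n::finite kernel \<Rightarrow> real" where
  "Hnorm \<alpha> k \<gamma> = sqrt (LINT z|Mk k. (cmod (Sop \<alpha> k \<gamma> z))^2)"

definition Hinner :: "real \<Rightarrow> nat \<Rightarrow> 'n::finite kernel \<Rightarrow> 'n kernel \<Rightarrow> complex" where
  "Hinner \<alpha> k \<gamma> \<phi> = (LINT z|Mk k. Sop \<alpha> k \<gamma> z * cnj (Sop \<alpha> k \<phi> z))"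

text \<open>Free evolution U_0^(k)(t) = exp(it sum_j (Delta_{x_j} - Delta_{x'_j})),
  Fourier multiplier exp(it sum_j (|p'_j|^2 - |p_j|^2)).\<close>
definition Uop :: "nat \<Rightarrow> real \<Rightarrow> 'n::finite kernel \<Rightarrow> 'n kernel" where
  "Uop k t \<gamma> = (SOME u. L2 k u \<and> (\<exists>g. is_FT k \<gamma> g \<and>
      is_FT k u (\<lambda>w. cis (t * (\<Sum>j<k. (norm (snd w j))^2 - (norm (fst w j))^2)) * g w)))"

text \<open>Schwartz class on R^{mn} x R^{mn}: all iterated partial derivatives exist
  and are rapidly decreasing.  A direction is (primed?, particle, coordinate).\<close>
definition shift :: "bool \<times> nat \<times> 'n \<Rightarrow> real \<Rightarrow> 'n::finite cfg \<times> 'n cfg \<Rightarrow> 'n cfg \<times> 'n cfg" where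
  "shift d h z = (case d of (s, j, i) \<Rightarrow>
     if s then (fst z, (snd z)(j := snd z j + h *\<^sub>R axis i 1))
     else ((fst z)(j := fst z j + h *\<^sub>R axis i 1), snd z))"

definition schwartz :: "nat \<Rightarrow> 'n::finite kernel \<Rightarrow> bool" where
  "schwartz m f \<longleftrightarrow> (\<exists>F :: (bool \<times> nat \<times> 'n) list \<Rightarrow> 'n kernel.
     F [] = f \<and>
     (\<forall>ds d z. z \<in> space (Mk m) \<and> fst (snd d) < m \<longrightarrow>
        ((\<lambda>h. F ds (shift d h z)) has_vector_derivative F (d # ds) z) (at 0)) \<and>
     (\<forall>ds (N::nat). \<exists>C. \<forall>z \<in> space (Mk m).
        (1 + (\<Sum>j<m. (norm (fst z j))^2 + (norm (snd z j))^2))^N * cmod (F ds z) \<le> C))"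

definition B0 :: "nat \<Rightarrow> 'n::finite kernel \<Rightarrow> 'n kernel" where
  "B0 k \<gamma> z = (\<Sum>j<k. \<gamma> ((fst z)(k := fst z j), (snd z)(k := fst z j))
                    - \<gamma> ((fst z)(k := snd z j), (snd z)(k := snd z j)))"

definition B_ext :: "real \<Rightarrow> nat \<Rightarrow> 'n::finite kernel \<Rightarrow> 'n kernel" where
  "B_ext \<alpha> k \<gamma> = (SOME h. inH \<alpha> k h \<and>
     (\<exists>s. (\<forall>i. schwartz (Suc k) (s i)) \<and>
          (\<lambda>i. Hnorm \<alpha> (Suc k) (\<lambda>z. s i z - \<gamma> z)) \<longlonglongrightarrow> 0 \<and>
          (\<lambda>i. Hnorm \<alpha> k (\<lambda>z. B0 k (s i) z - h z)) \<longlonglongrightarrow> 0))"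

definition Btil :: "real \<Rightarrow> real \<Rightarrow> nat \<Rightarrow> 'n::finite kernel \<Rightarrow> 'n kernel" where
  "Btil \<alpha> \<mu> k \<gamma> = (\<lambda>z. - \<i> * of_real \<mu> * B_ext \<alpha> k \<gamma> z)"

text \<open>The space H^alpha_xi of sequences (index 0 is ignored; k >= 1).\<close>
definition inHseq :: "real \<Rightarrow> real \<Rightarrow> (nat \<Rightarrow> 'n::finite kernel) \<Rightarrow> bool" where
  "inHseq \<alpha> \<xi> \<Gamma> \<longleftrightarrow> (\<forall>k\<ge>1. inH \<alpha> k (\<Gamma> k)) \<and>
     summable (\<lambda>k. \<xi> ^ Suc k * Hnorm \<alpha> (Suc k) (\<Gamma> (Suc k)))"

definition Hseq_norm :: "real \<Rightarrow> real \<Rightarrow> (nat \<Rightarrow> 'n::finite kernel) \<Rightarrow> real" where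
  "Hseq_norm \<alpha> \<xi> \<Gamma> = (\<Sum>k. \<xi> ^ Suc k * Hnorm \<alpha> (Suc k) (\<Gamma> (Suc k)))"

definition seq_diff :: "(nat \<Rightarrow> 'n::finite kernel) \<Rightarrow> (nat \<Rightarrow> 'n kernel) \<Rightarrow> nat \<Rightarrow> 'n kernel" where
  "seq_diff \<Gamma> \<Gamma>' = (\<lambda>k z. \<Gamma> k z - \<Gamma>' k z)"

definition cont_H :: "real \<Rightarrow> real \<Rightarrow> real \<Rightarrow> (real \<Rightarrow> nat \<Rightarrow> 'n::finite kernel) \<Rightarrow> bool" where
  "cont_H \<alpha> \<eta> T \<Gamma> \<longleftrightarrow> (\<forall>t\<in>{0..T}. inHseq \<alpha> \<eta> (\<Gamma> t)) \<and>
     (\<forall>t0\<in>{0..T}. \<forall>\<epsilon>>0. \<exists>\<delta>>0. \<forall>t\<in>{0..T}. \<bar>t - t0\<bar> < \<delta> \<longrightarrow>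
        Hseq_norm \<alpha> \<eta> (seq_diff (\<Gamma> t) (\<Gamma> t0)) < \<epsilon>)"

text \<open>Mild (Duhamel) solution; the H^alpha_k-valued integral identity is stated
  weakly, tested against every element of H^alpha_k via its inner product.\<close>
definition mild :: "real \<Rightarrow> real \<Rightarrow> real \<Rightarrow> (nat \<Rightarrow> 'n::finite kernel) \<Rightarrow> (real \<Rightarrow> nat \<Rightarrow> 'n kernel) \<Rightarrow> bool" where
  "mild \<alpha> \<mu> T \<Gamma>0 \<Gamma> \<longleftrightarrow> (\<forall>k\<ge>1. \<forall>t\<in>{0..T}. \<forall>\<phi>. inH \<alpha> k \<phi> \<longrightarrow>
      Hinner \<alpha> k (\<lambda>z. \<Gamma> t k z - Uop k t (\<Gamma>0 k) z) \<phi> =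
      integral {0..t} (\<lambda>s. Hinner \<alpha> k (Uop k (t - s) (Btil \<alpha> \<mu> k (\<Gamma> s (Suc k)))) \<phi>))"

end

theory Submission
  imports Defs "HOL-Probability.Characteristic_Functions" "HOL-Probability.Discrete_Topology"
begin

text \<open>
In momentum variables, with the Sobolev weight absorbed, every level of the hierarchy becomes an
L2 space on which the free evolution is multiplication by a phase. The interaction operator becomes
a sum of integral operators whose kernels are square integrable in the integration variable,
uniformly in the other one, exactly because \<open>\<alpha>\<close> exceeds half the dimension; the Cauchy-Schwarz
inequality then bounds it by \<open>C * k\<close> from level \<open>k + 1\<close> to level \<open>k\<close>. By induction, the \<open>m\<close>-th Duhamel term at level
\<open>i + 1\<close> is at most \<open>((i + m) choose m) * (C * t) ^ m\<close> times the norm of the datum at level \<open>i + m + 1\<close>,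
and the binomial theorem resums these bounds with weights \<open>\<eta> ^ (i + 1)\<close> to weights \<open>(\<eta> + C * T) ^ (i + 1)\<close>.
For the difference of two solutions the same iteration leaves a remainder of order
\<open>((i + m) choose m) * (C * t / \<eta>) ^ m\<close>, which vanishes in the limit when \<open>C * t < \<eta>\<close>.
\<close>

text \<open>The definitions fix every operator only indirectly: the L2 transform enters through
  duality, and \<open>Sop\<close>, \<open>Uop\<close> and \<open>B_ext\<close> are choices of
  functions determined up to null sets. Nothing can be computed before Plancherel's theorem is
  available for \<open>is_FT\<close>, and nothing about \<open>B_ext\<close> before Schwartz
  functions are known to be dense and their restriction to the diagonal, a null set, has been
  computed pointwise. Gaussians serve both needs: the heat kernel replaces the delta function in
  Plancherel's theorem, and it smooths cut-off transforms into transforms of Schwartz functions. Two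
  more obstacles shape the end. The levels live over different measures, while vector-valued
  integration asks for one Banach space; hence the embedding of all levels into a single space of
  bounded functions. And the bound on a given solution controls the iteration only while
  \<open>C * t < \<eta>\<close>, which fails on part of the interval once T reaches half of
  \<open>\<xi> / C\<close>; uniqueness there needs a subdivision in time.\<close>

type_synonym 'n pts = "'n cfg \<times> 'n cfg"

abbreviation Mk2 :: "nat \<Rightarrow> ('n::finite pts \<times> 'n pts) measure" where
  "Mk2 k \<equiv> Mk k \<Otimes>\<^sub>M Mk k"

section \<open>Square-integrable functions\<close>

lemma borel_measurable_cnj [measurable (raw)]:
  "f \<in> borel_measurable M \<Longrightarrow> (\<lambda>z. cnj (f z)) \<in> borel_measurable M"
  by (rule measurable_compose[of f M borel])
    (assumption, intro borel_measurable_continuous_onI continuous_on_cnj continuous_on_id)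

text \<open>Stated over an arbitrary measure: it is applied to \<open>Mk k\<close>, to the pair
  space \<open>Mk2 k\<close> and to the momentum space \<open>QQ\<close>.\<close>

definition sqi :: "'a measure \<Rightarrow> ('a \<Rightarrow> complex) \<Rightarrow> bool" where
  "sqi M f \<longleftrightarrow> f \<in> borel_measurable M \<and> integrable M (\<lambda>z. (cmod (f z))\<^sup>2)"

definition ip :: "'a measure \<Rightarrow> ('a \<Rightarrow> complex) \<Rightarrow> ('a \<Rightarrow> complex) \<Rightarrow> complex" where
  "ip M f g = (LINT z|M. f z * cnj (g z))"

definition nrm :: "'a measure \<Rightarrow> ('a \<Rightarrow> complex) \<Rightarrow> real" where
  "nrm M f = sqrt (LINT z|M. (cmod (f z))\<^sup>2)"

lemma sqi_meas [measurable_dest]: "sqi M f \<Longrightarrow> f \<in> borel_measurable M"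
  by (simp add: sqi_def)

lemma sqi_int: "sqi M f \<Longrightarrow> integrable M (\<lambda>z. (cmod (f z))\<^sup>2)"
  by (simp add: sqi_def)

lemma nrm_ge0 [simp]: "nrm M f \<ge> 0"
  by (simp add: nrm_def)

lemma nrm_sq: "(nrm M f)\<^sup>2 = (LINT z|M. (cmod (f z))\<^sup>2)"
  by (simp add: nrm_def)

lemma nn_nrm: "sqi M f \<Longrightarrow> (\<integral>\<^sup>+z. ennreal ((cmod (f z))\<^sup>2) \<partial>M) = ennreal ((nrm M f)\<^sup>2)"
  unfolding nrm_sq by (intro nn_integral_eq_integral sqi_int) auto

text \<open>Tonelli and Fatou deliver bounds on \<open>nn_integral\<close> before integrability is
  known; this turns such a bound into membership and a norm estimate.\<close>

lemma sqi_nnI: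
  assumes [measurable]: "f \<in> borel_measurable M" and le: "(\<integral>\<^sup>+z. ennreal ((cmod (f z))\<^sup>2) \<partial>M) \<le> ennreal (c\<^sup>2)"
    and "c \<ge> 0"
  shows "sqi M f" "nrm M f \<le> c"
proof -
  show s: "sqi M f"
    unfolding sqi_def using le
    by (auto intro!: integrableI_bounded simp: le_less_trans)
  have "ennreal ((nrm M f)\<^sup>2) \<le> ennreal (c\<^sup>2)"
    using le nn_nrm[OF s] by simp
  then have "(nrm M f)\<^sup>2 \<le> c\<^sup>2" by (simp add: ennreal_le_iff)
  then show "nrm M f \<le> c" using \<open>c \<ge> 0\<close> by (rule power2_le_imp_le)
qed

lemma sqi_bound:
  assumes "sqi M g" and [measurable]: "f \<in> borel_measurable M"
    and "AE z in M. cmod (f z) \<le> c * cmod (g z)"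
  shows "sqi M f"
proof -
  have "integrable M (\<lambda>z. c\<^sup>2 * (cmod (g z))\<^sup>2)" using sqi_int[OF assms(1)] by simp
  then have "integrable M (\<lambda>z. (cmod (f z))\<^sup>2)"
  proof (rule Bochner_Integration.integrable_bound)
    show "AE z in M. norm ((cmod (f z))\<^sup>2) \<le> norm (c\<^sup>2 * (cmod (g z))\<^sup>2)"
      using assms(3)
    proof eventually_elim
      case (elim z)
      then have "(cmod (f z))\<^sup>2 \<le> (c * cmod (g z))\<^sup>2" by (intro power_mono) auto
      then show ?case by (simp add: power_mult_distrib)
    qed
  qed measurable
  then show ?thesis by (simp add: sqi_def)
qed

lemma nrm_bound:
  assumes "sqi M g" and "f \<in> borel_measurable M"
    and "AE z in M. cmod (f z) \<le> c * cmod (g z)" "c \<ge> 0"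
  shows "nrm M f \<le> c * nrm M g"
proof -
  have "(nrm M f)\<^sup>2 \<le> (LINT z|M. c\<^sup>2 * (cmod (g z))\<^sup>2)"
    unfolding nrm_sq
  proof (rule integral_mono_AE)
    show "integrable M (\<lambda>z. (cmod (f z))\<^sup>2)" using sqi_int[OF sqi_bound[OF assms(1-3)]] .
    show "integrable M (\<lambda>z. c\<^sup>2 * (cmod (g z))\<^sup>2)" using sqi_int[OF assms(1)] by simp
    show "AE z in M. (cmod (f z))\<^sup>2 \<le> c\<^sup>2 * (cmod (g z))\<^sup>2"
      using assms(3)
      by eventually_elim (metis norm_ge_zero power_mono power_mult_distrib)
  qed
  also have "\<dots> = (c * nrm M g)\<^sup>2" by (simp add: nrm_sq power_mult_distrib)
  finally show ?thesis by (rule power2_le_imp_le) (simp add: assms(4))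
qed

lemma sqi_cong_AE:
  assumes "sqi M f" "g \<in> borel_measurable M" "AE z in M. f z = g z"
  shows "sqi M g"
  using assms(3) by (intro sqi_bound[OF assms(1,2), of 1]) auto

lemma nrm_cong_AE:
  assumes "f \<in> borel_measurable M" "g \<in> borel_measurable M" "AE z in M. f z = g z"
  shows "nrm M f = nrm M g"
proof -
  note [measurable] = assms(1,2)
  have "(LINT z|M. (cmod (f z))\<^sup>2) = (LINT z|M. (cmod (g z))\<^sup>2)"
    using assms(3) by (intro integral_cong_AE) auto
  then show ?thesis by (simp add: nrm_def)
qed

lemma ip_cong_AE:
  assumes "f \<in> borel_measurable M" "g \<in> borel_measurable M" "AE z in M. f z = g z"
    "f' \<in> borel_measurable M" "g' \<in> borel_measurable M" "AE z in M. f' z = g' z"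
  shows "ip M f f' = ip M g g'"
proof -
  note [measurable] = assms(1,2,4,5)
  show ?thesis unfolding ip_def
    using assms(3,6) by (intro integral_cong_AE) auto
qed

lemma sqi_int_mult_abs:
  assumes f: "sqi M f" and g: "sqi M g"
  shows "integrable M (\<lambda>z. cmod (f z) * cmod (g z))"
proof -
  note [measurable] = sqi_meas[OF f] sqi_meas[OF g]
  have "integrable M (\<lambda>z. (cmod (f z))\<^sup>2 + (cmod (g z))\<^sup>2)"
    using sqi_int[OF f] sqi_int[OF g] by simp
  then show ?thesis
  proof (rule Bochner_Integration.integrable_bound)
    have "a * b \<le> a\<^sup>2 + b\<^sup>2" if "a \<ge> 0" "b \<ge> 0" for a b :: real
      using sum_squares_bound[of a b] that mult_nonneg_nonneg[of a b] by linarith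
    then show "AE z in M. norm (cmod (f z) * cmod (g z)) \<le> norm ((cmod (f z))\<^sup>2 + (cmod (g z))\<^sup>2)"
      by (auto simp: abs_mult)
  qed measurable
qed

lemma sqi_int_mult:
  assumes f: "sqi M f" and g: "sqi M g"
  shows "integrable M (\<lambda>z. f z * g z)"
proof -
  note [measurable] = sqi_meas[OF f] sqi_meas[OF g]
  show ?thesis
    by (rule Bochner_Integration.integrable_bound[OF sqi_int_mult_abs[OF f g]]) (auto simp: norm_mult)
qed

lemma sqi_cnj: "sqi M f \<Longrightarrow> sqi M (\<lambda>z. cnj (f z))"
  unfolding sqi_def by (auto intro: borel_measurable_cnj)

lemma nrm_cnj: "nrm M (\<lambda>z. cnj (f z)) = nrm M f"
  by (simp add: nrm_def)

lemma sqi_cnj_iff [simp]: "sqi M (\<lambda>z. cnj (f z)) \<longleftrightarrow> sqi M f"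
  using sqi_cnj[of M f] sqi_cnj[of M "\<lambda>z. cnj (f z)"] by auto

lemma sqi_int_ip: "sqi M f \<Longrightarrow> sqi M g \<Longrightarrow> integrable M (\<lambda>z. f z * cnj (g z))"
  by (intro sqi_int_mult) auto

lemma sqi_scale: "sqi M f \<Longrightarrow> sqi M (\<lambda>z. c * f z)"
  by (rule sqi_bound[of M f _ "cmod c"]) (auto simp: norm_mult sqi_meas)

lemma sqi_zero [simp]: "sqi M (\<lambda>z. 0)"
  by (simp add: sqi_def)

lemma sqi_add:
  assumes f: "sqi M f" and g: "sqi M g"
  shows "sqi M (\<lambda>z. f z + g z)"
proof -
  note [measurable] = sqi_meas[OF f] sqi_meas[OF g]
  have "integrable M (\<lambda>z. 2 * ((cmod (f z))\<^sup>2 + (cmod (g z))\<^sup>2))"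
    using sqi_int[OF f] sqi_int[OF g] by simp
  then have "integrable M (\<lambda>z. (cmod (f z + g z))\<^sup>2)"
  proof (rule Bochner_Integration.integrable_bound)
    have "(cmod (a + b))\<^sup>2 \<le> 2 * ((cmod a)\<^sup>2 + (cmod b)\<^sup>2)" for a b
    proof -
      have "(cmod (a + b))\<^sup>2 \<le> (cmod a + cmod b)\<^sup>2" by (intro power_mono norm_triangle_ineq) auto
      also have "\<dots> \<le> 2 * ((cmod a)\<^sup>2 + (cmod b)\<^sup>2)"
        using sum_squares_bound[of "cmod a" "cmod b"] by (simp add: power2_sum)
      finally show ?thesis .
    qed
    then show "AE z in M. norm ((cmod (f z + g z))\<^sup>2) \<le> norm (2 * ((cmod (f z))\<^sup>2 + (cmod (g z))\<^sup>2))"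
      by auto
  qed measurable
  then show ?thesis by (auto simp: sqi_def)
qed

lemma sqi_diff: "sqi M f \<Longrightarrow> sqi M g \<Longrightarrow> sqi M (\<lambda>z. f z - g z)"
  using sqi_add[of M f "\<lambda>z. -1 * g z"] sqi_scale[of M g "-1"] by simp

lemma sqi_sum: "(\<And>i. i \<in> I \<Longrightarrow> sqi M (f i)) \<Longrightarrow> sqi M (\<lambda>z. \<Sum>i\<in>I. f i z)"
  by (induction I rule: infinite_finite_induct) (auto intro: sqi_add)

lemma sqi_indicator: "A \<in> sets M \<Longrightarrow> emeasure M A < \<infinity> \<Longrightarrow> sqi M (indicator A)"
proof -
  assume A: "A \<in> sets M" "emeasure M A < \<infinity>"
  have "(\<lambda>z. (cmod (indicator A z :: complex))\<^sup>2) = (indicator A :: _ \<Rightarrow> real)"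
    by (auto simp: indicator_def fun_eq_iff)
  then show ?thesis using A by (simp add: sqi_def)
qed

lemma nrm_scale: "nrm M (\<lambda>z. c * f z) = cmod c * nrm M f"
  by (simp add: nrm_def norm_mult power_mult_distrib real_sqrt_mult)

lemma nrm_minus_commute: "nrm M (\<lambda>z. f z - g z) = nrm M (\<lambda>z. g z - f z)"
  by (simp add: nrm_def norm_minus_commute)

lemma nrm_zero_AE:
  assumes "sqi M f" "nrm M f = 0"
  shows "AE z in M. f z = 0"
proof -
  have "(LINT z|M. (cmod (f z))\<^sup>2) = 0" using assms(2) by (simp add: nrm_def)
  then have "AE z in M. (cmod (f z))\<^sup>2 = 0"
    using integral_nonneg_eq_0_iff_AE[OF sqi_int[OF assms(1)]] by simp
  then show ?thesis by simp
qed

section \<open>Cauchy-Schwarz, triangle inequality and polarization\<close>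

lemma holder2:
  assumes f: "sqi M f" and g: "sqi M g"
  shows "(LINT z|M. cmod (f z) * cmod (g z)) \<le> nrm M f * nrm M g"
proof -
  note [measurable] = sqi_meas[OF f] sqi_meas[OF g]
  show ?thesis
  proof (cases "nrm M f = 0 \<or> nrm M g = 0")
    case True
    then have "AE z in M. cmod (f z) * cmod (g z) = 0"
      using nrm_zero_AE[OF f] nrm_zero_AE[OF g] by (auto elim: AE_mp)
    then have "(LINT z|M. cmod (f z) * cmod (g z)) = (LINT z|M. 0)"
      by (intro integral_cong_AE) auto
    then show ?thesis by simp
  next
    case False
    define A B where "A = nrm M f" and "B = nrm M g"
    have AB: "A > 0" "B > 0" using False by (auto simp: A_def B_def less_le)
    have "(LINT z|M. cmod (f z) * cmod (g z)) \<le>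
        (LINT z|M. (B / A / 2) * (cmod (f z))\<^sup>2 + (A / B / 2) * (cmod (g z))\<^sup>2)"
    proof (rule integral_mono)
      show "integrable M (\<lambda>z. cmod (f z) * cmod (g z))" by (rule sqi_int_mult_abs[OF f g])
      show "integrable M (\<lambda>z. (B / A / 2) * (cmod (f z))\<^sup>2 + (A / B / 2) * (cmod (g z))\<^sup>2)"
        using sqi_int[OF f] sqi_int[OF g] by simp
      fix z
      define a b where "a = cmod (f z)" and "b = cmod (g z)"
      \<comment> \<open>Weighted Young inequality: with the ratio of the norms as weight, both
        squares integrate to \<open>A * B / 2\<close>.\<close>
      have "0 \<le> (B * a - A * b)\<^sup>2 / (2 * A * B)" using AB by simp
      also have "\<dots> = (B / A / 2) * a\<^sup>2 + (A / B / 2) * b\<^sup>2 - a * b"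
        using AB by (simp add: field_simps power2_eq_square)
      finally show "cmod (f z) * cmod (g z) \<le> (B / A / 2) * (cmod (f z))\<^sup>2 + (A / B / 2) * (cmod (g z))\<^sup>2"
        by (simp add: a_def b_def)
    qed
    also have "\<dots> = (B / A / 2) * A\<^sup>2 + (A / B / 2) * B\<^sup>2"
      using sqi_int[OF f] sqi_int[OF g] by (simp add: A_def B_def nrm_sq)
    also have "\<dots> = A * B" using AB by (simp add: field_simps power2_eq_square)
    finally show ?thesis by (simp add: A_def B_def)
  qed
qed

lemma cauchy_schwarz_ip:
  assumes f: "sqi M f" and g: "sqi M g"
  shows "cmod (ip M f g) \<le> nrm M f * nrm M g"
proof -
  have "cmod (ip M f g) \<le> (LINT z|M. cmod (f z * cnj (g z)))"
    unfolding ip_def by (rule integral_norm_bound)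
  also have "\<dots> \<le> nrm M f * nrm M g" using holder2[OF f g] by (simp add: norm_mult)
  finally show ?thesis .
qed

lemma nrm_triangle:
  assumes f: "sqi M f" and g: "sqi M g"
  shows "nrm M (\<lambda>z. f z + g z) \<le> nrm M f + nrm M g"
proof -
  have "(nrm M (\<lambda>z. f z + g z))\<^sup>2 \<le>
     (LINT z|M. (cmod (f z))\<^sup>2 + 2 * (cmod (f z) * cmod (g z)) + (cmod (g z))\<^sup>2)"
    unfolding nrm_sq
  proof (rule integral_mono)
    fix z
    have "(cmod (f z + g z))\<^sup>2 \<le> (cmod (f z) + cmod (g z))\<^sup>2" by (intro power_mono norm_triangle_ineq) auto
    then show "(cmod (f z + g z))\<^sup>2 \<le> (cmod (f z))\<^sup>2 + 2 * (cmod (f z) * cmod (g z)) + (cmod (g z))\<^sup>2"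
      by (simp add: power2_sum)
  qed (use sqi_int[OF sqi_add[OF f g]] sqi_int[OF f] sqi_int[OF g] sqi_int_mult_abs[OF f g] in auto)
  also have "\<dots> = (nrm M f)\<^sup>2 + 2 * (LINT z|M. cmod (f z) * cmod (g z)) + (nrm M g)\<^sup>2"
    using sqi_int[OF f] sqi_int[OF g] sqi_int_mult_abs[OF f g] by (simp add: nrm_sq)
  also have "\<dots> \<le> (nrm M f + nrm M g)\<^sup>2"
    using holder2[OF f g] by (simp add: power2_sum)
  finally show ?thesis by (rule power2_le_imp_le) simp
qed

lemma nrm_triangle_diff:
  assumes f: "sqi M f" and g: "sqi M g" and h: "sqi M h"
  shows "nrm M (\<lambda>z. f z - h z) \<le> nrm M (\<lambda>z. f z - g z) + nrm M (\<lambda>z. g z - h z)"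
  using nrm_triangle[OF sqi_diff[OF f g] sqi_diff[OF g h]] by simp

lemma nrm_diff_ge:
  assumes f: "sqi M f" and g: "sqi M g"
  shows "\<bar>nrm M f - nrm M g\<bar> \<le> nrm M (\<lambda>z. f z - g z)"
  using nrm_triangle[OF sqi_diff[OF f g] g] nrm_triangle[OF sqi_diff[OF g f] f] nrm_minus_commute[of M f g]
  by simp

lemma ip_add_left: "sqi M f \<Longrightarrow> sqi M g \<Longrightarrow> sqi M h \<Longrightarrow> ip M (\<lambda>z. f z + g z) h = ip M f h + ip M g h"
  unfolding ip_def by (simp add: distrib_right sqi_int_ip)

lemma ip_diff_left: "sqi M f \<Longrightarrow> sqi M g \<Longrightarrow> sqi M h \<Longrightarrow> ip M (\<lambda>z. f z - g z) h = ip M f h - ip M g h"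
  unfolding ip_def by (simp add: left_diff_distrib sqi_int_ip)

lemma ip_scale_left: "ip M (\<lambda>z. c * f z) h = c * ip M f h"
  unfolding ip_def by (simp add: mult.assoc)

lemma ip_add_right: "sqi M f \<Longrightarrow> sqi M g \<Longrightarrow> sqi M h \<Longrightarrow> ip M h (\<lambda>z. f z + g z) = ip M h f + ip M h g"
  unfolding ip_def by (simp add: distrib_left sqi_int_ip)

lemma ip_diff_right: "sqi M f \<Longrightarrow> sqi M g \<Longrightarrow> sqi M h \<Longrightarrow> ip M h (\<lambda>z. f z - g z) = ip M h f - ip M h g"
  unfolding ip_def by (simp add: right_diff_distrib sqi_int_ip)

lemma ip_scale_right: "ip M h (\<lambda>z. c * f z) = cnj c * ip M h f"
  unfolding ip_def by (simp add: mult.left_commute)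

lemma ip_self: "ip M f f = of_real ((nrm M f)\<^sup>2)"
proof -
  have "(LINT z|M. complex_of_real ((cmod (f z))\<^sup>2)) = of_real (LINT z|M. (cmod (f z))\<^sup>2)"
    by (rule integral_complex_of_real)
  then show ?thesis unfolding ip_def nrm_sq complex_norm_square by simp
qed

text \<open>Norms determine inner products, so Parseval's identity \<open>is_FT_ip\<close> will
  follow from the isometry \<open>is_FT_nrm\<close> and linearity.\<close>

lemma ip_polarization:
  assumes f: "sqi M f" and g: "sqi M g"
  shows "4 * ip M f g = of_real ((nrm M (\<lambda>z. f z + g z))\<^sup>2) - of_real ((nrm M (\<lambda>z. f z - g z))\<^sup>2)
     + \<i> * of_real ((nrm M (\<lambda>z. f z + \<i> * g z))\<^sup>2) - \<i> * of_real ((nrm M (\<lambda>z. f z - \<i> * g z))\<^sup>2)"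
proof -
  have e: "ip M (\<lambda>z. f z + h z) (\<lambda>z. f z + h z) = ip M f f + ip M f h + ip M h f + ip M h h"
    "ip M (\<lambda>z. f z - h z) (\<lambda>z. f z - h z) = ip M f f - ip M f h - ip M h f + ip M h h" if h: "sqi M h" for h
    using ip_add_left[OF f h sqi_add[OF f h]] ip_add_right[OF f h f] ip_add_right[OF f h h]
      ip_diff_left[OF f h sqi_diff[OF f h]] ip_diff_right[OF f h f] ip_diff_right[OF f h h] by simp_all
  have g': "sqi M (\<lambda>z. \<i> * g z)" by (rule sqi_scale[OF g])
  show ?thesis
    unfolding ip_self[symmetric] e[OF g] e[OF g'] ip_scale_left ip_scale_right
    by (simp add: ring_distribs mult.assoc[symmetric])
qed

lemma ip_tendsto:
  assumes "\<And>i. sqi M (s i)" "sqi M f" "sqi M g" "(\<lambda>i. nrm M (\<lambda>z. s i z - f z)) \<longlonglongrightarrow> 0"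
  shows "(\<lambda>i. ip M (s i) g) \<longlonglongrightarrow> ip M f g"
proof (rule LIM_zero_cancel, rule Lim_null_comparison)
  show "(\<lambda>i. nrm M (\<lambda>z. s i z - f z) * nrm M g) \<longlonglongrightarrow> 0"
    using tendsto_mult_left_zero[OF assms(4)] by simp
  show "\<forall>\<^sub>F i in sequentially. norm (ip M (s i) g - ip M f g) \<le> nrm M (\<lambda>z. s i z - f z) * nrm M g"
  proof (rule always_eventually, rule allI)
    fix i
    show "norm (ip M (s i) g - ip M f g) \<le> nrm M (\<lambda>z. s i z - f z) * nrm M g"
      using cauchy_schwarz_ip[OF sqi_diff[OF assms(1,2)] assms(3), of i] assms(1-3)
      by (simp add: ip_diff_left)
  qed
qed

lemma nrm_tendsto:
  assumes "\<And>i. sqi M (s i)" "sqi M f" "(\<lambda>i. nrm M (\<lambda>z. s i z - f z)) \<longlonglongrightarrow> 0"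
  shows "(\<lambda>i. nrm M (s i)) \<longlonglongrightarrow> nrm M f"
proof (rule LIM_zero_cancel, rule Lim_null_comparison[OF _ assms(3)])
  show "\<forall>\<^sub>F i in sequentially. norm (nrm M (s i) - nrm M f) \<le> nrm M (\<lambda>z. s i z - f z)"
    using nrm_diff_ge[OF assms(1,2)] by simp
qed

lemma sqi_dominated:
  assumes "\<And>i. s i \<in> borel_measurable M" "f \<in> borel_measurable M" and g: "sqi M g"
    and "\<And>i. AE z in M. cmod (s i z) \<le> c * cmod (g z)"
    and "AE z in M. (\<lambda>i. s i z) \<longlonglongrightarrow> f z"
  shows "\<And>i. sqi M (s i)" "sqi M f" "(\<lambda>i. nrm M (\<lambda>z. s i z - f z)) \<longlonglongrightarrow> 0"
proof -
  note [measurable] = assms(1,2) sqi_meas[OF g]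
  show s: "sqi M (s i)" for i by (rule sqi_bound[OF g assms(1,4)])
  have all: "AE z in M. \<forall>i. cmod (s i z) \<le> c * cmod (g z)" using assms(4) by (simp add: AE_all_countable)
  have fb: "AE z in M. cmod (f z) \<le> c * cmod (g z)"
    using all assms(5)
    by eventually_elim (auto intro: LIMSEQ_le_const2[OF tendsto_norm])
  show f: "sqi M f" by (rule sqi_bound[OF g assms(2) fb])
  have "(\<lambda>i. LINT z|M. (cmod (s i z - f z))\<^sup>2) \<longlonglongrightarrow> (LINT z|M. 0)"
  proof (rule integral_dominated_convergence[where w = "\<lambda>z. 4 * c\<^sup>2 * (cmod (g z))\<^sup>2"])
    show "integrable M (\<lambda>z. 4 * c\<^sup>2 * (cmod (g z))\<^sup>2)" using sqi_int[OF g] by simp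
    show "AE z in M. (\<lambda>i. (cmod (s i z - f z))\<^sup>2) \<longlonglongrightarrow> 0"
      using assms(5)
    proof eventually_elim
      case (elim z)
      then have "(\<lambda>i. cmod (s i z - f z)) \<longlonglongrightarrow> 0" by (intro tendsto_norm_zero LIM_zero)
      from tendsto_power[OF this, of 2] show ?case by simp
    qed
    fix i
    show "AE z in M. norm ((cmod (s i z - f z))\<^sup>2) \<le> 4 * c\<^sup>2 * (cmod (g z))\<^sup>2"
      using all fb
    proof eventually_elim
      case (elim z)
      have "cmod (s i z - f z) \<le> 2 * (c * cmod (g z))"
        using elim(2) spec[OF elim(1), of i] norm_triangle_ineq4[of "s i z" "f z"] by linarith
      then have "(cmod (s i z - f z))\<^sup>2 \<le> (2 * (c * cmod (g z)))\<^sup>2" by (intro power_mono) auto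
      then show ?case by (simp add: power_mult_distrib)
    qed
  qed (measurable)
  then show "(\<lambda>i. nrm M (\<lambda>z. s i z - f z)) \<longlonglongrightarrow> 0"
    unfolding nrm_def using tendsto_real_sqrt by fastforce
qed

text \<open>The limit case asks for convergence in norm rather than pointwise, the mode of
  convergence under which bounded forms are stable; it serves \<open>approx_id\<close>.\<close>

lemma sqi_induct [consumes 1, case_names indicator scale add lim]:
  assumes "sqi M f"
    and base: "\<And>A. A \<in> sets M \<Longrightarrow> emeasure M A < \<infinity> \<Longrightarrow> P (indicator A)"
    and scale: "\<And>f c. sqi M f \<Longrightarrow> P f \<Longrightarrow> P (\<lambda>z. c * f z)"
    and add: "\<And>f g. sqi M f \<Longrightarrow> sqi M g \<Longrightarrow> P f \<Longrightarrow> P g \<Longrightarrow> P (\<lambda>z. f z + g z)"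
    and lim: "\<And>s f. (\<And>i::nat. sqi M (s i)) \<Longrightarrow> (\<And>i. P (s i)) \<Longrightarrow> sqi M f \<Longrightarrow>
      (\<lambda>i. nrm M (\<lambda>z. s i z - f z)) \<longlonglongrightarrow> 0 \<Longrightarrow> P f"
  shows "P f"
proof -
  note [measurable] = sqi_meas[OF assms(1)]
  have z: "P (\<lambda>z. 0)" using base[of "{}"] scale[OF sqi_indicator[of "{}" M], of 0] by simp
  obtain F where F: "\<And>i. simple_function M (F i)" "\<And>x. x \<in> space M \<Longrightarrow> (\<lambda>i. F i x) \<longlonglongrightarrow> f x"
     "\<And>i x. x \<in> space M \<Longrightarrow> cmod (F i x) \<le> 2 * cmod (f x)"
    using borel_measurable_implies_sequence_metric[OF sqi_meas[OF assms(1)], of 0]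
    unfolding norm_conv_dist by metis
  have [measurable]: "F i \<in> borel_measurable M" for i
    by (rule borel_measurable_simple_function[OF F(1)])
  have dom: "\<And>i. sqi M (F i)" "(\<lambda>i. nrm M (\<lambda>z. F i z - f z)) \<longlonglongrightarrow> 0"
    using sqi_dominated[of F M f f 2] assms(1) F by auto
  have simple: "P h" if h: "simple_function M h" "sqi M h" for h
  proof -
    have [measurable]: "h \<in> borel_measurable M" using h(2) by (rule sqi_meas)
    \<comment> \<open>The zero level set may have infinite measure; every other level set is finite
      by Chebyshev's inequality.\<close>
    define R where "R = h ` space M - {0}"
    have finR: "finite R" unfolding R_def using simple_functionD(1)[OF h(1)] by simp
    define A where "A = (\<lambda>y. h -` {y} \<inter> space M)"
    have As: "A y \<in> sets M" for y unfolding A_def by measurable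
    have Af: "emeasure M (A y) < \<infinity>" if "y \<in> R" for y
    proof -
      have y: "cmod y > 0" using that by (auto simp: R_def)
      have "ennreal ((cmod y)\<^sup>2) * emeasure M (A y) = (\<integral>\<^sup>+z. ennreal ((cmod y)\<^sup>2) * indicator (A y) z \<partial>M)"
        by (simp add: nn_integral_cmult_indicator As)
      also have "\<dots> \<le> (\<integral>\<^sup>+z. ennreal ((cmod (h z))\<^sup>2) \<partial>M)"
        by (intro nn_integral_mono) (auto simp: A_def indicator_def)
      also have "\<dots> < \<infinity>" using nn_nrm[OF h(2)] by simp
      finally have lt: "ennreal ((cmod y)\<^sup>2) * emeasure M (A y) < \<infinity>" .
      show ?thesis
      proof (rule ccontr)
        assume "\<not> emeasure M (A y) < \<infinity>"
        then have "emeasure M (A y) = \<infinity>" by (auto simp: less_top[symmetric])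
        then show False using lt y by (simp add: ennreal_mult_eq_top_iff)
      qed
    qed
    have sm: "sqi M (\<lambda>z. \<Sum>y\<in>S. y * indicator (A y) z) \<and> P (\<lambda>z. \<Sum>y\<in>S. y * indicator (A y) z)" if "S \<subseteq> R" for S
    proof -
      have "finite S" using that finR finite_subset by blast
      then show ?thesis using that
      proof (induction S)
        case empty
        then show ?case using z by simp
      next
        case (insert y S)
        have i: "sqi M (indicator (A y))" using insert.prems by (intro sqi_indicator As Af) auto
        have p: "P (\<lambda>z. y * indicator (A y) z)" using insert.prems by (intro scale base As Af i) auto
        have s: "sqi M (\<lambda>z. y * indicator (A y) z)" by (rule sqi_scale[OF i])
        have IH: "sqi M (\<lambda>z. \<Sum>y\<in>S. y * indicator (A y) z)" "P (\<lambda>z. \<Sum>y\<in>S. y * indicator (A y) z)"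
          using insert by auto
        show ?case using add[OF s IH(1) p IH(2)] sqi_add[OF s IH(1)]
          unfolding sum.insert[OF insert.hyps] by blast
      qed
    qed
    have eq: "(\<Sum>y\<in>R. y * indicator (A y) z) = h z" if "z \<in> space M" for z
    proof (cases "h z = 0")
      case True
      have "(\<Sum>y\<in>R. y * indicator (A y) z) = 0"
        by (rule sum.neutral) (use True in \<open>auto simp: A_def R_def indicator_def\<close>)
      then show ?thesis using True by simp
    next
      case False
      then have "h z \<in> R" using that by (auto simp: R_def)
      have "(\<Sum>y\<in>R. y * indicator (A y) z) = (\<Sum>y\<in>R. if y = h z then y else 0)"
        by (rule sum.cong) (use that in \<open>auto simp: A_def indicator_def\<close>)
      also have "\<dots> = h z" using \<open>h z \<in> R\<close> finR by simp
      finally show ?thesis .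
    qed
    have "AE z in M. (\<Sum>y\<in>R. y * indicator (A y) z) - h z = 0" using eq by (intro AE_I2) simp
    then have "nrm M (\<lambda>z. (\<Sum>y\<in>R. y * indicator (A y) z) - h z) = nrm M (\<lambda>z. 0)"
      using sm[of R] h(2) by (intro nrm_cong_AE) (auto intro!: sqi_meas sqi_diff)
    then have n: "nrm M (\<lambda>z. (\<Sum>y\<in>R. y * indicator (A y) z) - h z) = 0" by (simp add: nrm_def)
    \<comment> \<open>The sum equals \<open>h\<close> only on \<open>space M\<close>, so the two
      functions may differ; the limit case with a constant sequence at distance 0 bridges
      this.\<close>
    show "P h"
      by (rule lim[of "\<lambda>_ z. \<Sum>y\<in>R. y * indicator (A y) z"]) (use sm[of R] h n in auto)
  qed
  show ?thesis by (rule lim[of F]) (use simple F dom assms(1) in auto)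
qed

text \<open>Riesz-Fischer: a subsequence with successive distances below \<open>(1/2)^n\<close>
  converges almost everywhere, and Fatou's lemma makes its pointwise limit a norm limit of the whole
  sequence.\<close>

lemma sqi_complete:
  assumes f: "\<And>i. sqi M (f i)"
    and C: "\<And>e. e > 0 \<Longrightarrow> \<exists>N::nat. \<forall>m\<ge>N. \<forall>n\<ge>N. nrm M (\<lambda>z. f m z - f n z) < e"
  shows "\<exists>g. sqi M g \<and> (\<lambda>i. nrm M (\<lambda>z. f i z - g z)) \<longlonglongrightarrow> 0"
proof -
  note [measurable] = sqi_meas[OF f]
  have "\<exists>N::nat. \<forall>m\<ge>N. \<forall>n\<ge>N. nrm M (\<lambda>z. f m z - f n z) < (1/2)^j" for j by (rule C) simp
  then obtain r where r: "\<And>j m n. m \<ge> r j \<Longrightarrow> n \<ge> r j \<Longrightarrow> nrm M (\<lambda>z. f m z - f n z) < (1/2)^j" by metis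
  \<comment> \<open>Partial sums give an index beyond \<open>r j\<close> for every
    \<open>j \<le> n\<close>.\<close>
  define R where "R = (\<lambda>n. (\<Sum>j\<le>n. r j))"
  have R: "r j \<le> R n" if "j \<le> n" for j n
    unfolding R_def using that by (intro member_le_sum) auto
  define D where "D = (\<lambda>n z. f (R (Suc n)) z - f (R n) z)"
  have sD: "sqi M (D n)" for n unfolding D_def by (intro sqi_diff f)
  note [measurable] = sqi_meas[OF sD]
  have D: "(nrm M (D n))\<^sup>2 \<le> (1/4)^n" for n
  proof -
    have "nrm M (D n) < (1/2)^n" unfolding D_def by (rule r) (auto intro: R)
    then have "(nrm M (D n))\<^sup>2 \<le> ((1/2)^n)\<^sup>2" by (intro power_mono) auto
    also have "\<dots> = (1/4::real)^n" by (simp add: power2_eq_square power_mult_distrib[symmetric])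
    finally show ?thesis .
  qed
  have "(\<integral>\<^sup>+z. (\<Sum>n. ennreal (2^n * (cmod (D n z))\<^sup>2)) \<partial>M) = (\<Sum>n. \<integral>\<^sup>+z. ennreal (2^n * (cmod (D n z))\<^sup>2) \<partial>M)"
    by (rule nn_integral_suminf) measurable
  also have "\<dots> = (\<Sum>n. ennreal (2^n * (nrm M (D n))\<^sup>2))"
    by (rule suminf_cong)
      (simp add: ennreal_mult nn_integral_cmult nn_nrm[OF sD])
  also have "\<dots> \<le> (\<Sum>n. ennreal ((1/2)^n))"
  proof (rule suminf_le)
    fix n
    have "2^n * (nrm M (D n))\<^sup>2 \<le> 2^n * (1/4)^n" by (intro mult_left_mono D) auto
    also have "\<dots> = (1/2::real)^n" by (simp add: power_mult_distrib[symmetric])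
    finally show "ennreal (2^n * (nrm M (D n))\<^sup>2) \<le> ennreal ((1/2)^n)" by (rule ennreal_leI)
  qed auto
  also have "\<dots> = ennreal (\<Sum>n. (1/2)^n)" by (intro suminf_ennreal2) (auto intro!: summable_geometric)
  also have "\<dots> < \<infinity>" by simp
  finally have "AE z in M. (\<Sum>n. ennreal (2^n * (cmod (D n z))\<^sup>2)) \<noteq> \<infinity>"
    by (intro nn_integral_PInf_AE) auto
  then have conv: "AE z in M. (\<lambda>n. f (R n) z) \<longlonglongrightarrow> lim (\<lambda>n. f (R n) z)"
  proof eventually_elim
    case (elim z)
    then have s1: "summable (\<lambda>n. 2^n * (cmod (D n z))\<^sup>2)"
      by (intro summable_suminf_not_top) auto
    have s2: "summable (\<lambda>n. (1/2::real)^n + 2^n * (cmod (D n z))\<^sup>2)"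
      by (intro summable_add s1 summable_geometric) auto
    have "summable (\<lambda>n. D n z)"
    proof (rule summable_comparison_test'[OF s2, of 0])
      fix n :: nat
      \<comment> \<open>Splitting \<open>cmod (D n z)\<close> as \<open>1 / a\<close> times
        \<open>a * cmod (D n z)\<close> bounds it by two summable series; this is what the weight
        \<open>2^n\<close> above is for.\<close>
      define a where "a = sqrt (2^n)"
      have a: "a > 0" "a\<^sup>2 = 2^n" by (auto simp: a_def)
      have "cmod (D n z) = (1/a) * (a * cmod (D n z))" using a by simp
      also have "\<dots> \<le> (1/a)\<^sup>2 + (a * cmod (D n z))\<^sup>2"
        using sum_squares_bound[of "1/a" "a * cmod (D n z)"] zero_le_power2[of "1/a"] zero_le_power2[of "a * cmod (D n z)"]
        by linarith
      also have "\<dots> = (1/2)^n + 2^n * (cmod (D n z))\<^sup>2"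
        by (simp add: power_mult_distrib a power_divide)
      finally show "norm (D n z) \<le> (1/2)^n + 2^n * (cmod (D n z))\<^sup>2" .
    qed
    then have "(\<lambda>n. \<Sum>i<n. D i z) \<longlonglongrightarrow> suminf (\<lambda>n. D n z)" by (rule summable_LIMSEQ)
    moreover have "(\<Sum>i<n. D i z) = f (R n) z - f (R 0) z" for n
      unfolding D_def by (rule sum_lessThan_telescope)
    ultimately have "(\<lambda>n. f (R n) z - f (R 0) z + f (R 0) z) \<longlonglongrightarrow> suminf (\<lambda>n. D n z) + f (R 0) z"
      by (intro tendsto_add) auto
    then have "convergent (\<lambda>n. f (R n) z)" by (auto simp: convergent_def)
    then show ?case by (simp add: convergent_LIMSEQ_iff)
  qed
  define g where "g = (\<lambda>z. lim (\<lambda>n. f (R n) z))"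
  have [measurable]: "g \<in> borel_measurable M" unfolding g_def by measurable
  have main: "sqi M (\<lambda>z. f m z - g z) \<and> nrm M (\<lambda>z. f m z - g z) \<le> (1/2)^j" if m: "m \<ge> r j" for m j
  proof -
    have "(\<integral>\<^sup>+z. ennreal ((cmod (f m z - g z))\<^sup>2) \<partial>M) = (\<integral>\<^sup>+z. liminf (\<lambda>n. ennreal ((cmod (f m z - f (R n) z))\<^sup>2)) \<partial>M)"
    proof (rule nn_integral_cong_AE)
      show "AE z in M. ennreal ((cmod (f m z - g z))\<^sup>2) = liminf (\<lambda>n. ennreal ((cmod (f m z - f (R n) z))\<^sup>2))"
        using conv
      proof eventually_elim
        case (elim z)
        then have "(\<lambda>n. ennreal ((cmod (f m z - f (R n) z))\<^sup>2)) \<longlonglongrightarrow> ennreal ((cmod (f m z - g z))\<^sup>2)"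
          unfolding g_def by (intro tendsto_intros)
        then show ?case by (intro lim_imp_Liminf[symmetric]) auto
      qed
    qed
    also have "\<dots> \<le> liminf (\<lambda>n. \<integral>\<^sup>+z. ennreal ((cmod (f m z - f (R n) z))\<^sup>2) \<partial>M)"
      by (rule nn_integral_liminf) measurable
    also have "\<dots> \<le> ennreal (((1/2)^j)\<^sup>2)"
    proof (rule Liminf_le)
      show "\<forall>\<^sub>F n in sequentially. (\<integral>\<^sup>+z. ennreal ((cmod (f m z - f (R n) z))\<^sup>2) \<partial>M) \<le> ennreal (((1/2)^j)\<^sup>2)"
        using eventually_ge_at_top[of j]
      proof eventually_elim
        case (elim n)
        have "nrm M (\<lambda>z. f m z - f (R n) z) < (1/2)^j" by (rule r) (use m R elim in auto)
        then show ?case unfolding nn_nrm[OF sqi_diff[OF f f]]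
          by (intro ennreal_leI power_mono) auto
      qed
    qed simp
    finally show ?thesis using sqi_nnI[of "\<lambda>z. f m z - g z" M "(1/2)^j"] by auto
  qed
  have "sqi M (\<lambda>z. f (r 0) z - (f (r 0) z - g z))"
    by (rule sqi_diff[OF f]) (use main[of 0 "r 0"] in simp)
  then have g: "sqi M g" by simp
  have "(\<lambda>i. nrm M (\<lambda>z. f i z - g z)) \<longlonglongrightarrow> 0"
  proof (rule LIMSEQ_I)
    fix e :: real assume "e > 0"
    then obtain j where "(1/2::real)^j < e" using real_arch_pow_inv[of e "1/2"] by auto
    then show "\<exists>no. \<forall>n\<ge>no. norm (nrm M (\<lambda>z. f n z - g z) - 0) < e"
      using main[of j] by (intro exI[of _ "r j"]) fastforce
  qed
  then show ?thesis using g by blast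
qed

section \<open>Gaussian integrals and the heat kernel\<close>

text \<open>Scaling by \<open>sqrt a\<close> reduces both claims to the characteristic function of
  the standard normal distribution.\<close>

lemma gauss_1d:
  fixes a t :: real
  assumes a: "a > 0"
  shows "integrable lborel (\<lambda>x::real. cis (x * t) * of_real (exp (- a * x\<^sup>2 / 2)))"
    and "(LINT x|lborel. cis (x * t) * of_real (exp (- a * x\<^sup>2 / 2))) = of_real (sqrt (2 * pi / a) * exp (- t\<^sup>2 / (2 * a)))"
proof -
  define s where "s = t / sqrt a"
  define f where "f = (\<lambda>x::real. cis (x * s) * of_real (exp (- x\<^sup>2 / 2)))"
  have f_eq: "f x = sqrt (2 * pi) *\<^sub>R (std_normal_density x *\<^sub>R iexp (s * x))" for x
    by (simp add: f_def std_normal_density_def cis_conv_exp scaleR_conv_of_real mult.commute field_simps)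
  have int0: "integrable lborel (\<lambda>x. std_normal_density x *\<^sub>R iexp (s * x))"
  proof (rule Bochner_Integration.integrable_bound[OF integrable_normal_density[of 1 0]])
    show "AE x in lborel. norm (std_normal_density x *\<^sub>R iexp (s * x)) \<le> norm (std_normal_density x)"
      by simp
  qed auto
  have intf: "integrable lborel f"
    unfolding f_eq[abs_def] using int0 by (intro integrable_scaleR_right) auto
  have "(LINT x|lborel. std_normal_density x *\<^sub>R iexp (s * x)) = char std_normal_distribution s"
    unfolding char_def by (subst integral_density) (auto simp: normal_density_nonneg)
  also have "\<dots> = of_real (exp (- (s\<^sup>2) / 2))" by (simp add: char_std_normal_distribution)
  finally have If: "integral\<^sup>L lborel f = sqrt (2 * pi) *\<^sub>R of_real (exp (- (s\<^sup>2) / 2))"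
    unfolding f_eq[abs_def] Bochner_Integration.integral_scaleR_right by simp
  have sa: "sqrt a > 0" "sqrt a \<noteq> 0" using a by auto
  have fc: "f (0 + sqrt a * x) = cis (x * t) * of_real (exp (- a * x\<^sup>2 / 2))" for x
    using a by (simp add: f_def s_def power_mult_distrib mult.commute)
  show "integrable lborel (\<lambda>x::real. cis (x * t) * of_real (exp (- a * x\<^sup>2 / 2)))"
    using lborel_integrable_real_affine[OF intf sa(2), of 0] unfolding fc .
  have "integral\<^sup>L lborel f = sqrt a *\<^sub>R (LINT x|lborel. cis (x * t) * of_real (exp (- a * x\<^sup>2 / 2)))"
    using lborel_integral_real_affine[OF sa(2), of f 0] sa(1) unfolding fc by simp
  then have "(LINT x|lborel. cis (x * t) * of_real (exp (- a * x\<^sup>2 / 2))) = (1 / sqrt a) *\<^sub>R integral\<^sup>L lborel f"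
    using sa by simp
  also have "\<dots> = of_real (sqrt (2 * pi / a) * exp (- t\<^sup>2 / (2 * a)))"
    unfolding If using a by (simp add: s_def real_sqrt_divide scaleR_conv_of_real power_divide mult.commute)
  finally show "(LINT x|lborel. cis (x * t) * of_real (exp (- a * x\<^sup>2 / 2))) = of_real (sqrt (2 * pi / a) * exp (- t\<^sup>2 / (2 * a)))" .
qed

text \<open>\<open>lborel\<close> on a Euclidean space is the image of the product of
  one-dimensional Lebesgue measures over \<open>Basis\<close>.\<close>

lemma eucl_prod:
  fixes f :: "'a::euclidean_space \<Rightarrow> real \<Rightarrow> complex"
  assumes "\<And>b. b \<in> Basis \<Longrightarrow> integrable lborel (f b)"
  shows "integrable lborel (\<lambda>x::'a. \<Prod>b\<in>Basis. f b (x \<bullet> b))"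
    and "(LINT x|lborel. (\<Prod>b\<in>Basis. f b (x \<bullet> b))) = (\<Prod>b\<in>Basis. (LINT x|lborel. f b x))"
proof -
  interpret product_sigma_finite "\<lambda>_::'a. lborel :: real measure"
    by standard
  have [measurable]: "\<And>b. b \<in> Basis \<Longrightarrow> f b \<in> borel_measurable borel"
    using borel_measurable_integrable[OF assms] by simp
  have m: "(\<lambda>x::'a. \<Prod>b\<in>Basis. f b (x \<bullet> b)) \<in> borel_measurable borel" by measurable
  have T: "(\<lambda>g. \<Sum>b\<in>Basis. g b *\<^sub>R b) \<in> (\<Pi>\<^sub>M b\<in>(Basis::'a set). lborel) \<rightarrow>\<^sub>M borel" by measurable
  have e: "(\<Prod>b\<in>Basis. f b ((\<Sum>b\<in>Basis. g b *\<^sub>R b) \<bullet> b)) = (\<Prod>b\<in>Basis. f b (g b))" for g :: "'a \<Rightarrow> real"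
    by (intro prod.cong) auto
  show "integrable lborel (\<lambda>x::'a. \<Prod>b\<in>Basis. f b (x \<bullet> b))"
    unfolding lborel_eq[where 'a='a] integrable_distr_eq[OF T m] e
    by (intro product_integrable_prod assms) auto
  show "(LINT x|lborel. (\<Prod>b\<in>Basis. f b (x \<bullet> b))) = (\<Prod>b\<in>Basis. (LINT x|lborel. f b x))"
    unfolding lborel_eq[where 'a='a] integral_distr[OF T m] e
    by (intro product_integral_prod assms) auto
qed

lemma norm_sq_Basis: "(norm (x::'a::euclidean_space))\<^sup>2 = (\<Sum>b\<in>Basis. (x \<bullet> b)\<^sup>2)"
  unfolding power2_norm_eq_inner by (subst euclidean_inner) (simp add: power2_eq_square)

lemma cis_sum: "cis (\<Sum>i\<in>I. f i) = (\<Prod>i\<in>I. cis (f i))"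
  by (induction I rule: infinite_finite_induct) (auto simp: cis_mult[symmetric])

lemma gauss_eucl0:
  fixes w :: "'a::euclidean_space"
  assumes a: "a > 0"
  shows "integrable lborel (\<lambda>x::'a. cis (x \<bullet> w) * of_real (exp (- a * (norm x)\<^sup>2 / 2)))"
    and "(LINT x|lborel. cis (x \<bullet> w) * of_real (exp (- a * (norm x)\<^sup>2 / 2)))
      = of_real (sqrt (2 * pi / a) ^ DIM('a) * exp (- (norm w)\<^sup>2 / (2 * a)))"
proof -
  define f where "f = (\<lambda>b (x::real). cis (x * (w \<bullet> b)) * of_real (exp (- a * x\<^sup>2 / 2)))"
  have e: "cis (x \<bullet> w) * of_real (exp (- a * (norm x)\<^sup>2 / 2)) = (\<Prod>b\<in>Basis. f b (x \<bullet> b))" for x :: 'a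
  proof -
    have "cis (x \<bullet> w) = (\<Prod>b\<in>Basis. cis ((x \<bullet> b) * (w \<bullet> b)))"
      by (subst euclidean_inner) (simp add: cis_sum)
    moreover have "exp (- a * (norm x)\<^sup>2 / 2) = (\<Prod>b\<in>Basis. exp (- a * (x \<bullet> b)\<^sup>2 / 2))"
      unfolding norm_sq_Basis by (subst exp_sum[symmetric]) (auto simp: sum_distrib_left sum_divide_distrib)
    ultimately show ?thesis by (simp add: f_def prod.distrib)
  qed
  have i: "integrable lborel (f b)" for b unfolding f_def by (rule gauss_1d[OF a])
  show "integrable lborel (\<lambda>x::'a. cis (x \<bullet> w) * of_real (exp (- a * (norm x)\<^sup>2 / 2)))"
    unfolding e by (rule eucl_prod(1)[OF i])
  have "(LINT x|lborel. cis (x \<bullet> w) * of_real (exp (- a * (norm x)\<^sup>2 / 2))) = (\<Prod>b\<in>Basis. (LINT x|lborel. f b x))"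
    unfolding e by (rule eucl_prod(2)[OF i])
  also have "\<dots> = (\<Prod>b\<in>(Basis::'a set). of_real (sqrt (2 * pi / a) * exp (- (w \<bullet> b)\<^sup>2 / (2 * a))))"
    unfolding f_def by (intro prod.cong refl gauss_1d(2)[OF a])
  also have "\<dots> = of_real (\<Prod>b\<in>(Basis::'a set). sqrt (2 * pi / a) * exp (- (w \<bullet> b)\<^sup>2 / (2 * a)))" by simp
  also have "(\<Prod>b\<in>(Basis::'a set). sqrt (2 * pi / a) * exp (- (w \<bullet> b)\<^sup>2 / (2 * a)))
     = sqrt (2 * pi / a) ^ DIM('a) * exp (- (norm w)\<^sup>2 / (2 * a))"
    unfolding norm_sq_Basis prod.distrib
    by (subst exp_sum[symmetric]) (auto simp: sum_divide_distrib sum_negf)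
  finally show "(LINT x|lborel. cis (x \<bullet> w) * of_real (exp (- a * (norm x)\<^sup>2 / 2)))
      = of_real (sqrt (2 * pi / a) ^ DIM('a) * exp (- (norm w)\<^sup>2 / (2 * a)))" .
qed

lemma lborel_translate:
  fixes f :: "'a::euclidean_space \<Rightarrow> 'b::{banach, second_countable_topology}"
  assumes [measurable]: "f \<in> borel_measurable borel"
  shows "integrable lborel (\<lambda>y. f (x + y)) \<longleftrightarrow> integrable lborel f"
    and "(LINT y|lborel. f (x + y)) = integral\<^sup>L lborel f"
  using integrable_distr_eq[of "(+) x" lborel borel f] integral_distr[of "(+) x" lborel borel f] lborel_distr_plus[of x]
  by simp_all

lemma gauss_eucl:
  fixes w :: "'a::euclidean_space"
  assumes a: "a > 0"
  shows "integrable lborel (\<lambda>y::'a. cis (y \<bullet> w) * of_real (exp (- a * (norm (x - y))\<^sup>2 / 2)))"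
    and "(LINT y|lborel. cis (y \<bullet> w) * of_real (exp (- a * (norm (x - y))\<^sup>2 / 2)))
      = cis (x \<bullet> w) * of_real (sqrt (2 * pi / a) ^ DIM('a) * exp (- (norm w)\<^sup>2 / (2 * a)))"
proof -
  define f where "f = (\<lambda>y::'a. cis (y \<bullet> w) * of_real (exp (- a * (norm (x - y))\<^sup>2 / 2)))"
  have m: "f \<in> borel_measurable borel"
    unfolding f_def by (intro borel_measurable_continuous_onI continuous_intros) auto
  have e: "f (x + y) = cis (x \<bullet> w) * (cis (y \<bullet> w) * of_real (exp (- a * (norm y)\<^sup>2 / 2)))" for y
    by (simp add: f_def inner_add_left cis_mult[symmetric])
  show "integrable lborel (\<lambda>y::'a. cis (y \<bullet> w) * of_real (exp (- a * (norm (x - y))\<^sup>2 / 2)))"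
    using lborel_translate(1)[OF m, of x] gauss_eucl0(1)[OF a, of w] unfolding e f_def[symmetric]
    by simp
  have "integral\<^sup>L lborel f = (LINT y|lborel. f (x + y))" using lborel_translate(2)[OF m] by simp
  also have "\<dots> = cis (x \<bullet> w) * of_real (sqrt (2 * pi / a) ^ DIM('a) * exp (- (norm w)\<^sup>2 / (2 * a)))"
    unfolding e using gauss_eucl0(2)[OF a, of w] by simp
  finally show "(LINT y|lborel. cis (y \<bullet> w) * of_real (exp (- a * (norm (x - y))\<^sup>2 / 2)))
      = cis (x \<bullet> w) * of_real (sqrt (2 * pi / a) ^ DIM('a) * exp (- (norm w)\<^sup>2 / (2 * a)))"
    unfolding f_def .
qed

text \<open>Gaussian density with variance \<open>a\<close> in each coordinate, that is, the heat
  kernel at time \<open>a / 2\<close>.\<close>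

definition heat :: "real \<Rightarrow> 'a::euclidean_space \<Rightarrow> 'a \<Rightarrow> real" where
  "heat a x y = exp (- (norm (x - y))\<^sup>2 / (2 * a)) / sqrt (2 * pi * a) ^ DIM('a)"

lemma heat_nonneg [simp]: "a > 0 \<Longrightarrow> heat a x y \<ge> 0"
  by (simp add: heat_def)

lemma heat_commute: "heat a x y = heat a y x"
  by (simp add: heat_def norm_minus_commute)

lemma measurable_heat [measurable]:
  "(\<lambda>p. heat a (fst p) (snd p)) \<in> borel_measurable (borel \<Otimes>\<^sub>M borel)"
  unfolding heat_def by measurable

lemma measurable_heat' [measurable (raw)]:
  fixes f g :: "'b \<Rightarrow> 'a::euclidean_space"
  assumes [measurable]: "f \<in> borel_measurable M" "g \<in> borel_measurable M"
  shows "(\<lambda>p. heat a (f p) (g p)) \<in> borel_measurable M"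
  unfolding heat_def by measurable

lemma heat_integral:
  fixes x :: "'a::euclidean_space"
  assumes a: "a > 0"
  shows "integrable lborel (\<lambda>y. heat a x y)" "(LINT y|lborel. heat a x y) = 1"
proof -
  have i1: "1 / a > 0" using a by simp
  have eq: "cis (y \<bullet> 0) * of_real (exp (- (1 / a) * (norm (x - y))\<^sup>2 / 2)) = complex_of_real (sqrt (2 * pi * a) ^ DIM('a) * heat a x y)" for y
    using a by (simp add: heat_def)
  have i: "integrable lborel (\<lambda>y. complex_of_real (sqrt (2 * pi * a) ^ DIM('a) * heat a x y))"
    using gauss_eucl(1)[OF i1, of 0 x] unfolding eq .
  have nz: "sqrt (2 * pi * a) ^ DIM('a) \<noteq> 0" using a by simp
  have "integrable lborel (\<lambda>y. sqrt (2 * pi * a) ^ DIM('a) * heat a x y)"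
    using integrable_Re[OF i] by simp
  then have "integrable lborel (\<lambda>y. (1 / sqrt (2 * pi * a) ^ DIM('a)) * (sqrt (2 * pi * a) ^ DIM('a) * heat a x y))"
    by (rule integrable_mult_right)
  then show "integrable lborel (\<lambda>y. heat a x y)" using nz by simp
  have "complex_of_real (LINT y|lborel. sqrt (2 * pi * a) ^ DIM('a) * heat a x y) = of_real (sqrt (2 * pi * a) ^ DIM('a))"
    using gauss_eucl(2)[OF i1, of 0 x] unfolding eq integral_complex_of_real using a by simp
  then have "(LINT y|lborel. sqrt (2 * pi * a) ^ DIM('a) * heat a x y) = sqrt (2 * pi * a) ^ DIM('a)"
    using of_real_eq_iff by blast
  then show "(LINT y|lborel. heat a x y) = 1" using nz by simp
qed

lemma heat_nn:
  fixes x :: "'a::euclidean_space"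
  assumes a: "a > 0"
  shows "(\<integral>\<^sup>+y. ennreal (heat a x y) \<partial>lborel) = 1"
  using nn_integral_eq_integral[OF heat_integral(1)[OF a, of x]] heat_integral(2)[OF a, of x] a by simp

text \<open>The heat form on two indicators, kept in \<open>ennreal\<close> so that Tonelli and
  additivity need no integrability.\<close>

definition heatQ :: "real \<Rightarrow> 'a::euclidean_space set \<Rightarrow> 'a set \<Rightarrow> ennreal" where
  "heatQ a A B = (\<integral>\<^sup>+x. \<integral>\<^sup>+y. ennreal (heat a x y) * indicator A x * indicator B y \<partial>lborel \<partial>lborel)"

lemma heatQ_commute:
  fixes A B :: "'a::euclidean_space set"
  assumes [measurable]: "A \<in> sets borel" "B \<in> sets borel"
  shows "heatQ a A B = heatQ a B A"
proof -
  have "heatQ a A B = (\<integral>\<^sup>+y. \<integral>\<^sup>+x. ennreal (heat a x y) * indicator A x * indicator B y \<partial>lborel \<partial>lborel)"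
    unfolding heatQ_def by (rule lborel_pair.Fubini'[symmetric]) measurable
  then show ?thesis unfolding heatQ_def by (simp add: heat_commute[of a] mult.assoc mult.commute[of "indicator A _"])
qed

lemma heatQ_Un:
  fixes A B C :: "'a::euclidean_space set"
  assumes [measurable]: "A \<in> sets borel" "B \<in> sets borel" "C \<in> sets borel" and "A \<inter> B = {}"
  shows "heatQ a (A \<union> B) C = heatQ a A C + heatQ a B C"
proof -
  have "heatQ a (A \<union> B) C = (\<integral>\<^sup>+x. (\<integral>\<^sup>+y. ennreal (heat a x y) * indicator A x * indicator C y + ennreal (heat a x y) * indicator B x * indicator C y \<partial>lborel) \<partial>lborel)"
    unfolding heatQ_def
    by (intro nn_integral_cong) (use assms(4) in \<open>auto simp: indicator_def\<close>)
  then show ?thesis unfolding heatQ_def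
    by (simp add: nn_integral_add)
qed

lemma heatQ_le:
  fixes A B :: "'a::euclidean_space set"
  assumes [measurable]: "A \<in> sets borel" "B \<in> sets borel" and a: "a > 0"
  shows "heatQ a A B \<le> emeasure lborel A"
proof -
  have "heatQ a A B \<le> (\<integral>\<^sup>+x. (\<integral>\<^sup>+y. indicator A x * ennreal (heat a x y) \<partial>lborel) \<partial>lborel)"
    unfolding heatQ_def by (intro nn_integral_mono) (auto simp: indicator_def)
  also have "\<dots> = emeasure lborel A"
    by (simp add: nn_integral_cmult heat_nn[OF a])
  finally show ?thesis .
qed

text \<open>Substituting \<open>y = x + sqrt (s i) *\<^sub>R v\<close> fixes the Gaussian and moves
  the parameter into the indicator of U, which is eventually 1 at each v because U is open. Fatou's
  lemma, in v and then in x, gives the lower bound.\<close>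

lemma heat_open_tendsto:
  fixes U :: "'a::euclidean_space set"
  assumes U: "open U" and s: "\<And>i. s i > 0" "s \<longlonglongrightarrow> 0"
  shows "emeasure lborel U \<le> liminf (\<lambda>i. heatQ (s i) U U)"
proof -
  have [measurable]: "U \<in> sets borel" using U by simp
  have T: "1 \<le> liminf (\<lambda>i. \<integral>\<^sup>+y. ennreal (heat (s i) x y) * indicator U y \<partial>lborel)" if x: "x \<in> U" for x
  proof -
    have c: "(\<integral>\<^sup>+y. ennreal (heat (s i) x y) * indicator U y \<partial>lborel) = (\<integral>\<^sup>+v. ennreal (heat 1 0 v) * indicator U (x + sqrt (s i) *\<^sub>R v) \<partial>lborel)" for i
    proof -
      have nz: "sqrt (s i) \<noteq> 0" using s(1)[of i] by simp
      have e: "ennreal (heat 1 0 v) = ennreal (\<bar>sqrt (s i)\<bar> ^ DIM('a)) * ennreal (heat (s i) x (x + sqrt (s i) *\<^sub>R v))" for v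
        using s(1)[of i] by (simp add: ennreal_mult'[symmetric] heat_def real_sqrt_mult power_mult_distrib)
      have "(\<integral>\<^sup>+y. ennreal (heat (s i) x y) * indicator U y \<partial>lborel) =
        (\<integral>\<^sup>+y. ennreal (heat (s i) x y) * indicator U y \<partial>density (distr lborel borel (\<lambda>v. x + sqrt (s i) *\<^sub>R v)) (\<lambda>_. ennreal (\<bar>sqrt (s i)\<bar> ^ DIM('a))))"
        using lborel_affine[OF nz, of x] by simp
      also have "\<dots> = (\<integral>\<^sup>+v. ennreal (\<bar>sqrt (s i)\<bar> ^ DIM('a)) * (ennreal (heat (s i) x (x + sqrt (s i) *\<^sub>R v)) * indicator U (x + sqrt (s i) *\<^sub>R v)) \<partial>lborel)"
        by (subst nn_integral_density) (auto simp: nn_integral_distr)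
      finally show ?thesis unfolding e by (simp add: mult.assoc)
    qed
    have lim: "liminf (\<lambda>i. ennreal (heat 1 0 v) * indicator U (x + sqrt (s i) *\<^sub>R v)) = ennreal (heat 1 0 v)" for v
    proof (rule lim_imp_Liminf)
      have "(\<lambda>i. x + sqrt (s i) *\<^sub>R v) \<longlonglongrightarrow> x + sqrt 0 *\<^sub>R v" by (intro tendsto_intros s(2))
      then have "\<forall>\<^sub>F i in sequentially. x + sqrt (s i) *\<^sub>R v \<in> U" using U x by (auto dest: topological_tendstoD)
      then have "\<forall>\<^sub>F i in sequentially. ennreal (heat 1 0 v) * indicator U (x + sqrt (s i) *\<^sub>R v) = ennreal (heat 1 0 v)"
        by eventually_elim simp
      then show "(\<lambda>i. ennreal (heat 1 0 v) * indicator U (x + sqrt (s i) *\<^sub>R v)) \<longlonglongrightarrow> ennreal (heat 1 0 v)"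
        by (rule tendsto_eventually)
    qed simp
    have "1 = (\<integral>\<^sup>+v. liminf (\<lambda>i. ennreal (heat 1 0 v) * indicator U (x + sqrt (s i) *\<^sub>R v)) \<partial>lborel)"
      unfolding lim using heat_nn[of 1 "0::'a"] by simp
    also have "\<dots> \<le> liminf (\<lambda>i. \<integral>\<^sup>+v. ennreal (heat 1 0 v) * indicator U (x + sqrt (s i) *\<^sub>R v) \<partial>lborel)"
      by (rule nn_integral_liminf) measurable
    finally show ?thesis unfolding c .
  qed
  have "emeasure lborel U = (\<integral>\<^sup>+x. indicator U x \<partial>lborel)" by simp
  also have "\<dots> \<le> (\<integral>\<^sup>+x. liminf (\<lambda>i. \<integral>\<^sup>+y. ennreal (heat (s i) x y) * indicator U x * indicator U y \<partial>lborel) \<partial>lborel)"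
    by (intro nn_integral_mono) (auto simp: indicator_def dest: T)
  also have "\<dots> \<le> liminf (\<lambda>i. heatQ (s i) U U)"
    unfolding heatQ_def by (rule nn_integral_liminf) measurable
  finally show ?thesis .
qed

text \<open>The upper bound is \<open>heatQ_le\<close>. For the lower one, A is replaced by an open
  superset U; since the kernel has mass one, \<open>U - A\<close> contributes at most twice its
  measure.\<close>

lemma heatQ_tendsto_same:
  fixes A :: "'a::euclidean_space set"
  assumes A [measurable]: "A \<in> sets borel" and fin: "emeasure lborel A < \<infinity>" and s: "\<And>i. s i > 0" "s \<longlonglongrightarrow> 0"
  shows "(\<lambda>i. enn2real (heatQ (s i) A A)) \<longlonglongrightarrow> measure lborel A"
proof (rule LIMSEQ_I)
  fix e :: real assume e: "e > 0"
  \<comment> \<open>A quarter of e is lost in the lower limit and twice a quarter on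
    \<open>U - A\<close>, which together stay below e.\<close>
  obtain U where U: "open U" "A \<subseteq> U" "emeasure lborel (U - A) < ennreal (e/4)"
    using outer_regular_lborel[of A "e/4"] e A by auto
  have [measurable]: "U \<in> sets borel" using U by simp
  have UA: "emeasure lborel U = emeasure lborel A + emeasure lborel (U - A)"
    using U(2) by (subst plus_emeasure) (auto simp: Un_absorb1)
  have finU: "emeasure lborel U < \<infinity>" "emeasure lborel (U - A) < \<infinity>"
    using UA U(3) fin by (auto simp: less_top[symmetric])
  have q: "enn2real (heatQ (s i) U U) \<le> enn2real (heatQ (s i) A A) + 2 * measure lborel (U - A)" for i
  proof -
    have "heatQ (s i) U U = heatQ (s i) (A \<union> (U - A)) (A \<union> (U - A))" using U(2) by (simp add: Un_absorb1)
    also have "\<dots> = heatQ (s i) A (A \<union> (U - A)) + heatQ (s i) (U - A) (A \<union> (U - A))"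
      by (rule heatQ_Un) auto
    also have "heatQ (s i) A (A \<union> (U - A)) = heatQ (s i) (A \<union> (U - A)) A" by (rule heatQ_commute) auto
    also have "\<dots> = heatQ (s i) A A + heatQ (s i) (U - A) A" by (rule heatQ_Un) auto
    finally have "heatQ (s i) U U = heatQ (s i) A A + heatQ (s i) (U - A) A + heatQ (s i) (U - A) (A \<union> (U - A))" .
    also have "\<dots> \<le> heatQ (s i) A A + emeasure lborel (U - A) + emeasure lborel (U - A)"
      by (intro add_mono heatQ_le s) auto
    finally have le: "heatQ (s i) U U \<le> heatQ (s i) A A + emeasure lborel (U - A) + emeasure lborel (U - A)" .
    have fA: "heatQ (s i) A A < \<infinity>" using heatQ_le[of A A "s i"] s(1) fin by (auto intro: le_less_trans)
    have "enn2real (heatQ (s i) U U) \<le> enn2real (heatQ (s i) A A + emeasure lborel (U - A) + emeasure lborel (U - A))"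
      using le fA finU by (intro enn2real_mono) (auto simp: less_top[symmetric])
    also have "\<dots> = enn2real (heatQ (s i) A A) + 2 * measure lborel (U - A)"
      using fA finU by (simp add: enn2real_plus measure_def less_top[symmetric])
    finally show ?thesis .
  qed
  have mUA: "measure lborel (U - A) < e / 4"
  proof -
    have "emeasure lborel (U - A) = ennreal (measure lborel (U - A))"
      using finU(2) by (intro emeasure_eq_ennreal_measure) auto
    then show ?thesis using U(3) by (simp add: ennreal_less_iff)
  qed
  have mA: "measure lborel A \<le> measure lborel U"
    using U(2) finU by (intro measure_mono_fmeasurable) (auto simp: fmeasurable_def)
  have up: "enn2real (heatQ (s i) A A) \<le> measure lborel A" for i
    unfolding measure_def using heatQ_le[of A A "s i"] s(1) fin by (intro enn2real_mono) auto
  have "\<forall>\<^sub>F i in sequentially. measure lborel U - e / 4 < enn2real (heatQ (s i) U U)"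
  proof (cases "measure lborel U - e / 4 < 0")
    case True
    then show ?thesis by (auto intro!: always_eventually less_le_trans[OF True])
  next
    case False
    have "ennreal (measure lborel U - e / 4) < ennreal (measure lborel U)"
      using e False by (intro ennreal_lessI) auto
    also have "\<dots> = emeasure lborel U" using finU by (simp add: emeasure_eq_ennreal_measure less_top[symmetric])
    also have "\<dots> \<le> liminf (\<lambda>i. heatQ (s i) U U)" by (rule heat_open_tendsto[OF U(1) s])
    finally have "\<forall>\<^sub>F i in sequentially. ennreal (measure lborel U - e / 4) < heatQ (s i) U U"
      by (rule less_LiminfD)
    then show ?thesis
    proof eventually_elim
      case (elim i)
      have "heatQ (s i) U U < \<infinity>" using heatQ_le[of U U "s i"] s(1) finU by (auto intro: le_less_trans)
      then show ?case using elim False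
        by (metis ennreal_enn2real ennreal_less_iff infinity_ennreal_def not_less)
    qed
  qed
  then obtain N where N: "\<And>i. i \<ge> N \<Longrightarrow> measure lborel U - e / 4 < enn2real (heatQ (s i) U U)"
    by (auto simp: eventually_sequentially)
  have "\<bar>enn2real (heatQ (s i) A A) - measure lborel A\<bar> < e" if "i \<ge> N" for i
    using N[OF that] q[of i] up[of i] mUA mA e by linarith
  then show "\<exists>no. \<forall>n\<ge>no. norm (enn2real (heatQ (s n) A A) - measure lborel A) < e" by auto
qed

text \<open>For disjoint sets, additivity and symmetry express \<open>heatQ\<close> through its
  diagonal values on \<open>C\<close>, \<open>D\<close> and \<open>C \<union> D\<close>. In general
  A and B are split along their intersection, and only the diagonal term survives.\<close>

lemma heatQ_tendsto:
  fixes A B :: "'a::euclidean_space set"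
  assumes A [measurable]: "A \<in> sets borel" "B \<in> sets borel" and fin: "emeasure lborel A < \<infinity>" "emeasure lborel B < \<infinity>"
    and s: "\<And>i. s i > 0" "s \<longlonglongrightarrow> 0"
  shows "(\<lambda>i. enn2real (heatQ (s i) A B)) \<longlonglongrightarrow> measure lborel (A \<inter> B)"
proof -
  have fQ: "heatQ (s i) C D < top" if "C \<in> sets borel" "D \<in> sets borel" "emeasure lborel C < \<infinity>" for C D :: "'a set" and i
    using heatQ_le[OF that(1,2) s(1), of i] that(3) by (auto intro: le_less_trans)
  have dis: "(\<lambda>i. enn2real (heatQ (s i) C D)) \<longlonglongrightarrow> 0"
    if [measurable]: "C \<in> sets borel" "D \<in> sets borel" and f: "emeasure lborel C < \<infinity>" "emeasure lborel D < \<infinity>"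
      and d: "C \<inter> D = {}" for C D :: "'a set"
  proof -
    have CD: "emeasure lborel (C \<union> D) = emeasure lborel C + emeasure lborel D"
      using d by (subst plus_emeasure) auto
    then have fCD: "emeasure lborel (C \<union> D) < \<infinity>" using f by simp
    have m: "measure lborel (C \<union> D) = measure lborel C + measure lborel D"
      unfolding measure_def CD using f by (intro enn2real_plus) auto
    have "heatQ (s i) (C \<union> D) (C \<union> D) = heatQ (s i) C C + heatQ (s i) D C + (heatQ (s i) D C + heatQ (s i) D D)" for i
      using heatQ_Un[of C D "C \<union> D" "s i"] heatQ_Un[of C D C "s i"] heatQ_Un[of C D D "s i"] d
        heatQ_commute[of C "C \<union> D" "s i"] heatQ_commute[of D "C \<union> D" "s i"] heatQ_commute[of D C "s i"] by simp
    then have "enn2real (heatQ (s i) (C \<union> D) (C \<union> D)) =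
      enn2real (heatQ (s i) C C) + enn2real (heatQ (s i) D C) + (enn2real (heatQ (s i) D C) + enn2real (heatQ (s i) D D))" for i
      using fQ[of C C i] fQ[of D C i] fQ[of D D i] f by (simp add: enn2real_plus)
    then have e: "enn2real (heatQ (s i) C D) = (enn2real (heatQ (s i) (C \<union> D) (C \<union> D)) - enn2real (heatQ (s i) C C) - enn2real (heatQ (s i) D D)) / 2" for i
      using heatQ_commute[of D C "s i"] by simp
    have "(\<lambda>i. (enn2real (heatQ (s i) (C \<union> D) (C \<union> D)) - enn2real (heatQ (s i) C C) - enn2real (heatQ (s i) D D)) / 2)
      \<longlonglongrightarrow> (measure lborel (C \<union> D) - measure lborel C - measure lborel D) / 2"
      by (intro tendsto_intros heatQ_tendsto_same s f fCD) auto
    then show ?thesis unfolding e m by simp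
  qed
  let ?I = "A \<inter> B"
  have fi: "emeasure lborel ?I < \<infinity>" "emeasure lborel (A - B) < \<infinity>" "emeasure lborel (B - A) < \<infinity>"
    using fin emeasure_mono[of ?I A lborel] emeasure_mono[of "A - B" A lborel] emeasure_mono[of "B - A" B lborel]
    by (auto intro: le_less_trans)
  have AI: "A = ?I \<union> (A - B)" "B = ?I \<union> (B - A)" by auto
  have "heatQ (s i) A B = heatQ (s i) ?I ?I + heatQ (s i) (B - A) ?I + (heatQ (s i) ?I (A - B) + heatQ (s i) (B - A) (A - B))" for i
  proof -
    have "heatQ (s i) A B = heatQ (s i) ?I B + heatQ (s i) (A - B) B"
      by (subst (1) AI(1)) (rule heatQ_Un, auto)
    also have "heatQ (s i) ?I B = heatQ (s i) B ?I" by (rule heatQ_commute) auto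
    also have "\<dots> = heatQ (s i) ?I ?I + heatQ (s i) (B - A) ?I"
      by (subst (1) AI(2)) (rule heatQ_Un, auto)
    also have "heatQ (s i) (A - B) B = heatQ (s i) B (A - B)" by (rule heatQ_commute) auto
    also have "\<dots> = heatQ (s i) ?I (A - B) + heatQ (s i) (B - A) (A - B)"
      by (subst (1) AI(2)) (rule heatQ_Un, auto)
    finally show ?thesis .
  qed
  then have e: "enn2real (heatQ (s i) A B) = enn2real (heatQ (s i) ?I ?I) + enn2real (heatQ (s i) (B - A) ?I)
     + (enn2real (heatQ (s i) ?I (A - B)) + enn2real (heatQ (s i) (B - A) (A - B)))" for i
    using fQ[of ?I ?I i] fQ[of "B - A" ?I i] fQ[of ?I "A - B" i] fQ[of "B - A" "A - B" i] fi
    by (simp add: enn2real_plus)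
  have "(\<lambda>i. enn2real (heatQ (s i) ?I ?I) + enn2real (heatQ (s i) (B - A) ?I)
     + (enn2real (heatQ (s i) ?I (A - B)) + enn2real (heatQ (s i) (B - A) (A - B)))) \<longlonglongrightarrow> measure lborel ?I + 0 + (0 + 0)"
    using fi by (intro tendsto_add heatQ_tendsto_same dis s) auto
  then show ?thesis unfolding e by simp
qed

interpretation lb: product_sigma_finite "\<lambda>_::nat. lborel :: 'a::euclidean_space measure"
  by standard

section \<open>Configuration spaces\<close>

abbreviation PP :: "nat \<Rightarrow> (nat \<Rightarrow> real^'n::finite) measure" where
  "PP k \<equiv> PiM {..<k} (\<lambda>_. lborel)"

lemma sf_PP: "sigma_finite_measure (PP k)"
  by (rule lb.sigma_finite) simp

lemma psf_PP: "pair_sigma_finite (PP k) (PP k)"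
  by (simp add: pair_sigma_finite_def sf_PP)

lemma sf_Mk: "sigma_finite_measure (Mk k)"
  unfolding Mk_def by (intro sigma_finite_pair_measure sf_PP)

lemma psf_Mk: "pair_sigma_finite (Mk k) (Mk l)"
  by (simp add: pair_sigma_finite_def sf_Mk)

lemma space_Mk: "space (Mk k) = (extensional {..<k}) \<times> (extensional {..<k})"
  by (simp add: Mk_def space_pair_measure space_PiM PiE_def)

lemma measurable_Mk_fst [measurable]: "j < k \<Longrightarrow> (\<lambda>z. fst z j) \<in> borel_measurable (Mk k)"
  unfolding Mk_def
  by (rule measurable_compose[OF measurable_fst])
    (use measurable_component_singleton[of j "{..<k}" "\<lambda>_. lborel"] in simp)

lemma measurable_Mk_snd [measurable]: "j < k \<Longrightarrow> (\<lambda>z. snd z j) \<in> borel_measurable (Mk k)"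
  unfolding Mk_def
  by (rule measurable_compose[OF measurable_snd])
    (use measurable_component_singleton[of j "{..<k}" "\<lambda>_. lborel"] in simp)

lemma measurable_Mk_fst' [measurable (raw)]:
  "f \<in> measurable N (Mk k) \<Longrightarrow> j < k \<Longrightarrow> (\<lambda>x. fst (f x) j) \<in> borel_measurable N"
  by (rule measurable_compose[OF _ measurable_Mk_fst])

lemma measurable_Mk_snd' [measurable (raw)]:
  "f \<in> measurable N (Mk k) \<Longrightarrow> j < k \<Longrightarrow> (\<lambda>x. snd (f x) j) \<in> borel_measurable N"
  by (rule measurable_compose[OF _ measurable_Mk_snd])

lemma measurable_dotk [measurable (raw)]:
  assumes "f \<in> measurable N (Mk k)" "g \<in> measurable N (Mk k)"
  shows "(\<lambda>x. dotk k (f x) (g x)) \<in> borel_measurable N"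
  unfolding dotk_def
  by (intro borel_measurable_sum borel_measurable_add borel_measurable_inner
      measurable_Mk_fst' measurable_Mk_snd') (use assms in auto)

definition heatk :: "nat \<Rightarrow> real \<Rightarrow> 'n::finite pts \<Rightarrow> 'n pts \<Rightarrow> real" where
  "heatk k a x y = (\<Prod>j<k. heat a (fst x j) (fst y j) * heat a (snd x j) (snd y j))"

lemma measurable_heatk [measurable (raw)]:
  assumes "f \<in> measurable N (Mk k)" "g \<in> measurable N (Mk k)"
  shows "(\<lambda>x. heatk k a (f x) (g x)) \<in> borel_measurable N"
  unfolding heatk_def
  by (intro borel_measurable_prod borel_measurable_times measurable_heat'
      measurable_Mk_fst' measurable_Mk_snd') (use assms in auto)

lemma heatk_nonneg [simp]: "a > 0 \<Longrightarrow> heatk k a x y \<ge> 0"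
  unfolding heatk_def by (intro prod_nonneg) auto

lemma heatk_commute: "heatk k a x y = heatk k a y x"
  by (simp add: heatk_def heat_commute)

lemma pair_prod:
  fixes f :: "'a \<Rightarrow> 'c::{real_normed_field,banach,second_countable_topology}" and g :: "'b \<Rightarrow> 'c"
  assumes "pair_sigma_finite M N" and f: "integrable M f" and g: "integrable N g"
  shows "integrable (M \<Otimes>\<^sub>M N) (\<lambda>z. f (fst z) * g (snd z))"
    and "(LINT z|(M \<Otimes>\<^sub>M N). f (fst z) * g (snd z)) = integral\<^sup>L M f * integral\<^sup>L N g"
proof -
  interpret pair_sigma_finite M N by fact
  note [measurable] = borel_measurable_integrable[OF f] borel_measurable_integrable[OF g]
  show i: "integrable (M \<Otimes>\<^sub>M N) (\<lambda>z. f (fst z) * g (snd z))"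
  proof (rule Fubini_integrable)
    show "integrable M (\<lambda>x. LINT y|N. norm (f (fst (x, y)) * g (snd (x, y))))"
      using f by (simp add: norm_mult)
    show "AE x in M. integrable N (\<lambda>y. f (fst (x, y)) * g (snd (x, y)))"
      using g by simp
  qed measurable
  show "(LINT z|(M \<Otimes>\<^sub>M N). f (fst z) * g (snd z)) = integral\<^sup>L M f * integral\<^sup>L N g"
    using integral_fst'[OF i] by simp
qed

lemma Mk_prod:
  fixes f g :: "nat \<Rightarrow> real^'n::finite \<Rightarrow> 'c::{real_normed_field,banach,second_countable_topology}"
  assumes f: "\<And>j. j < k \<Longrightarrow> integrable lborel (f j)" and g: "\<And>j. j < k \<Longrightarrow> integrable lborel (g j)"
  shows "integrable (Mk k) (\<lambda>z. \<Prod>j<k. f j (fst z j) * g j (snd z j))"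
    and "(LINT z|Mk k. (\<Prod>j<k. f j (fst z j) * g j (snd z j))) = (\<Prod>j<k. integral\<^sup>L lborel (f j) * integral\<^sup>L lborel (g j))"
proof -
  have i: "integrable (PP k) (\<lambda>x. \<Prod>j<k. f j (x j))" "integrable (PP k) (\<lambda>x. \<Prod>j<k. g j (x j))"
    using f g by (auto intro!: lb.product_integrable_prod)
  have v: "(LINT x|PP k. (\<Prod>j<k. f j (x j))) = (\<Prod>j<k. integral\<^sup>L lborel (f j))"
     "(LINT x|PP k. (\<Prod>j<k. g j (x j))) = (\<Prod>j<k. integral\<^sup>L lborel (g j))"
    using f g by (auto intro!: lb.product_integral_prod)
  show "integrable (Mk k) (\<lambda>z. \<Prod>j<k. f j (fst z j) * g j (snd z j))"
    unfolding Mk_def prod.distrib by (rule pair_prod(1)[OF psf_PP i])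
  show "(LINT z|Mk k. (\<Prod>j<k. f j (fst z j) * g j (snd z j))) = (\<Prod>j<k. integral\<^sup>L lborel (f j) * integral\<^sup>L lborel (g j))"
    unfolding Mk_def prod.distrib by (simp add: pair_prod(2)[OF psf_PP i] v)
qed

lemma Mk_nn_prod:
  fixes f g :: "nat \<Rightarrow> real^'n::finite \<Rightarrow> ennreal"
  assumes [measurable]: "\<And>j. j < k \<Longrightarrow> f j \<in> borel_measurable borel" "\<And>j. j < k \<Longrightarrow> g j \<in> borel_measurable borel"
  shows "(\<integral>\<^sup>+z. (\<Prod>j<k. f j (fst z j) * g j (snd z j)) \<partial>Mk k) = (\<Prod>j<k. integral\<^sup>N lborel (f j) * integral\<^sup>N lborel (g j))"
proof -
  interpret sigma_finite_measure "PP k" by (rule sf_PP)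
  have m: "(\<lambda>x. \<Prod>j<k. f j (x j)) \<in> borel_measurable (PP k)" "(\<lambda>x. \<Prod>j<k. g j (x j)) \<in> borel_measurable (PP k)"
    by (auto intro!: borel_measurable_prod_ennreal measurable_compose[OF measurable_component_singleton] assms)
  have v: "(\<integral>\<^sup>+x. (\<Prod>j<k. f j (x j)) \<partial>PP k) = (\<Prod>j<k. integral\<^sup>N lborel (f j))"
     "(\<integral>\<^sup>+x. (\<Prod>j<k. g j (x j)) \<partial>PP k) = (\<Prod>j<k. integral\<^sup>N lborel (g j))"
    by (auto intro!: lb.product_nn_integral_prod)
  have "(\<integral>\<^sup>+z. (\<Prod>j<k. f j (fst z j) * g j (snd z j)) \<partial>Mk k)
    = (\<integral>\<^sup>+x. (\<integral>\<^sup>+y. (\<Prod>j<k. f j (x j)) * (\<Prod>j<k. g j (y j)) \<partial>PP k) \<partial>PP k)"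
    unfolding Mk_def prod.distrib using m by (subst nn_integral_fst[symmetric]) auto
  also have "\<dots> = (\<Prod>j<k. integral\<^sup>N lborel (f j) * integral\<^sup>N lborel (g j))"
    using m by (simp add: nn_integral_cmult nn_integral_multc v prod.distrib)
  finally show ?thesis .
qed

lemma heatk_integral:
  assumes a: "a > 0"
  shows "integrable (Mk k) (\<lambda>y. heatk k a x y)" "(LINT y|Mk k. heatk k a x y) = 1"
  unfolding heatk_def
  by (intro Mk_prod(1) heat_integral(1) a, subst Mk_prod(2)) (simp_all add: heat_integral[OF a])

lemma heatk_nn:
  assumes a: "a > 0"
  shows "(\<integral>\<^sup>+y. ennreal (heatk k a x y) \<partial>Mk k) = 1"
  using nn_integral_eq_integral[OF heatk_integral(1)[OF a, of k x]] heatk_integral(2)[OF a, of k x] a by simp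

text \<open>Plancherel constant \<open>(2 * pi) ^ d\<close> of the unnormalised transform, where
  \<open>d = 2 * k * CARD('n)\<close> counts the real coordinates of both configurations.\<close>

definition cF :: "'n::finite itself \<Rightarrow> nat \<Rightarrow> real" where
  "cF _ k = ((2 * pi) ^ CARD('n)) ^ (2 * k)"

lemma cF_pos [simp]: "cF t k > 0"
  by (simp add: cF_def)

lemma cF_nz [simp]: "cF t k \<noteq> 0"
  using cF_pos[of t k] by linarith

lemma dotk_commute: "dotk k z w = dotk k w z"
  by (simp add: dotk_def inner_commute)

lemma dotk_self_nonneg [simp]: "dotk k z z \<ge> 0"
  unfolding dotk_def by (intro sum_nonneg) auto

lemma cis_dotk: "cis (dotk k z w) = (\<Prod>j<k. cis (fst z j \<bullet> fst w j) * cis (snd z j \<bullet> snd w j))"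
  unfolding dotk_def cis_sum by (simp add: cis_mult)

lemma cis_dotk_minus: "cis (- dotk k z w) = (\<Prod>j<k. cis (- (fst z j \<bullet> fst w j)) * cis (- (snd z j \<bullet> snd w j)))"
  unfolding dotk_def sum_negf[symmetric] cis_sum by (simp add: cis_mult)

lemma exp_dotk: "exp (- a * dotk k w w / 2) = (\<Prod>j<k. exp (- a * (norm (fst w j))\<^sup>2 / 2) * exp (- a * (norm (snd w j))\<^sup>2 / 2))"
  unfolding dotk_def power2_norm_eq_inner
  by (simp add: sum_distrib_left sum_divide_distrib sum_negf[symmetric] exp_sum exp_add[symmetric] algebra_simps add_divide_distrib diff_divide_distrib)

lemma gauss_heat:
  fixes x y :: "real^'n::finite"
  assumes a: "a > 0"
  shows "integrable lborel (\<lambda>w. cis (- (x \<bullet> w)) * cis (y \<bullet> w) * of_real (exp (- a * (norm w)\<^sup>2 / 2)))"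
    and "(LINT w|lborel. cis (- (x \<bullet> w)) * cis (y \<bullet> w) * of_real (exp (- a * (norm w)\<^sup>2 / 2)))
      = of_real ((2 * pi) ^ CARD('n) * heat a x y)"
proof -
  have e: "cis (- (x \<bullet> w)) * cis (y \<bullet> w) = cis (w \<bullet> (y - x))" for w :: "real^'n"
    by (simp add: cis_mult inner_diff_right inner_commute)
  have c: "sqrt (2 * pi / a) ^ CARD('n) = (2 * pi) ^ CARD('n) / sqrt (2 * pi * a) ^ CARD('n)"
  proof -
    have "sqrt (2 * pi / a) * sqrt (2 * pi * a) = sqrt ((2 * pi)\<^sup>2)"
      using a by (simp add: real_sqrt_mult[symmetric] power2_eq_square)
    also have "\<dots> = 2 * pi" unfolding real_sqrt_abs by simp
    finally have "sqrt (2 * pi / a) = 2 * pi / sqrt (2 * pi * a)" using a by (simp add: field_simps)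
    then show ?thesis by (simp add: power_divide)
  qed
  show "integrable lborel (\<lambda>w. cis (- (x \<bullet> w)) * cis (y \<bullet> w) * of_real (exp (- a * (norm w)\<^sup>2 / 2)))"
    unfolding e by (rule gauss_eucl0(1)[OF a])
  show "(LINT w|lborel. cis (- (x \<bullet> w)) * cis (y \<bullet> w) * of_real (exp (- a * (norm w)\<^sup>2 / 2)))
      = of_real ((2 * pi) ^ CARD('n) * heat a x y)"
    unfolding e gauss_eucl0(2)[OF a] heat_def using c by (simp add: norm_minus_commute DIM_cart)
qed

text \<open>The rigorous form of the inversion formula: damped by a Gaussian, the integral of the
  plane waves is a heat kernel instead of a delta function.\<close>

lemma gauss_heatk:
  fixes x y :: "'n::finite pts"
  assumes a: "a > 0"
  shows "integrable (Mk k) (\<lambda>w. cis (- dotk k x w) * cis (dotk k y w) * of_real (exp (- a * dotk k w w / 2)))" (is ?A)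
    and "(LINT w|Mk k. cis (- dotk k x w) * cis (dotk k y w) * of_real (exp (- a * dotk k w w / 2)))
      = of_real (cF TYPE('n) k * heatk k a x y)" (is ?B)
proof -
  define F where "F = (\<lambda>(x::real^'n) y w. cis (- (x \<bullet> w)) * cis (y \<bullet> w) * complex_of_real (exp (- a * (norm w)\<^sup>2 / 2)))"
  have e: "cis (- dotk k x w) * cis (dotk k y w) * of_real (exp (- a * dotk k w w / 2)) =
    (\<Prod>j<k. F (fst x j) (fst y j) (fst w j) * F (snd x j) (snd y j) (snd w j))" for w
    unfolding cis_dotk cis_dotk_minus exp_dotk of_real_prod of_real_mult F_def
    by (simp add: prod.distrib)
  have i: "integrable lborel (F u v)" "integral\<^sup>L lborel (F u v) = of_real ((2 * pi) ^ CARD('n) * heat a u v)" for u v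
    unfolding F_def using gauss_heat[OF a, of u v] by auto
  show ?A unfolding e by (intro Mk_prod(1) i)
  show ?B unfolding e
    by (subst Mk_prod(2)) (auto simp: i heatk_def cF_def prod.distrib power_mult power2_eq_square power_mult_distrib)
qed

text \<open>Boxes generate the sigma-algebra of \<open>Mk k\<close>, and on them both the measure
  and the heat form factor into one-particle quantities.\<close>

definition bx :: "nat \<Rightarrow> (nat \<Rightarrow> (real^'n::finite) set) \<Rightarrow> (nat \<Rightarrow> (real^'n) set) \<Rightarrow> 'n pts set" where
  "bx k A B = PiE {..<k} A \<times> PiE {..<k} B"

lemma bx_sets [measurable]:
  "(\<And>j. A j \<in> sets borel) \<Longrightarrow> (\<And>j. B j \<in> sets borel) \<Longrightarrow> bx k A B \<in> sets (Mk k)"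
  unfolding bx_def Mk_def by (intro pair_measureI sets_PiM_I_finite) auto

lemma indicator_bx:
  assumes "z \<in> space (Mk k)"
  shows "(indicator (bx k A B) z :: 'c::{comm_semiring_1}) = (\<Prod>j<k. indicator (A j) (fst z j) * indicator (B j) (snd z j))"
proof -
  have ex: "fst z \<in> extensional {..<k}" "snd z \<in> extensional {..<k}" using assms by (auto simp: space_Mk)
  show ?thesis
  proof (cases "z \<in> bx k A B")
    case True
    then show ?thesis by (auto simp: bx_def indicator_def mem_Times_iff PiE_def Pi_def intro!: prod.neutral[symmetric])
  next
    case False
    then obtain j where j: "j < k" "fst z j \<notin> A j \<or> snd z j \<notin> B j"
      using ex by (auto simp: bx_def mem_Times_iff PiE_def Pi_def)
    have "(\<Prod>j<k. indicator (A j) (fst z j) * indicator (B j) (snd z j) :: 'c) = 0"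
      by (rule prod_zero) (use j in \<open>auto intro!: bexI[of _ j]\<close>)
    then show ?thesis using False by simp
  qed
qed

lemma emeasure_bx:
  assumes [measurable]: "\<And>j. A j \<in> sets borel" "\<And>j. B j \<in> sets borel"
  shows "emeasure (Mk k) (bx k A B) = (\<Prod>j<k. emeasure lborel (A j) * emeasure lborel (B j))"
proof -
  have "emeasure (Mk k) (bx k A B) = (\<integral>\<^sup>+z. indicator (bx k A B) z \<partial>Mk k)" by simp
  also have "\<dots> = (\<integral>\<^sup>+z. (\<Prod>j<k. indicator (A j) (fst z j) * indicator (B j) (snd z j)) \<partial>Mk k)"
    by (intro nn_integral_cong indicator_bx)
  also have "\<dots> = (\<Prod>j<k. emeasure lborel (A j) * emeasure lborel (B j))"
    by (subst Mk_nn_prod) auto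
  finally show ?thesis .
qed

lemma emeasure_bx_finite:
  assumes "\<And>j. A j \<in> sets borel" "\<And>j. B j \<in> sets borel"
    and "\<And>j. emeasure lborel (A j) < \<infinity>" "\<And>j. emeasure lborel (B j) < \<infinity>"
  shows "emeasure (Mk k) (bx k A B) < \<infinity>"
  unfolding emeasure_bx[OF assms(1,2)] using assms(3,4)
  by (simp add: less_top[symmetric] ennreal_prod_eq_top ennreal_mult_eq_top_iff)

lemma bx_Int: "bx k A B \<inter> bx k A' B' = bx k (\<lambda>j. A j \<inter> A' j) (\<lambda>j. B j \<inter> B' j)"
  by (auto simp: bx_def PiE_def Pi_def)

section \<open>Induction from boxes to square-integrable kernels\<close>

lemma sets_PP: "sets (PP k :: (nat \<Rightarrow> real^'n::finite) measure) = sigma_sets (space (PP k)) {PiE {..<k} A | A. \<forall>j. A j \<in> sets borel}"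
proof -
  have "prod_algebra {..<k} (\<lambda>_. lborel) = {PiE {..<k} A | A. \<forall>j. A j \<in> sets (borel :: (real^'n) measure)}"
    unfolding prod_algebra_eq_finite[OF finite_lessThan]
  proof safe
    fix X :: "nat \<Rightarrow> (real^'n) set" assume "X \<in> (\<Pi> j\<in>{..<k}. sets lborel)"
    then show "\<exists>A. PiE {..<k} X = PiE {..<k} A \<and> (\<forall>j. A j \<in> sets borel)"
      by (intro exI[of _ "\<lambda>j. if j < k then X j else {}"]) (auto intro!: PiE_cong)
  next
    fix A :: "nat \<Rightarrow> (real^'n) set" assume "\<forall>j. A j \<in> sets borel"
    then show "\<exists>X. PiE {..<k} A = PiE {..<k} X \<and> X \<in> (\<Pi> j\<in>{..<k}. sets lborel)" by auto
  qed
  then show ?thesis by (simp add: sets_PiM space_PiM)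
qed

lemma sets_Mk: "sets (Mk k :: 'n::finite pts measure) = sigma_sets (space (Mk k)) {bx k A B | A B. (\<forall>j. A j \<in> sets borel) \<and> (\<forall>j. B j \<in> sets borel)}"
proof -
  let ?E = "{PiE {..<k} A | A. \<forall>j. A j \<in> sets (borel :: (real^'n) measure)}"
  have sub: "?E \<subseteq> Pow (space (PP k))" by (auto simp: space_PiM)
  have top: "space (PP k) \<in> ?E" by (auto simp: space_PiM intro!: exI[of _ "\<lambda>_. UNIV"])
  have "sets (Mk k) = sets (sigma (space (PP k) \<times> space (PP k)) {a \<times> b | a b. a \<in> ?E \<and> b \<in> ?E})"
    unfolding Mk_def
    by (rule sets_pair_eq[where Ca = "{space (PP k)}" and Cb = "{space (PP k)}"])
      (use sub top sets_PP in auto)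
  also have "{a \<times> b | a b. a \<in> ?E \<and> b \<in> ?E} = {bx k A B | A B. (\<forall>j. A j \<in> sets borel) \<and> (\<forall>j. B j \<in> sets borel)}"
    unfolding bx_def by blast
  also have "sets (sigma (space (PP k) \<times> space (PP k)) \<dots>) = sigma_sets (space (Mk k)) \<dots>"
    by (subst sets_measure_of) (auto simp: bx_def Mk_def space_pair_measure space_PiM)
  finally show ?thesis .
qed

text \<open>Sets are reached from boxes by a Dynkin argument. It is carried out inside the bounded
  boxes \<open>D r\<close>, where complements keep finite measure; the truncation is removed by
  letting r grow.\<close>

lemma Mk_induct [consumes 1, case_names box scale add lim]:
  fixes f :: "'n::finite kernel"
  assumes "sqi (Mk k) f"
    and base: "\<And>A B. (\<And>j. A j \<in> sets borel) \<Longrightarrow> (\<And>j. B j \<in> sets borel) \<Longrightarrow> (\<And>j. emeasure lborel (A j) < \<infinity>) \<Longrightarrow>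
      (\<And>j. emeasure lborel (B j) < \<infinity>) \<Longrightarrow> P (indicator (bx k A B))"
    and scale: "\<And>f c. sqi (Mk k) f \<Longrightarrow> P f \<Longrightarrow> P (\<lambda>z. c * f z)"
    and add: "\<And>f g. sqi (Mk k) f \<Longrightarrow> sqi (Mk k) g \<Longrightarrow> P f \<Longrightarrow> P g \<Longrightarrow> P (\<lambda>z. f z + g z)"
    and lim: "\<And>s f. (\<And>i::nat. sqi (Mk k) (s i)) \<Longrightarrow> (\<And>i. P (s i)) \<Longrightarrow> sqi (Mk k) f \<Longrightarrow>
      (\<lambda>i. nrm (Mk k) (\<lambda>z. s i z - f z)) \<longlonglongrightarrow> 0 \<Longrightarrow> P f"
  shows "P f"
  using assms(1)
proof (induction rule: sqi_induct)
  case (indicator S)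
  define D where "D = (\<lambda>r::nat. bx k (\<lambda>_. ball 0 (real r)) (\<lambda>_. ball (0::real^'n) (real r)))"
  have bf: "emeasure lborel (ball (0::real^'n) r) < \<infinity>" for r
    using emeasure_bounded_finite[of "ball (0::real^'n) r"] by (simp add: less_top)
  have D: "D r \<in> sets (Mk k)" "emeasure (Mk k) (D r) < \<infinity>" for r
    unfolding D_def by (intro bx_sets emeasure_bx_finite bf; simp)+
  have sD: "sqi (Mk k) (indicator (D r))" for r by (intro sqi_indicator D)
  have PD: "P (indicator (D r))" for r unfolding D_def by (rule base; (rule bf)?) auto
  have sS: "sqi (Mk k) (indicator (X \<inter> D r))" if "X \<in> sets (Mk k)" for X r
    using that D(1)[of r] D(2)[of r] emeasure_mono[of "X \<inter> D r" "D r" "Mk k"]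
    by (intro sqi_indicator) (auto intro: le_less_trans)
  let ?G = "{bx k A B | A B :: nat \<Rightarrow> (real^'n) set. (\<forall>j. A j \<in> sets borel) \<and> (\<forall>j. B j \<in> sets borel)}"
  have step: "P (indicator (X \<inter> D r))" if X: "X \<in> sets (Mk k)" for X r
  proof -
    have Gs: "?G \<subseteq> Pow (space (Mk k))" by (auto simp: bx_def Mk_def space_pair_measure space_PiM)
    have Gi: "Int_stable ?G"
    proof (rule Int_stableI)
      fix a b assume "a \<in> ?G" "b \<in> ?G"
      then obtain A B A' B' where ab: "a = bx k A B" "b = bx k A' B'" "\<forall>j. A j \<in> sets borel" "\<forall>j. B j \<in> sets borel"
        "\<forall>j. A' j \<in> sets borel" "\<forall>j. B' j \<in> sets borel" by blast
      then show "a \<inter> b \<in> ?G" unfolding ab(1,2) bx_Int by blast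
    qed
    have X': "X \<in> sigma_sets (space (Mk k)) ?G" using X by (subst (asm) sets_Mk)
    have insets: "Y \<in> sets (Mk k)" if "Y \<in> sigma_sets (space (Mk k)) ?G" for Y
      using that by (subst sets_Mk)
    show ?thesis
      using Gi Gs X'
    proof (induction rule: sigma_sets_induct_disjoint)
      case (basic Y)
      then obtain A B where Y: "Y = bx k A B" "\<And>j. A j \<in> sets borel" "\<And>j. B j \<in> sets borel" by blast
      have fi: "emeasure lborel (C \<inter> ball (0::real^'n) r) < \<infinity>" if "C \<in> sets borel" for C r
        using bf[of r] emeasure_mono[of "C \<inter> ball (0::real^'n) r" "ball 0 r" lborel] by (auto intro: le_less_trans)
      show ?case unfolding Y(1) D_def bx_Int
        by (rule base) (use Y(2,3) fi in auto)
    next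
      case empty
      have "(\<lambda>z. 0 * indicator (D r) z) = (indicator ({} \<inter> D r) :: _ \<Rightarrow> complex)" by auto
      then show ?case using scale[OF sD PD, where c = 0] by simp
    next
      case (compl Y)
      have "(indicator ((space (Mk k) - Y) \<inter> D r) :: _ \<Rightarrow> complex) = (\<lambda>z. indicator (D r) z + (-1) * indicator (Y \<inter> D r) z)"
        using sets.sets_into_space[OF D(1)[of r]] by (auto simp: indicator_def fun_eq_iff)
      then show ?case
        using add[OF sD sqi_scale[OF sS[OF insets[OF compl(1)], of r], where c = "-1"] PD[of r] scale[OF sS[OF insets[OF compl(1)]] compl(2), where c = "-1"]]
        by simp
    next
      case (union Y)
      have Ys: "Y i \<in> sets (Mk k)" for i using union(2) insets by auto
      define s where "s = (\<lambda>n z. \<Sum>i<n. (indicator (Y i \<inter> D r) z :: complex))"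
      have ss: "sqi (Mk k) (s n)" for n unfolding s_def by (intro sqi_sum sS Ys)
      have Ps: "P (s n)" for n
      proof (induction n)
        case 0
        have "(\<lambda>z. 0 * indicator (D r) z) = s 0" by (auto simp: s_def)
        then show ?case using scale[OF sD PD, where c = 0] by simp
      next
        case (Suc n)
        have "s (Suc n) = (\<lambda>z. s n z + indicator (Y n \<inter> D r) z)" by (auto simp: s_def)
        then show ?case using add[OF ss[of n] sS[OF Ys[of n], of r] Suc union(3)[of n]] by simp
      qed
      have s_eq: "s n z = indicator ((\<Union>i<n. Y i) \<inter> D r) z" for n z
      proof (cases "z \<in> (\<Union>i<n. Y i) \<inter> D r")
        case True
        then obtain i where i: "i < n" "z \<in> Y i" "z \<in> D r" by auto
        have "(\<Sum>l<n. (indicator (Y l \<inter> D r) z :: complex)) = (\<Sum>l<n. if l = i then 1 else 0)"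
          by (intro sum.cong refl) (use i union(1) in \<open>auto simp: disjoint_family_on_def indicator_def\<close>)
        then show ?thesis using i True by (simp add: s_def)
      next
        case False
        then show ?thesis by (auto simp: s_def indicator_def)
      qed
      have lim0: "(\<lambda>n. s n z) \<longlonglongrightarrow> indicator ((\<Union>i. Y i) \<inter> D r) z" for z
      proof (cases "z \<in> (\<Union>i. Y i) \<inter> D r")
        case True
        then obtain i where i: "z \<in> Y i" "z \<in> D r" by auto
        have "s n z = indicator ((\<Union>i. Y i) \<inter> D r) z" if "n \<ge> Suc i" for n
          unfolding s_eq using i that True by (auto simp: indicator_def)
        then show ?thesis by (intro tendsto_eventually eventually_sequentiallyI[of "Suc i"]) auto
      next
        case False
        then have "s n z = indicator ((\<Union>i. Y i) \<inter> D r) z" for n unfolding s_eq by (auto simp: indicator_def)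
        then show ?thesis by simp
      qed
      have U: "(\<Union>i. Y i) \<in> sets (Mk k)" using Ys by auto
      show ?case
        by (rule lim[of s, OF ss Ps sS[OF U]],
            rule sqi_dominated(3)[OF sqi_meas[OF ss] sqi_meas[OF sS[OF U]] sD[of r], where c = 1])
          (use lim0 s_eq in \<open>auto simp: indicator_def\<close>)
    qed
  qed
  have s: "sqi (Mk k) (indicator (S \<inter> D r))" for r by (rule sS[OF indicator(1)])
  have S: "sqi (Mk k) (indicator S)" by (rule sqi_indicator[OF indicator])
  have ev: "(\<lambda>r. indicator (S \<inter> D r) z :: complex) \<longlonglongrightarrow> indicator S z" if z: "z \<in> space (Mk k)" for z
  proof -
    obtain N :: nat where N: "(\<Sum>j<k. norm (fst z j) + norm (snd z j)) < real N" using reals_Archimedean2 by blast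
    have "z \<in> D r" if "r \<ge> N" for r
    proof -
      have "norm (fst z j) + norm (snd z j) < real r" if j: "j < k" for j
      proof -
        have "norm (fst z j) + norm (snd z j) \<le> (\<Sum>j<k. norm (fst z j) + norm (snd z j))"
          using j by (intro member_le_sum[of j "{..<k}" "\<lambda>j. norm (fst z j) + norm (snd z j)"]) auto
        then show ?thesis using N \<open>r \<ge> N\<close> by linarith
      qed
      then have "norm (fst z j) < real r" "norm (snd z j) < real r" if "j < k" for j
        using that norm_ge_zero[of "fst z j"] norm_ge_zero[of "snd z j"] by (meson add_increasing add_increasing2 le_less_trans order_refl)+
      then show ?thesis using z unfolding D_def bx_def by (auto simp: space_Mk mem_Times_iff PiE_def Pi_def)
    qed
    then show ?thesis
      by (intro tendsto_eventually eventually_sequentiallyI[of N]) (auto simp: indicator_def)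
  qed
  show ?case
    by (rule lim[of "\<lambda>r. indicator (S \<inter> D r)", OF s step[OF indicator(1)] S],
        rule sqi_dominated(3)[OF sqi_meas[OF s] sqi_meas[OF S] S, where c = 1])
      (use ev in \<open>auto simp: indicator_def\<close>)
qed (fact scale, fact add, fact lim)

section \<open>The heat kernel as a sesquilinear form\<close>

definition bform :: "nat \<Rightarrow> real \<Rightarrow> 'n::finite kernel \<Rightarrow> 'n kernel \<Rightarrow> complex" where
  "bform k a f h = (LINT p|(Mk2 k). of_real (heatk k a (fst p) (snd p)) * f (fst p) * cnj (h (snd p)))"

text \<open>The kernel has mass one in each variable, so lifting a function to the pair space with
  the square root of the kernel does not increase its norm.\<close>

lemma sqi_heat_lift:
  fixes f :: "'n::finite kernel"
  assumes f: "sqi (Mk k) f" and a: "a > 0"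
  shows "sqi (Mk2 k) (\<lambda>p. of_real (sqrt (heatk k a (fst p) (snd p))) * f (fst p))"
    and "nrm (Mk2 k) (\<lambda>p. of_real (sqrt (heatk k a (fst p) (snd p))) * f (fst p)) \<le> nrm (Mk k) f"
    and "sqi (Mk2 k) (\<lambda>p. of_real (sqrt (heatk k a (fst p) (snd p))) * f (snd p))"
    and "nrm (Mk2 k) (\<lambda>p. of_real (sqrt (heatk k a (fst p) (snd p))) * f (snd p)) \<le> nrm (Mk k) f"
proof -
  interpret pair_sigma_finite "Mk k :: 'n pts measure" "Mk k :: 'n pts measure" by (rule psf_Mk)
  note [measurable] = sqi_meas[OF f]
  have e: "ennreal ((cmod (of_real (sqrt (heatk k a x y)) * c))\<^sup>2) = ennreal (heatk k a x y) * ennreal ((cmod c)\<^sup>2)" for x y c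
    using a by (simp add: norm_mult power_mult_distrib ennreal_mult)
  have "(\<integral>\<^sup>+p. ennreal ((cmod (of_real (sqrt (heatk k a (fst p) (snd p))) * f (fst p)))\<^sup>2) \<partial>(Mk2 k))
    = (\<integral>\<^sup>+x. \<integral>\<^sup>+y. ennreal (heatk k a x y) * ennreal ((cmod (f x))\<^sup>2) \<partial>Mk k \<partial>Mk k)"
    by (subst sigma_finite_measure.nn_integral_fst[OF sf_Mk, symmetric]) (auto simp: e)
  also have "\<dots> = (\<integral>\<^sup>+x. ennreal ((cmod (f x))\<^sup>2) \<partial>Mk k)"
    by (intro nn_integral_cong) (simp add: nn_integral_multc heatk_nn[OF a])
  finally have 1: "(\<integral>\<^sup>+p. ennreal ((cmod (of_real (sqrt (heatk k a (fst p) (snd p))) * f (fst p)))\<^sup>2) \<partial>(Mk2 k))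
     \<le> ennreal ((nrm (Mk k) f)\<^sup>2)" by (simp add: nn_nrm[OF f])
  have "(\<integral>\<^sup>+p. ennreal ((cmod (of_real (sqrt (heatk k a (fst p) (snd p))) * f (snd p)))\<^sup>2) \<partial>(Mk2 k))
    = (\<integral>\<^sup>+y. \<integral>\<^sup>+x. ennreal (heatk k a x y) * ennreal ((cmod (f y))\<^sup>2) \<partial>Mk k \<partial>Mk k)"
    by (subst nn_integral_snd[symmetric]) (auto simp: e)
  also have "\<dots> = (\<integral>\<^sup>+y. ennreal ((cmod (f y))\<^sup>2) \<partial>Mk k)"
    by (intro nn_integral_cong) (simp add: nn_integral_multc heatk_nn[OF a] heatk_commute[of k a _ y for y])
  finally have 2: "(\<integral>\<^sup>+p. ennreal ((cmod (of_real (sqrt (heatk k a (fst p) (snd p))) * f (snd p)))\<^sup>2) \<partial>(Mk2 k))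
     \<le> ennreal ((nrm (Mk k) f)\<^sup>2)" by (simp add: nn_nrm[OF f])
  have m1: "(\<lambda>p. of_real (sqrt (heatk k a (fst p) (snd p))) * f (fst p)) \<in> borel_measurable (Mk2 k)" by measurable
  have m2: "(\<lambda>p. of_real (sqrt (heatk k a (fst p) (snd p))) * f (snd p)) \<in> borel_measurable (Mk2 k)" by measurable
  show "sqi (Mk2 k) (\<lambda>p. of_real (sqrt (heatk k a (fst p) (snd p))) * f (fst p))"
    "nrm (Mk2 k) (\<lambda>p. of_real (sqrt (heatk k a (fst p) (snd p))) * f (fst p)) \<le> nrm (Mk k) f"
    "sqi (Mk2 k) (\<lambda>p. of_real (sqrt (heatk k a (fst p) (snd p))) * f (snd p))"
    "nrm (Mk2 k) (\<lambda>p. of_real (sqrt (heatk k a (fst p) (snd p))) * f (snd p)) \<le> nrm (Mk k) f"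
    using sqi_nnI[OF m1 1] sqi_nnI[OF m2 2] by auto
qed

text \<open>Giving a square root of the kernel to each argument turns the form into an inner
  product, which supplies its bound and its linearity.\<close>

lemma bform_ip:
  fixes f h :: "'n::finite kernel"
  assumes a: "a > 0"
  shows "bform k a f h = ip (Mk2 k) (\<lambda>p. of_real (sqrt (heatk k a (fst p) (snd p))) * f (fst p))
    (\<lambda>p. of_real (sqrt (heatk k a (fst p) (snd p))) * h (snd p))"
proof -
  have e: "of_real (heatk k a x y) * u * cnj v = of_real (sqrt (heatk k a x y)) * u * cnj (of_real (sqrt (heatk k a x y)) * v)" for x y :: "'n pts" and u v
  proof -
    have "complex_of_real (heatk k a x y) = of_real (sqrt (heatk k a x y)) * of_real (sqrt (heatk k a x y))"
      using a by (simp flip: of_real_mult)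
    then show ?thesis by simp
  qed
  show ?thesis unfolding bform_def ip_def by (simp only: e)
qed

lemma bform_bound:
  assumes "sqi (Mk k) f" "sqi (Mk k) h" "a > 0"
  shows "cmod (bform k a f h) \<le> nrm (Mk k) f * nrm (Mk k) h"
  unfolding bform_ip[OF assms(3)]
  by (rule order_trans[OF cauchy_schwarz_ip[OF sqi_heat_lift(1)[OF assms(1,3)] sqi_heat_lift(3)[OF assms(2,3)]]])
    (intro mult_mono sqi_heat_lift assms, auto)

lemma bform_add_left: "sqi (Mk k) f \<Longrightarrow> sqi (Mk k) g \<Longrightarrow> sqi (Mk k) h \<Longrightarrow> a > 0 \<Longrightarrow>
    bform k a (\<lambda>z. f z + g z) h = bform k a f h + bform k a g h"
  unfolding bform_ip ring_distribs by (intro ip_add_left sqi_heat_lift)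

lemma bform_add_right: "sqi (Mk k) f \<Longrightarrow> sqi (Mk k) g \<Longrightarrow> sqi (Mk k) h \<Longrightarrow> a > 0 \<Longrightarrow>
    bform k a h (\<lambda>z. f z + g z) = bform k a h f + bform k a h g"
  unfolding bform_ip ring_distribs by (intro ip_add_right sqi_heat_lift)

lemma bform_diff_left: "sqi (Mk k) f \<Longrightarrow> sqi (Mk k) g \<Longrightarrow> sqi (Mk k) h \<Longrightarrow> a > 0 \<Longrightarrow>
    bform k a (\<lambda>z. f z - g z) h = bform k a f h - bform k a g h"
  unfolding bform_ip ring_distribs by (intro ip_diff_left sqi_heat_lift)

lemma bform_diff_right: "sqi (Mk k) f \<Longrightarrow> sqi (Mk k) g \<Longrightarrow> sqi (Mk k) h \<Longrightarrow> a > 0 \<Longrightarrow>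
    bform k a h (\<lambda>z. f z - g z) = bform k a h f - bform k a h g"
  unfolding bform_ip ring_distribs by (intro ip_diff_right sqi_heat_lift)

lemma bform_scale_left: "bform k a (\<lambda>z. c * f z) h = c * bform k a f h"
  unfolding bform_def by (subst integral_mult_right_zero[symmetric]) (simp add: ac_simps)

lemma bform_scale_right: "bform k a h (\<lambda>z. c * f z) = cnj c * bform k a h f"
  unfolding bform_def by (subst integral_mult_right_zero[symmetric]) (simp add: ac_simps)

lemma enn2real_prod: "enn2real (\<Prod>i\<in>I. f i) = (\<Prod>i\<in>I. enn2real (f i))"
  by (induction I rule: infinite_finite_induct) (auto simp: enn2real_mult)

lemma bform_box:
  fixes A B A' B' :: "nat \<Rightarrow> (real^'n::finite) set"
  assumes [measurable]: "\<And>j. A j \<in> sets borel" "\<And>j. B j \<in> sets borel" "\<And>j. A' j \<in> sets borel" "\<And>j. B' j \<in> sets borel"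
    and a: "a > 0"
  shows "bform k a (indicator (bx k A B)) (indicator (bx k A' B')) =
    of_real (\<Prod>j<k. enn2real (heatQ a (A j) (A' j)) * enn2real (heatQ a (B j) (B' j)))"
proof -
  interpret pair_sigma_finite "Mk k :: 'n pts measure" "Mk k :: 'n pts measure" by (rule psf_Mk)
  define g where "g = (\<lambda>p. heatk k a (fst p) (snd p) * indicator (bx k A B) (fst p) * indicator (bx k A' B') (snd p))"
  have [measurable]: "bx k A B \<in> sets (Mk k)" "bx k A' B' \<in> sets (Mk k)" by (intro bx_sets; measurable)+
  have gm: "g \<in> borel_measurable (Mk2 k)" unfolding g_def by measurable
  have "bform k a (indicator (bx k A B)) (indicator (bx k A' B')) = (LINT p|(Mk2 k). of_real (g p))"
    unfolding bform_def by (intro Bochner_Integration.integral_cong refl) (auto simp: g_def indicator_def)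
  also have "\<dots> = of_real (LINT p|(Mk2 k). g p)" by (rule integral_complex_of_real)
  also have "(LINT p|(Mk2 k). g p) = enn2real (\<integral>\<^sup>+p. ennreal (g p) \<partial>(Mk2 k))"
    by (rule integral_eq_nn_integral[OF gm]) (use a in \<open>auto simp: g_def\<close>)
  also have "(\<integral>\<^sup>+p. ennreal (g p) \<partial>(Mk2 k)) = (\<integral>\<^sup>+x. \<integral>\<^sup>+y. ennreal (g (x, y)) \<partial>Mk k \<partial>Mk k)"
    using gm by (subst sigma_finite_measure.nn_integral_fst[OF sf_Mk, symmetric]) auto
  also have "\<dots> = (\<integral>\<^sup>+x. (\<Prod>j<k. (\<integral>\<^sup>+y. ennreal (heat a (fst x j) y) * indicator (A j) (fst x j) * indicator (A' j) y \<partial>lborel)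
       * (\<integral>\<^sup>+y. ennreal (heat a (snd x j) y) * indicator (B j) (snd x j) * indicator (B' j) y \<partial>lborel)) \<partial>Mk k)"
  proof (rule nn_integral_cong)
    fix x :: "'n pts" assume x: "x \<in> space (Mk k)"
    have "(\<integral>\<^sup>+y. ennreal (g (x, y)) \<partial>Mk k) = (\<integral>\<^sup>+y. (\<Prod>j<k. (ennreal (heat a (fst x j) (fst y j)) * indicator (A j) (fst x j) * indicator (A' j) (fst y j))
       * (ennreal (heat a (snd x j) (snd y j)) * indicator (B j) (snd x j) * indicator (B' j) (snd y j))) \<partial>Mk k)"
    proof (rule nn_integral_cong)
      fix y :: "'n pts" assume y: "y \<in> space (Mk k)"
      have "ennreal (g (x, y)) = ennreal (heatk k a x y) * indicator (bx k A B) x * indicator (bx k A' B') y"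
        using a by (auto simp: g_def indicator_def)
      also have "\<dots> = (\<Prod>j<k. (ennreal (heat a (fst x j) (fst y j)) * indicator (A j) (fst x j) * indicator (A' j) (fst y j))
       * (ennreal (heat a (snd x j) (snd y j)) * indicator (B j) (snd x j) * indicator (B' j) (snd y j)))"
        unfolding indicator_bx[OF x] indicator_bx[OF y] heatk_def
        using a by (subst prod_ennreal[symmetric]) (auto simp: ennreal_mult prod.distrib ac_simps)
      finally show "ennreal (g (x, y)) = \<dots>" .
    qed
    also have "\<dots> = (\<Prod>j<k. (\<integral>\<^sup>+y. ennreal (heat a (fst x j) y) * indicator (A j) (fst x j) * indicator (A' j) y \<partial>lborel)
       * (\<integral>\<^sup>+y. ennreal (heat a (snd x j) y) * indicator (B j) (snd x j) * indicator (B' j) y \<partial>lborel))"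
      by (rule Mk_nn_prod) measurable
    finally show "(\<integral>\<^sup>+y. ennreal (g (x, y)) \<partial>Mk k) = \<dots>" .
  qed
  also have "\<dots> = (\<Prod>j<k. heatQ a (A j) (A' j) * heatQ a (B j) (B' j))"
    unfolding heatQ_def by (rule Mk_nn_prod) measurable
  finally show ?thesis by (simp add: enn2real_prod enn2real_mult)
qed

text \<open>The error \<open>e n\<close> is uniform in i, which is what permits exchanging the two
  limits; it handles the limit case of \<open>Mk_induct\<close>.\<close>

lemma limit_exchange:
  fixes b :: "nat \<Rightarrow> nat \<Rightarrow> complex"
  assumes "\<And>n. b n \<longlonglongrightarrow> L n" "\<And>n i. cmod (b n i - B i) \<le> e n" "\<And>n. cmod (L n - l) \<le> e n" "e \<longlonglongrightarrow> 0"
  shows "B \<longlonglongrightarrow> l"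
proof (rule LIMSEQ_I)
  fix r :: real assume r: "r > 0"
  obtain n where n: "e n < r / 3" using order_tendstoD(2)[OF assms(4), of "r/3"] r by (auto simp: eventually_sequentially)
  obtain N where N: "\<And>i. i \<ge> N \<Longrightarrow> cmod (b n i - L n) < r / 3"
    using LIMSEQ_D[OF assms(1)[of n], of "r/3"] r by auto
  have "norm (B i - l) < r" if "i \<ge> N" for i
  proof -
    have "B i - l = (B i - b n i) + (b n i - L n) + (L n - l)" by simp
    then have "norm (B i - l) \<le> norm (B i - b n i) + norm (b n i - L n) + norm (L n - l)"
      by (metis norm_triangle_ineq order_trans add_right_mono)
    also have "norm (B i - b n i) \<le> e n" using assms(2)[of n i] by (simp add: norm_minus_commute)
    finally show ?thesis using N[OF that] assms(3)[of n] n by linarith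
  qed
  then show "\<exists>no. \<forall>n\<ge>no. norm (B n - l) < r" by blast
qed

text \<open>Both arguments are reduced to boxes by a double induction; there the form factors by
  \<open>bform_box\<close>, and \<open>heatQ_tendsto\<close> applies to each factor.\<close>

lemma approx_id:
  fixes f h :: "'n::finite kernel"
  assumes s: "\<And>i. s i > 0" "s \<longlonglongrightarrow> 0" and f: "sqi (Mk k) f" and h: "sqi (Mk k) h"
  shows "(\<lambda>i. bform k (s i) f h) \<longlonglongrightarrow> ip (Mk k) f h"
  using f
proof (induction rule: Mk_induct)
  case (box A B)
  have sR: "sqi (Mk k) (indicator (bx k A B))"
    using box by (intro sqi_indicator emeasure_bx_finite bx_sets) auto
  show ?case using h
  proof (induction rule: Mk_induct)
    case (box A' B')
    note AB = \<open>\<And>j. A j \<in> sets borel\<close> \<open>\<And>j. B j \<in> sets borel\<close>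
    have [measurable]: "bx k A B \<in> sets (Mk k)" "bx k A' B' \<in> sets (Mk k)" using AB box(1,2) by (auto intro: bx_sets)
    have m: "measure (Mk k) (bx k A B \<inter> bx k A' B') = (\<Prod>j<k. measure lborel (A j \<inter> A' j) * measure lborel (B j \<inter> B' j))"
      unfolding bx_Int measure_def
      by (subst emeasure_bx) (use AB box in \<open>auto simp: enn2real_prod enn2real_mult\<close>)
    have "ip (Mk k) (indicator (bx k A B)) (indicator (bx k A' B')) = (LINT z|Mk k. of_real (indicator (bx k A B \<inter> bx k A' B') z))"
      unfolding ip_def by (intro Bochner_Integration.integral_cong refl) (auto simp: indicator_def)
    also have "\<dots> = of_real (LINT z|Mk k. indicator (bx k A B \<inter> bx k A' B') z)" by (rule integral_complex_of_real)
    also have "\<dots> = of_real (\<Prod>j<k. measure lborel (A j \<inter> A' j) * measure lborel (B j \<inter> B' j))"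
      using m sets.sets_into_space[OF \<open>bx k A B \<in> sets (Mk k)\<close>] by (simp add: Int_absorb2 le_infI1)
    finally have ipe: "ip (Mk k) (indicator (bx k A B)) (indicator (bx k A' B')) = \<dots>" .
    show ?case
      unfolding ipe bform_box[OF AB box(1,2) s(1)]
      by (intro tendsto_of_real tendsto_prod tendsto_mult heatQ_tendsto s AB box \<open>\<And>j. emeasure lborel (A j) < \<infinity>\<close> \<open>\<And>j. emeasure lborel (B j) < \<infinity>\<close>)
  next
    case (scale h c)
    then show ?case unfolding bform_scale_right ip_scale_right by (intro tendsto_intros)
  next
    case (add h g)
    have e: "bform k (s i) (indicator (bx k A B)) (\<lambda>z. h z + g z) = bform k (s i) (indicator (bx k A B)) h + bform k (s i) (indicator (bx k A B)) g" for i
      by (rule bform_add_right[OF add(1,2) sR s(1)])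
    show ?case unfolding e ip_add_right[OF add(1,2) sR] using add by (intro tendsto_intros)
  next
    case (lim u h)
    show ?case
    proof (rule limit_exchange[where b = "\<lambda>n i. bform k (s i) (indicator (bx k A B)) (u n)" and e = "\<lambda>n. nrm (Mk k) (indicator (bx k A B)) * nrm (Mk k) (\<lambda>z. u n z - h z)"])
      show "(\<lambda>i. bform k (s i) (indicator (bx k A B)) (u n)) \<longlonglongrightarrow> ip (Mk k) (indicator (bx k A B)) (u n)" for n using lim(4) .
      show "cmod (bform k (s i) (indicator (bx k A B)) (u n) - bform k (s i) (indicator (bx k A B)) h) \<le> nrm (Mk k) (indicator (bx k A B)) * nrm (Mk k) (\<lambda>z. u n z - h z)" for n i
        using bform_bound[OF sR sqi_diff[OF lim(1,2)] s(1), of i n] bform_diff_right[OF lim(1,2) sR s(1), of i n] by simp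
      show "cmod (ip (Mk k) (indicator (bx k A B)) (u n) - ip (Mk k) (indicator (bx k A B)) h) \<le> nrm (Mk k) (indicator (bx k A B)) * nrm (Mk k) (\<lambda>z. u n z - h z)" for n
        using cauchy_schwarz_ip[OF sR sqi_diff[OF lim(1,2)], of n] ip_diff_right[OF lim(1,2) sR, of n] by simp
      show "(\<lambda>n. nrm (Mk k) (indicator (bx k A B)) * nrm (Mk k) (\<lambda>z. u n z - h z)) \<longlonglongrightarrow> 0"
        using tendsto_mult_right_zero[OF lim(3)] by simp
    qed
  qed
next
  case (scale f c)
  then show ?case unfolding bform_scale_left ip_scale_left by (intro tendsto_intros)
next
  case (add f g)
  have e: "bform k (s i) (\<lambda>z. f z + g z) h = bform k (s i) f h + bform k (s i) g h" for i
    by (rule bform_add_left[OF add(1,2) h s(1)])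
  show ?case unfolding e ip_add_left[OF add(1,2) h] using add by (intro tendsto_intros)
next
  case (lim u f)
  show ?case
  proof (rule limit_exchange[where b = "\<lambda>n i. bform k (s i) (u n) h" and e = "\<lambda>n. nrm (Mk k) (\<lambda>z. u n z - f z) * nrm (Mk k) h"])
    show "(\<lambda>i. bform k (s i) (u n) h) \<longlonglongrightarrow> ip (Mk k) (u n) h" for n by (rule lim(4))
    show "cmod (bform k (s i) (u n) h - bform k (s i) f h) \<le> nrm (Mk k) (\<lambda>z. u n z - f z) * nrm (Mk k) h" for n i
      using bform_bound[OF sqi_diff[OF lim(1,2)] h s(1), of i n] bform_diff_left[OF lim(1,2) h s(1), of i n] by simp
    show "cmod (ip (Mk k) (u n) h - ip (Mk k) f h) \<le> nrm (Mk k) (\<lambda>z. u n z - f z) * nrm (Mk k) h" for n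
      using cauchy_schwarz_ip[OF sqi_diff[OF lim(1,2)] h, of n] ip_diff_left[OF lim(1,2) h, of n] by simp
    show "(\<lambda>n. nrm (Mk k) (\<lambda>z. u n z - f z) * nrm (Mk k) h) \<longlonglongrightarrow> 0"
      using tendsto_mult_left_zero[OF lim(3)] by simp
  qed
qed

section \<open>The Fourier transform of integrable kernels\<close>

lemma measurable_FT [measurable]:
  fixes \<phi> :: "'n::finite kernel"
  assumes [measurable]: "\<phi> \<in> borel_measurable (Mk k)"
  shows "FT k \<phi> \<in> borel_measurable (Mk k)"
proof -
  interpret sigma_finite_measure "Mk k :: 'n pts measure" by (rule sf_Mk)
  have [measurable]: "cis \<in> borel_measurable borel"
    by (intro borel_measurable_continuous_onI continuous_intros)
  show ?thesis unfolding FT_def by (intro borel_measurable_lebesgue_integral) measurable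
qed

lemma measurable_cis [measurable]: "cis \<in> borel_measurable borel"
  by (intro borel_measurable_continuous_onI continuous_intros)

lemma integrable_cis_mult:
  assumes "integrable M f" "g \<in> borel_measurable M"
  shows "integrable M (\<lambda>z. cis (g z) * f z)"
proof -
  note [measurable] = assms(2) borel_measurable_integrable[OF assms(1)]
  show ?thesis by (rule Bochner_Integration.integrable_bound[OF assms(1)]) (auto simp: norm_mult)
qed

lemma integrable_gauss: "a > 0 \<Longrightarrow> integrable (Mk k) (\<lambda>w. exp (- a * dotk k w w / 2))"
  using integrable_Re[OF gauss_heatk(1)[of a k x x for x]] by (simp add: cis_mult)

text \<open>The Gaussian makes the triple integral absolutely convergent, so w can be integrated out
  first; by \<open>gauss_heatk\<close> this leaves the heat kernel.\<close>

lemma FT_gauss: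
  fixes \<phi> \<psi> :: "'n::finite kernel"
  assumes i: "integrable (Mk k) \<phi>" "integrable (Mk k) \<psi>" and a: "a > 0"
  shows "(LINT w|Mk k. FT k \<phi> w * cnj (FT k \<psi> w) * of_real (exp (- a * dotk k w w / 2))) = of_real (cF TYPE('n) k) * bform k a \<phi> \<psi>"
proof -
  let ?M = "Mk k :: 'n pts measure"
  interpret pair_sigma_finite ?M ?M by (rule psf_Mk)
  interpret P: pair_sigma_finite ?M "?M \<Otimes>\<^sub>M ?M"
    by (simp add: pair_sigma_finite_def sf_Mk sigma_finite_pair_measure)
  note [measurable] = borel_measurable_integrable[OF i(1)] borel_measurable_integrable[OF i(2)]
  define I where "I = (\<lambda>w p. cis (- dotk k (fst p) w) * cis (dotk k (snd p) w) * \<phi> (fst p) * cnj (\<psi> (snd p)) * complex_of_real (exp (- a * dotk k w w / 2)))"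
  have icnj: "integrable ?M (\<lambda>y. cnj (\<psi> y))" using i(2) by simp
  have ip2: "integrable (?M \<Otimes>\<^sub>M ?M) (\<lambda>p. \<phi> (fst p) * cnj (\<psi> (snd p)))"
    by (rule pair_prod(1)[OF psf_Mk i(1) icnj])
  have ig: "integrable ?M (\<lambda>w. complex_of_real (exp (- a * dotk k w w / 2)))"
    using integrable_gauss[OF a] by (intro integrable_of_real)
  have ip3: "integrable (?M \<Otimes>\<^sub>M (?M \<Otimes>\<^sub>M ?M)) (\<lambda>q. complex_of_real (exp (- a * dotk k (fst q) (fst q) / 2)) * (\<phi> (fst (snd q)) * cnj (\<psi> (snd (snd q)))))"
    using pair_prod(1)[OF P.pair_sigma_finite_axioms ig ip2] .
  have int: "integrable (?M \<Otimes>\<^sub>M (?M \<Otimes>\<^sub>M ?M)) (case_prod I)"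
    unfolding I_def by (rule Bochner_Integration.integrable_bound[OF ip3]) (auto simp: norm_mult)
  have "(LINT w|?M. FT k \<phi> w * cnj (FT k \<psi> w) * of_real (exp (- a * dotk k w w / 2))) = (LINT w|?M. (LINT p|(?M \<Otimes>\<^sub>M ?M). I w p))"
  proof (rule Bochner_Integration.integral_cong[OF refl])
    fix w :: "'n pts" assume w: "w \<in> space ?M"
    have [measurable]: "(\<lambda>z. dotk k z w) \<in> borel_measurable ?M" using w by measurable
    have c1: "integrable ?M (\<lambda>x. cis (- dotk k x w) * \<phi> x)" by (intro integrable_cis_mult i) measurable
    have c3: "integrable ?M (\<lambda>x. cis (dotk k x w) * cnj (\<psi> x))" by (intro integrable_cis_mult icnj) measurable
    have "cnj (FT k \<psi> w) = (LINT x|?M. cnj (cis (- dotk k x w) * \<psi> x))"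
      unfolding FT_def by (rule Bochner_Integration.integral_cnj[symmetric])
    also have "\<dots> = (LINT x|?M. cis (dotk k x w) * cnj (\<psi> x))"
      by (simp add: cis_cnj)
    finally have "FT k \<phi> w * cnj (FT k \<psi> w) = (LINT p|(?M \<Otimes>\<^sub>M ?M). cis (- dotk k (fst p) w) * \<phi> (fst p) * (cis (dotk k (snd p) w) * cnj (\<psi> (snd p))))"
      unfolding pair_prod(2)[OF psf_Mk c1 c3] by (simp add: FT_def)
    moreover have "I w p = cis (- dotk k (fst p) w) * \<phi> (fst p) * (cis (dotk k (snd p) w) * cnj (\<psi> (snd p))) * of_real (exp (- a * dotk k w w / 2))" for p
      unfolding I_def by (simp only: ac_simps)
    ultimately show "FT k \<phi> w * cnj (FT k \<psi> w) * of_real (exp (- a * dotk k w w / 2)) = (LINT p|(?M \<Otimes>\<^sub>M ?M). I w p)"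
      by (simp only: integral_mult_left_zero)
  qed
  also have "\<dots> = (LINT p|(?M \<Otimes>\<^sub>M ?M). (LINT w|?M. I w p))" by (rule P.Fubini_integral[OF int, symmetric])
  also have "\<dots> = (LINT p|(?M \<Otimes>\<^sub>M ?M). of_real (cF TYPE('n) k) * (of_real (heatk k a (fst p) (snd p)) * \<phi> (fst p) * cnj (\<psi> (snd p))))"
  proof (rule Bochner_Integration.integral_cong[OF refl])
    fix p :: "'n pts \<times> 'n pts"
    have "(LINT w|?M. I w p) = (LINT w|?M. (\<phi> (fst p) * cnj (\<psi> (snd p))) * (cis (- dotk k (fst p) w) * cis (dotk k (snd p) w) * complex_of_real (exp (- a * dotk k w w / 2))))"
      unfolding I_def by (simp add: ac_simps)
    also have "\<dots> = (\<phi> (fst p) * cnj (\<psi> (snd p))) * of_real (cF TYPE('n) k * heatk k a (fst p) (snd p))"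
      unfolding integral_mult_right_zero gauss_heatk(2)[OF a] ..
    finally show "(LINT w|?M. I w p) = of_real (cF TYPE('n) k) * (of_real (heatk k a (fst p) (snd p)) * \<phi> (fst p) * cnj (\<psi> (snd p)))"
      by simp
  qed
  also have "\<dots> = of_real (cF TYPE('n) k) * bform k a \<phi> \<psi>" unfolding bform_def by simp
  finally show ?thesis .
qed

section \<open>The Plancherel transform\<close>

text \<open>The test functions of \<open>is_FT\<close>: their transform is an absolutely convergent
  integral and lies in L2 by Plancherel's theorem.\<close>

definition L12 :: "nat \<Rightarrow> 'n::finite kernel \<Rightarrow> bool" where
  "L12 k \<phi> \<longleftrightarrow> integrable (Mk k) \<phi> \<and> sqi (Mk k) \<phi>"

lemma L2_sqi: "L2 k f \<longleftrightarrow> sqi (Mk k) f"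
  by (simp add: L2_def sqi_def)

lemma L12D: "L12 k \<phi> \<Longrightarrow> integrable (Mk k) \<phi>" "L12 k \<phi> \<Longrightarrow> sqi (Mk k) \<phi>"
  by (auto simp: L12_def)

lemma is_FT_iff: "is_FT k f g \<longleftrightarrow> sqi (Mk k) g \<and>
   (\<forall>\<phi>. L12 k \<phi> \<longrightarrow> (LINT w|Mk k. g w * \<phi> w) = (LINT z|Mk k. f z * FT k \<phi> z))"
  unfolding is_FT_def L2_sqi L12_def by (blast dest: sqi_meas)

lemma L12_diff: "L12 k f \<Longrightarrow> L12 k g \<Longrightarrow> L12 k (\<lambda>z. f z - g z)"
  by (auto simp: L12_def intro: sqi_diff)

lemma L12_cnj: "L12 k f \<Longrightarrow> L12 k (\<lambda>z. cnj (f z))"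
  by (auto simp: L12_def)

lemma integrable_cis_dotk:
  assumes "integrable (Mk k) f" "w \<in> space (Mk k)"
  shows "integrable (Mk k) (\<lambda>z. cis (- dotk k z w) * f z)" "integrable (Mk k) (\<lambda>z. cis (dotk k w z) * f z)"
  using assms(2) by (auto intro!: integrable_cis_mult assms(1))

lemma FT_diff: "integrable (Mk k) f \<Longrightarrow> integrable (Mk k) g \<Longrightarrow> w \<in> space (Mk k) \<Longrightarrow> FT k (\<lambda>z. f z - g z) w = FT k f w - FT k g w"
  unfolding FT_def by (simp add: right_diff_distrib integrable_cis_dotk)

lemma FT_bound: "cmod (FT k f w) \<le> (LINT z|Mk k. cmod (f z))"
proof -
  have "cmod (FT k f w) \<le> (LINT z|Mk k. cmod (cis (- dotk k z w) * f z))"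
    unfolding FT_def by (rule integral_norm_bound)
  then show ?thesis by (simp add: norm_mult)
qed

lemma FT_mult:
  fixes \<phi> \<psi> :: "'n::finite kernel"
  assumes i: "integrable (Mk k) \<phi>" "integrable (Mk k) \<psi>"
  shows "(LINT w|Mk k. FT k \<phi> w * \<psi> w) = (LINT z|Mk k. \<phi> z * FT k \<psi> z)"
proof -
  let ?M = "Mk k :: 'n pts measure"
  interpret pair_sigma_finite ?M ?M by (rule psf_Mk)
  note [measurable] = borel_measurable_integrable[OF i(1)] borel_measurable_integrable[OF i(2)]
  have i2: "integrable (?M \<Otimes>\<^sub>M ?M) (\<lambda>p. \<psi> (fst p) * \<phi> (snd p))"
    by (rule pair_prod(1)[OF psf_Mk i(2,1)])
  have int: "integrable (?M \<Otimes>\<^sub>M ?M) (\<lambda>(w, z). cis (- dotk k z w) * \<phi> z * \<psi> w)"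
    by (rule Bochner_Integration.integrable_bound[OF i2]) (auto simp: norm_mult)
  have "(LINT w|?M. FT k \<phi> w * \<psi> w) = (LINT w|?M. (LINT z|?M. cis (- dotk k z w) * \<phi> z * \<psi> w))"
    unfolding FT_def by simp
  also have "\<dots> = (LINT z|?M. (LINT w|?M. cis (- dotk k z w) * \<phi> z * \<psi> w))"
    by (rule Fubini_integral[OF int, symmetric])
  also have "\<dots> = (LINT z|?M. (LINT w|?M. \<phi> z * (cis (- dotk k w z) * \<psi> w)))"
    by (simp only: ac_simps dotk_commute[of k _ z for z])
  also have "\<dots> = (LINT z|?M. \<phi> z * FT k \<psi> z)" unfolding FT_def by simp
  finally show ?thesis .
qed

text \<open>Inserting the factor \<open>exp (- a * dotk k w w / 2)\<close> turns the norm of the transform into a heat kernel form, which tends to the norm of \<open>\<phi>\<close> as \<open>a\<close> tends to 0.\<close>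
lemma plancherel_L12:
  fixes \<phi> :: "'n::finite kernel"
  assumes "L12 k \<phi>"
  shows "sqi (Mk k) (FT k \<phi>)" "nrm (Mk k) (FT k \<phi>) = sqrt (cF TYPE('n) k) * nrm (Mk k) \<phi>"
proof -
  let ?M = "Mk k :: 'n pts measure"
  note i = L12D(1)[OF assms] and s = L12D(2)[OF assms]
  note [measurable] = borel_measurable_integrable[OF i]
  define a where "a = (\<lambda>i. 1 / real (Suc i))"
  have a: "a i > 0" for i by (simp add: a_def)
  have a0: "a \<longlonglongrightarrow> 0" unfolding a_def by (rule LIMSEQ_Suc[OF lim_1_over_n])
  define c where "c = cF TYPE('n) k"
  have c: "c > 0" by (simp add: c_def)
  define G where "G = (\<lambda>i w. (cmod (FT k \<phi> w))\<^sup>2 * exp (- a i * dotk k w w / 2))"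
  have [measurable]: "G i \<in> borel_measurable ?M" for i unfolding G_def by measurable
  have intG: "(LINT w|?M. of_real (G i w)) = of_real c * bform k (a i) \<phi> \<phi>" for i
  proof -
    have "(LINT w|?M. of_real (G i w)) = (LINT w|?M. FT k \<phi> w * cnj (FT k \<phi> w) * of_real (exp (- a i * dotk k w w / 2)))"
      by (simp only: G_def complex_norm_square of_real_mult)
    then show ?thesis unfolding FT_gauss[OF i i a] c_def by simp
  qed
  have iG: "integrable ?M (G i)" for i
  proof -
    have "integrable ?M (\<lambda>w. (LINT z|?M. cmod (\<phi> z))\<^sup>2 * exp (- a i * dotk k w w / 2))"
      by (intro integrable_mult_right integrable_gauss a)
    then show ?thesis
      by (rule Bochner_Integration.integrable_bound)
        (auto simp: G_def abs_mult intro!: mult_right_mono power_mono FT_bound)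
  qed
  have ReG: "(LINT w|?M. G i w) = Re (of_real c * bform k (a i) \<phi> \<phi>)" for i
    using arg_cong[OF intG[of i], of Re] by simp
  have G_le: "(LINT w|?M. G i w) \<le> c * (nrm ?M \<phi>)\<^sup>2" for i
  proof -
    have "Re (of_real c * bform k (a i) \<phi> \<phi>) \<le> c * cmod (bform k (a i) \<phi> \<phi>)"
      using c complex_Re_le_cmod[of "bform k (a i) \<phi> \<phi>"] by simp
    also have "\<dots> \<le> c * (nrm ?M \<phi> * nrm ?M \<phi>)" using c by (intro mult_left_mono bform_bound[OF s s a]) auto
    finally show ?thesis unfolding ReG by (simp add: power2_eq_square)
  qed
  have limG: "(\<lambda>i. G i w) \<longlonglongrightarrow> (cmod (FT k \<phi> w))\<^sup>2" for w :: "'n pts"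
  proof -
    have "(\<lambda>i. (cmod (FT k \<phi> w))\<^sup>2 * exp (- a i * dotk k w w / 2)) \<longlonglongrightarrow> (cmod (FT k \<phi> w))\<^sup>2 * exp (- 0 * dotk k w w / 2)"
      by (intro tendsto_intros a0) auto
    then show ?thesis unfolding G_def by simp
  qed
  have "(\<integral>\<^sup>+w. ennreal ((cmod (FT k \<phi> w))\<^sup>2) \<partial>?M) = (\<integral>\<^sup>+w. liminf (\<lambda>i. ennreal (G i w)) \<partial>?M)"
    by (intro nn_integral_cong lim_imp_Liminf[symmetric] tendsto_ennrealI limG) auto
  also have "\<dots> \<le> liminf (\<lambda>i. \<integral>\<^sup>+w. ennreal (G i w) \<partial>?M)"
    by (rule nn_integral_liminf) measurable
  also have "\<dots> \<le> ennreal ((sqrt c * nrm ?M \<phi>)\<^sup>2)"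
  proof (intro Liminf_le always_eventually allI)
    fix i
    have "(\<integral>\<^sup>+w. ennreal (G i w) \<partial>?M) = ennreal (LINT w|?M. G i w)"
      by (rule nn_integral_eq_integral[OF iG]) (simp add: G_def)
    also have "\<dots> \<le> ennreal ((sqrt c * nrm ?M \<phi>)\<^sup>2)"
      using G_le[of i] c by (intro ennreal_leI) (simp add: power_mult_distrib)
    finally show "(\<integral>\<^sup>+w. ennreal (G i w) \<partial>?M) \<le> ennreal ((sqrt c * nrm ?M \<phi>)\<^sup>2)" .
  qed auto
  finally have le: "(\<integral>\<^sup>+w. ennreal ((cmod (FT k \<phi> w))\<^sup>2) \<partial>?M) \<le> ennreal ((sqrt c * nrm ?M \<phi>)\<^sup>2)" .
  show sF: "sqi ?M (FT k \<phi>)" by (rule sqi_nnI(1)[OF _ le]) (use c in auto)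
  \<comment> \<open>Fatou's lemma above has made the transform square integrable; its square can now
    serve as the majorant that turns the inequality into an equality.\<close>
  have "(\<lambda>i. LINT w|?M. G i w) \<longlonglongrightarrow> (LINT w|?M. (cmod (FT k \<phi> w))\<^sup>2)"
  proof (rule integral_dominated_convergence[OF _ _ sqi_int[OF sF]])
    show "AE w in ?M. (\<lambda>i. G i w) \<longlonglongrightarrow> (cmod (FT k \<phi> w))\<^sup>2" using limG by simp
    show "AE w in ?M. norm (G i w) \<le> (cmod (FT k \<phi> w))\<^sup>2" for i
    proof (rule AE_I2)
      fix w :: "'n pts"
      have "exp (- a i * dotk k w w / 2) \<le> 1" using a[of i] by (auto simp: mult_nonneg_nonneg less_imp_le)
      then show "norm (G i w) \<le> (cmod (FT k \<phi> w))\<^sup>2"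
        unfolding G_def by (simp add: abs_mult mult_left_le)
    qed
  qed measurable
  moreover have "(\<lambda>i. LINT w|?M. G i w) \<longlonglongrightarrow> Re (of_real c * ip ?M \<phi> \<phi>)"
    unfolding ReG by (intro tendsto_Re tendsto_mult tendsto_const approx_id a a0 s)
  ultimately have "(nrm ?M (FT k \<phi>))\<^sup>2 = Re (of_real c * ip ?M \<phi> \<phi>)"
    unfolding nrm_sq by (rule LIMSEQ_unique)
  also have "\<dots> = (sqrt c * nrm ?M \<phi>)\<^sup>2" unfolding ip_self using c by (simp add: power_mult_distrib)
  finally show "nrm ?M (FT k \<phi>) = sqrt (cF TYPE('n) k) * nrm ?M \<phi>"
    unfolding c_def[symmetric] using c by (simp add: power2_eq_iff_nonneg)
qed

text \<open>Truncation to sets of finite measure suffices: there square integrability implies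
  integrability.\<close>

lemma L12_dense:
  fixes f :: "'n::finite kernel"
  assumes f: "sqi (Mk k) f"
  shows "\<exists>s. (\<forall>i. L12 k (s i)) \<and> (\<lambda>i. nrm (Mk k) (\<lambda>z. s i z - f z)) \<longlonglongrightarrow> 0"
proof -
  let ?M = "Mk k :: 'n pts measure"
  interpret sigma_finite_measure ?M by (rule sf_Mk)
  obtain A :: "nat \<Rightarrow> 'n pts set" where A: "range A \<subseteq> sets ?M" "(\<Union>i. A i) = space ?M" "\<And>i. emeasure ?M (A i) \<noteq> \<infinity>" "incseq A"
    using sigma_finite_incseq by blast
  note [measurable] = sqi_meas[OF f]
  have [measurable]: "A i \<in> sets ?M" for i using A(1) by auto
  have sA: "sqi ?M (indicator (A i))" for i using A(3)[of i] by (intro sqi_indicator) (auto simp: less_top)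
  define s where "s = (\<lambda>i z. f z * indicator (A i) z)"
  have [measurable]: "s i \<in> borel_measurable ?M" for i unfolding s_def by measurable
  have "L12 k (s i)" for i
    unfolding L12_def
  proof
    show "integrable ?M (s i)" unfolding s_def by (rule sqi_int_mult[OF f sA])
    show "sqi ?M (s i)" by (rule sqi_bound[OF f, of _ 1]) (auto simp: s_def indicator_def)
  qed
  moreover have "(\<lambda>i. nrm ?M (\<lambda>z. s i z - f z)) \<longlonglongrightarrow> 0"
  proof (rule sqi_dominated(3)[OF _ _ f, of _ _ 1])
    show "AE z in ?M. (\<lambda>i. s i z) \<longlonglongrightarrow> f z"
    proof (rule AE_I2)
      fix z assume "z \<in> space ?M"
      then obtain n where n: "z \<in> A n" using A(2) by blast
      then have "z \<in> A i" if "i \<ge> n" for i using A(4) that by (auto simp: incseq_def)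
      then show "(\<lambda>i. s i z) \<longlonglongrightarrow> f z"
        by (intro tendsto_eventually eventually_sequentiallyI[of n]) (auto simp: s_def)
    qed
  qed (auto simp: s_def indicator_def)
  ultimately show ?thesis by blast
qed

lemma is_FT_sqi: "is_FT k f g \<Longrightarrow> sqi (Mk k) g"
  by (simp add: is_FT_iff)

lemma is_FT_FT:
  assumes "L12 k f"
  shows "is_FT k f (FT k f)"
  unfolding is_FT_iff using plancherel_L12[OF assms] FT_mult L12D assms by blast

lemma integral_ip: "(LINT z|M. f z * g z) = ip M f (\<lambda>z. cnj (g z))"
  by (simp add: ip_def)

text \<open>Extension by continuity: by Plancherel the transforms of an approximating sequence are
  Cauchy, and the multiplication formula survives the limit because its other side pairs with
  \<open>FT k \<phi>\<close>, again in L2.\<close>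

lemma is_FT_exists:
  fixes f :: "'n::finite kernel"
  assumes f: "sqi (Mk k) f"
  shows "\<exists>g. is_FT k f g \<and> nrm (Mk k) g = sqrt (cF TYPE('n) k) * nrm (Mk k) f"
proof -
  let ?M = "Mk k :: 'n pts measure"
  define c where "c = sqrt (cF TYPE('n) k)"
  have c: "c > 0" by (simp add: c_def)
  obtain s where s: "\<And>i. L12 k (s i)" and lim: "(\<lambda>i. nrm ?M (\<lambda>z. s i z - f z)) \<longlonglongrightarrow> 0"
    using L12_dense[OF f] by blast
  note ss = L12D(2)[OF s] and si = L12D(1)[OF s]
  have sF: "sqi ?M (FT k (s i))" for i by (rule plancherel_L12[OF s])
  have d: "nrm ?M (\<lambda>w. FT k (s m) w - FT k (s n) w) = c * nrm ?M (\<lambda>z. s m z - s n z)" for m n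
  proof -
    have "nrm ?M (\<lambda>w. FT k (s m) w - FT k (s n) w) = nrm ?M (FT k (\<lambda>z. s m z - s n z))"
      by (intro nrm_cong_AE AE_I2 sqi_meas[OF sqi_diff[OF sF sF]] sqi_meas[OF plancherel_L12(1)[OF L12_diff[OF s s]]])
        (simp add: FT_diff si)
    then show ?thesis using plancherel_L12(2)[OF L12_diff[OF s s]] by (simp add: c_def)
  qed
  have "\<exists>N. \<forall>m\<ge>N. \<forall>n\<ge>N. nrm ?M (\<lambda>w. FT k (s m) w - FT k (s n) w) < e" if e: "e > 0" for e
  proof -
    obtain N where N: "\<And>i. i \<ge> N \<Longrightarrow> nrm ?M (\<lambda>z. s i z - f z) < e / (2 * c)"
      using LIMSEQ_D[OF lim, of "e / (2 * c)"] e c by auto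
    have "nrm ?M (\<lambda>w. FT k (s m) w - FT k (s n) w) < e" if "m \<ge> N" "n \<ge> N" for m n
    proof -
      have "nrm ?M (\<lambda>z. s m z - s n z) \<le> nrm ?M (\<lambda>z. s m z - f z) + nrm ?M (\<lambda>z. f z - s n z)"
        by (rule nrm_triangle_diff[OF ss f ss])
      also have "\<dots> < e / (2 * c) + e / (2 * c)"
        using N[OF that(1)] N[OF that(2)] by (intro add_strict_mono) (auto simp: nrm_minus_commute[of _ f])
      also have "\<dots> = e / c" by simp
      finally show ?thesis unfolding d using c by (simp add: field_simps)
    qed
    then show ?thesis by blast
  qed
  then obtain g where g: "sqi ?M g" "(\<lambda>i. nrm ?M (\<lambda>z. FT k (s i) z - g z)) \<longlonglongrightarrow> 0"
    using sqi_complete[of ?M "\<lambda>i. FT k (s i)", OF sF] by blast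
  have "is_FT k f g"
    unfolding is_FT_iff
  proof (intro conjI g(1) allI impI)
    fix \<phi> :: "'n kernel" assume \<phi>: "L12 k \<phi>"
    have c1: "sqi ?M (\<lambda>z. cnj (\<phi> z))" "sqi ?M (\<lambda>z. cnj (FT k \<phi> z))"
      using L12D(2)[OF \<phi>] plancherel_L12(1)[OF \<phi>] by auto
    have "(\<lambda>i. LINT w|?M. FT k (s i) w * \<phi> w) \<longlonglongrightarrow> (LINT w|?M. g w * \<phi> w)"
      unfolding integral_ip by (rule ip_tendsto[OF sF g(1) c1(1) g(2)])
    moreover have "(\<lambda>i. LINT w|?M. FT k (s i) w * \<phi> w) \<longlonglongrightarrow> (LINT z|?M. f z * FT k \<phi> z)"
    proof -
      have "(\<lambda>i. LINT z|?M. s i z * FT k \<phi> z) \<longlonglongrightarrow> (LINT z|?M. f z * FT k \<phi> z)"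
        unfolding integral_ip by (rule ip_tendsto[OF ss f c1(2) lim])
      then show ?thesis unfolding FT_mult[OF si L12D(1)[OF \<phi>]] .
    qed
    ultimately show "(LINT w|?M. g w * \<phi> w) = (LINT z|?M. f z * FT k \<phi> z)" by (rule LIMSEQ_unique)
  qed
  moreover have "nrm ?M g = c * nrm ?M f"
  proof (rule LIMSEQ_unique[OF nrm_tendsto[OF sF g(1,2)]])
    show "(\<lambda>i. nrm ?M (FT k (s i))) \<longlonglongrightarrow> c * nrm ?M f"
      unfolding plancherel_L12(2)[OF s] c_def[symmetric]
      by (intro tendsto_mult tendsto_const nrm_tendsto[OF ss f lim])
  qed
  ultimately show ?thesis unfolding c_def by blast
qed

text \<open>The difference annihilates \<open>L12\<close>, which is dense and therefore approximates
  the conjugate of the difference itself.\<close>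

lemma is_FT_unique:
  fixes f :: "'n::finite kernel"
  assumes "is_FT k f g" "is_FT k f g'"
  shows "AE w in Mk k. g w = g' w"
proof -
  let ?M = "Mk k :: 'n pts measure"
  note g = is_FT_sqi[OF assms(1)] is_FT_sqi[OF assms(2)]
  define d where "d = (\<lambda>w. g w - g' w)"
  have d: "sqi ?M d" unfolding d_def by (intro sqi_diff g)
  have 0: "(LINT w|?M. d w * \<phi> w) = 0" if \<phi>: "L12 k \<phi>" for \<phi>
  proof -
    have "(LINT w|?M. d w * \<phi> w) = (LINT w|?M. g w * \<phi> w) - (LINT w|?M. g' w * \<phi> w)"
      unfolding d_def left_diff_distrib
      by (intro Bochner_Integration.integral_diff sqi_int_mult g L12D(2)[OF \<phi>])
    then show ?thesis using assms \<phi> unfolding is_FT_iff by simp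
  qed
  obtain s where s: "\<And>i. L12 k (s i)" and lim: "(\<lambda>i. nrm ?M (\<lambda>z. s i z - cnj (d z))) \<longlonglongrightarrow> 0"
    using L12_dense[OF sqi_cnj[OF d]] by blast
  have "(\<lambda>i. ip ?M (s i) (\<lambda>z. cnj (d z))) \<longlonglongrightarrow> ip ?M (\<lambda>z. cnj (d z)) (\<lambda>z. cnj (d z))"
    by (rule ip_tendsto[OF L12D(2)[OF s] sqi_cnj[OF d] sqi_cnj[OF d] lim])
  moreover have "ip ?M (s i) (\<lambda>z. cnj (d z)) = 0" for i
    using 0[OF s[of i]] by (simp add: ip_def mult.commute)
  ultimately have "ip ?M (\<lambda>z. cnj (d z)) (\<lambda>z. cnj (d z)) = 0" by (simp add: LIMSEQ_const_iff)
  then have "nrm ?M d = 0" unfolding ip_self by (simp add: nrm_cnj)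
  from nrm_zero_AE[OF d this] show ?thesis by (auto simp: d_def)
qed

lemma is_FT_cong:
  fixes f :: "'n::finite kernel"
  assumes "is_FT k f g" "sqi (Mk k) f" "sqi (Mk k) f'" "AE z in Mk k. f z = f' z"
    "g' \<in> borel_measurable (Mk k)" "AE z in Mk k. g z = g' z"
  shows "is_FT k f' g'"
  unfolding is_FT_iff
proof (intro conjI allI impI)
  note g = is_FT_sqi[OF assms(1)]
  note [measurable] = sqi_meas[OF assms(2)] sqi_meas[OF assms(3)] sqi_meas[OF g] assms(5)
  show "sqi (Mk k) g'" by (rule sqi_cong_AE[OF g assms(5,6)])
  fix \<phi> :: "'n kernel" assume \<phi>: "L12 k \<phi>"
  note [measurable] = sqi_meas[OF L12D(2)[OF \<phi>]]
  have "(LINT w|Mk k. g' w * \<phi> w) = (LINT w|Mk k. g w * \<phi> w)"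
    using assms(6) by (intro integral_cong_AE) auto
  moreover have "(LINT w|Mk k. f' w * FT k \<phi> w) = (LINT w|Mk k. f w * FT k \<phi> w)"
    using assms(4) by (intro integral_cong_AE) auto
  ultimately show "(LINT w|Mk k. g' w * \<phi> w) = (LINT z|Mk k. f' z * FT k \<phi> z)"
    using assms(1) \<phi> unfolding is_FT_iff by simp
qed

lemma is_FT_add:
  fixes f :: "'n::finite kernel"
  assumes "is_FT k f g" "sqi (Mk k) f" "is_FT k f' g'" "sqi (Mk k) f'"
  shows "is_FT k (\<lambda>z. f z + f' z) (\<lambda>z. g z + g' z)"
  unfolding is_FT_iff
proof (intro conjI allI impI)
  note g = is_FT_sqi[OF assms(1)] is_FT_sqi[OF assms(3)]
  show "sqi (Mk k) (\<lambda>z. g z + g' z)" by (intro sqi_add g)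
  fix \<phi> :: "'n kernel" assume \<phi>: "L12 k \<phi>"
  show "(LINT w|Mk k. (g w + g' w) * \<phi> w) = (LINT z|Mk k. (f z + f' z) * FT k \<phi> z)"
    using assms(1,3) \<phi> unfolding is_FT_iff distrib_right
    by (simp add: sqi_int_mult g assms plancherel_L12 L12D)
qed

lemma is_FT_scale:
  assumes "is_FT k f g"
  shows "is_FT k (\<lambda>z. c * f z) (\<lambda>z. c * g z)"
  using assms unfolding is_FT_iff by (auto intro: sqi_scale simp: mult.assoc)

lemma is_FT_diff:
  fixes f :: "'n::finite kernel"
  assumes "is_FT k f g" "sqi (Mk k) f" "is_FT k f' g'" "sqi (Mk k) f'"
  shows "is_FT k (\<lambda>z. f z - f' z) (\<lambda>z. g z - g' z)"
  using is_FT_add[OF assms(1,2) is_FT_scale[OF assms(3), of "-1"] sqi_scale[OF assms(4), of "-1"]] by simp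

lemma is_FT_nrm:
  fixes f :: "'n::finite kernel"
  assumes "is_FT k f g" "sqi (Mk k) f"
  shows "nrm (Mk k) g = sqrt (cF TYPE('n) k) * nrm (Mk k) f"
proof -
  obtain g' where g': "is_FT k f g'" "nrm (Mk k) g' = sqrt (cF TYPE('n) k) * nrm (Mk k) f"
    using is_FT_exists[OF assms(2)] by blast
  have "nrm (Mk k) g = nrm (Mk k) g'"
    by (intro nrm_cong_AE sqi_meas is_FT_sqi[OF assms(1)] is_FT_sqi[OF g'(1)] is_FT_unique[OF assms(1) g'(1)])
  then show ?thesis using g'(2) by simp
qed

lemma is_FT_ip:
  fixes f :: "'n::finite kernel"
  assumes "is_FT k f g" "sqi (Mk k) f" "is_FT k f' g'" "sqi (Mk k) f'"
  shows "ip (Mk k) g g' = of_real (cF TYPE('n) k) * ip (Mk k) f f'"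
proof -
  let ?c = "cF TYPE('n) k"
  have sq: "complex_of_real ((nrm (Mk k) g)\<^sup>2) = of_real ?c * of_real ((nrm (Mk k) f)\<^sup>2)" if "is_FT k f g" "sqi (Mk k) f" for f g :: "'n kernel"
    unfolding is_FT_nrm[OF that] by (simp add: power_mult_distrib less_imp_le flip: of_real_power)
  note g = is_FT_sqi[OF assms(1)] is_FT_sqi[OF assms(3)]
  note i = is_FT_scale[OF assms(3), of \<i>] and si = sqi_scale[OF assms(4), of \<i>]
  note e = sq[OF is_FT_add[OF assms] sqi_add[OF assms(2,4)]] sq[OF is_FT_diff[OF assms] sqi_diff[OF assms(2,4)]]
     sq[OF is_FT_add[OF assms(1,2) i si] sqi_add[OF assms(2) si]] sq[OF is_FT_diff[OF assms(1,2) i si] sqi_diff[OF assms(2) si]]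
  have "4 * ip (Mk k) g g' = of_real ?c * (4 * ip (Mk k) f f')"
    unfolding ip_polarization[OF g] ip_polarization[OF assms(2,4)] e by (simp add: algebra_simps)
  then show ?thesis by simp
qed

text \<open>The candidate is the conjugate of a transform of the conjugate of g, divided by
  \<open>cF\<close>; Parseval's identity \<open>is_FT_ip\<close> verifies the multiplication
  formula.\<close>

lemma is_FT_surj:
  fixes g :: "'n::finite kernel"
  assumes g: "sqi (Mk k) g"
  shows "\<exists>f. sqi (Mk k) f \<and> is_FT k f g"
proof -
  let ?c = "complex_of_real (cF TYPE('n) k)"
  obtain h where h: "is_FT k (\<lambda>z. cnj (g z)) h" using is_FT_exists[OF sqi_cnj[OF g]] by blast
  define f where "f = (\<lambda>z. (1 / ?c) * cnj (h z))"
  have sf: "sqi (Mk k) f" unfolding f_def by (intro sqi_scale sqi_cnj is_FT_sqi[OF h])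
  have "is_FT k f g"
    unfolding is_FT_iff
  proof (intro conjI g allI impI)
    fix \<phi> :: "'n kernel" assume \<phi>: "L12 k \<phi>"
    have "(LINT z|Mk k. f z * FT k \<phi> z) = (1 / ?c) * ip (Mk k) (FT k \<phi>) h"
      unfolding ip_def by (subst integral_mult_right_zero[symmetric]) (simp add: f_def ac_simps)
    also have "\<dots> = ip (Mk k) \<phi> (\<lambda>z. cnj (g z))"
      unfolding is_FT_ip[OF is_FT_FT[OF \<phi>] L12D(2)[OF \<phi>] h sqi_cnj[OF g]] by simp
    also have "\<dots> = (LINT w|Mk k. g w * \<phi> w)" by (simp add: ip_def mult.commute)
    finally show "(LINT w|Mk k. g w * \<phi> w) = (LINT z|Mk k. f z * FT k \<phi> z)" by simp
  qed
  then show ?thesis using sf by blast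
qed

lemma is_FT_inj:
  fixes f :: "'n::finite kernel"
  assumes "is_FT k f g" "sqi (Mk k) f" "is_FT k f' g'" "sqi (Mk k) f'" "AE z in Mk k. g z = g' z"
  shows "AE z in Mk k. f z = f' z"
proof -
  note g = is_FT_sqi[OF assms(1)] is_FT_sqi[OF assms(3)]
  have "nrm (Mk k) (\<lambda>z. g z - g' z) = nrm (Mk k :: 'n pts measure) (\<lambda>z. 0)"
    by (intro nrm_cong_AE) (use assms(5) in \<open>auto intro!: sqi_meas sqi_diff g\<close>)
  also have "\<dots> = 0" by (simp add: nrm_def)
  finally have "nrm (Mk k) (\<lambda>z. f z - f' z) = 0"
    using is_FT_nrm[OF is_FT_diff[OF assms(1-4)] sqi_diff[OF assms(2,4)]] by simp
  from nrm_zero_AE[OF sqi_diff[OF assms(2,4)] this] show ?thesis by simp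
qed

text \<open>Inverse transform without its factor \<open>1 / cF\<close>.\<close>

definition FTm :: "nat \<Rightarrow> 'n::finite kernel \<Rightarrow> 'n kernel" where
  "FTm k G z = (LINT w|Mk k. cis (dotk k z w) * G w)"

lemma FTm_FT: "FTm k G z = cnj (FT k (\<lambda>w. cnj (G w)) z)"
proof -
  have "cnj (FT k (\<lambda>w. cnj (G w)) z) = (LINT w|Mk k. cnj (cis (- dotk k w z) * cnj (G w)))"
    unfolding FT_def by (rule Bochner_Integration.integral_cnj[symmetric])
  then show ?thesis by (simp add: FTm_def cis_cnj dotk_commute)
qed

text \<open>Conjugating both the argument and the value of \<open>FT\<close> inverts it up to the
  Plancherel constant, by Parseval's identity.\<close>

lemma is_FT_FTm:
  fixes G :: "'n::finite kernel"
  assumes G: "L12 k G"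
  shows "sqi (Mk k) (FTm k G)" "is_FT k (FTm k G) (\<lambda>w. of_real (cF TYPE('n) k) * G w)"
proof -
  have F: "FTm k G = (\<lambda>z. cnj (FT k (\<lambda>w. cnj (G w)) z))" by (auto simp: FTm_FT)
  note p = plancherel_L12[OF L12_cnj[OF G]]
  show "sqi (Mk k) (FTm k G)" unfolding F by (rule sqi_cnj[OF p(1)])
  show "is_FT k (FTm k G) (\<lambda>w. of_real (cF TYPE('n) k) * G w)"
    unfolding is_FT_iff
  proof (intro conjI allI impI)
    show "sqi (Mk k) (\<lambda>w. of_real (cF TYPE('n) k) * G w)" by (intro sqi_scale L12D(2)[OF G])
    fix \<phi> :: "'n kernel" assume \<phi>: "L12 k \<phi>"
    have "(LINT z|Mk k. FTm k G z * FT k \<phi> z) = ip (Mk k) (FT k \<phi>) (FT k (\<lambda>w. cnj (G w)))"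
      unfolding F ip_def by (simp add: mult.commute)
    also have "\<dots> = of_real (cF TYPE('n) k) * ip (Mk k) \<phi> (\<lambda>w. cnj (G w))"
      by (intro is_FT_ip is_FT_FT \<phi> L12_cnj[OF G] L12D(2))
    also have "\<dots> = (LINT w|Mk k. of_real (cF TYPE('n) k) * G w * \<phi> w)"
      unfolding ip_def by (subst integral_mult_right_zero[symmetric]) (simp add: ac_simps)
    finally show "(LINT w|Mk k. of_real (cF TYPE('n) k) * G w * \<phi> w) = (LINT z|Mk k. FTm k G z * FT k \<phi> z)" by simp
  qed
qed

section \<open>Sobolev spaces in momentum variables\<close>

lemma jbr_ge1: "jbr p \<ge> 1"
  by (simp add: jbr_def)

lemma measurable_jbr [measurable]: "jbr \<in> borel_measurable borel"
  unfolding jbr_def[abs_def] by measurable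

lemma measurable_wS [measurable (raw)]:
  assumes "f \<in> measurable N (Mk k)"
  shows "(\<lambda>x. wS \<alpha> k (f x)) \<in> borel_measurable N"
proof -
  have "(\<lambda>x. jbr (fst (f x) j) powr \<alpha> * jbr (snd (f x) j) powr \<alpha>) \<in> borel_measurable N" if "j < k" for j
  proof -
    have [measurable]: "(\<lambda>x. fst (f x) j) \<in> borel_measurable N" "(\<lambda>x. snd (f x) j) \<in> borel_measurable N"
      using measurable_Mk_fst'[OF assms that] measurable_Mk_snd'[OF assms that] by auto
    show ?thesis by measurable
  qed
  then show ?thesis unfolding wS_def by (intro borel_measurable_prod) auto
qed

lemma wS_ge1:
  assumes "\<alpha> \<ge> 0"
  shows "wS \<alpha> k w \<ge> 1"
proof -
  have "jbr p powr \<alpha> \<ge> 1" for p :: "real^'a" using jbr_ge1[of p] assms by (rule ge_one_powr_ge_zero)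
  moreover have "1 \<le> a * b" if "1 \<le> a" "1 \<le> b" for a b :: real
    using mult_mono[of 1 a 1 b] that by simp
  ultimately show ?thesis unfolding wS_def by (intro prod_ge_1) auto
qed

lemma wS_pos: "wS \<alpha> k w > 0"
proof -
  have "jbr p > 0" for p :: "real^'a" using jbr_ge1[of p] by linarith
  then have "jbr p powr \<alpha> > 0" for p :: "real^'a" by (metis powr_gt_zero less_irrefl)
  then show ?thesis unfolding wS_def by (intro prod_pos) auto
qed

lemma wS_nz [simp]: "wS \<alpha> k w \<noteq> 0"
  using wS_pos[of \<alpha> k w] by simp

lemma is_FT_meas: "is_FT k f g \<Longrightarrow> g \<in> borel_measurable (Mk k)"
  by (auto dest: is_FT_sqi sqi_meas)

text \<open>\<open>is_FT_surj\<close> supplies the witness \<open>h\<close> of \<open>is_S\<close>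
  as soon as the weighted transform is square integrable.\<close>

lemma inH_iff: "inH \<alpha> k \<gamma> \<longleftrightarrow> sqi (Mk k) \<gamma> \<and> (\<exists>g. is_FT k \<gamma> g \<and> sqi (Mk k) (\<lambda>w. of_real (wS \<alpha> k w) * g w))"
  unfolding inH_def is_S_def L2_sqi using is_FT_surj is_FT_sqi by blast

lemma inH_sqi: "inH \<alpha> k \<gamma> \<Longrightarrow> sqi (Mk k) \<gamma>"
  by (simp add: inH_iff)

text \<open>A representative of the transform: it is unique only up to null sets, so the linearity
  and evolution rules for \<open>phi\<close> hold almost everywhere.\<close>

definition ft :: "nat \<Rightarrow> 'n::finite kernel \<Rightarrow> 'n kernel" where
  "ft k \<gamma> = (SOME g. is_FT k \<gamma> g)"

text \<open>The constant compensates for the unnormalised transform \<open>FT\<close>, so that \<open>Hnorm\<close> is exactly the norm of \<open>phi\<close>.\<close>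
definition phi :: "real \<Rightarrow> nat \<Rightarrow> 'n::finite kernel \<Rightarrow> 'n kernel" where
  "phi \<alpha> k \<gamma> = (\<lambda>w. of_real (wS \<alpha> k w / sqrt (cF TYPE('n) k)) * ft k \<gamma> w)"

lemma is_FT_ft: "sqi (Mk k) \<gamma> \<Longrightarrow> is_FT k \<gamma> (ft k \<gamma>)"
  unfolding ft_def using someI_ex is_FT_exists by metis

lemma phi_AE:
  fixes \<gamma> :: "'n::finite kernel"
  assumes "sqi (Mk k) \<gamma>" "is_FT k \<gamma> g"
  shows "AE w in Mk k. phi \<alpha> k \<gamma> w = of_real (wS \<alpha> k w / sqrt (cF TYPE('n) k)) * g w"
  using is_FT_unique[OF is_FT_ft[OF assms(1)] assms(2)] by eventually_elim (simp add: phi_def)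

lemma phi_meas: "sqi (Mk k) \<gamma> \<Longrightarrow> phi \<alpha> k \<gamma> \<in> borel_measurable (Mk k)"
proof -
  assume s: "sqi (Mk k) \<gamma>"
  have [measurable]: "ft k \<gamma> \<in> borel_measurable (Mk k)" by (rule is_FT_meas[OF is_FT_ft[OF s]])
  show ?thesis unfolding phi_def by measurable
qed

lemma inH_phi_iff: "inH \<alpha> k \<gamma> \<longleftrightarrow> sqi (Mk k) \<gamma> \<and> sqi (Mk k) (phi \<alpha> k \<gamma>)"
proof (intro iffI conjI)
  assume i: "inH \<alpha> k \<gamma>"
  then show s: "sqi (Mk k) \<gamma>" by (rule inH_sqi)
  obtain g where g: "is_FT k \<gamma> g" "sqi (Mk k) (\<lambda>w. of_real (wS \<alpha> k w) * g w)" using i unfolding inH_iff by blast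
  have "sqi (Mk k) (\<lambda>w. (1 / of_real (sqrt (cF TYPE('a) k))) * (of_real (wS \<alpha> k w) * g w))" by (rule sqi_scale[OF g(2)])
  then show "sqi (Mk k) (phi \<alpha> k \<gamma>)"
  proof (rule sqi_cong_AE[OF _ phi_meas[OF s]])
    show "AE z in Mk k. (1 / of_real (sqrt (cF TYPE('a) k))) * (of_real (wS \<alpha> k z) * g z) = phi \<alpha> k \<gamma> z"
      using phi_AE[OF s g(1), of \<alpha>] by eventually_elim simp
  qed
next
  assume a: "sqi (Mk k) \<gamma> \<and> sqi (Mk k) (phi \<alpha> k \<gamma>)"
  have "sqi (Mk k) (\<lambda>w. of_real (sqrt (cF TYPE('a) k)) * phi \<alpha> k \<gamma> w)" by (rule sqi_scale) (use a in simp)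
  moreover have "of_real (sqrt (cF TYPE('a) k)) * phi \<alpha> k \<gamma> w = of_real (wS \<alpha> k w) * ft k \<gamma> w" for w
    by (simp add: phi_def)
  ultimately have "sqi (Mk k) (\<lambda>w. of_real (wS \<alpha> k w) * ft k \<gamma> w)" by simp
  then show "inH \<alpha> k \<gamma>" unfolding inH_iff using a is_FT_ft by blast
qed

lemma phi_sqi: "inH \<alpha> k \<gamma> \<Longrightarrow> sqi (Mk k) (phi \<alpha> k \<gamma>)"
  by (simp add: inH_phi_iff)

lemma Sop_FT:
  fixes \<gamma> :: "'n::finite kernel"
  assumes i: "inH \<alpha> k \<gamma>"
  shows "sqi (Mk k) (Sop \<alpha> k \<gamma>)"
    and "is_FT k (Sop \<alpha> k \<gamma>) (\<lambda>w. of_real (sqrt (cF TYPE('n) k)) * phi \<alpha> k \<gamma> w)"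
proof -
  have "is_S \<alpha> k \<gamma> (Sop \<alpha> k \<gamma>)" using i unfolding inH_def Sop_def by (metis someI_ex)
  then obtain g where g: "sqi (Mk k) (Sop \<alpha> k \<gamma>)" "is_FT k \<gamma> g" "is_FT k (Sop \<alpha> k \<gamma>) (\<lambda>w. of_real (wS \<alpha> k w) * g w)"
    unfolding is_S_def L2_sqi by blast
  show "sqi (Mk k) (Sop \<alpha> k \<gamma>)" by (rule g(1))
  show "is_FT k (Sop \<alpha> k \<gamma>) (\<lambda>w. of_real (sqrt (cF TYPE('n) k)) * phi \<alpha> k \<gamma> w)"
  proof (rule is_FT_cong[OF g(3,1,1)])
    show "(\<lambda>w. of_real (sqrt (cF TYPE('n) k)) * phi \<alpha> k \<gamma> w) \<in> borel_measurable (Mk k)"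
      using phi_meas[OF inH_sqi[OF i]] by measurable
    show "AE z in Mk k. of_real (wS \<alpha> k z) * g z = of_real (sqrt (cF TYPE('n) k)) * phi \<alpha> k \<gamma> z"
      using phi_AE[OF inH_sqi[OF i] g(2), of \<alpha>] by eventually_elim simp
  qed simp
qed

lemma Hinner_phi:
  assumes "inH \<alpha> k \<gamma>" "inH \<alpha> k \<phi>"
  shows "Hinner \<alpha> k \<gamma> \<phi> = ip (Mk k) (phi \<alpha> k \<gamma>) (phi \<alpha> k \<phi>)"
proof -
  have c: "complex_of_real (sqrt (cF TYPE('a) k)) * of_real (sqrt (cF TYPE('a) k)) = of_real (cF TYPE('a) k)"
    by (simp add: less_imp_le flip: of_real_mult)
  have "of_real (cF TYPE('a) k) * ip (Mk k) (Sop \<alpha> k \<gamma>) (Sop \<alpha> k \<phi>)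
    = of_real (cF TYPE('a) k) * ip (Mk k) (phi \<alpha> k \<gamma>) (phi \<alpha> k \<phi>)"
    unfolding is_FT_ip[OF Sop_FT(2)[OF assms(1)] Sop_FT(1)[OF assms(1)] Sop_FT(2)[OF assms(2)] Sop_FT(1)[OF assms(2)], symmetric]
    by (simp add: ip_scale_left ip_scale_right mult.assoc[symmetric] c)
  then show ?thesis unfolding Hinner_def ip_def by simp
qed

lemma Hnorm_phi:
  assumes "inH \<alpha> k \<gamma>"
  shows "Hnorm \<alpha> k \<gamma> = nrm (Mk k) (phi \<alpha> k \<gamma>)"
proof -
  have "sqrt (cF TYPE('a) k) * nrm (Mk k) (phi \<alpha> k \<gamma>) = sqrt (cF TYPE('a) k) * nrm (Mk k) (Sop \<alpha> k \<gamma>)"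
    using is_FT_nrm[OF Sop_FT(2,1)[OF assms]] unfolding nrm_scale by (simp add: less_imp_le)
  then show ?thesis unfolding Hnorm_def nrm_def by simp
qed

text \<open>The weight is at least 1, so dividing by it stays in L2. Together with
  \<open>Hinner_phi\<close> this makes \<open>phi\<close> unitary onto L2, which lets the test
  functions of \<open>mild\<close> range over all of L2.\<close>

lemma phi_surj:
  fixes f :: "'n::finite kernel"
  assumes f: "sqi (Mk k) f" and \<alpha>: "\<alpha> \<ge> 0"
  shows "\<exists>\<gamma>. inH \<alpha> k \<gamma> \<and> (AE w in Mk k. phi \<alpha> k \<gamma> w = f w)"
proof -
  define c where "c = sqrt (cF TYPE('n) k)"
  have c: "c > 0" by (simp add: c_def)
  define g where "g = (\<lambda>w. of_real (c / wS \<alpha> k w) * f w)"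
  note [measurable] = sqi_meas[OF f]
  have "sqi (Mk k) g"
  proof (rule sqi_bound[OF f, of _ c])
    show "g \<in> borel_measurable (Mk k)" unfolding g_def by measurable
    have "c / wS \<alpha> k w \<le> c" for w :: "'n pts"
      using wS_ge1[OF \<alpha>, of k w] c by (simp add: divide_le_eq mult_left_le)
    then show "AE z in Mk k. cmod (g z) \<le> c * cmod (f z)"
    proof (intro AE_I2)
      fix z :: "'n pts"
      have "cmod (g z) = (c / wS \<alpha> k z) * cmod (f z)"
        unfolding g_def norm_mult norm_of_real using c wS_pos[of \<alpha> k z] by simp
      also have "\<dots> \<le> c * cmod (f z)"
        by (rule mult_right_mono) (use \<open>\<And>w. c / wS \<alpha> k w \<le> c\<close> in auto)
      finally show "cmod (g z) \<le> c * cmod (f z)" .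
    qed
  qed
  then obtain \<gamma> where \<gamma>: "sqi (Mk k) \<gamma>" "is_FT k \<gamma> g" using is_FT_surj by blast
  have ae: "AE w in Mk k. phi \<alpha> k \<gamma> w = f w"
    using phi_AE[OF \<gamma>, of \<alpha>] unfolding c_def[symmetric] g_def
    by eventually_elim (use c in simp)
  then have "sqi (Mk k) (phi \<alpha> k \<gamma>)"
    by (intro sqi_cong_AE[OF f phi_meas[OF \<gamma>(1)]]) auto
  then show ?thesis using \<gamma>(1) ae inH_phi_iff by blast
qed

lemma phi_add:
  assumes "inH \<alpha> k \<gamma>" "inH \<alpha> k \<phi>"
  shows "inH \<alpha> k (\<lambda>z. \<gamma> z + \<phi> z)" "AE w in Mk k. phi \<alpha> k (\<lambda>z. \<gamma> z + \<phi> z) w = phi \<alpha> k \<gamma> w + phi \<alpha> k \<phi> w"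
proof -
  note s = inH_sqi[OF assms(1)] inH_sqi[OF assms(2)]
  note F = is_FT_add[OF is_FT_ft[OF s(1)] s(1) is_FT_ft[OF s(2)] s(2)]
  show ae: "AE w in Mk k. phi \<alpha> k (\<lambda>z. \<gamma> z + \<phi> z) w = phi \<alpha> k \<gamma> w + phi \<alpha> k \<phi> w"
    using phi_AE[OF sqi_add[OF s] F, of \<alpha>] by eventually_elim (simp add: phi_def distrib_left)
  have "sqi (Mk k) (phi \<alpha> k (\<lambda>z. \<gamma> z + \<phi> z))"
    using ae by (intro sqi_cong_AE[OF sqi_add[OF phi_sqi[OF assms(1)] phi_sqi[OF assms(2)]]] phi_meas sqi_add s) auto
  then show "inH \<alpha> k (\<lambda>z. \<gamma> z + \<phi> z)" using sqi_add[OF s] inH_phi_iff by blast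
qed

lemma phi_scale:
  assumes "inH \<alpha> k \<gamma>"
  shows "inH \<alpha> k (\<lambda>z. c * \<gamma> z)" "AE w in Mk k. phi \<alpha> k (\<lambda>z. c * \<gamma> z) w = c * phi \<alpha> k \<gamma> w"
proof -
  note s = inH_sqi[OF assms(1)]
  note F = is_FT_scale[OF is_FT_ft[OF s(1)], of c]
  show ae: "AE w in Mk k. phi \<alpha> k (\<lambda>z. c * \<gamma> z) w = c * phi \<alpha> k \<gamma> w"
    using phi_AE[OF sqi_scale[OF s] F, of \<alpha>] by eventually_elim (simp add: phi_def)
  have "sqi (Mk k) (phi \<alpha> k (\<lambda>z. c * \<gamma> z))"
    using ae by (intro sqi_cong_AE[OF sqi_scale[OF phi_sqi[OF assms(1)], of c]] phi_meas sqi_scale s) auto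
  then show "inH \<alpha> k (\<lambda>z. c * \<gamma> z)" using sqi_scale[OF s] inH_phi_iff by blast
qed

lemma phi_diff:
  assumes "inH \<alpha> k \<gamma>" "inH \<alpha> k \<phi>"
  shows "inH \<alpha> k (\<lambda>z. \<gamma> z - \<phi> z)" "AE w in Mk k. phi \<alpha> k (\<lambda>z. \<gamma> z - \<phi> z) w = phi \<alpha> k \<gamma> w - phi \<alpha> k \<phi> w"
proof -
  have e: "(\<lambda>z. \<gamma> z - \<phi> z) = (\<lambda>z. \<gamma> z + (-1) * \<phi> z)" by auto
  note p = phi_scale[OF assms(2), of "-1"]
  show "inH \<alpha> k (\<lambda>z. \<gamma> z - \<phi> z)" unfolding e by (rule phi_add(1)[OF assms(1) p(1)])
  show "AE w in Mk k. phi \<alpha> k (\<lambda>z. \<gamma> z - \<phi> z) w = phi \<alpha> k \<gamma> w - phi \<alpha> k \<phi> w"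
    unfolding e using phi_add(2)[OF assms(1) p(1)] p(2) by eventually_elim simp
qed

lemma Hnorm_diff:
  assumes "inH \<alpha> k \<gamma>" "inH \<alpha> k \<phi>"
  shows "Hnorm \<alpha> k (\<lambda>z. \<gamma> z - \<phi> z) = nrm (Mk k) (\<lambda>w. phi \<alpha> k \<gamma> w - phi \<alpha> k \<phi> w)"
  unfolding Hnorm_phi[OF phi_diff(1)[OF assms]]
  by (intro nrm_cong_AE phi_diff(2) assms sqi_meas phi_sqi phi_diff(1) sqi_diff)

section \<open>The free evolution as a phase\<close>

definition \<theta> :: "nat \<Rightarrow> 'n::finite pts \<Rightarrow> real" where
  "\<theta> k w = (\<Sum>j<k. (norm (snd w j))\<^sup>2 - (norm (fst w j))\<^sup>2)"

lemma measurable_theta [measurable (raw)]: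
  assumes "f \<in> measurable N (Mk k)"
  shows "(\<lambda>x. \<theta> k (f x)) \<in> borel_measurable N"
  unfolding \<theta>_def
  by (intro borel_measurable_sum borel_measurable_diff borel_measurable_power borel_measurable_norm
      measurable_Mk_fst' measurable_Mk_snd') (use assms in auto)

text \<open>Whatever kernel the choice in \<open>Uop\<close> returns, its transform is prescribed up
  to null sets; existence comes from \<open>is_FT_surj\<close>.\<close>

lemma Uop_phi:
  assumes i: "inH \<alpha> k \<gamma>"
  shows "inH \<alpha> k (Uop k t \<gamma>)" "AE w in Mk k. phi \<alpha> k (Uop k t \<gamma>) w = cis (t * \<theta> k w) * phi \<alpha> k \<gamma> w"
proof -
  note s = inH_sqi[OF i]
  let ?P = "\<lambda>u. sqi (Mk k) u \<and> (\<exists>g. is_FT k \<gamma> g \<and> is_FT k u (\<lambda>w. cis (t * \<theta> k w) * g w))"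
  note F = is_FT_ft[OF s]
  have "sqi (Mk k) (\<lambda>w. cis (t * \<theta> k w) * ft k \<gamma> w)"
    using is_FT_meas[OF F] by (intro sqi_bound[OF is_FT_sqi[OF F], of _ 1]) (auto simp: norm_mult)
  then obtain u where "?P u" using is_FT_surj F by blast
  then have "?P (Uop k t \<gamma>)" unfolding Uop_def L2_sqi \<theta>_def[symmetric] by (rule someI[where P = ?P])
  then obtain g where g: "sqi (Mk k) (Uop k t \<gamma>)" "is_FT k \<gamma> g" "is_FT k (Uop k t \<gamma>) (\<lambda>w. cis (t * \<theta> k w) * g w)" by blast
  show ae: "AE w in Mk k. phi \<alpha> k (Uop k t \<gamma>) w = cis (t * \<theta> k w) * phi \<alpha> k \<gamma> w"
    using phi_AE[OF g(1,3), of \<alpha>] phi_AE[OF s g(2), of \<alpha>] by eventually_elim simp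
  have "sqi (Mk k) (phi \<alpha> k (Uop k t \<gamma>))"
    by (rule sqi_bound[OF phi_sqi[OF i] phi_meas[OF g(1)], where c = 1])
      (use ae in \<open>eventually_elim, simp add: norm_mult\<close>)
  then show "inH \<alpha> k (Uop k t \<gamma>)" using g(1) inH_phi_iff by blast
qed

section \<open>The interaction operator in momentum variables\<close>

lemma jbr_pos [simp]: "jbr p > 0"
  using jbr_ge1[of p] by linarith

text \<open>Dyadic decomposition: where \<open>norm p\<close> is of size \<open>2^m\<close> the
  integrand is at most \<open>2 powr (- 2 * \<alpha> * m)\<close>, and the ball of radius
  \<open>2^(m + 1)\<close> has volume of order \<open>2^(m * n)\<close>. The series is geometric
  with ratio \<open>2 powr (n - 2 * \<alpha>) < 1\<close>.\<close>

lemma jbr_nn_finite: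
  assumes "\<alpha> > real CARD('n::finite) / 2"
  shows "(\<integral>\<^sup>+p. ennreal (jbr (p::real^'n) powr (- 2 * \<alpha>)) \<partial>lborel) < \<infinity>"
proof -
  define n where "n = CARD('n)"
  define f where "f = (\<lambda>p::real^'n. jbr p powr (- 2 * \<alpha>))"
  define g where "g = (\<lambda>m p. ennreal (2 powr (- 2 * \<alpha> * real m)) * indicator (ball (0::real^'n) (2 ^ Suc m)) p)"
  have \<alpha>: "\<alpha> > 0" using assms by (smt (verit) divide_nonneg_nonneg of_nat_0_le_iff)
  have "ennreal (f p) \<le> (\<Sum>m. g m p)" for p
  proof -
    \<comment> \<open>The dyadic shell of p; \<open>m = 0\<close> collects all p of norm below 2,
      where \<open>jbr p \<ge> 1\<close> is enough.\<close>
    obtain m where m: "norm p < 2 ^ Suc m" "m = 0 \<or> norm p \<ge> 2 ^ m"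
    proof -
      obtain N where N: "norm p < 2 ^ N" using real_arch_pow[of 2 "norm p"] by auto
      define M where "M = (LEAST N. norm p < 2 ^ N)"
      have M: "norm p < 2 ^ M" unfolding M_def by (rule LeastI[of _ N]) (rule N)
      show thesis
      proof (cases M)
        case 0
        then have "norm p < 2 ^ Suc 0" using M by simp
        then show ?thesis using that[of 0] by blast
      next
        case (Suc m)
        have "\<not> norm p < 2 ^ m" using not_less_Least[of m "\<lambda>N. norm p < 2 ^ N"] Suc unfolding M_def by auto
        then show ?thesis using that[of m] M Suc by auto
      qed
    qed
    have j: "2 ^ m \<le> jbr p"
    proof (cases "m = 0")
      case True then show ?thesis using jbr_ge1[of p] by simp
    next
      case False
      then have "2 ^ m \<le> norm p" using m(2) by simp
      also have "\<dots> \<le> jbr p" unfolding jbr_def by (intro real_le_rsqrt) auto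
      finally show ?thesis .
    qed
    have "f p \<le> (2 ^ m) powr (- 2 * \<alpha>)"
      unfolding f_def using j \<alpha> by (intro powr_mono2') auto
    also have "(2 ^ m) powr (- 2 * \<alpha>) = 2 powr (- 2 * \<alpha> * real m)"
    proof -
      have "(2::real) ^ m = 2 powr real m" by (simp add: powr_realpow)
      then have "((2::real) ^ m) powr (- 2 * \<alpha>) = (2 powr real m) powr (- 2 * \<alpha>)" by (rule arg_cong)
      then show ?thesis unfolding powr_powr by (simp only: ac_simps)
    qed
    finally have "ennreal (f p) \<le> g m p" using m(1) by (simp add: g_def ennreal_leI)
    also have "\<dots> \<le> (\<Sum>m. g m p)" using sum_le_suminf[of "\<lambda>m. g m p" "{m}"] by simp
    finally show ?thesis .
  qed
  then have "(\<integral>\<^sup>+p. ennreal (f p) \<partial>lborel) \<le> (\<integral>\<^sup>+p. (\<Sum>m. g m p) \<partial>lborel)" by (intro nn_integral_mono)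
  also have "\<dots> = (\<Sum>m. \<integral>\<^sup>+p. g m p \<partial>lborel)"
  proof (rule nn_integral_suminf)
    have "ball (0::real^'n) r \<in> sets lborel" for r by simp
    then show "g m \<in> borel_measurable lborel" for m
      unfolding g_def by (intro borel_measurable_times_ennreal borel_measurable_const borel_measurable_indicator)
  qed
  also have "\<dots> = (\<Sum>m. ennreal (2 powr (- 2 * \<alpha> * real m) * (unit_ball_vol (real n) * (2 ^ Suc m) ^ n)))"
    unfolding g_def
    by (intro suminf_cong) (simp add: nn_integral_cmult_indicator emeasure_ball ennreal_mult n_def DIM_cart)
  also have "\<dots> < \<infinity>"
  proof -
    define r where "r = 2 powr (real n - 2 * \<alpha>)"
    have r: "0 < r" "r < 1" using assms powr_less_mono[of "real n - 2 * \<alpha>" 0 2] by (auto simp: r_def n_def)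
    have e: "2 powr (- 2 * \<alpha> * real m) * (unit_ball_vol (real n) * (2 ^ Suc m) ^ n) = (unit_ball_vol (real n) * 2 ^ n) * r ^ m" for m
    proof -
      have "2 powr (- 2 * \<alpha> * real m) * (2 ^ m) ^ n = r ^ m"
      proof -
        have "((2::real) ^ m) ^ n = 2 powr real (m * n)" unfolding power_mult[symmetric] by (rule powr_realpow[symmetric]) simp
        moreover have "r ^ m = r powr real m" by (rule powr_realpow[symmetric, OF r(1)])
        moreover have "r powr real m = 2 powr ((real n - 2 * \<alpha>) * real m)" unfolding r_def by (rule powr_powr)
        moreover have "(real n - 2 * \<alpha>) * real m = - 2 * \<alpha> * real m + real (m * n)" by (simp add: algebra_simps)
        ultimately show ?thesis by (simp only: powr_add)
      qed
      then show ?thesis by (simp add: power_mult_distrib ac_simps)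
    qed
    have "summable (\<lambda>m. (unit_ball_vol (real n) * 2 ^ n) * r ^ m)"
      using r by (intro summable_mult summable_geometric) auto
    then have "(\<Sum>m. ennreal ((unit_ball_vol (real n) * 2 ^ n) * r ^ m)) = ennreal (\<Sum>m. (unit_ball_vol (real n) * 2 ^ n) * r ^ m)"
      using r by (intro suminf_ennreal2) auto
    then show ?thesis unfolding e by simp
  qed
  finally show ?thesis by (simp add: f_def)
qed

definition JI :: "'n::finite itself \<Rightarrow> real \<Rightarrow> real" where
  "JI _ \<alpha> = enn2real (\<integral>\<^sup>+p. ennreal (jbr (p::real^'n) powr (- 2 * \<alpha>)) \<partial>lborel)"

lemma JI_nn:
  assumes "\<alpha> > real CARD('n::finite) / 2"
  shows "(\<integral>\<^sup>+p. ennreal (jbr (p::real^'n) powr (- 2 * \<alpha>)) \<partial>lborel) = ennreal (JI TYPE('n) \<alpha>)"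
  using jbr_nn_finite[OF assms] by (simp add: JI_def)

lemma integrable_jbr:
  assumes "\<alpha> > real CARD('n::finite) / 2"
  shows "integrable lborel (\<lambda>p::real^'n. jbr p powr (- 2 * \<alpha>))"
  using jbr_nn_finite[OF assms] by (intro integrableI_bounded) auto

lemma integrable_wS_neg:
  assumes "\<alpha> > real CARD('n::finite) / 2"
  shows "integrable (Mk k) (\<lambda>w::'n pts. wS (- 2 * \<alpha>) k w)"
  unfolding wS_def by (intro Mk_prod(1) integrable_jbr[OF assms])

lemma wS_powr: "wS (c * \<alpha>) k w = (wS \<alpha> k w) powr c"
proof -
  have "jbr p powr (c * \<alpha>) = (jbr p powr \<alpha>) powr c" for p :: "real^'a"
    by (simp add: powr_powr mult.commute)
  then show ?thesis unfolding wS_def by (simp add: powr_mult prod_powr_distrib)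
qed

text \<open>Through this polynomial bound, rapid decrease of a transform yields membership in
  \<open>inH\<close> for every exponent \<alpha> \<ge> 0.\<close>

lemma wS_le:
  assumes "\<alpha> \<ge> 0"
  shows "wS \<alpha> k w \<le> (1 + dotk k w w) powr (real k * \<alpha>)"
proof -
  have j: "jbr p powr \<alpha> \<le> (1 + dotk k w w) powr (\<alpha> / 2)" if "(norm p)\<^sup>2 \<le> dotk k w w" for p :: "real^'a"
  proof -
    have "jbr p powr \<alpha> = ((jbr p)\<^sup>2) powr (\<alpha> / 2)"
    proof -
      have "(jbr p)\<^sup>2 = jbr p powr 2" using powr_realpow[of "jbr p" 2] by simp
      then have "((jbr p)\<^sup>2) powr (\<alpha> / 2) = (jbr p powr 2) powr (\<alpha> / 2)" by (rule arg_cong)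
      then show ?thesis unfolding powr_powr by simp
    qed
    also have "\<dots> \<le> (1 + dotk k w w) powr (\<alpha> / 2)"
      using that assms by (intro powr_mono2) (auto simp: jbr_def)
    finally show ?thesis .
  qed
  have le: "(norm (fst w j))\<^sup>2 \<le> dotk k w w \<and> (norm (snd w j))\<^sup>2 \<le> dotk k w w" if "j < k" for j
  proof -
    have "fst w j \<bullet> fst w j + snd w j \<bullet> snd w j \<le> dotk k w w"
      unfolding dotk_def by (rule member_le_sum) (use that in auto)
    moreover have "fst w j \<bullet> fst w j \<ge> 0" "snd w j \<bullet> snd w j \<ge> 0" by auto
    ultimately show ?thesis unfolding power2_norm_eq_inner by linarith
  qed
  have "wS \<alpha> k w \<le> (\<Prod>j<k. (1 + dotk k w w) powr (\<alpha> / 2) * (1 + dotk k w w) powr (\<alpha> / 2))"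
    unfolding wS_def by (intro prod_mono conjI mult_mono j mult_nonneg_nonneg) (use le in auto)
  also have "\<dots> = (1 + dotk k w w) powr (real k * \<alpha>)"
  proof -
    have p: "1 + dotk k w w > 0" using dotk_self_nonneg[of k w] by linarith
    have "(1 + dotk k w w) powr (\<alpha> / 2) * (1 + dotk k w w) powr (\<alpha> / 2) = (1 + dotk k w w) powr \<alpha>"
      by (simp add: powr_add[symmetric])
    moreover have "((1 + dotk k w w) powr \<alpha>) ^ k = ((1 + dotk k w w) powr \<alpha>) powr real k"
      using p by (intro powr_realpow[symmetric]) simp
    ultimately show ?thesis unfolding powr_powr by (simp add: mult.commute)
  qed
  finally show ?thesis .
qed

section \<open>Inserting a particle and translating momenta\<close>

abbreviation QQ :: "((real^'n::finite) \<times> (real^'n)) measure" where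
  "QQ \<equiv> lborel \<Otimes>\<^sub>M lborel"

abbreviation MQ :: "nat \<Rightarrow> ('n::finite pts \<times> (real^'n) \<times> (real^'n)) measure" where
  "MQ k \<equiv> Mk k \<Otimes>\<^sub>M QQ"

lemma sf_QQ: "sigma_finite_measure (QQ :: ((real^'n::finite) \<times> (real^'n)) measure)"
  by (intro sigma_finite_pair_measure sigma_finite_lborel)

lemma psf_MQ: "pair_sigma_finite (Mk k) QQ"
  by (simp add: pair_sigma_finite_def sf_Mk sf_QQ)

definition ins :: "nat \<Rightarrow> 'n::finite pts \<Rightarrow> (real^'n) \<times> (real^'n) \<Rightarrow> 'n pts" where
  "ins k z q = ((fst z)(k := fst q), (snd z)(k := snd q))"

text \<open>The flag selects the primed half, so \<open>False\<close> belongs to the first and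
  \<open>True\<close> to the second trace in \<open>B0\<close>.\<close>

definition crd :: "bool \<Rightarrow> 'n::finite pts \<Rightarrow> nat \<Rightarrow> real^'n" where
  "crd b z = (if b then snd z else fst z)"

definition shiftv :: "bool \<Rightarrow> nat \<Rightarrow> real^'n::finite \<Rightarrow> 'n pts \<Rightarrow> 'n pts" where
  "shiftv b j v z = (if b then (fst z, (snd z)(j := snd z j + v)) else ((fst z)(j := fst z j + v), snd z))"

lemma measurable_ins [measurable (raw)]:
  fixes f :: "'a \<Rightarrow> 'n::finite pts"
  assumes [measurable]: "f \<in> measurable N (Mk k)" "g \<in> measurable N QQ"
  shows "(\<lambda>x. ins k (f x) (g x)) \<in> measurable N (Mk (Suc k))"
proof -
  have f: "(\<lambda>x. fst (f x)) \<in> measurable N (PP k)" "(\<lambda>x. snd (f x)) \<in> measurable N (PP k)"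
    using measurable_compose[OF assms(1)[unfolded Mk_def] measurable_fst] measurable_compose[OF assms(1)[unfolded Mk_def] measurable_snd] by auto
  have g: "(\<lambda>x. fst (g x)) \<in> measurable N lborel" "(\<lambda>x. snd (g x)) \<in> measurable N lborel"
    using measurable_compose[OF assms(2) measurable_fst] measurable_compose[OF assms(2) measurable_snd] by auto
  have I: "{..<Suc k} = {..<k} \<union> {k}" by auto
  show ?thesis unfolding ins_def Mk_def
    by (intro measurable_Pair measurable_fun_upd[OF I] f g)
qed

lemma measurable_shiftv [measurable (raw)]:
  fixes f :: "'a \<Rightarrow> 'n::finite pts"
  assumes "j < k" and [measurable]: "f \<in> measurable N (Mk k)" "g \<in> borel_measurable N"
  shows "(\<lambda>x. shiftv b j (g x) (f x)) \<in> measurable N (Mk k)"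
proof -
  have f: "(\<lambda>x. fst (f x)) \<in> measurable N (PP k)" "(\<lambda>x. snd (f x)) \<in> measurable N (PP k)"
    using measurable_compose[OF assms(2)[unfolded Mk_def] measurable_fst] measurable_compose[OF assms(2)[unfolded Mk_def] measurable_snd] by auto
  have I: "{..<k} = {..<k} \<union> {j}" using assms(1) by auto
  have g: "(\<lambda>x. fst (f x) j + g x) \<in> measurable N lborel" "(\<lambda>x. snd (f x) j + g x) \<in> measurable N lborel"
    using measurable_Mk_fst'[OF assms(2,1)] measurable_Mk_snd'[OF assms(2,1)] by auto
  have u: "(\<lambda>x. (fst (f x))(j := fst (f x) j + g x)) \<in> measurable N (PP k)" "(\<lambda>x. (snd (f x))(j := snd (f x) j + g x)) \<in> measurable N (PP k)"
    by (auto intro!: measurable_fun_upd[OF I] f g)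
  show ?thesis unfolding shiftv_def Mk_def
    by (cases b) (auto intro!: measurable_Pair f u)
qed

lemma nn_PP_Suc:
  assumes "f \<in> borel_measurable (PP (Suc k))"
  shows "(\<integral>\<^sup>+x. f x \<partial>PP (Suc k)) = (\<integral>\<^sup>+x. \<integral>\<^sup>+q. f (x(k := q)) \<partial>lborel \<partial>PP k)"
  unfolding lessThan_Suc by (rule lb.product_nn_integral_insert) (use assms in \<open>auto simp: lessThan_Suc\<close>)

lemma nn_lborel_translate:
  fixes v :: "'a::euclidean_space"
  assumes "f \<in> borel_measurable borel"
  shows "(\<integral>\<^sup>+q. f (q + v) \<partial>lborel) = (\<integral>\<^sup>+q. f q \<partial>lborel)"
proof -
  have "(\<integral>\<^sup>+q. f q \<partial>distr lborel borel ((+) v)) = (\<integral>\<^sup>+q. f (v + q) \<partial>lborel)"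
    by (rule nn_integral_distr) (use assms in auto)
  then show ?thesis by (simp add: lborel_distr_plus add.commute)
qed

lemma nn_lborel_reflect:
  fixes v :: "'a::euclidean_space"
  assumes "f \<in> borel_measurable borel"
  shows "(\<integral>\<^sup>+q. f (v - q) \<partial>lborel) = (\<integral>\<^sup>+q. f q \<partial>lborel)"
proof -
  have e: "(lborel :: 'a measure) = distr lborel borel (\<lambda>x. v + (-1) *\<^sub>R x)"
    by (subst lborel_affine[of "-1" v]) (auto simp: density_1)
  have "(\<integral>\<^sup>+q. f q \<partial>distr lborel borel (\<lambda>x. v + (-1) *\<^sub>R x)) = (\<integral>\<^sup>+q. f (v + (-1) *\<^sub>R q) \<partial>lborel)"
    by (rule nn_integral_distr) (use assms in auto)
  then show ?thesis unfolding e[symmetric] by simp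
qed

lemma nn_PP_shift:
  fixes v :: "real^'n::finite"
  assumes j: "j < k" and f: "f \<in> borel_measurable (PP k)"
  shows "(\<integral>\<^sup>+x. f (x(j := x j + v)) \<partial>PP k) = (\<integral>\<^sup>+x. f x \<partial>PP k)"
proof -
  let ?I = "{..<k} - {j}"
  have I: "{..<k} = insert j ?I" using j by auto
  have I2: "{..<k} = {..<k} \<union> {j}" using j by auto
  have I3: "{..<k} = ?I \<union> {j}" using j by auto
  have m: "(\<lambda>x. x(j := x j + v)) \<in> measurable (PP k) (PP k)"
    by (rule measurable_fun_upd[OF I2]) (use j in \<open>auto intro!: borel_measurable_add measurable_component_singleton[of j "{..<k}" "\<lambda>_. lborel", simplified]\<close>)
  have fm: "(\<lambda>x. f (x(j := x j + v))) \<in> borel_measurable (PP k)" by (rule measurable_compose[OF m f])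
  have "(\<integral>\<^sup>+x. f (x(j := x j + v)) \<partial>PP k) = (\<integral>\<^sup>+x. \<integral>\<^sup>+q. f ((x(j := q))(j := (x(j := q)) j + v)) \<partial>lborel \<partial>PiM ?I (\<lambda>_. lborel))"
    by (subst I, rule lb.product_nn_integral_insert) (use fm I in auto)
  also have "\<dots> = (\<integral>\<^sup>+x. \<integral>\<^sup>+q. f (x(j := q + v)) \<partial>lborel \<partial>PiM ?I (\<lambda>_. lborel))" by simp
  also have "\<dots> = (\<integral>\<^sup>+x. \<integral>\<^sup>+q. f (x(j := q)) \<partial>lborel \<partial>PiM ?I (\<lambda>_. lborel))"
  proof (rule nn_integral_cong)
    fix x :: "'n cfg" assume x: "x \<in> space (PiM ?I (\<lambda>_. lborel))"
    have "(\<lambda>q. x(j := q)) \<in> measurable lborel (PP k)"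
      by (rule measurable_fun_upd[OF I3]) (use x in auto)
    then have "(\<lambda>q. f (x(j := q))) \<in> borel_measurable borel"
      using measurable_compose[OF _ f] by fastforce
    from nn_lborel_translate[OF this, of v]
    show "(\<integral>\<^sup>+q. f (x(j := q + v)) \<partial>lborel) = (\<integral>\<^sup>+q. f (x(j := q)) \<partial>lborel)" .
  qed
  also have "\<dots> = (\<integral>\<^sup>+x. f x \<partial>PP k)"
    by (subst (2) I, rule lb.product_nn_integral_insert[symmetric]) (use f I in auto)
  finally show ?thesis .
qed

lemma nn_Mk:
  assumes "f \<in> borel_measurable (Mk k)"
  shows "(\<integral>\<^sup>+z. f z \<partial>Mk k) = (\<integral>\<^sup>+x. \<integral>\<^sup>+y. f (x, y) \<partial>PP k \<partial>PP k)"
  unfolding Mk_def by (rule sigma_finite_measure.nn_integral_fst[OF sf_PP, symmetric]) (use assms in \<open>simp add: Mk_def\<close>)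

lemma nn_Mk_shift:
  fixes v :: "real^'n::finite"
  assumes j: "j < k" and f: "f \<in> borel_measurable (Mk k)"
  shows "(\<integral>\<^sup>+z. f (shiftv b j v z) \<partial>Mk k) = (\<integral>\<^sup>+z. f z \<partial>Mk k)"
proof -
  have fs: "(\<lambda>z. f (shiftv b j v z)) \<in> borel_measurable (Mk k)"
    by (rule measurable_compose[OF measurable_shiftv[OF j] f]) auto
  have fp: "f \<in> borel_measurable (PP k \<Otimes>\<^sub>M PP k)" using f by (simp add: Mk_def)
  show ?thesis
  proof (cases b)
    case True
    have "(\<integral>\<^sup>+z. f (shiftv b j v z) \<partial>Mk k) = (\<integral>\<^sup>+x. \<integral>\<^sup>+y. f (x, y(j := y j + v)) \<partial>PP k \<partial>PP k)"
      unfolding nn_Mk[OF fs] using True by (simp add: shiftv_def)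
    also have "\<dots> = (\<integral>\<^sup>+x. \<integral>\<^sup>+y. f (x, y) \<partial>PP k \<partial>PP k)"
      by (intro nn_integral_cong nn_PP_shift[OF j]) (use fp in \<open>auto intro: measurable_compose_Pair1\<close>)
    finally show ?thesis by (simp add: nn_Mk[OF f])
  next
    case False
    have fy: "(\<lambda>x. \<integral>\<^sup>+y. f (x, y) \<partial>PP k) \<in> borel_measurable (PP k)"
      by (rule sigma_finite_measure.borel_measurable_nn_integral_fst[OF sf_PP fp])
    have "(\<integral>\<^sup>+z. f (shiftv b j v z) \<partial>Mk k) = (\<integral>\<^sup>+x. \<integral>\<^sup>+y. f (x(j := x j + v), y) \<partial>PP k \<partial>PP k)"
      unfolding nn_Mk[OF fs] using False by (simp add: shiftv_def)
    also have "\<dots> = (\<integral>\<^sup>+x. \<integral>\<^sup>+y. f (x, y) \<partial>PP k \<partial>PP k)"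
      by (rule nn_PP_shift[OF j fy])
    finally show ?thesis by (simp add: nn_Mk[OF f])
  qed
qed

lemma distr_shiftv:
  fixes v :: "real^'n::finite"
  assumes j: "j < k"
  shows "distr (Mk k) (Mk k) (shiftv b j v) = Mk k"
proof (rule measure_eqI)
  fix A :: "'n pts set" assume "A \<in> sets (distr (Mk k) (Mk k) (shiftv b j v))"
  then have A: "A \<in> sets (Mk k)" by simp
  have m: "shiftv b j v \<in> measurable (Mk k) (Mk k)" using measurable_shiftv[OF j, of "\<lambda>z. z" "Mk k" "\<lambda>_. v" b] by simp
  have "emeasure (distr (Mk k) (Mk k) (shiftv b j v)) A = (\<integral>\<^sup>+z. indicator A z \<partial>distr (Mk k) (Mk k) (shiftv b j v))" using A by simp
  also have "\<dots> = (\<integral>\<^sup>+z. indicator A (shiftv b j v z) \<partial>Mk k)" by (rule nn_integral_distr[OF m]) (use A in auto)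
  also have "\<dots> = (\<integral>\<^sup>+z. indicator A z \<partial>Mk k)" by (rule nn_Mk_shift[OF j]) (use A in auto)
  finally show "emeasure (distr (Mk k) (Mk k) (shiftv b j v)) A = emeasure (Mk k) A" using A by simp
qed simp

lemma nn_Mk_Suc:
  fixes f :: "'n::finite pts \<Rightarrow> ennreal"
  assumes f: "f \<in> borel_measurable (Mk (Suc k))"
  shows "(\<integral>\<^sup>+z. f z \<partial>Mk (Suc k)) = (\<integral>\<^sup>+z. \<integral>\<^sup>+q. f (ins k z q) \<partial>QQ \<partial>Mk k)"
proof -
  have I: "{..<Suc k} = {..<k} \<union> {k}" by auto
  have fp: "f \<in> borel_measurable (PP (Suc k) \<Otimes>\<^sub>M PP (Suc k))" using f by (simp add: Mk_def)
  have upd [measurable]: "(\<lambda>x. (g x)(k := h x)) \<in> measurable N (PP (Suc k))"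
    if "g \<in> measurable N (PP k)" "h \<in> borel_measurable N" for g h and N :: "'b measure"
    by (rule measurable_fun_upd[OF I]) (use that in auto)
  note [measurable] = fp
  have [measurable]: "(\<lambda>p. f (g p, h p)) \<in> borel_measurable N" if "g \<in> measurable N (PP (Suc k))" "h \<in> measurable N (PP (Suc k))" for g h and N :: "'b measure"
    by (rule measurable_compose[OF measurable_Pair[OF that] fp])
  interpret PL: pair_sigma_finite "PP k :: (nat \<Rightarrow> real^'n) measure" "lborel :: (real^'n) measure"
    by (simp add: pair_sigma_finite_def sf_PP sigma_finite_lborel)
  interpret P: sigma_finite_measure "PP k :: (nat \<Rightarrow> real^'n) measure" by (rule sf_PP)
  have fy: "(\<lambda>x. \<integral>\<^sup>+y. f (x, y) \<partial>PP (Suc k)) \<in> borel_measurable (PP (Suc k))"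
    by (rule sigma_finite_measure.borel_measurable_nn_integral_fst[OF sf_PP fp])
  have "(\<integral>\<^sup>+z. f z \<partial>Mk (Suc k)) = (\<integral>\<^sup>+x. \<integral>\<^sup>+y. f (x, y) \<partial>PP (Suc k) \<partial>PP (Suc k))" by (rule nn_Mk[OF f])
  also have "\<dots> = (\<integral>\<^sup>+x. \<integral>\<^sup>+q. \<integral>\<^sup>+y. f (x(k := q), y) \<partial>PP (Suc k) \<partial>lborel \<partial>PP k)"
    by (rule nn_PP_Suc[OF fy])
  also have "\<dots> = (\<integral>\<^sup>+x. \<integral>\<^sup>+q. \<integral>\<^sup>+y. \<integral>\<^sup>+q'. f (x(k := q), y(k := q')) \<partial>lborel \<partial>PP k \<partial>lborel \<partial>PP k)"
  proof (intro nn_integral_cong nn_PP_Suc)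
    fix x q assume "x \<in> space (PP k :: (nat \<Rightarrow> real^'n) measure)" "q \<in> space (lborel :: (real^'n) measure)"
    then have "x(k := q) \<in> space (PP (Suc k))" by (auto simp: space_PiM PiE_def extensional_def)
    then show "(\<lambda>y. f (x(k := q), y)) \<in> borel_measurable (PP (Suc k))" using fp by (rule measurable_compose_Pair1)
  qed
  \<comment> \<open>Tonelli moves the new coordinate of the first half past the old coordinates of
    the second half, so that both new coordinates end up innermost.\<close>
  also have "\<dots> = (\<integral>\<^sup>+x. \<integral>\<^sup>+y. \<integral>\<^sup>+q. \<integral>\<^sup>+q'. f (x(k := q), y(k := q')) \<partial>lborel \<partial>lborel \<partial>PP k \<partial>PP k)"
  proof (rule nn_integral_cong)
    fix x :: "'n cfg" assume x: "x \<in> space (PP k)"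
    have cx2: "(\<lambda>p. x) \<in> measurable ((PP k \<Otimes>\<^sub>M lborel) \<Otimes>\<^sub>M lborel) (PP k)" using x by simp
    have m3: "(\<lambda>p. f (x(k := snd (fst p)), (fst (fst p))(k := snd p))) \<in> borel_measurable ((PP k \<Otimes>\<^sub>M lborel) \<Otimes>\<^sub>M lborel)"
      by (rule measurable_compose[OF measurable_Pair fp]; rule measurable_fun_upd[OF I]) (use cx2 in auto)
    have "(\<lambda>p. \<integral>\<^sup>+q'. f (x(k := snd p), (fst p)(k := q')) \<partial>lborel) \<in> borel_measurable (PP k \<Otimes>\<^sub>M lborel)"
      by (rule lborel.borel_measurable_nn_integral) (use m3 in \<open>simp add: case_prod_unfold\<close>)
    then have m: "case_prod (\<lambda>y q. \<integral>\<^sup>+q'. f (x(k := q), y(k := q')) \<partial>lborel) \<in> borel_measurable (PP k \<Otimes>\<^sub>M lborel)"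
      by (simp add: case_prod_unfold)
    show "(\<integral>\<^sup>+q. \<integral>\<^sup>+y. \<integral>\<^sup>+q'. f (x(k := q), y(k := q')) \<partial>lborel \<partial>PP k \<partial>lborel) = (\<integral>\<^sup>+y. \<integral>\<^sup>+q. \<integral>\<^sup>+q'. f (x(k := q), y(k := q')) \<partial>lborel \<partial>lborel \<partial>PP k)"
      by (rule PL.Fubini'[OF m])
  qed
  also have "\<dots> = (\<integral>\<^sup>+x. \<integral>\<^sup>+y. \<integral>\<^sup>+q. f (ins k (x, y) q) \<partial>QQ \<partial>PP k \<partial>PP k)"
  proof (intro nn_integral_cong)
    fix x y :: "'n cfg" assume "x \<in> space (PP k)" "y \<in> space (PP k)"
    then have z: "(x, y) \<in> space (Mk k)" by (simp add: Mk_def space_pair_measure)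
    have m: "(\<lambda>q. f (ins k (x, y) q)) \<in> borel_measurable QQ"
      by (rule measurable_compose[OF measurable_ins f]) (use z in auto)
    show "(\<integral>\<^sup>+q. \<integral>\<^sup>+q'. f (x(k := q), y(k := q')) \<partial>lborel \<partial>lborel) = (\<integral>\<^sup>+q. f (ins k (x, y) q) \<partial>QQ)"
      by (subst lborel.nn_integral_fst[OF m, symmetric]) (simp add: ins_def)
  qed
  also have "\<dots> = (\<integral>\<^sup>+z. \<integral>\<^sup>+q. f (ins k z q) \<partial>QQ \<partial>Mk k)"
  proof (rule nn_Mk[symmetric], rule sigma_finite_measure.borel_measurable_nn_integral[OF sf_QQ])
    show "case_prod (\<lambda>z q. f (ins k z q)) \<in> borel_measurable (MQ k)"
      unfolding case_prod_unfold by (rule measurable_compose[OF measurable_ins f]) auto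
  qed
  finally show ?thesis .
qed

text \<open>Restricting the last pair of variables to the diagonal \<open>x j\<close> becomes, in momentum variables, integration over the last pair \<open>q\<close> of momenta, with \<open>p j\<close> replaced by \<open>p j - fst q - snd q\<close>.\<close>
definition Psi :: "bool \<Rightarrow> nat \<Rightarrow> nat \<Rightarrow> 'n::finite pts \<Rightarrow> ((real^'n) \<times> (real^'n)) \<Rightarrow> 'n pts" where
  "Psi b j k w q = ins k (shiftv b j (- (fst q + snd q)) w) q"

lemma measurable_Psi [measurable (raw)]:
  fixes f :: "'a \<Rightarrow> 'n::finite pts"
  assumes "j < k" and [measurable]: "f \<in> measurable N (Mk k)" "g \<in> measurable N QQ"
  shows "(\<lambda>x. Psi b j k (f x) (g x)) \<in> measurable N (Mk (Suc k))"
proof -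
  have g: "(\<lambda>x. fst (g x)) \<in> measurable N borel" "(\<lambda>x. snd (g x)) \<in> measurable N borel"
    using measurable_compose[OF assms(3) measurable_fst] measurable_compose[OF assms(3) measurable_snd] by auto
  show ?thesis unfolding Psi_def
    by (intro measurable_ins measurable_shiftv assms borel_measurable_uminus borel_measurable_add g)
qed

text \<open>For fixed q the map is a translation followed by an insertion, so Tonelli and
  translation invariance make \<open>Psi\<close> measure preserving.\<close>

lemma nn_Psi:
  fixes f :: "'n::finite pts \<Rightarrow> ennreal"
  assumes j: "j < k" and f: "f \<in> borel_measurable (Mk (Suc k))"
  shows "(\<integral>\<^sup>+w. \<integral>\<^sup>+q. f (Psi b j k w q) \<partial>QQ \<partial>Mk k) = (\<integral>\<^sup>+z. f z \<partial>Mk (Suc k))"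
proof -
  interpret pair_sigma_finite "Mk k :: 'n pts measure" "QQ :: ((real^'n) \<times> (real^'n)) measure" by (rule psf_MQ)
  have m1: "case_prod (\<lambda>w q. f (Psi b j k w q)) \<in> borel_measurable (MQ k)"
    unfolding case_prod_unfold by (rule measurable_compose[OF measurable_Psi[OF j] f]) auto
  have m2: "case_prod (\<lambda>w q. f (ins k w q)) \<in> borel_measurable (MQ k)"
    unfolding case_prod_unfold by (rule measurable_compose[OF measurable_ins f]) auto
  have "(\<integral>\<^sup>+w. \<integral>\<^sup>+q. f (Psi b j k w q) \<partial>QQ \<partial>Mk k) = (\<integral>\<^sup>+q. \<integral>\<^sup>+w. f (Psi b j k w q) \<partial>Mk k \<partial>QQ)"
    by (rule Fubini'[OF m1, symmetric])
  also have "\<dots> = (\<integral>\<^sup>+q. \<integral>\<^sup>+w. f (ins k w q) \<partial>Mk k \<partial>QQ)"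
    unfolding Psi_def
    by (intro nn_integral_cong nn_Mk_shift[OF j], rule measurable_compose[OF measurable_ins f]) auto
  also have "\<dots> = (\<integral>\<^sup>+w. \<integral>\<^sup>+q. f (ins k w q) \<partial>QQ \<partial>Mk k)" by (rule Fubini'[OF m2])
  finally show ?thesis by (simp add: nn_Mk_Suc[OF f])
qed

lemma distr_Psi:
  assumes j: "j < k"
  shows "distr (MQ k) (Mk (Suc k)) (\<lambda>p. Psi b j k (fst p) (snd p)) = (Mk (Suc k) :: 'n::finite pts measure)"
proof (rule measure_eqI)
  let ?f = "\<lambda>p::('n pts \<times> ((real^'n) \<times> (real^'n))). Psi b j k (fst p) (snd p)"
  have m: "?f \<in> measurable (MQ k) (Mk (Suc k))" by (rule measurable_Psi[OF j]) auto
  fix A :: "'n pts set" assume "A \<in> sets (distr (MQ k) (Mk (Suc k)) ?f)"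
  then have A [measurable]: "A \<in> sets (Mk (Suc k))" by simp
  have "emeasure (distr (MQ k) (Mk (Suc k)) ?f) A = (\<integral>\<^sup>+z. indicator A z \<partial>distr (MQ k) (Mk (Suc k)) ?f)" by simp
  also have "\<dots> = (\<integral>\<^sup>+p. indicator A (?f p) \<partial>(MQ k))" by (rule nn_integral_distr[OF m]) simp
  also have "\<dots> = (\<integral>\<^sup>+w. \<integral>\<^sup>+q. indicator A (Psi b j k w q) \<partial>QQ \<partial>Mk k)"
    by (subst sigma_finite_measure.nn_integral_fst[OF sf_QQ, symmetric]) (use measurable_compose[OF m borel_measurable_indicator[OF A]] in auto)
  also have "\<dots> = (\<integral>\<^sup>+z. indicator A z \<partial>Mk (Suc k))" by (rule nn_Psi[OF j]) simp
  finally show "emeasure (distr (MQ k) (Mk (Suc k)) ?f) A = emeasure (Mk (Suc k)) A" by simp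
qed simp

section \<open>Bounds for the weight quotient\<close>

lemma jbr_norm: "jbr p = norm (1::real, p)"
  by (simp add: jbr_def norm_Pair)

text \<open>\<open>jbr p\<close> is the Euclidean norm of \<open>(1, p)\<close>, and the 1 can be
  left on the first summand.\<close>

lemma jbr_triangle: "jbr (x + y) \<le> jbr x + jbr y"
proof -
  have "jbr (x + y) = norm ((1::real, x) + (0, y))" by (simp add: jbr_norm)
  also have "\<dots> \<le> norm (1::real, x) + norm (0::real, y)" by (rule norm_triangle_ineq)
  also have "norm (0::real, y) \<le> jbr y" by (simp add: norm_Pair jbr_def real_le_rsqrt)
  finally show ?thesis by (simp add: jbr_norm)
qed

text \<open>The quotient of Sobolev weights, which is square integrable in \<open>q\<close> uniformly in \<open>w\<close> when \<open>\<alpha>\<close> exceeds half the dimension: one of the three momenta \<open>fst q\<close>, \<open>snd q\<close>, \<open>p - fst q - snd q\<close> carries a third of \<open>p\<close>.\<close>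
definition Kp :: "real \<Rightarrow> bool \<Rightarrow> nat \<Rightarrow> nat \<Rightarrow> 'n::finite pts \<Rightarrow> (real^'n) \<times> (real^'n) \<Rightarrow> real" where
  "Kp \<alpha> b j k w q = wS \<alpha> k w / wS \<alpha> (Suc k) (Psi b j k w q)"

text \<open>Only the factor at \<open>j\<close> changes and one factor is added; cross
  multiplication with the weight of the old momentum avoids a division.\<close>

lemma wS_Psi:
  fixes w :: "'n::finite pts"
  assumes j: "j < k"
  shows "wS \<alpha> (Suc k) (Psi b j k w q) * jbr (crd b w j) powr \<alpha> =
    wS \<alpha> k w * (jbr (crd b w j - (fst q + snd q)) powr \<alpha> * (jbr (fst q) powr \<alpha> * jbr (snd q) powr \<alpha>))"
proof -
  define F where "F = (\<lambda>(w :: 'n pts) i. jbr (fst w i) powr \<alpha> * jbr (snd w i) powr \<alpha>)"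
  define z where "z = Psi b j k w q"
  have wSF: "wS \<alpha> m w = (\<Prod>i<m. F w i)" for m and w :: "'n pts" by (simp add: wS_def F_def)
  have R: "(\<Prod>i<k. F w i) = F w j * (\<Prod>i\<in>{..<k} - {j}. F w i)" for w
    by (rule prod.remove) (use j in auto)
  have other: "(\<Prod>i\<in>{..<k} - {j}. F z i) = (\<Prod>i\<in>{..<k} - {j}. F w i)"
    by (rule prod.cong) (auto simp: F_def z_def Psi_def ins_def shiftv_def)
  have last: "F z k = jbr (fst q) powr \<alpha> * jbr (snd q) powr \<alpha>"
    by (simp add: F_def z_def Psi_def ins_def)
  have jj: "F z j * jbr (crd b w j) powr \<alpha> = F w j * jbr (crd b w j - (fst q + snd q)) powr \<alpha>"
    using j by (auto simp: F_def z_def Psi_def ins_def shiftv_def crd_def algebra_simps)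
  have "wS \<alpha> (Suc k) z * jbr (crd b w j) powr \<alpha> = (F z j * jbr (crd b w j) powr \<alpha>) * (\<Prod>i\<in>{..<k} - {j}. F w i) * (jbr (fst q) powr \<alpha> * jbr (snd q) powr \<alpha>)"
    unfolding wSF prod.lessThan_Suc last R[of z] other by (simp only: ac_simps)
  also have "\<dots> = wS \<alpha> k w * (jbr (crd b w j - (fst q + snd q)) powr \<alpha> * (jbr (fst q) powr \<alpha> * jbr (snd q) powr \<alpha>))"
    unfolding jj wSF R[of w] by (simp only: ac_simps)
  finally show ?thesis by (simp add: z_def)
qed

text \<open>The three momenta add up to \<open>p\<close>, so the largest bracket is at least a third
  of that of \<open>p\<close>. Replacing the maximum of the powers by their sum lets each summand
  cancel one of the three decaying factors, leaving products of two.\<close>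

lemma Kp_sq_le:
  fixes w :: "'n::finite pts" and b :: bool
  assumes j: "j < k" and \<alpha>: "\<alpha> \<ge> 0"
  defines "p \<equiv> crd b w j"
  shows "(Kp \<alpha> b j k w q)\<^sup>2 \<le> 3 powr (2 * \<alpha>) * (jbr (fst q) powr (- 2 * \<alpha>) * jbr (snd q) powr (- 2 * \<alpha>)
     + jbr (p - snd q - fst q) powr (- 2 * \<alpha>) * jbr (snd q) powr (- 2 * \<alpha>)
     + jbr (fst q) powr (- 2 * \<alpha>) * jbr (p - fst q - snd q) powr (- 2 * \<alpha>))"
proof -
  define P A B C where "P = jbr p" and "A = jbr (p - (fst q + snd q))" and "B = jbr (fst q)" and "C = jbr (snd q)"
  have pos: "P > 0" "A > 0" "B > 0" "C > 0" by (auto simp: P_def A_def B_def C_def)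
  have "P \<le> A + jbr (fst q + snd q)" using jbr_triangle[of "p - (fst q + snd q)" "fst q + snd q"] by (simp add: P_def A_def)
  also have "jbr (fst q + snd q) \<le> B + C" unfolding B_def C_def by (rule jbr_triangle)
  finally have "P \<le> 3 * max A (max B C)" by (simp add: max_def split: if_splits)
  then have "P powr (2 * \<alpha>) \<le> (3 * max A (max B C)) powr (2 * \<alpha>)"
    using pos \<alpha> by (intro powr_mono2) auto
  also have "\<dots> = 3 powr (2 * \<alpha>) * (max A (max B C)) powr (2 * \<alpha>)"
    using pos by (intro powr_mult)
  also have "\<dots> \<le> 3 powr (2 * \<alpha>) * (A powr (2 * \<alpha>) + B powr (2 * \<alpha>) + C powr (2 * \<alpha>))"
    by (intro mult_left_mono) (auto simp: max_def)
  finally have P: "P powr (2 * \<alpha>) \<le> 3 powr (2 * \<alpha>) * (A powr (2 * \<alpha>) + B powr (2 * \<alpha>) + C powr (2 * \<alpha>))" .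
  have nz: "wS \<alpha> (Suc k) (Psi b j k w q) \<noteq> 0" by simp
  have K: "Kp \<alpha> b j k w q = P powr \<alpha> * (A powr (- \<alpha>) * B powr (- \<alpha>) * C powr (- \<alpha>))"
  proof -
    have "wS \<alpha> (Suc k) (Psi b j k w q) * P powr \<alpha> = wS \<alpha> k w * (A powr \<alpha> * (B powr \<alpha> * C powr \<alpha>))"
      using wS_Psi[OF j, of \<alpha> b w q] by (simp add: P_def A_def B_def C_def p_def)
    then have "wS \<alpha> k w = wS \<alpha> (Suc k) (Psi b j k w q) * P powr \<alpha> * (A powr (- \<alpha>) * B powr (- \<alpha>) * C powr (- \<alpha>))"
      using pos by (simp add: powr_minus field_simps)
    then show ?thesis unfolding Kp_def using nz by simp
  qed
  have sq: "(x powr y)\<^sup>2 = x powr (2 * y)" if "x > 0" for x y :: real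
    using that by (simp add: power2_eq_square powr_add[symmetric])
  have "(Kp \<alpha> b j k w q)\<^sup>2 = P powr (2 * \<alpha>) * (A powr (- 2 * \<alpha>) * B powr (- 2 * \<alpha>) * C powr (- 2 * \<alpha>))"
    unfolding K power_mult_distrib using pos by (simp add: sq)
  also have "\<dots> \<le> 3 powr (2 * \<alpha>) * (A powr (2 * \<alpha>) + B powr (2 * \<alpha>) + C powr (2 * \<alpha>)) * (A powr (- 2 * \<alpha>) * B powr (- 2 * \<alpha>) * C powr (- 2 * \<alpha>))"
    by (intro mult_right_mono P) auto
  also have "\<dots> = 3 powr (2 * \<alpha>) * (B powr (- 2 * \<alpha>) * C powr (- 2 * \<alpha>) + A powr (- 2 * \<alpha>) * C powr (- 2 * \<alpha>) + B powr (- 2 * \<alpha>) * A powr (- 2 * \<alpha>))"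
    using pos by (simp add: powr_minus field_simps)
  finally show ?thesis
    unfolding A_def B_def C_def by (simp add: algebra_simps)
qed

text \<open>The constant of \<open>Kp_sq_le\<close> times three double integrals, each equal to
  \<open>(JI t \<alpha>)\<^sup>2\<close>.\<close>

definition AB :: "'n::finite itself \<Rightarrow> real \<Rightarrow> real" where
  "AB t \<alpha> = 3 powr (2 * \<alpha>) * (3 * (JI t \<alpha>)\<^sup>2)"

lemma JI_nonneg: "JI t \<alpha> \<ge> 0" by (simp add: JI_def)

lemma AB_nonneg: "AB t \<alpha> \<ge> 0"
  unfolding AB_def by (intro mult_nonneg_nonneg) auto

lemma half_card_pos: "\<alpha> > real CARD('n::finite) / 2 \<Longrightarrow> \<alpha> > 0"
  by (smt (verit) divide_nonneg_nonneg of_nat_0_le_iff)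

text \<open>In each product at least one variable occurs in a single factor; integrating it first
  and using invariance under reflection removes p, which makes the bound uniform in w.\<close>

lemma Kp_nn:
  fixes w :: "'n::finite pts"
  assumes j: "j < k" and \<alpha>: "\<alpha> > real CARD('n) / 2"
  shows "(\<integral>\<^sup>+q. ennreal ((Kp \<alpha> b j k w q)\<^sup>2) \<partial>QQ) \<le> ennreal (AB TYPE('n) \<alpha>)"
proof -
  define g where "g = (\<lambda>x::real^'n. ennreal (jbr x powr (- 2 * \<alpha>)))"
  define I where "I = ennreal (JI TYPE('n) \<alpha>)"
  have g [measurable]: "g \<in> borel_measurable borel" unfolding g_def by measurable
  have gI: "(\<integral>\<^sup>+x. g x \<partial>lborel) = I" unfolding g_def I_def by (rule JI_nn[OF \<alpha>])
  have gr: "(\<integral>\<^sup>+x. g (v - x) \<partial>lborel) = I" for v unfolding nn_lborel_reflect[OF g] by (rule gI)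
  define p where "p = crd b w j"
  have le: "ennreal ((Kp \<alpha> b j k w q)\<^sup>2) \<le> ennreal (3 powr (2 * \<alpha>)) * (g (fst q) * g (snd q) + g (p - snd q - fst q) * g (snd q) + g (fst q) * g (p - fst q - snd q))" for q
  proof -
    have "ennreal ((Kp \<alpha> b j k w q)\<^sup>2) \<le> ennreal (3 powr (2 * \<alpha>) * (jbr (fst q) powr (- 2 * \<alpha>) * jbr (snd q) powr (- 2 * \<alpha>)
     + jbr (p - snd q - fst q) powr (- 2 * \<alpha>) * jbr (snd q) powr (- 2 * \<alpha>)
     + jbr (fst q) powr (- 2 * \<alpha>) * jbr (p - fst q - snd q) powr (- 2 * \<alpha>)))"
      unfolding p_def using half_card_pos[OF \<alpha>] by (intro ennreal_leI Kp_sq_le[OF j]) simp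
    also have "\<dots> = ennreal (3 powr (2 * \<alpha>)) * (g (fst q) * g (snd q) + g (p - snd q - fst q) * g (snd q) + g (fst q) * g (p - fst q - snd q))"
      unfolding g_def by (simp add: ennreal_mult ennreal_plus)
    finally show ?thesis .
  qed
  have 1: "(\<integral>\<^sup>+q. g (fst q) * g (snd q) \<partial>QQ) = I * I"
    by (subst lborel.nn_integral_fst[symmetric]) (auto simp: nn_integral_cmult nn_integral_multc gI)
  have 2: "(\<integral>\<^sup>+q. g (p - snd q - fst q) * g (snd q) \<partial>QQ) = I * I"
    by (subst lborel_pair.nn_integral_snd[symmetric]) (auto simp: nn_integral_cmult nn_integral_multc gI gr)
  have 3: "(\<integral>\<^sup>+q. g (fst q) * g (p - fst q - snd q) \<partial>QQ) = I * I"
    by (subst lborel.nn_integral_fst[symmetric]) (auto simp: nn_integral_cmult nn_integral_multc gI gr)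
  have "(\<integral>\<^sup>+q. ennreal ((Kp \<alpha> b j k w q)\<^sup>2) \<partial>QQ) \<le> (\<integral>\<^sup>+q. ennreal (3 powr (2 * \<alpha>)) * (g (fst q) * g (snd q) + g (p - snd q - fst q) * g (snd q) + g (fst q) * g (p - fst q - snd q)) \<partial>QQ)"
    by (intro nn_integral_mono le)
  also have "\<dots> = ennreal (3 powr (2 * \<alpha>)) * (I * I + I * I + I * I)"
    by (simp add: nn_integral_cmult nn_integral_add 1 2 3)
  also have "\<dots> = ennreal (AB TYPE('n) \<alpha>)"
    unfolding I_def AB_def by (simp add: ennreal_mult[symmetric] ennreal_plus[symmetric] JI_nonneg power2_eq_square del: ennreal_plus)
  finally show ?thesis .
qed

text \<open>One collision term of \<open>B0\<close> acting on \<open>phi\<close>; the kernel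
  \<open>Kp\<close> appears because the weights of both levels are absorbed.\<close>

definition TT :: "real \<Rightarrow> bool \<Rightarrow> nat \<Rightarrow> nat \<Rightarrow> 'n::finite kernel \<Rightarrow> 'n kernel" where
  "TT \<alpha> b j k f w = (LINT q|QQ. of_real (Kp \<alpha> b j k w q) * f (Psi b j k w q))"

lemma measurable_Kp [measurable (raw)]:
  fixes f :: "'a \<Rightarrow> 'n::finite pts"
  assumes "j < k" "f \<in> measurable N (Mk k)" "g \<in> measurable N QQ"
  shows "(\<lambda>x. Kp \<alpha> b j k (f x) (g x)) \<in> borel_measurable N"
  unfolding Kp_def using assms by (intro borel_measurable_divide measurable_wS measurable_Psi) auto

lemma measurable_Psi_comp:
  fixes f :: "'n::finite pts \<Rightarrow> 'b"
  assumes "j < k" "f \<in> measurable (Mk (Suc k)) L"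
  shows "w \<in> space (Mk k) \<Longrightarrow> (\<lambda>q. f (Psi b j k w q)) \<in> measurable QQ L"
    "(\<lambda>p. f (Psi b j k (fst p) (snd p))) \<in> measurable (MQ k) L"
  by (auto intro!: measurable_compose[OF measurable_Psi[OF assms(1)] assms(2)])

text \<open>Since \<open>Psi\<close> preserves measure, \<open>f\<close> composed with it is square
  integrable in q for almost every w; there Cauchy-Schwarz in q against \<open>Kp\<close> gives
  convergence and the pointwise bound.\<close>

lemma TT_AE:
  fixes f :: "'n::finite kernel"
  assumes j: "j < k" and \<alpha>: "\<alpha> > real CARD('n) / 2" and f: "sqi (Mk (Suc k)) f"
  shows "TT \<alpha> b j k f \<in> borel_measurable (Mk k)"
    and "AE w in Mk k. integrable QQ (\<lambda>q. of_real (Kp \<alpha> b j k w q) * f (Psi b j k w q))"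
    and "AE w in Mk k. ennreal ((cmod (TT \<alpha> b j k f w))\<^sup>2) \<le> ennreal (AB TYPE('n) \<alpha>) * (\<integral>\<^sup>+q. ennreal ((cmod (f (Psi b j k w q)))\<^sup>2) \<partial>QQ)"
proof -
  note fm = sqi_meas[OF f]
  note fP = measurable_Psi_comp[OF j fm]
  have "(\<lambda>p. of_real (Kp \<alpha> b j k (fst p) (snd p)) * f (Psi b j k (fst p) (snd p))) \<in> borel_measurable (MQ k)"
    using j by (intro borel_measurable_times fP borel_measurable_of_real measurable_Kp) auto
  then show "TT \<alpha> b j k f \<in> borel_measurable (Mk k)"
    unfolding TT_def by (intro sigma_finite_measure.borel_measurable_lebesgue_integral[OF sf_QQ]) (simp add: case_prod_unfold)
  define F where "F = (\<lambda>w. \<integral>\<^sup>+q. ennreal ((cmod (f (Psi b j k w q)))\<^sup>2) \<partial>QQ)"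
  have fm2: "(\<lambda>z. ennreal ((cmod (f z))\<^sup>2)) \<in> borel_measurable (Mk (Suc k))" using fm by measurable
  have Fm: "F \<in> borel_measurable (Mk k)"
    unfolding F_def using measurable_Psi_comp(2)[OF j fm2]
    by (intro sigma_finite_measure.borel_measurable_nn_integral[OF sf_QQ]) (simp add: case_prod_unfold)
  have "(\<integral>\<^sup>+w. F w \<partial>Mk k) = (\<integral>\<^sup>+z. ennreal ((cmod (f z))\<^sup>2) \<partial>Mk (Suc k))"
    unfolding F_def by (rule nn_Psi[OF j fm2])
  also have "\<dots> < \<infinity>" using nn_nrm[OF f] by simp
  finally have "AE w in Mk k. F w \<noteq> \<infinity>" by (intro nn_integral_PInf_AE Fm) simp
  then have main: "AE w in Mk k. integrable QQ (\<lambda>q. of_real (Kp \<alpha> b j k w q) * f (Psi b j k w q)) \<and>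
     ennreal ((cmod (TT \<alpha> b j k f w))\<^sup>2) \<le> ennreal (AB TYPE('n) \<alpha>) * F w"
    using AE_space
  proof eventually_elim
    case (elim w)
    have [measurable]: "Kp \<alpha> b j k w \<in> borel_measurable QQ"
      using measurable_Kp[OF j, of "\<lambda>_. w" QQ "\<lambda>q. q" \<alpha> b] elim(2) by simp
    have Km: "(\<lambda>q. complex_of_real (Kp \<alpha> b j k w q)) \<in> borel_measurable QQ"
      by measurable
    have K: "sqi QQ (\<lambda>q. complex_of_real (Kp \<alpha> b j k w q))" "nrm QQ (\<lambda>q. complex_of_real (Kp \<alpha> b j k w q)) \<le> sqrt (AB TYPE('n) \<alpha>)"
      using sqi_nnI[OF Km, of "sqrt (AB TYPE('n) \<alpha>)"] Kp_nn[OF j \<alpha>, of b w] AB_nonneg by auto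
    have Ff: "F w < \<infinity>" using elim(1) by (simp add: less_top)
    define r where "r = enn2real (F w)"
    have r: "F w = ennreal r" "r \<ge> 0" using Ff by (auto simp: r_def)
    have g: "sqi QQ (\<lambda>q. f (Psi b j k w q))" "nrm QQ (\<lambda>q. f (Psi b j k w q)) \<le> sqrt r"
      using sqi_nnI[OF fP(1)[OF elim(2)], of b "sqrt r"] r unfolding F_def by auto
    have i: "integrable QQ (\<lambda>q. of_real (Kp \<alpha> b j k w q) * f (Psi b j k w q))" by (rule sqi_int_mult[OF K(1) g(1)])
    have "TT \<alpha> b j k f w = ip QQ (\<lambda>q. of_real (Kp \<alpha> b j k w q)) (\<lambda>q. cnj (f (Psi b j k w q)))"
      by (simp add: TT_def ip_def)
    then have "cmod (TT \<alpha> b j k f w) \<le> nrm QQ (\<lambda>q. complex_of_real (Kp \<alpha> b j k w q)) * nrm QQ (\<lambda>q. f (Psi b j k w q))"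
      using cauchy_schwarz_ip[OF K(1) sqi_cnj[OF g(1)]] by (simp add: nrm_cnj)
    also have "\<dots> \<le> sqrt (AB TYPE('n) \<alpha>) * sqrt r" by (intro mult_mono K(2) g(2)) (auto simp: AB_nonneg)
    finally have "(cmod (TT \<alpha> b j k f w))\<^sup>2 \<le> (sqrt (AB TYPE('n) \<alpha>) * sqrt r)\<^sup>2" by (intro power_mono) auto
    also have "\<dots> = AB TYPE('n) \<alpha> * r" using r by (simp add: power_mult_distrib AB_nonneg)
    finally have "ennreal ((cmod (TT \<alpha> b j k f w))\<^sup>2) \<le> ennreal (AB TYPE('n) \<alpha>) * F w"
      unfolding r(1) by (simp add: ennreal_mult[symmetric] AB_nonneg r(2) ennreal_leI)
    then show ?case using i by simp
  qed
  then show "AE w in Mk k. integrable QQ (\<lambda>q. of_real (Kp \<alpha> b j k w q) * f (Psi b j k w q))" by eventually_elim simp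
  show "AE w in Mk k. ennreal ((cmod (TT \<alpha> b j k f w))\<^sup>2) \<le> ennreal (AB TYPE('n) \<alpha>) * (\<integral>\<^sup>+q. ennreal ((cmod (f (Psi b j k w q)))\<^sup>2) \<partial>QQ)"
    using main unfolding F_def by eventually_elim simp
qed

lemma TT_sqi:
  fixes f :: "'n::finite kernel"
  assumes j: "j < k" and \<alpha>: "\<alpha> > real CARD('n) / 2" and f: "sqi (Mk (Suc k)) f"
  shows "sqi (Mk k) (TT \<alpha> b j k f)" "nrm (Mk k) (TT \<alpha> b j k f) \<le> sqrt (AB TYPE('n) \<alpha>) * nrm (Mk (Suc k)) f"
proof -
  note T = TT_AE[OF assms, of b]
  have fm2: "(\<lambda>z. ennreal ((cmod (f z))\<^sup>2)) \<in> borel_measurable (Mk (Suc k))" using sqi_meas[OF f] by measurable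
  have Fm: "(\<lambda>w. \<integral>\<^sup>+q. ennreal ((cmod (f (Psi b j k w q)))\<^sup>2) \<partial>QQ) \<in> borel_measurable (Mk k)"
    using measurable_Psi_comp(2)[OF j fm2]
    by (intro sigma_finite_measure.borel_measurable_nn_integral[OF sf_QQ]) (simp add: case_prod_unfold)
  have "(\<integral>\<^sup>+w. ennreal ((cmod (TT \<alpha> b j k f w))\<^sup>2) \<partial>Mk k) \<le> (\<integral>\<^sup>+w. ennreal (AB TYPE('n) \<alpha>) * (\<integral>\<^sup>+q. ennreal ((cmod (f (Psi b j k w q)))\<^sup>2) \<partial>QQ) \<partial>Mk k)"
    by (intro nn_integral_mono_AE T(3))
  also have "\<dots> = ennreal (AB TYPE('n) \<alpha>) * (\<integral>\<^sup>+z. ennreal ((cmod (f z))\<^sup>2) \<partial>Mk (Suc k))"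
    by (simp add: nn_integral_cmult[OF Fm] nn_Psi[OF j fm2])
  also have "\<dots> = ennreal ((sqrt (AB TYPE('n) \<alpha>) * nrm (Mk (Suc k)) f)\<^sup>2)"
    unfolding nn_nrm[OF f] by (simp add: power_mult_distrib AB_nonneg ennreal_mult[symmetric])
  finally show "sqi (Mk k) (TT \<alpha> b j k f)" "nrm (Mk k) (TT \<alpha> b j k f) \<le> sqrt (AB TYPE('n) \<alpha>) * nrm (Mk (Suc k)) f"
    using sqi_nnI[OF T(1), of "sqrt (AB TYPE('n) \<alpha>) * nrm (Mk (Suc k)) f"] by (auto simp: AB_nonneg)
qed

lemma TT_add:
  fixes f :: "'n::finite kernel"
  assumes "j < k" "\<alpha> > real CARD('n) / 2" and "sqi (Mk (Suc k)) f" "sqi (Mk (Suc k)) g"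
  shows "AE w in Mk k. TT \<alpha> b j k (\<lambda>z. f z + g z) w = TT \<alpha> b j k f w + TT \<alpha> b j k g w"
  using TT_AE(2)[OF assms(1-3), of b] TT_AE(2)[OF assms(1,2,4), of b]
  by eventually_elim (simp add: TT_def distrib_left)

lemma TT_scale: "TT \<alpha> b j k (\<lambda>z. c * f z) w = c * TT \<alpha> b j k f w"
  unfolding TT_def by (subst integral_mult_right_zero[symmetric]) (simp only: ac_simps)

text \<open>The constant is the square root of the quotient of \<open>cF\<close> at levels
  \<open>k\<close> and \<open>k + 1\<close>, left over from normalising \<open>phi\<close> at both
  levels.\<close>

definition Bop :: "real \<Rightarrow> nat \<Rightarrow> 'n::finite kernel \<Rightarrow> 'n kernel" where
  "Bop \<alpha> k f w = of_real (1 / (2 * pi) ^ CARD('n)) * (\<Sum>j<k. TT \<alpha> False j k f w - TT \<alpha> True j k f w)"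

text \<open>Two collision terms per particle, each of norm at most \<open>sqrt AB\<close>, times the
  constant of \<open>Bop\<close>; the number of particles is kept apart as the factor
  \<open>k\<close>.\<close>

definition CB :: "'n::finite itself \<Rightarrow> real \<Rightarrow> real" where
  "CB t \<alpha> = 2 * sqrt (AB t \<alpha>) / (2 * pi) ^ CARD('n)"

lemma CB_nonneg: "CB t \<alpha> \<ge> 0"
  by (simp add: CB_def AB_nonneg)

lemma nrm_sum_le:
  assumes "\<And>i. i \<in> I \<Longrightarrow> sqi M (f i)" "\<And>i. i \<in> I \<Longrightarrow> nrm M (f i) \<le> c"
  shows "nrm M (\<lambda>z. \<Sum>i\<in>I. f i z) \<le> real (card I) * c"
  using assms
proof (induction I rule: infinite_finite_induct)
  case (insert i I)
  have "nrm M (\<lambda>z. f i z + (\<Sum>i\<in>I. f i z)) \<le> nrm M (f i) + nrm M (\<lambda>z. \<Sum>i\<in>I. f i z)"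
    by (intro nrm_triangle sqi_sum insert.prems) auto
  also have "\<dots> \<le> c + real (card I) * c" by (intro add_mono insert) (use insert.prems in auto)
  finally show ?case using insert.hyps by (simp add: algebra_simps)
qed (simp_all add: nrm_def)

lemma Bop_sqi:
  fixes f :: "'n::finite kernel"
  assumes \<alpha>: "\<alpha> > real CARD('n) / 2" and f: "sqi (Mk (Suc k)) f"
  shows "sqi (Mk k) (Bop \<alpha> k f)" "nrm (Mk k) (Bop \<alpha> k f) \<le> CB TYPE('n) \<alpha> * real k * nrm (Mk (Suc k)) f"
proof -
  let ?c = "1 / (2 * pi) ^ CARD('n)" and ?b = "sqrt (AB TYPE('n) \<alpha>) * nrm (Mk (Suc k)) f"
  have d: "sqi (Mk k) (\<lambda>w. TT \<alpha> False j k f w - TT \<alpha> True j k f w)"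
    "nrm (Mk k) (\<lambda>w. TT \<alpha> False j k f w - TT \<alpha> True j k f w) \<le> 2 * ?b" if "j < k" for j
  proof -
    note T = TT_sqi[OF that \<alpha> f]
    show "sqi (Mk k) (\<lambda>w. TT \<alpha> False j k f w - TT \<alpha> True j k f w)" by (intro sqi_diff T)
    have "nrm (Mk k) (\<lambda>w. TT \<alpha> False j k f w + (-1) * TT \<alpha> True j k f w) \<le> ?b + nrm (Mk k) (\<lambda>w. (-1) * TT \<alpha> True j k f w)"
      by (rule order_trans[OF nrm_triangle[OF T(1) sqi_scale[OF T(1)]]]) (intro add_mono T order_refl)
    also have "nrm (Mk k) (\<lambda>w. (-1) * TT \<alpha> True j k f w) \<le> ?b" unfolding nrm_scale using T(2)[of True] by simp
    finally show "nrm (Mk k) (\<lambda>w. TT \<alpha> False j k f w - TT \<alpha> True j k f w) \<le> 2 * ?b" by simp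
  qed
  have B: "Bop \<alpha> k f = (\<lambda>w. of_real ?c * (\<Sum>j<k. TT \<alpha> False j k f w - TT \<alpha> True j k f w))" by (auto simp: Bop_def)
  show "sqi (Mk k) (Bop \<alpha> k f)" unfolding B by (intro sqi_scale sqi_sum d) auto
  have "nrm (Mk k) (Bop \<alpha> k f) = ?c * nrm (Mk k) (\<lambda>w. \<Sum>j<k. TT \<alpha> False j k f w - TT \<alpha> True j k f w)"
    unfolding B nrm_scale norm_of_real by simp
  also have "\<dots> \<le> ?c * (real (card {..<k}) * (2 * ?b))" by (intro mult_left_mono nrm_sum_le d) auto
  also have "\<dots> = CB TYPE('n) \<alpha> * real k * nrm (Mk (Suc k)) f" by (simp add: CB_def)
  finally show "nrm (Mk k) (Bop \<alpha> k f) \<le> CB TYPE('n) \<alpha> * real k * nrm (Mk (Suc k)) f" .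
qed

lemma Bop_scale: "Bop \<alpha> k (\<lambda>z. c * f z) w = c * Bop \<alpha> k f w"
  unfolding Bop_def TT_scale by (simp add: right_diff_distrib[symmetric] sum_distrib_left[symmetric])

lemma Bop_add:
  fixes f :: "'n::finite kernel"
  assumes \<alpha>: "\<alpha> > real CARD('n) / 2" and f: "sqi (Mk (Suc k)) f" "sqi (Mk (Suc k)) g"
  shows "AE w in Mk k. Bop \<alpha> k (\<lambda>z. f z + g z) w = Bop \<alpha> k f w + Bop \<alpha> k g w"
proof -
  have "AE w in Mk k. \<forall>j\<in>{..<k}. \<forall>b\<in>UNIV. TT \<alpha> b j k (\<lambda>z. f z + g z) w = TT \<alpha> b j k f w + TT \<alpha> b j k g w"
    by (intro AE_finite_allI TT_add \<alpha> f) auto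
  then show ?thesis
  proof eventually_elim
    case (elim w)
    then have "(\<Sum>j<k. TT \<alpha> False j k (\<lambda>z. f z + g z) w - TT \<alpha> True j k (\<lambda>z. f z + g z) w) =
      (\<Sum>j<k. (TT \<alpha> False j k f w - TT \<alpha> True j k f w) + (TT \<alpha> False j k g w - TT \<alpha> True j k g w))"
      by (intro sum.cong) auto
    then show ?case by (simp add: Bop_def sum.distrib distrib_left)
  qed
qed

lemma Bop_diff:
  fixes f :: "'n::finite kernel"
  assumes \<alpha>: "\<alpha> > real CARD('n) / 2" and f: "sqi (Mk (Suc k)) f" "sqi (Mk (Suc k)) g"
  shows "AE w in Mk k. Bop \<alpha> k (\<lambda>z. f z - g z) w = Bop \<alpha> k f w - Bop \<alpha> k g w"
  using Bop_add[OF \<alpha> f(1) sqi_scale[OF f(2), where c = "-1"]] unfolding Bop_scale by simp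

lemma Bop_diff_nrm:
  fixes f :: "'n::finite kernel"
  assumes \<alpha>: "\<alpha> > real CARD('n) / 2" and f: "sqi (Mk (Suc k)) f" "sqi (Mk (Suc k)) g"
  shows "nrm (Mk k) (\<lambda>w. Bop \<alpha> k f w - Bop \<alpha> k g w) \<le> CB TYPE('n) \<alpha> * real k * nrm (Mk (Suc k)) (\<lambda>z. f z - g z)"
proof -
  have "nrm (Mk k) (\<lambda>w. Bop \<alpha> k f w - Bop \<alpha> k g w) = nrm (Mk k) (Bop \<alpha> k (\<lambda>z. f z - g z))"
    by (rule nrm_cong_AE)
      (use Bop_diff[OF assms] in \<open>auto intro!: sqi_meas[OF sqi_diff] sqi_meas[OF Bop_sqi(1)] Bop_sqi(1) sqi_diff \<alpha> f\<close>)
  then show ?thesis using Bop_sqi(2)[OF \<alpha> sqi_diff[OF f]] by simp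
qed

section \<open>The trace formula\<close>

text \<open>Convergence of the finitely many relevant coordinates, along points of the space only:
  kernels are arbitrary functions outside \<open>space (Mk k)\<close>, so a topology on the whole
  type would not fit.\<close>

definition conv_Mk :: "nat \<Rightarrow> (nat \<Rightarrow> 'n::finite pts) \<Rightarrow> 'n pts \<Rightarrow> bool" where
  "conv_Mk k u z \<longleftrightarrow> (\<forall>i. u i \<in> space (Mk k)) \<and>
     (\<forall>j<k. (\<lambda>i. fst (u i) j) \<longlonglongrightarrow> fst z j \<and> (\<lambda>i. snd (u i) j) \<longlonglongrightarrow> snd z j)"

definition cts :: "nat \<Rightarrow> 'n::finite kernel \<Rightarrow> bool" where
  "cts k f \<longleftrightarrow> (\<forall>z\<in>space (Mk k). \<forall>u. conv_Mk k u z \<longrightarrow> (\<lambda>i. f (u i)) \<longlonglongrightarrow> f z)"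

lemma ctsD: "cts k f \<Longrightarrow> z \<in> space (Mk k) \<Longrightarrow> conv_Mk k u z \<Longrightarrow> (\<lambda>i. f (u i)) \<longlonglongrightarrow> f z"
  by (simp add: cts_def)

text \<open>Rounding every coordinate by simple functions gives finitely valued maps into the space;
  composing them with \<open>f\<close> yields simple functions that converge to \<open>f\<close> by
  continuity.\<close>

lemma cts_measurable:
  fixes f :: "'n::finite kernel"
  assumes f: "cts k f"
  shows "f \<in> borel_measurable (Mk k)"
proof -
  obtain F :: "nat \<Rightarrow> real^'n \<Rightarrow> real^'n" where F: "\<And>i. simple_function borel (F i)" "\<And>x. (\<lambda>i. F i x) \<longlonglongrightarrow> x"
    using borel_measurable_implies_sequence_metric[of "\<lambda>x::real^'n. x" borel 0] by auto
  define u where "u = (\<lambda>i (z :: 'n pts). (\<lambda>j\<in>{..<k}. F i (fst z j), \<lambda>j\<in>{..<k}. F i (snd z j)))"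
  have [measurable]: "F i \<in> borel_measurable borel" for i by (rule borel_measurable_simple_function[OF F(1)])
  have restrict_eq: "(restrict f A = restrict g A) = (\<forall>j\<in>A. f j = g j)" for f g :: "nat \<Rightarrow> real^'n" and A
    by (metis restrict_apply' restrict_ext)
  have s: "simple_function (Mk k) (u i)" for i
    unfolding simple_function_def
  proof
    have "finite (range (F i))" using simple_functionD(1)[OF F(1), of i] by simp
    then have "finite (PiE {..<k} (\<lambda>_. range (F i)) \<times> PiE {..<k} (\<lambda>_. range (F i)))"
      by (intro finite_cartesian_product finite_PiE) auto
    moreover have "u i ` space (Mk k) \<subseteq> PiE {..<k} (\<lambda>_. range (F i)) \<times> PiE {..<k} (\<lambda>_. range (F i))"
    proof (rule image_subsetI)
      fix z :: "'n pts"
      have "(\<lambda>j\<in>{..<k}. F i (c j)) \<in> PiE {..<k} (\<lambda>_. range (F i))" for c by (rule restrict_PiE_iff[THEN iffD2]) blast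
      then show "u i z \<in> PiE {..<k} (\<lambda>_. range (F i)) \<times> PiE {..<k} (\<lambda>_. range (F i))"
        unfolding u_def by blast
    qed
    ultimately show "finite (u i ` space (Mk k))" by (rule rev_finite_subset)
    show "\<forall>x\<in>u i ` space (Mk k). u i -` {x} \<inter> space (Mk k) \<in> sets (Mk k)"
    proof
      fix p assume "p \<in> u i ` space (Mk k)"
      then obtain z0 where p_def: "p = u i z0" by blast
      have "u i -` {p} \<inter> space (Mk k) = {z \<in> space (Mk k). \<forall>j\<in>{..<k}. F i (fst z j) = fst p j \<and> F i (snd z j) = snd p j}"
        unfolding p_def u_def by (auto simp: restrict_eq)
      moreover have fib: "{z \<in> space (Mk k). F i (fst z j) = fst p j \<and> F i (snd z j) = snd p j} \<in> sets (Mk k)" if "j < k" for j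
      proof -
        have [measurable]: "(\<lambda>z. fst z j) \<in> borel_measurable (Mk k)" "(\<lambda>z. snd z j) \<in> borel_measurable (Mk k)"
          using that by auto
        show ?thesis by measurable
      qed
      moreover have "{z \<in> space (Mk k). \<forall>j\<in>{..<k}. F i (fst z j) = fst p j \<and> F i (snd z j) = snd p j} \<in> sets (Mk k)"
        by (rule sets.sets_Collect_finite_All) (use fib in auto)
      ultimately show "u i -` {p} \<inter> space (Mk k) \<in> sets (Mk k)" by simp
    qed
  qed
  have "simple_function (Mk k) (\<lambda>z. f (u i z))" for i by (rule simple_function_compose1[OF s])
  then have m: "(\<lambda>z. f (u i z)) \<in> borel_measurable (Mk k)" for i by (rule borel_measurable_simple_function)
  show ?thesis
  proof (rule borel_measurable_LIMSEQ_metric[OF m])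
    fix z :: "'n pts" assume z: "z \<in> space (Mk k)"
    have "conv_Mk k (\<lambda>i. u i z) z"
      unfolding conv_Mk_def using F(2) by (auto simp: u_def space_Mk)
    then show "(\<lambda>i. f (u i z)) \<longlonglongrightarrow> f z" using f z by (auto simp: cts_def)
  qed
qed

text \<open>Every box around z has positive measure and so contains a point of agreement. The
  pointwise form matters because the diagonal, to which \<open>B0\<close> restricts, is a null
  set.\<close>

lemma cts_AE_eq:
  fixes f g :: "'n::finite kernel"
  assumes f: "cts k f" and g: "cts k g" and ae: "AE z in Mk k. f z = g z" and z: "z \<in> space (Mk k)"
  shows "f z = g z"
proof -
  obtain N where N: "N \<in> null_sets (Mk k)" "{z \<in> space (Mk k). f z \<noteq> g z} \<subseteq> N"
    using ae by (auto simp: eventually_ae_filter)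
  define D where "D = (\<lambda>i::nat. bx k (\<lambda>j. ball (fst z j) (1 / real (Suc i))) (\<lambda>j. ball (snd z j) (1 / real (Suc i))))"
  have "\<exists>y. y \<in> D i \<and> f y = g y" for i
  proof (rule ccontr)
    assume c: "\<not> ?thesis"
    have Ds: "D i \<in> sets (Mk k)" unfolding D_def by (intro bx_sets) auto
    have "D i \<subseteq> N" using c N(2) sets.sets_into_space[OF Ds] by blast
    then have "emeasure (Mk k) (D i) = 0" using N(1) Ds by (metis null_setsD1 null_sets_subset)
    moreover have "emeasure (Mk k) (D i) = (\<Prod>j<k. emeasure lborel (ball (fst z j) (1 / real (Suc i))) * emeasure lborel (ball (snd z j) (1 / real (Suc i))))"
      unfolding D_def by (rule emeasure_bx) auto
    moreover have "emeasure lborel (ball (c::real^'n) (1 / real (Suc i))) \<noteq> 0" for c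
      by (subst emeasure_ball) (auto simp: unit_ball_vol_pos ennreal_eq_0_iff not_le intro!: mult_pos_pos)
    ultimately show False by (auto simp: prod_zero_iff)
  qed
  then obtain u where u: "\<And>i. u i \<in> D i" "\<And>i. f (u i) = g (u i)" by metis
  have lim: "(\<lambda>i. h i) \<longlonglongrightarrow> c" if "\<And>i. dist c (h i) < 1 / real (Suc i)" for h :: "nat \<Rightarrow> real^'n" and c
  proof (rule metric_LIMSEQ_I)
    fix r :: real assume "r > 0"
    then obtain n where n: "1 / real (Suc n) < r" using nat_approx_posE by blast
    have "dist (h i) c < r" if "i \<ge> n" for i
    proof -
      have "dist c (h i) < 1 / real (Suc i)" by fact
      also have "\<dots> \<le> 1 / real (Suc n)" using \<open>i \<ge> n\<close> by (simp add: field_simps)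
      finally show ?thesis using n by (simp add: dist_commute)
    qed
    then show "\<exists>no. \<forall>n\<ge>no. dist (h n) c < r" by blast
  qed
  have "conv_Mk k u z"
    unfolding conv_Mk_def
  proof (intro conjI allI impI)
    fix i
    have "D i \<in> sets (Mk k)" unfolding D_def by (intro bx_sets) auto
    then show "u i \<in> space (Mk k)" using u(1)[of i] sets.sets_into_space by blast
  next
    fix j assume j: "j < k"
    have "dist (fst z j) (fst (u i) j) < 1 / real (Suc i)" "dist (snd z j) (snd (u i) j) < 1 / real (Suc i)" for i
      using u(1)[of i] j by (auto simp: D_def bx_def mem_Times_iff PiE_def Pi_def)
    then show "(\<lambda>i. fst (u i) j) \<longlonglongrightarrow> fst z j" "(\<lambda>i. snd (u i) j) \<longlonglongrightarrow> snd z j" by (auto intro: lim)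
  qed
  then have "(\<lambda>i. f (u i)) \<longlonglongrightarrow> f z" "(\<lambda>i. g (u i)) \<longlonglongrightarrow> g z" using f g z by (auto simp: cts_def)
  then show ?thesis unfolding u(2) by (rule LIMSEQ_unique)
qed

lemma conv_Mk_dotk: "conv_Mk k u z \<Longrightarrow> (\<lambda>i. dotk k (u i) w) \<longlonglongrightarrow> dotk k z w"
  unfolding conv_Mk_def dotk_def by (intro tendsto_sum tendsto_add tendsto_inner tendsto_const) auto

lemma FTm_cts:
  fixes G :: "'n::finite kernel"
  assumes G: "integrable (Mk k) G"
  shows "cts k (FTm k G)"
  unfolding cts_def
proof (intro ballI allI impI)
  fix z :: "'n pts" and u assume z: "z \<in> space (Mk k)" and u: "conv_Mk k u z"
  have us: "u i \<in> space (Mk k)" for i using u by (simp add: conv_Mk_def)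
  note [measurable] = borel_measurable_integrable[OF G]
  show "(\<lambda>i. FTm k G (u i)) \<longlonglongrightarrow> FTm k G z"
    unfolding FTm_def
  proof (rule integral_dominated_convergence[where w = "\<lambda>w. cmod (G w)"])
    show "(\<lambda>w. cis (dotk k z w) * G w) \<in> borel_measurable (Mk k)" using z by measurable
    show "(\<lambda>w. cis (dotk k (u i) w) * G w) \<in> borel_measurable (Mk k)" for i
    proof -
      have [measurable]: "(\<lambda>w. u i) \<in> measurable (Mk k) (Mk k)" using us by simp
      show ?thesis by measurable
    qed
    show "integrable (Mk k) (\<lambda>w. cmod (G w))" using G by simp
    show "AE w in Mk k. (\<lambda>i. cis (dotk k (u i) w) * G w) \<longlonglongrightarrow> cis (dotk k z w) * G w"
      using conv_Mk_dotk[OF u] by (intro AE_I2 tendsto_mult tendsto_const) (simp add: cis_conv_exp tendsto_intros)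
    show "AE w in Mk k. norm (cis (dotk k (u i) w) * G w) \<le> cmod (G w)" for i by (simp add: norm_mult)
  qed
qed

lemma is_FT_sum:
  fixes f :: "nat \<Rightarrow> 'n::finite kernel"
  assumes "\<And>j. j < m \<Longrightarrow> is_FT k (f j) (g j)" "\<And>j. j < m \<Longrightarrow> sqi (Mk k) (f j)"
  shows "is_FT k (\<lambda>z. \<Sum>j<m. f j z) (\<lambda>z. \<Sum>j<m. g j z)"
  using assms
proof (induction m)
  case 0
  then show ?case by (simp add: is_FT_iff)
next
  case (Suc m)
  have "is_FT k (\<lambda>z. (\<Sum>j<m. f j z) + f m z) (\<lambda>z. (\<Sum>j<m. g j z) + g m z)"
    by (intro is_FT_add Suc sqi_sum) (use Suc.prems in auto)
  then show ?case by simp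
qed

text \<open>On the diagonal both inserted momenta pair with the position of particle
  \<open>j\<close>, which cancels the shift of its momentum by their sum; the phase no longer
  depends on q.\<close>

lemma dot_Psi:
  fixes z w :: "'n::finite pts"
  assumes j: "j < k"
  shows "dotk (Suc k) (ins k z (crd b z j, crd b z j)) (Psi b j k w q) = dotk k z w"
proof -
  define t where "t = (\<lambda>(z :: 'n pts) (w :: 'n pts) i. fst z i \<bullet> fst w i + snd z i \<bullet> snd w i)"
  have d: "dotk m z w = (\<Sum>i<m. t z w i)" for m and z w :: "'n pts" by (simp add: dotk_def t_def)
  let ?z = "ins k z (crd b z j, crd b z j)" and ?w = "Psi b j k w q"
  have R: "(\<Sum>i<k. t z w i) = t z w j + (\<Sum>i\<in>{..<k} - {j}. t z w i)" for z w :: "'n pts"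
    by (rule sum.remove) (use j in auto)
  have o: "(\<Sum>i\<in>{..<k} - {j}. t ?z ?w i) = (\<Sum>i\<in>{..<k} - {j}. t z w i)"
    by (rule sum.cong) (auto simp: t_def Psi_def ins_def shiftv_def)
  have l: "t ?z ?w k = crd b z j \<bullet> fst q + crd b z j \<bullet> snd q" by (simp add: t_def Psi_def ins_def)
  have jj: "t ?z ?w j = t z w j - crd b z j \<bullet> fst q - crd b z j \<bullet> snd q"
    using j by (auto simp: t_def Psi_def ins_def shiftv_def crd_def inner_add_right inner_diff_right)
  show ?thesis unfolding d sum.lessThan_Suc R[of ?z] R[of z] o l jj by simp
qed

lemma ins_space: "z \<in> space (Mk k) \<Longrightarrow> ins k z q \<in> space (Mk (Suc k))"
  by (auto simp: ins_def space_Mk extensional_def)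

text \<open>The inverse weight is square integrable because \<alpha> exceeds half the dimension, so
  its product with \<open>phi\<close> is integrable. This is the Sobolev embedding into continuous
  functions, seen on the transform side.\<close>

lemma ft_L12:
  fixes s :: "'n::finite kernel"
  assumes \<alpha>: "\<alpha> > real CARD('n) / 2" and s: "inH \<alpha> k s"
  shows "L12 k (ft k s)"
proof -
  let ?c = "sqrt (cF TYPE('n) k)"
  have e: "ft k s w = of_real (?c * inverse (wS \<alpha> k w)) * phi \<alpha> k s w" for w
    by (simp add: phi_def)
  have [measurable]: "(\<lambda>w. wS \<alpha> k w) \<in> borel_measurable (Mk k)" by measurable
  have e2: "(cmod (complex_of_real (?c * inverse (wS \<alpha> k w))))\<^sup>2 = cF TYPE('n) k * wS (- 2 * \<alpha>) k w" for w :: "'n pts"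
  proof -
    have "wS (- 2 * \<alpha>) k w = inverse (wS \<alpha> k w) ^ 2"
      unfolding wS_powr using wS_pos[of \<alpha> k w] by (simp add: powr_minus powr_numeral power_inverse)
    then show ?thesis unfolding norm_of_real power2_abs power_mult_distrib
      by (simp add: less_imp_le)
  qed
  have "sqi (Mk k) (\<lambda>w::'n pts. complex_of_real (?c * inverse (wS \<alpha> k w)))"
    unfolding sqi_def e2 by (intro conjI integrable_mult_right integrable_wS_neg \<alpha>) measurable
  then have "integrable (Mk k) (ft k s)" unfolding e[abs_def] by (rule sqi_int_mult[OF _ phi_sqi[OF s]])
  then show ?thesis unfolding L12_def using is_FT_sqi[OF is_FT_ft[OF inH_sqi[OF s]]] by simp
qed

text \<open>For the transform g of a kernel, this is the transform of its restriction to the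
  diagonal up to \<open>cF\<close> factors, before the weights are absorbed.\<close>

definition GG :: "bool \<Rightarrow> nat \<Rightarrow> nat \<Rightarrow> 'n::finite kernel \<Rightarrow> 'n kernel" where
  "GG b j k g w = (LINT q|QQ. g (Psi b j k w q))"

lemma TT_phi:
  fixes s :: "'n::finite kernel"
  shows "GG b j k (ft (Suc k) s) w = of_real (sqrt (cF TYPE('n) (Suc k)) / wS \<alpha> k w) * TT \<alpha> b j k (phi \<alpha> (Suc k) s) w"
  unfolding TT_def GG_def phi_def Kp_def
  by (subst integral_mult_right_zero[symmetric]) (simp add: field_simps)

text \<open>The inversion formula holds pointwise for continuous s with integrable transform.
  Evaluated on the diagonal and with variables changed by \<open>Psi\<close>, its phase depends on w
  alone, so q can be integrated out.\<close>

lemma trace_formula: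
  fixes s :: "'n::finite kernel"
  assumes \<alpha>: "\<alpha> > real CARD('n) / 2" and s: "inH \<alpha> (Suc k) s" and c: "cts (Suc k) s" and j: "j < k"
  shows "L12 k (GG b j k (ft (Suc k) s))"
    and "\<And>z. z \<in> space (Mk k) \<Longrightarrow> s (ins k z (crd b z j, crd b z j)) = (1 / of_real (cF TYPE('n) (Suc k))) * FTm k (GG b j k (ft (Suc k) s)) z"
proof -
  interpret pair_sigma_finite "Mk k :: 'n pts measure" "QQ :: ((real^'n) \<times> (real^'n)) measure" by (rule psf_MQ)
  define g where "g = ft (Suc k) s"
  define C where "C = complex_of_real (cF TYPE('n) (Suc k))"
  have C: "C \<noteq> 0" by (simp add: C_def)
  let ?P = "\<lambda>p::('n pts \<times> ((real^'n) \<times> (real^'n))). Psi b j k (fst p) (snd p)"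
  have Pm: "?P \<in> measurable (MQ k) (Mk (Suc k))" by (rule measurable_Psi[OF j]) auto
  have g12: "L12 (Suc k) g" unfolding g_def by (rule ft_L12[OF \<alpha> s])
  note gi = L12D(1)[OF g12]
  have gi2: "integrable (distr (MQ k) (Mk (Suc k)) ?P) g" unfolding distr_Psi[OF j] by (rule gi)
  have gP: "integrable (MQ k) (\<lambda>p. g (?P p))"
    using integrable_distr[OF Pm gi2] .
  have Gi: "integrable (Mk k) (GG b j k g)"
    unfolding GG_def using integrable_fst'[OF gP] by simp
  \<comment> \<open>By \<open>TT_phi\<close> and \<open>wS_ge1\<close> it is dominated by
    \<open>TT\<close>, whose square integrability is known.\<close>
  have "sqi (Mk k) (GG b j k g)"
  proof (rule sqi_bound[OF TT_sqi(1)[OF j \<alpha> phi_sqi[OF s], of b], of _ "sqrt (cF TYPE('n) (Suc k))"])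
    show "GG b j k g \<in> borel_measurable (Mk k)" using Gi by simp
    show "AE z in Mk k. cmod (GG b j k g z) \<le> sqrt (cF TYPE('n) (Suc k)) * cmod (TT \<alpha> b j k (phi \<alpha> (Suc k) s) z)"
    proof (rule AE_I2)
      fix z :: "'n pts"
      have "\<alpha> \<ge> 0" using half_card_pos[OF \<alpha>] by simp
      then have w1: "wS \<alpha> k z \<ge> 1" by (rule wS_ge1)
      have "cmod (GG b j k g z) = sqrt (cF TYPE('n) (Suc k)) / wS \<alpha> k z * cmod (TT \<alpha> b j k (phi \<alpha> (Suc k) s) z)"
        unfolding g_def TT_phi[of b j k s z \<alpha>] norm_mult norm_of_real using w1 by (simp add: less_imp_le)
      also have "\<dots> \<le> sqrt (cF TYPE('n) (Suc k)) * cmod (TT \<alpha> b j k (phi \<alpha> (Suc k) s) z)"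
      proof (rule mult_right_mono)
        have "sqrt (cF TYPE('n) (Suc k)) * 1 \<le> sqrt (cF TYPE('n) (Suc k)) * wS \<alpha> k z"
          by (rule mult_left_mono[OF w1]) (simp add: less_imp_le)
        then show "sqrt (cF TYPE('n) (Suc k)) / wS \<alpha> k z \<le> sqrt (cF TYPE('n) (Suc k))"
          using w1 by (simp add: divide_le_eq)
      qed simp
      finally show "cmod (GG b j k g z) \<le> sqrt (cF TYPE('n) (Suc k)) * cmod (TT \<alpha> b j k (phi \<alpha> (Suc k) s) z)" .
    qed
  qed
  then show "L12 k (GG b j k (ft (Suc k) s))" using Gi by (simp add: L12_def g_def)
  have s_eq: "s v = (1 / C) * FTm (Suc k) g v" if v: "v \<in> space (Mk (Suc k))" for v
  proof (rule cts_AE_eq[OF c _ _ v])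
    show "cts (Suc k) (\<lambda>v. (1 / C) * FTm (Suc k) g v)"
      unfolding cts_def by (intro ballI allI impI tendsto_mult tendsto_const ctsD[OF FTm_cts[OF gi]])
    have F: "is_FT (Suc k) (\<lambda>v. (1 / C) * FTm (Suc k) g v) (\<lambda>w. (1 / C) * (of_real (cF TYPE('n) (Suc k)) * g w))"
      by (intro is_FT_scale is_FT_FTm g12)
    show "AE v in Mk (Suc k). s v = (1 / C) * FTm (Suc k) g v"
      by (rule is_FT_inj[OF is_FT_ft[OF inH_sqi[OF s]] inH_sqi[OF s] F sqi_scale[OF is_FT_FTm(1)[OF g12]]])
        (use C in \<open>simp add: C_def g_def\<close>)
  qed
  fix z :: "'n pts" assume z: "z \<in> space (Mk k)"
  let ?v = "ins k z (crd b z j, crd b z j)"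
  have v: "?v \<in> space (Mk (Suc k))" by (rule ins_space[OF z])
  have hm: "(\<lambda>u. cis (dotk (Suc k) ?v u) * g u) \<in> borel_measurable (Mk (Suc k))"
  proof -
    have [measurable]: "(\<lambda>w. ?v) \<in> measurable (Mk (Suc k)) (Mk (Suc k))" "g \<in> borel_measurable (Mk (Suc k))" using v gi by auto
    show ?thesis by measurable
  qed
  have hi: "integrable (MQ k) (\<lambda>p. cis (dotk k z (fst p)) * g (?P p))"
  proof (rule integrable_cis_mult[OF gP])
    have [measurable]: "(\<lambda>w. z) \<in> measurable (MQ k) (Mk k)" using z by simp
    show "(\<lambda>p. dotk k z (fst p)) \<in> borel_measurable (MQ k)" by measurable
  qed
  have "FTm (Suc k) g ?v = integral\<^sup>L (distr (MQ k) (Mk (Suc k)) ?P) (\<lambda>u. cis (dotk (Suc k) ?v u) * g u)"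
    unfolding FTm_def distr_Psi[OF j] ..
  also have "\<dots> = (LINT p|(MQ k). cis (dotk (Suc k) ?v (?P p)) * g (?P p))"
    by (rule integral_distr[OF Pm hm])
  also have "\<dots> = (LINT p|(MQ k). cis (dotk k z (fst p)) * g (?P p))"
    unfolding dot_Psi[OF j] ..
  also have "\<dots> = (LINT w|Mk k. (LINT q|QQ. cis (dotk k z w) * g (Psi b j k w q)))"
    using integral_fst'[OF hi] by simp
  also have "\<dots> = FTm k (GG b j k g) z" unfolding FTm_def GG_def by simp
  finally show "s ?v = (1 / of_real (cF TYPE('n) (Suc k))) * FTm k (GG b j k (ft (Suc k) s)) z"
    unfolding s_eq[OF v] C_def g_def by simp
qed

text \<open>This joins the interaction on kernels with the integral operator \<open>Bop\<close>. It
  will be applied to Schwartz functions, the approximants through which \<open>B_ext\<close> refers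
  to \<open>B0\<close>.\<close>

lemma B0_phi:
  fixes s :: "'n::finite kernel"
  assumes \<alpha>: "\<alpha> > real CARD('n) / 2" and s: "inH \<alpha> (Suc k) s" and c: "cts (Suc k) s"
  shows "inH \<alpha> k (B0 k s)" "AE w in Mk k. phi \<alpha> k (B0 k s) w = Bop \<alpha> k (phi \<alpha> (Suc k) s) w"
proof -
  define G where "G = (\<lambda>b j. GG b j k (ft (Suc k) s))"
  define C where "C = complex_of_real (cF TYPE('n) (Suc k))"
  define H where "H = (\<lambda>j z. (1 / C) * FTm k (G False j) z - (1 / C) * FTm k (G True j) z)"
  note T = trace_formula[OF \<alpha> s c]
  have B: "B0 k s z = (\<Sum>j<k. H j z)" if z: "z \<in> space (Mk k)" for z
    unfolding B0_def H_def C_def G_def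
    by (intro sum.cong refl arg_cong2[where f = "(-)"])
      (use T(2)[OF _ z, of _ False] T(2)[OF _ z, of _ True] in \<open>auto simp: ins_def crd_def\<close>)
  have H: "is_FT k (H j) (\<lambda>w. (1 / C) * (of_real (cF TYPE('n) k) * G False j w) - (1 / C) * (of_real (cF TYPE('n) k) * G True j w))"
     "sqi (Mk k) (H j)" if j: "j < k" for j
  proof -
    have L: "L12 k (G b j)" for b unfolding G_def by (rule T(1)[OF j])
    show "is_FT k (H j) (\<lambda>w. (1 / C) * (of_real (cF TYPE('n) k) * G False j w) - (1 / C) * (of_real (cF TYPE('n) k) * G True j w))"
      unfolding H_def by (intro is_FT_diff is_FT_scale is_FT_FTm sqi_scale L)
    show "sqi (Mk k) (H j)" unfolding H_def by (intro sqi_diff sqi_scale is_FT_FTm L)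
  qed
  have sH: "sqi (Mk k) (\<lambda>z. \<Sum>j<k. H j z)" by (intro sqi_sum H(2)) auto
  have Bm: "B0 k s \<in> borel_measurable (Mk k)"
    using sqi_meas[OF sH] B by (subst measurable_cong[of _ _ "\<lambda>z. \<Sum>j<k. H j z"]) auto
  have sB: "sqi (Mk k) (B0 k s)" by (rule sqi_cong_AE[OF sH Bm]) (use B in \<open>auto intro: AE_I2\<close>)
  define g where "g = (\<lambda>w. \<Sum>j<k. (1 / C) * (of_real (cF TYPE('n) k) * G False j w) - (1 / C) * (of_real (cF TYPE('n) k) * G True j w))"
  have F0: "is_FT k (\<lambda>z. \<Sum>j<k. H j z) g" unfolding g_def by (rule is_FT_sum[OF H])
  have F: "is_FT k (B0 k s) g"
    by (rule is_FT_cong[OF F0 sH sB _ is_FT_meas[OF F0]]) (use B in \<open>auto intro: AE_I2\<close>)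
  have cc: "sqrt (cF TYPE('n) (Suc k)) = (2 * pi) ^ CARD('n) * sqrt (cF TYPE('n) k)"
  proof -
    have "cF TYPE('n) (Suc k) = ((2 * pi) ^ CARD('n))\<^sup>2 * cF TYPE('n) k" by (simp add: cF_def power_add[symmetric])
    then show ?thesis by (simp add: real_sqrt_mult)
  qed
  \<comment> \<open>All constants are written through \<open>a\<close> and \<open>b\<close>, so that
    they can be seen to cancel to \<open>1 / b\<close>, the constant of \<open>Bop\<close>.\<close>
  have key: "of_real (wS \<alpha> k w / sqrt (cF TYPE('n) k)) * g w = Bop \<alpha> k (phi \<alpha> (Suc k) s) w" for w
  proof -
    define a b W where "a = sqrt (cF TYPE('n) k)" and "b = (2 * pi) ^ CARD('n)" and "W = wS \<alpha> k w"
    have p: "a > 0" "b > 0" "W \<noteq> 0" by (auto simp: a_def b_def W_def)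
    have sq: "cF TYPE('n) m = sqrt (cF TYPE('n) m) * sqrt (cF TYPE('n) m)" for m
      by (simp add: less_imp_le)
    have Ceq: "C = of_real ((b * a) * (b * a))" "cF TYPE('n) k = a * a"
      using arg_cong[OF sq[of "Suc k"], of complex_of_real] sq[of k] unfolding C_def cc a_def b_def by blast+
    have "of_real (W / a) * ((1 / C) * (of_real (cF TYPE('n) k) * G False j w) - (1 / C) * (of_real (cF TYPE('n) k) * G True j w))
      = of_real (1 / b) * (TT \<alpha> False j k (phi \<alpha> (Suc k) s) w - TT \<alpha> True j k (phi \<alpha> (Suc k) s) w)" for j
      unfolding G_def TT_phi[of _ j k s w \<alpha>] Ceq cc a_def[symmetric] b_def[symmetric] W_def[symmetric]
      using p by (simp add: field_simps)
    then show ?thesis unfolding g_def Bop_def a_def[symmetric] b_def[symmetric] W_def[symmetric]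
      by (simp add: sum_distrib_left)
  qed
  show ae: "AE w in Mk k. phi \<alpha> k (B0 k s) w = Bop \<alpha> k (phi \<alpha> (Suc k) s) w"
    using phi_AE[OF sB F, of \<alpha>] unfolding key .
  have "sqi (Mk k) (phi \<alpha> k (B0 k s))"
    by (rule sqi_cong_AE[OF Bop_sqi(1)[OF \<alpha> phi_sqi[OF s]] phi_meas[OF sB]]) (use ae in auto)
  then show "inH \<alpha> k (B0 k s)" using sB by (simp add: inH_phi_iff)
qed

section \<open>Schwartz functions\<close>

definition cmp :: "bool \<times> nat \<times> 'n::finite \<Rightarrow> 'n pts \<Rightarrow> real" where
  "cmp d z = crd (fst d) z (fst (snd d)) $ snd (snd d)"

definition Dirs :: "nat \<Rightarrow> (bool \<times> nat \<times> 'n::finite) set" where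
  "Dirs m = UNIV \<times> {..<m} \<times> UNIV"

lemma finite_Dirs [simp]: "finite (Dirs m)"
  by (simp add: Dirs_def)

lemma shift_shiftv: "shift (b, j, i) h z = shiftv b j (h *\<^sub>R axis i 1) z"
  by (simp add: shift_def shiftv_def)

lemma shift_space: "fst (snd d) < m \<Longrightarrow> z \<in> space (Mk m) \<Longrightarrow> shift d h z \<in> space (Mk m)"
  by (cases d) (auto simp: shift_shiftv shiftv_def space_Mk extensional_def)

lemma shift_shift: "shift d h (shift d t z) = shift d (h + t) z"
  by (cases d) (auto simp: shift_shiftv shiftv_def scaleR_add_left algebra_simps)

lemma shift_0 [simp]: "shift d 0 z = z"
  by (cases d) (auto simp: shift_shiftv shiftv_def)

lemma cmp_shift: "cmp e (shift d h z) = cmp e z + (if e = d then h else 0)"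
  by (cases d; cases e) (auto simp: cmp_def crd_def shift_shiftv shiftv_def axis_def)

lemma dotk_cmp: "dotk m z w = (\<Sum>d\<in>Dirs m. cmp d z * cmp d (w :: 'n::finite pts))"
proof -
  have "dotk m z w = (\<Sum>j<m. \<Sum>i\<in>UNIV. fst z j $ i * fst w j $ i) + (\<Sum>j<m. \<Sum>i\<in>UNIV. snd z j $ i * snd w j $ i)"
    by (simp add: dotk_def inner_vec_def sum.distrib)
  also have "\<dots> = (\<Sum>b\<in>UNIV. \<Sum>j<m. \<Sum>i\<in>UNIV. cmp (b, j, i) z * cmp (b, j, i) w)"
    by (simp add: UNIV_bool cmp_def crd_def add.commute)
  also have "\<dots> = (\<Sum>d\<in>Dirs m. cmp d z * cmp d w)"
    unfolding Dirs_def by (simp add: sum.cartesian_product[symmetric] case_prod_unfold sum.cartesian_product)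
  finally show ?thesis .
qed

lemma cmp_sq_le: "fst (snd d) < m \<Longrightarrow> (cmp d z)\<^sup>2 \<le> dotk m z z"
proof -
  assume d: "fst (snd d) < m"
  have "(cmp d z)\<^sup>2 = (\<Sum>d\<in>{d}. (cmp d z)\<^sup>2)" by simp
  also have "\<dots> \<le> (\<Sum>d\<in>Dirs m. (cmp d z)\<^sup>2)"
    by (rule sum_mono2) (use d in \<open>auto simp: Dirs_def mem_Times_iff\<close>)
  finally show ?thesis by (simp add: dotk_cmp power2_eq_square)
qed

lemma cmp_abs_le: "fst (snd d) < m \<Longrightarrow> \<bar>cmp d z\<bar> \<le> 1 + dotk m z z"
proof -
  assume d: "fst (snd d) < m"
  have "\<bar>cmp d z\<bar> \<le> 1 + (cmp d z)\<^sup>2"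
    using sum_squares_bound[of 1 "\<bar>cmp d z\<bar>"] by (simp add: power2_abs)
  then show ?thesis using cmp_sq_le[OF d, of z] by linarith
qed

lemma dotk_shift:
  assumes "fst (snd d) < m"
  shows "dotk m (shift d h z) w = dotk m z w + h * cmp d w"
proof -
  have "dotk m (shift d h z) w = (\<Sum>e\<in>Dirs m. cmp e z * cmp e w + (if e = d then h * cmp d w else 0))"
    unfolding dotk_cmp cmp_shift by (rule sum.cong) (auto simp: algebra_simps)
  also have "\<dots> = dotk m z w + h * cmp d w"
    using assms unfolding sum.distrib dotk_cmp by (simp add: Dirs_def mem_Times_iff sum.delta)
  finally show ?thesis .
qed

lemma dotk_shift_self:
  assumes "fst (snd d) < m"
  shows "dotk m (shift d h z) (shift d h z) = dotk m z z + 2 * h * cmp d z + h\<^sup>2"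
  unfolding dotk_shift[OF assms] dotk_commute[of m z "shift d h z"]
  by (simp add: cmp_shift dotk_shift[OF assms] power2_eq_square algebra_simps)

lemma measurable_cmp [measurable]:
  assumes "fst (snd d) < m"
  shows "cmp d \<in> borel_measurable (Mk m)"
proof -
  have [measurable]: "(\<lambda>z. crd (fst d) z (fst (snd d))) \<in> borel_measurable (Mk m)"
    unfolding crd_def using assms by (cases "fst d") auto
  have "(\<lambda>v::real^'a. v $ i) \<in> borel_measurable borel" for i
    by (intro borel_measurable_continuous_onI continuous_intros)
  then show ?thesis unfolding cmp_def[abs_def] by measurable
qed

lemma mvt_bound:
  fixes g :: "real \<Rightarrow> complex"
  assumes "\<And>t. \<bar>t\<bar> \<le> \<bar>h\<bar> \<Longrightarrow> (g has_vector_derivative g' t) (at t)" "\<And>t. \<bar>t\<bar> \<le> \<bar>h\<bar> \<Longrightarrow> cmod (g' t) \<le> B"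
  shows "cmod (g h - g 0) \<le> B * \<bar>h\<bar>"
proof -
  have "norm (g h - g 0) \<le> B * norm (h - 0)"
  proof (rule differentiable_bound[of "{- \<bar>h\<bar>..\<bar>h\<bar>}" g "\<lambda>t h. h *\<^sub>R g' t"])
    fix t assume t: "t \<in> {- \<bar>h\<bar>..\<bar>h\<bar>}"
    then have "\<bar>t\<bar> \<le> \<bar>h\<bar>" by auto
    then show "(g has_derivative (\<lambda>h. h *\<^sub>R g' t)) (at t within {- \<bar>h\<bar>..\<bar>h\<bar>})"
      using has_derivative_at_withinI[OF assms(1)[unfolded has_vector_derivative_def]] by blast
    have "B \<ge> 0" using assms(2)[of 0] norm_ge_zero[of "g' 0"] by linarith
    then show "onorm (\<lambda>h. h *\<^sub>R g' t) \<le> B"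
    proof (intro onorm_le)
      fix x :: real
      have "norm (x *\<^sub>R g' t) = cmod (g' t) * norm x" by simp
      also have "\<dots> \<le> B * norm x" by (intro mult_right_mono assms(2) \<open>\<bar>t\<bar> \<le> \<bar>h\<bar>\<close>) simp
      finally show "norm (x *\<^sub>R g' t) \<le> B * norm x" .
    qed
  qed auto
  then show ?thesis by simp
qed

text \<open>Interpolates between two points so that one real coordinate changes at a time.\<close>
definition mix :: "nat \<Rightarrow> (bool \<times> nat \<times> 'n::finite) set \<Rightarrow> 'n pts \<Rightarrow> 'n pts \<Rightarrow> 'n pts" where
  "mix m S z u = (\<lambda>j\<in>{..<m}. \<chi> i. if (False, j, i) \<in> S then fst u j $ i else fst z j $ i,
     \<lambda>j\<in>{..<m}. \<chi> i. if (True, j, i) \<in> S then snd u j $ i else snd z j $ i)"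

lemma mix_space: "mix m S z u \<in> space (Mk m)"
  by (simp add: mix_def space_Mk)

lemma mix_empty: "z \<in> space (Mk m) \<Longrightarrow> mix m {} z u = z"
  by (cases z) (auto simp: mix_def space_Mk extensional_def fun_eq_iff)

lemma mix_Dirs: "u \<in> space (Mk m) \<Longrightarrow> mix m (Dirs m) z u = u"
  by (cases u) (auto simp: mix_def Dirs_def space_Mk extensional_def fun_eq_iff vec_eq_iff)

lemma mix_insert:
  assumes "d \<notin> S" "fst (snd d) < m"
  shows "mix m (insert d S) z u = shift d (cmp d u - cmp d z) (mix m S z u)"
proof -
  obtain b j i where d: "d = (b, j, i)" by (cases d)
  show ?thesis
    using assms unfolding d
    by (cases b) (auto simp: mix_def shift_def cmp_def crd_def fun_eq_iff vec_eq_iff axis_def)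
qed

text \<open>A witness for the existential in \<open>schwartz\<close>: \<open>F ds\<close> is the
  iterated partial derivative along \<open>ds\<close>, with the head of the list taken last.\<close>

locale schwartz_fun =
  fixes m :: nat and F :: "(bool \<times> nat \<times> 'n::finite) list \<Rightarrow> 'n kernel"
  assumes deriv: "\<And>ds d z. z \<in> space (Mk m) \<Longrightarrow> fst (snd d) < m \<Longrightarrow>
        ((\<lambda>h. F ds (shift d h z)) has_vector_derivative F (d # ds) z) (at 0)"
    and decay: "\<And>ds N. \<exists>C. \<forall>z \<in> space (Mk m). (1 + dotk m z z) ^ N * cmod (F ds z) \<le> C"
begin

lemma deriv_t:
  assumes z: "z \<in> space (Mk m)" and d: "fst (snd d) < m"
  shows "((\<lambda>h. F ds (shift d h z)) has_vector_derivative F (d # ds) (shift d t z)) (at t)"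
proof -
  have "((\<lambda>h. F ds (shift d h (shift d t z))) has_vector_derivative F (d # ds) (shift d t z)) (at 0)"
    by (rule deriv[OF shift_space[OF d z] d])
  then have 1: "((\<lambda>h. F ds (shift d (h + t) z)) has_vector_derivative F (d # ds) (shift d t z)) (at (t + - t))"
    by (simp add: shift_shift)
  have "((\<lambda>x. x + - t) has_vector_derivative 1) (at t)"
    by (auto intro!: derivative_eq_intros)
  from vector_diff_chain_at[OF this 1]
  show ?thesis by (simp add: o_def)
qed

lemma bound: "\<exists>C\<ge>0. \<forall>z \<in> space (Mk m). (1 + dotk m z z) ^ N * cmod (F ds z) \<le> C"
proof -
  obtain C where C: "\<forall>z \<in> space (Mk m). (1 + dotk m z z) ^ N * cmod (F ds z) \<le> C" using decay by blast
  then show ?thesis by (intro exI[of _ "max C 0"]) (auto simp: max_def)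
qed

text \<open>Partial derivatives alone do not give continuity, but bounded ones do:
  \<open>mix\<close> changes one coordinate at a time, and the mean value inequality applies to each
  change.\<close>

lemma lipschitz:
  "\<exists>C\<ge>0. \<forall>z\<in>space (Mk m). \<forall>u\<in>space (Mk m). cmod (F ds u - F ds z) \<le> C * (\<Sum>d\<in>Dirs m. \<bar>cmp d u - cmp d z\<bar>)"
proof -
  have "\<exists>C\<ge>0. \<forall>z \<in> space (Mk m). cmod (F (d # ds) z) \<le> C" for d
    using bound[of 0 "d # ds"] by simp
  then obtain c where c: "\<And>d. c d \<ge> 0" "\<And>d z. z \<in> space (Mk m) \<Longrightarrow> cmod (F (d # ds) z) \<le> c d" by metis
  define C where "C = (\<Sum>d\<in>Dirs m. c d)"
  have cC: "c d \<le> C" if "d \<in> Dirs m" for d unfolding C_def using that c(1) by (intro member_le_sum) auto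
  have C0: "C \<ge> 0" unfolding C_def using c(1) by (intro sum_nonneg) auto
  have "cmod (F ds u - F ds z) \<le> C * (\<Sum>d\<in>Dirs m. \<bar>cmp d u - cmp d z\<bar>)" if z: "z \<in> space (Mk m)" and u: "u \<in> space (Mk m)" for z u
  proof -
    have "cmod (F ds (mix m S z u) - F ds z) \<le> C * (\<Sum>d\<in>S. \<bar>cmp d u - cmp d z\<bar>)" if "S \<subseteq> Dirs m" for S
    proof -
      have "finite S" using that finite_subset[OF _ finite_Dirs] by blast
      then show ?thesis using that
      proof (induction S)
        case empty
        then show ?case using mix_empty[OF z] by simp
      next
        case (insert d S)
        have d: "fst (snd d) < m" "d \<in> Dirs m" using insert.prems by (auto simp: Dirs_def mem_Times_iff)
        let ?h = "cmp d u - cmp d z" and ?y = "mix m S z u"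
        have "cmod (F ds (shift d ?h ?y) - F ds (shift d 0 ?y)) \<le> C * \<bar>?h\<bar>"
        proof (rule mvt_bound)
          fix t
          show "((\<lambda>h. F ds (shift d h ?y)) has_vector_derivative F (d # ds) (shift d t ?y)) (at t)"
            by (rule deriv_t[OF mix_space d(1)])
          show "cmod (F (d # ds) (shift d t ?y)) \<le> C"
            using c(2)[OF shift_space[OF d(1) mix_space]] cC[OF d(2)] by (rule order_trans)
        qed
        then have 1: "cmod (F ds (mix m (insert d S) z u) - F ds ?y) \<le> C * \<bar>?h\<bar>"
          using mix_insert[OF insert.hyps(2) d(1)] by simp
        have 2: "cmod (F ds ?y - F ds z) \<le> C * (\<Sum>d\<in>S. \<bar>cmp d u - cmp d z\<bar>)" using insert by auto
        have "cmod (F ds (mix m (insert d S) z u) - F ds z) \<le> cmod (F ds (mix m (insert d S) z u) - F ds ?y) + cmod (F ds ?y - F ds z)"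
          using norm_triangle_ineq[of "F ds (mix m (insert d S) z u) - F ds ?y" "F ds ?y - F ds z"] by simp
        then show ?case using 1 2 insert.hyps by (simp add: distrib_left)
      qed
    qed
    from this[of "Dirs m"] show ?thesis using mix_Dirs[OF u] by simp
  qed
  then show ?thesis using C0 by blast
qed

lemma F_cts: "cts m (F ds)"
  unfolding cts_def
proof (intro ballI allI impI)
  fix z :: "'n pts" and u assume z: "z \<in> space (Mk m)" and u: "conv_Mk m u z"
  obtain C where C: "\<And>z u. z \<in> space (Mk m) \<Longrightarrow> u \<in> space (Mk m) \<Longrightarrow> cmod (F ds u - F ds z) \<le> C * (\<Sum>d\<in>Dirs m. \<bar>cmp d u - cmp d z\<bar>)"
    using lipschitz by blast
  have "(\<lambda>i. cmp d (u i)) \<longlonglongrightarrow> cmp d z" if "d \<in> Dirs m" for d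
    using u that unfolding conv_Mk_def Dirs_def cmp_def crd_def
    by (cases "fst d") (auto intro!: tendsto_vec_nth)
  then have "(\<lambda>i. C * (\<Sum>d\<in>Dirs m. \<bar>cmp d (u i) - cmp d z\<bar>)) \<longlonglongrightarrow> C * (\<Sum>d\<in>Dirs m. \<bar>cmp d z - cmp d z\<bar>)"
    by (intro tendsto_intros)
  then have l: "(\<lambda>i. C * (\<Sum>d\<in>Dirs m. \<bar>cmp d (u i) - cmp d z\<bar>)) \<longlonglongrightarrow> 0" by simp
  show "(\<lambda>i. F ds (u i)) \<longlonglongrightarrow> F ds z"
  proof (rule LIM_zero_cancel, rule Lim_null_comparison[OF _ l])
    show "\<forall>\<^sub>F i in sequentially. norm (F ds (u i) - F ds z) \<le> C * (\<Sum>d\<in>Dirs m. \<bar>cmp d (u i) - cmp d z\<bar>)"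
      using u z by (intro always_eventually allI C) (auto simp: conv_Mk_def)
  qed
qed

lemma F_meas [measurable]: "F ds \<in> borel_measurable (Mk m)"
  by (rule cts_measurable[OF F_cts])

end

text \<open>An integrable majorant, obtained from \<open>integrable_wS_neg\<close> at the exponent
  \<open>CARD('n)\<close>. \<open>NW\<close> is a power of \<open>1 + dotk\<close> at which
  polynomial decay reaches it.\<close>

definition wt :: "nat \<Rightarrow> 'n::finite pts \<Rightarrow> real" where
  "wt m z = wS (- 2 * real CARD('n)) m z"

definition NW :: "'n::finite itself \<Rightarrow> nat \<Rightarrow> nat" where
  "NW _ m = m * (2 * CARD('n))"

lemma wt_integrable: "integrable (Mk m) (wt m :: 'n::finite pts \<Rightarrow> real)"
  unfolding wt_def[abs_def] by (rule integrable_wS_neg) simp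

lemma wt_pos: "wt m z > 0" by (simp add: wt_def wS_pos)

lemma one_le_dot_wt:
  fixes z :: "'n::finite pts"
  shows "1 \<le> (1 + dotk m z z) ^ NW TYPE('n) m * wt m z"
proof -
  have p: "1 + dotk m z z > 0" using dotk_self_nonneg[of m z] by linarith
  have "wS (2 * real CARD('n)) m z \<le> (1 + dotk m z z) powr (real m * (2 * real CARD('n)))" by (rule wS_le) simp
  also have "\<dots> = (1 + dotk m z z) ^ NW TYPE('n) m"
    unfolding NW_def powr_realpow[OF p, symmetric] by simp
  finally have le: "wS (2 * real CARD('n)) m z \<le> (1 + dotk m z z) ^ NW TYPE('n) m" .
  have "wt m z = inverse (wS (2 * real CARD('n)) m z)"
    unfolding wt_def using wS_powr[of "-1" "2 * real CARD('n)" m z] wS_pos[of "2 * real CARD('n)" m z] by (simp add: powr_minus)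
  then have "wt m z * wS (2 * real CARD('n)) m z = 1" by simp
  moreover have "wt m z * wS (2 * real CARD('n)) m z \<le> wt m z * (1 + dotk m z z) ^ NW TYPE('n) m"
    by (rule mult_left_mono[OF le]) (simp add: wt_def wS_pos less_imp_le)
  ultimately show ?thesis by (simp add: mult.commute)
qed

lemma decay_wt:
  fixes z :: "'n::finite pts"
  assumes "(1 + dotk m z z) ^ NW TYPE('n) m * x \<le> C" "x \<ge> 0"
  shows "x \<le> C * wt m z"
proof -
  have "x * 1 \<le> x * ((1 + dotk m z z) ^ NW TYPE('n) m * wt m z)" by (intro mult_left_mono one_le_dot_wt assms)
  also have "\<dots> = ((1 + dotk m z z) ^ NW TYPE('n) m * x) * wt m z" by (simp only: ac_simps)
  also have "\<dots> \<le> C * wt m z" by (intro mult_right_mono assms) (simp add: wt_pos less_imp_le)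
  finally show ?thesis by simp
qed

lemma wt_le1: "wt m z \<le> 1"
proof -
  have "wt m (z :: 'a cfg \<times> 'a cfg) = inverse (wS (2 * real CARD('a)) m z)"
    unfolding wt_def using wS_powr[of "-1" "2 * real CARD('a)" m z] wS_pos[of "2 * real CARD('a)" m z] by (simp add: powr_minus)
  then show ?thesis using wS_ge1[of "2 * real CARD('a)" m z] by (simp add: inverse_le_1_iff)
qed

text \<open>Since \<open>wt\<close> is at most 1, the square of a function below
  \<open>C * wt m z\<close> lies below a multiple of \<open>wt\<close> again, so one integrable
  weight serves both conditions.\<close>

lemma L12_wt:
  fixes f :: "'n::finite kernel"
  assumes [measurable]: "f \<in> borel_measurable (Mk m)" and le: "\<And>z. z \<in> space (Mk m) \<Longrightarrow> cmod (f z) \<le> C * wt m z"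
  shows "L12 m f"
proof -
  have m: "(wt m :: 'n pts \<Rightarrow> real) \<in> borel_measurable (Mk m)" using wt_integrable by (rule borel_measurable_integrable)
  have "integrable (Mk m) (\<lambda>z::'n pts. C * wt m z)" by (intro integrable_mult_right wt_integrable)
  then have i: "integrable (Mk m) f"
    by (rule Bochner_Integration.integrable_bound) (use le in \<open>auto intro!: AE_I2 order_trans[OF le]\<close>)
  have "integrable (Mk m) (\<lambda>z::'n pts. C\<^sup>2 * wt m z)" by (intro integrable_mult_right wt_integrable)
  then have "integrable (Mk m) (\<lambda>z. (cmod (f z))\<^sup>2)"
  proof (rule Bochner_Integration.integrable_bound)
    show "AE z in Mk m. norm ((cmod (f z))\<^sup>2) \<le> norm (C\<^sup>2 * wt m z)"
    proof (rule AE_I2)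
      fix z :: "'n pts" assume z: "z \<in> space (Mk m)"
      have "(cmod (f z))\<^sup>2 \<le> (C * wt m z)\<^sup>2" by (intro power_mono le z) simp
      also have "\<dots> \<le> C\<^sup>2 * wt m z"
        unfolding power_mult_distrib using wt_le1[of m z] wt_pos[of m z]
        by (intro mult_left_mono) (auto simp: power2_eq_square mult_left_le)
      finally show "norm ((cmod (f z))\<^sup>2) \<le> norm (C\<^sup>2 * wt m z)" using wt_pos[of m z] by (simp add: less_imp_le)
    qed
  qed measurable
  then show ?thesis using i by (auto simp: L12_def sqi_def)
qed

lemma integral_shift:
  fixes f :: "'n::finite kernel"
  assumes d: "fst (snd d) < m" and f: "f \<in> borel_measurable (Mk m)"
  shows "(LINT z|Mk m. f (shift d h z)) = (LINT z|Mk m. f z)"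
proof -
  obtain b j i where e: "d = (b, j, i)" by (cases d)
  have j: "j < m" using d by (simp add: e)
  have m: "shiftv b j (h *\<^sub>R axis i 1) \<in> measurable (Mk m) (Mk m)"
    using measurable_shiftv[OF j, of "\<lambda>z. z" "Mk m" "\<lambda>_. h *\<^sub>R axis i 1" b] by simp
  have "(LINT z|Mk m. f z) = integral\<^sup>L (distr (Mk m) (Mk m) (shiftv b j (h *\<^sub>R axis i 1))) f"
    unfolding distr_shiftv[OF j] ..
  also have "\<dots> = (LINT z|Mk m. f (shiftv b j (h *\<^sub>R axis i 1) z))" by (rule integral_distr[OF m f])
  finally show ?thesis by (simp add: e shift_shiftv)
qed

lemma measurable_shift:
  assumes d: "fst (snd d) < m" shows "shift d h \<in> measurable (Mk m) (Mk m)"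
proof -
  obtain b j i where e: "d = (b, j, i)" by (cases d)
  have j: "j < m" using d by (simp add: e)
  show ?thesis using measurable_shiftv[OF j, of "\<lambda>z. z" "Mk m" "\<lambda>_. h *\<^sub>R axis i 1" b] by (simp add: e shift_shiftv[abs_def])
qed

text \<open>Dominated convergence works along sequences, so the derivative is taken along
  \<open>1 / (n + 1)\<close>.\<close>

lemma vd_seq:
  fixes f :: "real \<Rightarrow> complex"
  assumes "(f has_vector_derivative v) (at 0)"
  shows "(\<lambda>n. complex_of_real (real (Suc n)) * (f (1 / real (Suc n)) - f 0)) \<longlonglongrightarrow> v"
proof -
  have l: "((\<lambda>h. norm (f (0 + h) - f 0 - h *\<^sub>R v) / norm h) \<longlongrightarrow> 0) (at 0)"
    using assms unfolding has_vector_derivative_def has_derivative_at by blast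
  have "(\<lambda>n. 1 / real (Suc n)) \<longlonglongrightarrow> 0" by (intro LIMSEQ_Suc[OF lim_1_over_n])
  then have X: "filterlim (\<lambda>n. 1 / real (Suc n)) (at 0) sequentially"
    by (simp add: filterlim_at del: of_nat_Suc)
  have "(\<lambda>n. norm (f (0 + 1 / real (Suc n)) - f 0 - (1 / real (Suc n)) *\<^sub>R v) / norm (1 / real (Suc n))) \<longlonglongrightarrow> 0"
    by (rule filterlim_compose[OF l X])
  moreover have "norm (f (0 + 1 / real (Suc n)) - f 0 - (1 / real (Suc n)) *\<^sub>R v) / norm (1 / real (Suc n))
    = norm (complex_of_real (real (Suc n)) * (f (1 / real (Suc n)) - f 0) - v)" for n
  proof -
    have "complex_of_real (real (Suc n)) * (f (1 / real (Suc n)) - f 0) - v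
      = complex_of_real (real (Suc n)) * (f (0 + 1 / real (Suc n)) - f 0 - (1 / real (Suc n)) *\<^sub>R v)"
      by (simp add: scaleR_conv_of_real algebra_simps del: of_nat_Suc)
    then show ?thesis by (simp add: norm_mult del: of_nat_Suc)
  qed
  ultimately have "(\<lambda>n. norm (complex_of_real (real (Suc n)) * (f (1 / real (Suc n)) - f 0) - v)) \<longlonglongrightarrow> 0"
    by (simp only:)
  then show ?thesis by (rule LIM_zero_cancel[OF tendsto_norm_zero_cancel])
qed

lemma cis_has_vector_derivative: "((\<lambda>t. cis (t * x)) has_vector_derivative \<i> * of_real x) (at 0)"
proof -
  have "DERIV (\<lambda>z. exp (\<i> * of_real x * z)) (of_real 0) :> \<i> * of_real x"
    by (rule derivative_eq_intros refl | simp)+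
  from has_vector_derivative_real_field[OF this]
  have "((\<lambda>t. exp (\<i> * of_real x * of_real t)) has_vector_derivative \<i> * of_real x) (at 0)" .
  moreover have "exp (\<i> * of_real x * of_real t) = cis (t * x)" for t
    unfolding cis_conv_exp by (simp only: of_real_mult ac_simps)
  ultimately show ?thesis by (simp only:)
qed

text \<open>Moving by at most 1 changes \<open>1 + dotk\<close> by a bounded factor, so the decay is
  uniform over all points met by a difference quotient.\<close>

lemma dotk_shift_ge:
  assumes "fst (snd d) < m" "\<bar>t\<bar> \<le> 1"
  shows "1 + dotk m z z \<le> 3 * (1 + dotk m (shift d t z) (shift d t z))"
proof -
  define y where "y = shift d t z"
  have z: "z = shift d (- t) y" by (simp add: y_def shift_shift)
  have "dotk m z z = dotk m y y + 2 * (- t) * cmp d y + t\<^sup>2"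
    unfolding z dotk_shift_self[OF assms(1)] by simp
  also have "2 * (- t) * cmp d y \<le> t\<^sup>2 + (cmp d y)\<^sup>2"
    using zero_le_power2[of "t + cmp d y"] by (simp add: power2_sum)
  also have "(cmp d y)\<^sup>2 \<le> dotk m y y" by (rule cmp_sq_le[OF assms(1)])
  finally have "dotk m z z \<le> dotk m y y + (t\<^sup>2 + dotk m y y) + t\<^sup>2" by simp
  moreover have "t\<^sup>2 \<le> 1" using assms(2) by (simp add: abs_square_le_1)
  moreover have "dotk m y y \<ge> 0" by simp
  ultimately have "1 + dotk m z z \<le> 3 + 3 * dotk m y y" by linarith
  then show ?thesis by (simp add: y_def)
qed

context schwartz_fun
begin

lemma F_wt: "\<exists>C\<ge>0. \<forall>z\<in>space (Mk m). \<forall>d t. fst (snd d) < m \<longrightarrow> \<bar>t\<bar> \<le> 1 \<longrightarrow> cmod (F ds (shift d t z)) \<le> C * wt m z"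
proof -
  let ?N = "NW TYPE('n) m"
  obtain C where C: "C \<ge> 0" "\<And>z. z \<in> space (Mk m) \<Longrightarrow> (1 + dotk m z z) ^ ?N * cmod (F ds z) \<le> C" using bound by blast
  have "cmod (F ds (shift d t z)) \<le> (3 ^ ?N * C) * wt m z" if z: "z \<in> space (Mk m)" and d: "fst (snd d) < m" and t: "\<bar>t\<bar> \<le> 1" for z d t
  proof (rule decay_wt)
    let ?y = "shift d t z"
    have "(1 + dotk m z z) ^ ?N * cmod (F ds ?y) \<le> (3 * (1 + dotk m ?y ?y)) ^ ?N * cmod (F ds ?y)"
      by (intro mult_right_mono power_mono dotk_shift_ge d t) (auto simp: add_nonneg_nonneg)
    also have "\<dots> = 3 ^ ?N * ((1 + dotk m ?y ?y) ^ ?N * cmod (F ds ?y))" by (simp only: power_mult_distrib mult.assoc)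
    also have "\<dots> \<le> 3 ^ ?N * C" by (intro mult_left_mono C shift_space d z) auto
    finally show "(1 + dotk m z z) ^ ?N * cmod (F ds ?y) \<le> 3 ^ ?N * C" .
  qed auto
  then show ?thesis using C(1) by (intro exI[of _ "3 ^ ?N * C"]) auto
qed

lemma F_L12: "L12 m (F ds)"
proof -
  let ?N = "NW TYPE('n) m"
  obtain C where C: "C \<ge> 0" "\<And>z. z \<in> space (Mk m) \<Longrightarrow> (1 + dotk m z z) ^ ?N * cmod (F ds z) \<le> C" using bound by blast
  show ?thesis by (rule L12_wt[OF F_meas decay_wt[OF C(2)]]) auto
qed

text \<open>Replaces integration by parts: translation invariance turns the transform of a
  difference quotient into a multiple of \<open>FT m (F ds)\<close>. One side converges by dominated
  convergence, the other by the derivative of \<open>cis\<close>.\<close>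

lemma FT_deriv:
  assumes w: "w \<in> space (Mk m)" and d: "fst (snd d) < m"
  shows "FT m (F (d # ds)) w = \<i> * of_real (cmp d w) * FT m (F ds) w"
proof -
  define h where "h = (\<lambda>n. 1 / real (Suc n))"
  define r where "r = (\<lambda>n. complex_of_real (real (Suc n)))"
  have h: "\<bar>h n\<bar> \<le> 1" "h n \<ge> 0" "real (Suc n) * h n = 1" for n by (auto simp: h_def)
  have [measurable]: "(\<lambda>z. cis (- dotk m z w)) \<in> borel_measurable (Mk m)" using w by measurable
  have sm [measurable]: "(\<lambda>z. F ds (shift d t z)) \<in> borel_measurable (Mk m)" for t
    by (rule measurable_compose[OF measurable_shift[OF d] F_meas])
  obtain C where C: "C \<ge> 0" "\<And>z t. z \<in> space (Mk m) \<Longrightarrow> \<bar>t\<bar> \<le> 1 \<Longrightarrow> cmod (F (d # ds) (shift d t z)) \<le> C * wt m z"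
    using F_wt[of "d # ds"] d by blast
  obtain C' where C': "\<And>z t. z \<in> space (Mk m) \<Longrightarrow> \<bar>t\<bar> \<le> 1 \<Longrightarrow> cmod (F ds (shift d t z)) \<le> C' * wt m z"
    using F_wt[of ds] d by blast
  \<comment> \<open>The transform of the difference quotient of step \<open>1 / (n + 1)\<close>,
    evaluated once through the limit of the integrand (\<open>lim1\<close>) and once by translation
    (\<open>A_eq\<close>).\<close>
  define A where "A = (\<lambda>n. LINT z|Mk m. cis (- dotk m z w) * (r n * (F ds (shift d (h n) z) - F ds z)))"
  have lim1: "A \<longlonglongrightarrow> FT m (F (d # ds)) w"
    unfolding A_def FT_def
  proof (rule integral_dominated_convergence[where w = "\<lambda>z. C * wt m z"])
    show "integrable (Mk m) (\<lambda>z::'n pts. C * wt m z)" by (intro integrable_mult_right wt_integrable)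
    show "AE z in Mk m. (\<lambda>n. cis (- dotk m z w) * (r n * (F ds (shift d (h n) z) - F ds z))) \<longlonglongrightarrow> cis (- dotk m z w) * F (d # ds) z"
    proof (intro AE_I2 tendsto_mult tendsto_const)
      fix z :: "'n pts" assume z: "z \<in> space (Mk m)"
      show "(\<lambda>n. r n * (F ds (shift d (h n) z) - F ds z)) \<longlonglongrightarrow> F (d # ds) z"
        using vd_seq[OF deriv[OF z d]] unfolding r_def h_def by simp
    qed
    fix n
    show "AE z in Mk m. norm (cis (- dotk m z w) * (r n * (F ds (shift d (h n) z) - F ds z))) \<le> C * wt m z"
    proof (rule AE_I2)
      fix z :: "'n pts" assume z: "z \<in> space (Mk m)"
      have "cmod (F ds (shift d (h n) z) - F ds (shift d 0 z)) \<le> (C * wt m z) * \<bar>h n\<bar>"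
        by (rule mvt_bound[OF deriv_t[OF z d] C(2)[OF z]]) (use h(1)[of n] in linarith)
      then have "real (Suc n) * cmod (F ds (shift d (h n) z) - F ds z) \<le> real (Suc n) * (C * wt m z * h n)"
        using h(2)[of n] by (intro mult_left_mono) auto
      also have "\<dots> = C * wt m z" using h(3)[of n] by (simp only: ac_simps) (metis mult.commute mult.left_commute mult_1)
      finally show "norm (cis (- dotk m z w) * (r n * (F ds (shift d (h n) z) - F ds z))) \<le> C * wt m z"
        by (simp add: norm_mult r_def del: of_nat_Suc)
    qed
  qed measurable
  have A_eq: "A n = r n * (cis (h n * cmp d w) - cis (0 * cmp d w)) * FT m (F ds) w" for n
  proof -
    define G where "G = (\<lambda>z. cis (- dotk m (shift d (- h n) z) w) * F ds z)"
    have Gm: "G \<in> borel_measurable (Mk m)" unfolding G_def dotk_shift[OF d]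
      using w by measurable
    have i1: "integrable (Mk m) (\<lambda>z. cis (- dotk m z w) * F ds z)" by (rule integrable_cis_dotk(1)[OF L12D(1)[OF F_L12] w])
    have "L12 m (\<lambda>z. F ds (shift d (h n) z))" by (rule L12_wt[OF sm C'[OF _ h(1)]])
    then have i2: "integrable (Mk m) (\<lambda>z. cis (- dotk m z w) * F ds (shift d (h n) z))"
      by (intro integrable_cis_dotk(1)[OF L12D(1) w])
    have "(LINT z|Mk m. cis (- dotk m z w) * F ds (shift d (h n) z)) = (LINT z|Mk m. G (shift d (h n) z))"
      by (simp add: G_def shift_shift)
    also have "\<dots> = (LINT z|Mk m. G z)" by (rule integral_shift[OF d Gm])
    also have "\<dots> = (LINT z|Mk m. cis (h n * cmp d w) * (cis (- dotk m z w) * F ds z))"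
      unfolding G_def dotk_shift[OF d] by (simp add: mult.assoc[symmetric] cis_mult)
    also have "\<dots> = cis (h n * cmp d w) * FT m (F ds) w" unfolding FT_def by (rule integral_mult_right_zero)
    finally have e: "(LINT z|Mk m. cis (- dotk m z w) * F ds (shift d (h n) z)) = cis (h n * cmp d w) * FT m (F ds) w" .
    have "A n = (LINT z|Mk m. r n * (cis (- dotk m z w) * F ds (shift d (h n) z) - cis (- dotk m z w) * F ds z))"
      unfolding A_def by (simp only: right_diff_distrib ac_simps)
    also have "\<dots> = r n * (cis (h n * cmp d w) * FT m (F ds) w - FT m (F ds) w)"
      unfolding integral_mult_right_zero Bochner_Integration.integral_diff[OF i2 i1] e FT_def ..
    finally show ?thesis by (simp add: algebra_simps)
  qed
  have "(\<lambda>n. r n * (cis (h n * cmp d w) - cis (0 * cmp d w)) * FT m (F ds) w) \<longlonglongrightarrow> \<i> * of_real (cmp d w) * FT m (F ds) w"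
    unfolding r_def h_def by (rule tendsto_mult[OF vd_seq[OF cis_has_vector_derivative[of "cmp d w"]] tendsto_const])
  then show ?thesis using LIMSEQ_unique[OF lim1] unfolding A_eq[abs_def] by simp
qed

text \<open>The quantifier over all \<open>ds\<close> makes the class stable under multiplication by
  a coordinate, which \<open>FT_deriv\<close> trades for one more derivative.\<close>

definition Q :: "('n pts \<Rightarrow> real) \<Rightarrow> bool" where
  "Q P \<longleftrightarrow> (\<forall>ds. sqi (Mk m) (\<lambda>w. of_real (P w) * FT m (F ds) w))"

lemma Q_one: "Q (\<lambda>_. 1)"
  unfolding Q_def using plancherel_L12(1)[OF F_L12] by simp

lemma Q_add: "Q P \<Longrightarrow> Q R \<Longrightarrow> Q (\<lambda>w. P w + R w)"
  unfolding Q_def of_real_add distrib_right by (auto intro: sqi_add)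

lemma Q_cmp:
  assumes Q: "Q P" and d: "fst (snd d) < m"
  shows "Q (\<lambda>w. cmp d w * P w)"
  unfolding Q_def
proof
  fix ds
  have s: "sqi (Mk m) (\<lambda>w. - \<i> * (of_real (P w) * FT m (F (d # ds)) w))" using Q unfolding Q_def by (intro sqi_scale) blast
  have s0: "sqi (Mk m) (\<lambda>w. of_real (P w) * FT m (F ds) w)" using Q unfolding Q_def by blast
  note [measurable] = sqi_meas[OF s0] measurable_cmp[OF d]
  have "(\<lambda>w. of_real (cmp d w) * (of_real (P w) * FT m (F ds) w)) \<in> borel_measurable (Mk m)" by measurable
  then have m: "(\<lambda>w. of_real (cmp d w * P w) * FT m (F ds) w) \<in> borel_measurable (Mk m)" by (simp add: mult.assoc)
  have i2: "- \<i> * (a * (\<i> * c * f)) = c * a * f" for a c f :: complex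
  proof -
    have "\<i> * \<i> = (-1::complex)" by simp
    then show ?thesis by algebra
  qed
  show "sqi (Mk m) (\<lambda>w. of_real (cmp d w * P w) * FT m (F ds) w)"
    by (rule sqi_cong_AE[OF s m]) (intro AE_I2, simp only: FT_deriv[OF _ d] i2 of_real_mult)
qed

lemma Q_sum: "finite S \<Longrightarrow> (\<And>d. d \<in> S \<Longrightarrow> Q (P d)) \<Longrightarrow> Q R \<Longrightarrow> Q (\<lambda>w. R w + (\<Sum>d\<in>S. P d w))"
proof (induction S rule: finite_induct)
  case (insert d S)
  have "Q (\<lambda>w. P d w + (R w + (\<Sum>d\<in>S. P d w)))" by (rule Q_add) (use insert in auto)
  then show ?case using insert.hyps by (simp add: algebra_simps)
qed simp

lemma Q_pow: "Q (\<lambda>w. (1 + dotk m w w) ^ N)"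
proof (induction N)
  case 0
  then show ?case using Q_one by simp
next
  case (Suc N)
  have "Q (\<lambda>w. (1 + dotk m w w) ^ N + (\<Sum>d\<in>Dirs m. cmp d w * (cmp d w * (1 + dotk m w w) ^ N)))"
    by (intro Q_sum Q_cmp Suc) (auto simp: Dirs_def)
  moreover have "(1 + dotk m w w) ^ N + (\<Sum>d\<in>Dirs m. cmp d w * (cmp d w * (1 + dotk m w w) ^ N)) = (1 + dotk m w w) ^ Suc N" for w :: "'n pts"
  proof -
    have "dotk m w w * X = (\<Sum>d\<in>Dirs m. cmp d w * (cmp d w * X))" for X
      unfolding dotk_cmp sum_distrib_right mult.assoc ..
    from this[of "(1 + dotk m w w) ^ N"] show ?thesis by (simp add: distrib_right)
  qed
  ultimately show ?case by (simp only:)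
qed

lemma F_inH:
  assumes "\<alpha> \<ge> 0"
  shows "inH \<alpha> m (F ds)"
proof -
  obtain N :: nat where N: "real m * \<alpha> \<le> real N" using real_arch_simple by blast
  have s: "sqi (Mk m) (\<lambda>w. of_real ((1 + dotk m w w) ^ N) * FT m (F ds) w)" using Q_pow[of N] unfolding Q_def by blast
  have le: "wS \<alpha> m w \<le> (1 + dotk m w w) ^ N" for w :: "'n pts"
  proof -
    have p: "1 + dotk m w w \<ge> 1" using dotk_self_nonneg[of m w] by linarith
    have "wS \<alpha> m w \<le> (1 + dotk m w w) powr (real m * \<alpha>)" by (rule wS_le[OF assms])
    also have "\<dots> \<le> (1 + dotk m w w) powr (real N)" by (rule powr_mono[OF N p])
    also have "\<dots> = (1 + dotk m w w) ^ N" using p by (intro powr_realpow) linarith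
    finally show ?thesis .
  qed
  have "sqi (Mk m) (\<lambda>w. of_real (wS \<alpha> m w) * FT m (F ds) w)"
  proof (rule sqi_bound[OF s, where c = 1])
    show "(\<lambda>w. of_real (wS \<alpha> m w) * FT m (F ds) w) \<in> borel_measurable (Mk m)"
      using measurable_FT[OF F_meas] by measurable
    show "AE z in Mk m. cmod (of_real (wS \<alpha> m z) * FT m (F ds) z) \<le> 1 * cmod (of_real ((1 + dotk m z z) ^ N) * FT m (F ds) z)"
    proof (rule AE_I2)
      fix z :: "'n pts"
      show "cmod (of_real (wS \<alpha> m z) * FT m (F ds) z) \<le> 1 * cmod (of_real ((1 + dotk m z z) ^ N) * FT m (F ds) z)"
        unfolding norm_mult norm_of_real mult_1
        using le[of z] wS_pos[of \<alpha> m z] by (intro mult_right_mono) auto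
    qed
  qed
  then show ?thesis unfolding inH_iff using is_FT_FT[OF F_L12] L12D(2)[OF F_L12] by blast
qed

end

lemma dotk_norms: "(\<Sum>j<m. (norm (fst z j))\<^sup>2 + (norm (snd z j))\<^sup>2) = dotk m z z"
  by (simp add: dotk_def power2_norm_eq_inner)

lemma schwartz_iff: "schwartz m f \<longleftrightarrow> (\<exists>F. F [] = f \<and> schwartz_fun m F)"
  unfolding schwartz_def schwartz_fun_def dotk_norms by auto

lemma schwartz_inH: "schwartz m f \<Longrightarrow> \<alpha> \<ge> 0 \<Longrightarrow> inH \<alpha> m f"
  unfolding schwartz_iff using schwartz_fun.F_inH by blast

lemma schwartz_cts: "schwartz m f \<Longrightarrow> cts m f"
  unfolding schwartz_iff using schwartz_fun.F_cts by blast

section \<open>Density of Schwartz functions\<close>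

text \<open>Bounded functions with bounded support, on the transform side; all their moments are
  finite, so \<open>FTm\<close> of them can be differentiated repeatedly.\<close>

definition PsiC :: "nat \<Rightarrow> 'n::finite kernel \<Rightarrow> bool" where
  "PsiC m \<psi> \<longleftrightarrow> \<psi> \<in> borel_measurable (Mk m) \<and> (\<exists>B\<ge>0. \<forall>w\<in>space (Mk m). cmod (\<psi> w) \<le> B) \<and>
     (\<exists>R\<ge>0. \<forall>w\<in>space (Mk m). dotk m w w > R \<longrightarrow> \<psi> w = 0)"

lemma PsiC_decay:
  fixes \<psi> :: "'n::finite kernel"
  assumes "PsiC m \<psi>"
  shows "\<exists>C\<ge>0. \<forall>w\<in>space (Mk m). (1 + dotk m w w) ^ N * cmod (\<psi> w) \<le> C"
proof -
  obtain B R where B: "B \<ge> 0" "\<And>w. w \<in> space (Mk m) \<Longrightarrow> cmod (\<psi> w) \<le> B"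
    and R: "R \<ge> 0" "\<And>w. w \<in> space (Mk m) \<Longrightarrow> dotk m w w > R \<Longrightarrow> \<psi> w = 0"
    using assms unfolding PsiC_def by blast
  have "(1 + dotk m w w) ^ N * cmod (\<psi> w) \<le> (1 + R) ^ N * B" if w: "w \<in> space (Mk m)" for w
  proof (cases "dotk m w w > R")
    case True
    then show ?thesis using R(2)[OF w] B(1) R(1) by simp
  next
    case False
    then show ?thesis using B w R(1) by (intro mult_mono power_mono) auto
  qed
  then show ?thesis using B(1) R(1) by (intro exI[of _ "(1 + R) ^ N * B"]) auto
qed

lemma PsiC_L12:
  fixes \<psi> :: "'n::finite kernel"
  assumes "PsiC m \<psi>"
  shows "L12 m \<psi>"
proof -
  obtain C where C: "\<And>w. w \<in> space (Mk m) \<Longrightarrow> (1 + dotk m w w) ^ NW TYPE('n) m * cmod (\<psi> w) \<le> C"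
    using PsiC_decay[OF assms] by blast
  show ?thesis using assms by (intro L12_wt[OF _ decay_wt[OF C]]) (auto simp: PsiC_def)
qed

lemma PsiC_cmp:
  fixes \<psi> :: "'n::finite kernel"
  assumes P: "PsiC m \<psi>" and d: "fst (snd d) < m"
  shows "PsiC m (\<lambda>w. \<i> * of_real (cmp d w) * \<psi> w)"
  unfolding PsiC_def
proof (intro conjI)
  have [measurable]: "\<psi> \<in> borel_measurable (Mk m)" using P by (simp add: PsiC_def)
  note [measurable] = measurable_cmp[OF d]
  show "(\<lambda>w. \<i> * of_real (cmp d w) * \<psi> w) \<in> borel_measurable (Mk m)" by measurable
  obtain C where C: "C \<ge> 0" "\<And>w. w \<in> space (Mk m) \<Longrightarrow> (1 + dotk m w w) ^ 1 * cmod (\<psi> w) \<le> C"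
    using PsiC_decay[OF P] by blast
  have "cmod (\<i> * of_real (cmp d w) * \<psi> w) \<le> C" if w: "w \<in> space (Mk m)" for w
  proof -
    have "cmod (\<i> * of_real (cmp d w) * \<psi> w) = \<bar>cmp d w\<bar> * cmod (\<psi> w)" by (simp add: norm_mult)
    also have "\<dots> \<le> (1 + dotk m w w) * cmod (\<psi> w)" by (intro mult_right_mono cmp_abs_le d) auto
    finally show ?thesis using C(2)[OF w] by simp
  qed
  then show "\<exists>B\<ge>0. \<forall>w\<in>space (Mk m). cmod (\<i> * of_real (cmp d w) * \<psi> w) \<le> B" using C(1) by blast
  show "\<exists>R\<ge>0. \<forall>w\<in>space (Mk m). dotk m w w > R \<longrightarrow> \<i> * of_real (cmp d w) * \<psi> w = 0"
    using P unfolding PsiC_def by auto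
qed

lemma vd_quadratic:
  fixes f :: "real \<Rightarrow> complex"
  assumes K: "\<And>h. cmod (f h - f 0 - of_real h * v) \<le> K * h\<^sup>2"
  shows "(f has_vector_derivative v) (at 0)"
  unfolding has_vector_derivative_def has_derivative_at
proof
  show "bounded_linear (\<lambda>h. h *\<^sub>R v)" by (rule bounded_linear_scaleR_left)
  have l: "((\<lambda>h. K * \<bar>h\<bar>) \<longlongrightarrow> 0) (at 0)" by (auto intro!: tendsto_eq_intros)
  show "((\<lambda>h. norm (f (0 + h) - f 0 - h *\<^sub>R v) / norm h) \<longlongrightarrow> 0) (at 0)"
  proof (rule Lim_null_comparison[OF _ l])
    have "norm (norm (f (0 + h) - f 0 - h *\<^sub>R v) / norm h) \<le> K * \<bar>h\<bar>" if "h \<noteq> 0" for h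
      using K[of h] that by (simp add: scaleR_conv_of_real divide_le_eq power2_eq_square abs_mult mult.assoc)
    then show "\<forall>\<^sub>F h in at 0. norm (norm (f (0 + h) - f 0 - h *\<^sub>R v) / norm h) \<le> K * \<bar>h\<bar>"
      by (auto simp: eventually_at_filter)
  qed
qed

text \<open>The Taylor remainder of the phase is quadratic in \<open>h * cmp d w\<close>, and \<psi>
  has a finite second moment.\<close>

lemma FTm_shift_deriv:
  fixes \<psi> :: "'n::finite kernel"
  assumes P: "PsiC m \<psi>" and d: "fst (snd d) < m" and z: "z \<in> space (Mk m)"
  shows "((\<lambda>h. FTm m \<psi> (shift d h z)) has_vector_derivative FTm m (\<lambda>w. \<i> * of_real (cmp d w) * \<psi> w) z) (at 0)"
proof (rule vd_quadratic)
  fix h :: real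
  note P1 = PsiC_cmp[OF P d] and P2 = PsiC_cmp[OF PsiC_cmp[OF P d] d]
  have i: "integrable (Mk m) (\<lambda>w. cis (dotk m y w) * X w)" if "PsiC m X" "y \<in> space (Mk m)" for y and X :: "'n kernel"
    by (rule integrable_cis_dotk(2)[OF L12D(1)[OF PsiC_L12[OF that(1)]] that(2)])
  let ?E = "\<lambda>w. cis (dotk m (shift d h z) w) * \<psi> w - cis (dotk m (shift d 0 z) w) * \<psi> w - of_real h * (cis (dotk m z w) * (\<i> * of_real (cmp d w) * \<psi> w))"
  have e: "FTm m \<psi> (shift d h z) - FTm m \<psi> (shift d 0 z) - of_real h * FTm m (\<lambda>w. \<i> * of_real (cmp d w) * \<psi> w) z = (LINT w|Mk m. ?E w)"
    unfolding FTm_def integral_mult_right_zero[symmetric]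
    by (subst Bochner_Integration.integral_diff[symmetric]; (intro Bochner_Integration.integrable_diff integrable_mult_right i P P1 z shift_space d)?)+ simp
  have "cmod (LINT w|Mk m. ?E w) \<le> (LINT w|Mk m. h\<^sup>2 * cmod (\<i> * of_real (cmp d w) * (\<i> * of_real (cmp d w) * \<psi> w)))"
  proof (rule order_trans[OF integral_norm_bound], rule integral_mono)
    show "integrable (Mk m) (\<lambda>w. cmod (?E w))"
      by (intro integrable_norm Bochner_Integration.integrable_diff integrable_mult_right i P P1 z shift_space d)
    show "integrable (Mk m) (\<lambda>w. h\<^sup>2 * cmod (\<i> * of_real (cmp d w) * (\<i> * of_real (cmp d w) * \<psi> w)))"
      by (intro integrable_mult_right integrable_norm L12D(1)[OF PsiC_L12[OF P2]])
    fix w :: "'n pts"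
    define x where "x = h * cmp d w"
    have "?E w = cis (dotk m z w) * \<psi> w * (cis x - 1 - \<i> * of_real x)"
      unfolding dotk_shift[OF d] x_def by (simp add: cis_mult[symmetric] algebra_simps)
    then have "cmod (?E w) = cmod (\<psi> w) * cmod (cis x - 1 - \<i> * of_real x)" by (simp add: norm_mult)
    also have "cmod (cis x - 1 - \<i> * of_real x) \<le> x\<^sup>2"
    proof -
      have "cmod (iexp x - (\<Sum>k\<le>1. (\<i> * of_real x)^k / fact k)) \<le> \<bar>x\<bar> ^ Suc 1 / fact (Suc 1)" by (rule iexp_approx1)
      then have "cmod (cis x - 1 - \<i> * of_real x) \<le> x\<^sup>2 / 2"
        by (simp add: cis_conv_exp power2_eq_square diff_diff_eq)
      then show ?thesis by (smt (verit) zero_le_power2 field_sum_of_halves)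
    qed
    also have "cmod (\<psi> w) * x\<^sup>2 = h\<^sup>2 * cmod (\<i> * of_real (cmp d w) * (\<i> * of_real (cmp d w) * \<psi> w))"
      by (simp add: x_def norm_mult power_mult_distrib power2_eq_square abs_mult[symmetric])
    finally show "cmod (?E w) \<le> h\<^sup>2 * cmod (\<i> * of_real (cmp d w) * (\<i> * of_real (cmp d w) * \<psi> w))"
      by (simp add: mult_left_mono)
  qed
  also have "\<dots> = (LINT w|Mk m. cmod (\<i> * of_real (cmp d w) * (\<i> * of_real (cmp d w) * \<psi> w))) * h\<^sup>2" by simp
  finally show "cmod (FTm m \<psi> (shift d h z) - FTm m \<psi> (shift d 0 z) - of_real h * FTm m (\<lambda>w. \<i> * of_real (cmp d w) * \<psi> w) z)
     \<le> (LINT w|Mk m. cmod (\<i> * of_real (cmp d w) * (\<i> * of_real (cmp d w) * \<psi> w))) * h\<^sup>2"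
    unfolding e .
qed

lemma power_le_exp: "x \<ge> 0 \<Longrightarrow> x ^ N \<le> fact N * exp (x::real)"
proof -
  assume x: "x \<ge> 0"
  have s: "(\<lambda>n. x ^ n /\<^sub>R fact n) sums exp x" by (rule exp_converges)
  have "(\<Sum>n\<in>{N}. x ^ n /\<^sub>R fact n) \<le> (\<Sum>n. x ^ n /\<^sub>R fact n)"
    by (rule sum_le_suminf) (use s x in \<open>auto simp: sums_iff\<close>)
  then have "x ^ N / fact N \<le> exp x" using s by (simp add: sums_iff divide_inverse mult.commute)
  then show ?thesis by (simp add: divide_le_eq mult.commute)
qed

text \<open>A single term of the exponential series dominates the power; the shift by 1 costs the
  factor \<open>exp b\<close>.\<close>

lemma poly_exp_bound:
  assumes "b > 0"
  shows "\<exists>C\<ge>0. \<forall>y\<ge>0. (1 + y) ^ N * exp (- b * y) \<le> (C::real)"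
proof -
  have "(1 + y) ^ N * exp (- b * y) \<le> fact N * exp b / b ^ N" if y: "y \<ge> 0" for y
  proof -
    have "(b * (1 + y)) ^ N \<le> fact N * exp (b * (1 + y))" using assms y by (intro power_le_exp) auto
    then have "b ^ N * (1 + y) ^ N * exp (- b * y) \<le> fact N * exp (b * (1 + y)) * exp (- b * y)"
      unfolding power_mult_distrib by (intro mult_right_mono) auto
    also have "\<dots> = fact N * exp b" by (simp add: mult.assoc exp_add[symmetric] algebra_simps)
    finally show ?thesis using assms by (simp add: field_simps)
  qed
  moreover have "fact N * exp b / b ^ N \<ge> 0" using assms by simp
  ultimately show ?thesis by blast
qed

text \<open>A class of rapidly decreasing functions that is closed under partial derivatives, hence consists of Schwartz functions.\<close>
inductive Kc :: "nat \<Rightarrow> 'n::finite kernel \<Rightarrow> bool" for m where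
  base: "PsiC m \<psi> \<Longrightarrow> a > 0 \<Longrightarrow> Kc m (\<lambda>z. of_real (exp (- a * dotk m z z / 2)) * FTm m \<psi> z)"
| mult: "Kc m f \<Longrightarrow> fst (snd d) < m \<Longrightarrow> Kc m (\<lambda>z. of_real (cmp d z) * f z)"
| add: "Kc m f \<Longrightarrow> Kc m g \<Longrightarrow> Kc m (\<lambda>z. f z + g z)"
| scale: "Kc m f \<Longrightarrow> Kc m (\<lambda>z. c * f z)"

lemma Kc_decay: "Kc m f \<Longrightarrow> \<exists>C. \<forall>z\<in>space (Mk m). (1 + dotk m z z) ^ N * cmod (f z) \<le> C"
proof (induction arbitrary: N rule: Kc.induct)
  case (base \<psi> a)
  have "a / 2 > 0" using base by simp
  from poly_exp_bound[OF this, of N] obtain C where C: "C \<ge> 0" "\<And>y. y \<ge> 0 \<Longrightarrow> (1 + y) ^ N * exp (- (a / 2) * y) \<le> C" by blast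
  have F: "cmod (FTm m \<psi> z) \<le> (LINT w|Mk m. cmod (\<psi> w))" for z
    using FT_bound[of m "\<lambda>w. cnj (\<psi> w)" z] by (simp add: FTm_FT)
  have "(1 + dotk m z z) ^ N * cmod (of_real (exp (- a * dotk m z z / 2)) * FTm m \<psi> z) \<le> C * (LINT w|Mk m. cmod (\<psi> w))" for z
  proof -
    have "(1 + dotk m z z) ^ N * cmod (of_real (exp (- a * dotk m z z / 2)) * FTm m \<psi> z)
      = ((1 + dotk m z z) ^ N * exp (- (a / 2) * dotk m z z)) * cmod (FTm m \<psi> z)" by (simp add: norm_mult)
    also have "\<dots> \<le> C * (LINT w|Mk m. cmod (\<psi> w))" by (intro mult_mono C F) auto
    finally show ?thesis .
  qed
  then show ?case by blast
next
  case (mult f d)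
  \<comment> \<open>The coordinate is absorbed by one more power of \<open>1 + dotk\<close>, hence
    the hypothesis at \<open>Suc N\<close>.\<close>
  obtain C where C: "\<And>z. z \<in> space (Mk m) \<Longrightarrow> (1 + dotk m z z) ^ Suc N * cmod (f z) \<le> C" using mult.IH by blast
  have "(1 + dotk m z z) ^ N * cmod (of_real (cmp d z) * f z) \<le> C" if z: "z \<in> space (Mk m)" for z
  proof -
    have "(1 + dotk m z z) ^ N * cmod (of_real (cmp d z) * f z) = (1 + dotk m z z) ^ N * (\<bar>cmp d z\<bar> * cmod (f z))" by (simp add: norm_mult)
    also have "\<dots> \<le> (1 + dotk m z z) ^ N * ((1 + dotk m z z) * cmod (f z))"
      by (intro mult_left_mono mult_right_mono cmp_abs_le mult) (auto intro!: zero_le_power add_nonneg_nonneg)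
    also have "\<dots> = (1 + dotk m z z) ^ Suc N * cmod (f z)" by simp
    finally show ?thesis using C[OF z] by simp
  qed
  then show ?case by blast
next
  case (add f g)
  obtain C D where C: "\<And>z. z \<in> space (Mk m) \<Longrightarrow> (1 + dotk m z z) ^ N * cmod (f z) \<le> C"
     "\<And>z. z \<in> space (Mk m) \<Longrightarrow> (1 + dotk m z z) ^ N * cmod (g z) \<le> D" using add.IH by meson
  have "(1 + dotk m z z) ^ N * cmod (f z + g z) \<le> C + D" if z: "z \<in> space (Mk m)" for z
  proof -
    have "(1 + dotk m z z) ^ N * cmod (f z + g z) \<le> (1 + dotk m z z) ^ N * (cmod (f z) + cmod (g z))"
      by (intro mult_left_mono norm_triangle_ineq zero_le_power add_nonneg_nonneg) auto
    then show ?thesis using C[OF z] by (simp add: distrib_left)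
  qed
  then show ?case by blast
next
  case (scale f c)
  obtain C where C: "\<And>z. z \<in> space (Mk m) \<Longrightarrow> (1 + dotk m z z) ^ N * cmod (f z) \<le> C" using scale.IH by blast
  have "(1 + dotk m z z) ^ N * cmod (c * f z) \<le> cmod c * C" if z: "z \<in> space (Mk m)" for z
    using mult_left_mono[OF C[OF z], of "cmod c"] by (simp add: norm_mult ac_simps)
  then show ?case by blast
qed

text \<open>The derivative of the Gaussian brings down a coordinate, which \<open>Kc.mult\<close>
  allows; the derivative of \<open>FTm\<close> multiplies \<psi> by a coordinate, which stays in
  \<open>PsiC\<close> because the support is bounded.\<close>

lemma Kc_deriv:
  fixes f :: "'n::finite kernel"
  shows "Kc m f \<Longrightarrow> fst (snd d) < m \<Longrightarrow> \<exists>f'. Kc m f' \<and> (\<forall>z\<in>space (Mk m). ((\<lambda>h. f (shift d h z)) has_vector_derivative f' z) (at 0))"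
proof (induction rule: Kc.induct)
  case (base \<psi> a)
  note d = base(3)
  let ?b = "\<lambda>z. of_real (exp (- a * dotk m z z / 2)) * FTm m \<psi> z"
  let ?f = "\<lambda>z. of_real (- a) * (of_real (cmp d z) * ?b z) + of_real (exp (- a * dotk m z z / 2)) * FTm m (\<lambda>w. \<i> * of_real (cmp d w) * \<psi> w) z"
  have K: "Kc m ?f"
    by (intro Kc.add Kc.scale Kc.mult Kc.base base PsiC_cmp)
  have "((\<lambda>h. ?b (shift d h z)) has_vector_derivative ?f z) (at 0)" if z: "z \<in> space (Mk m)" for z
  proof -
    have "((\<lambda>h. exp (- a * (dotk m z z + 2 * h * cmp d z + h\<^sup>2) / 2)) has_real_derivative - a * cmp d z * exp (- a * dotk m z z / 2)) (at 0)"
      by (auto intro!: derivative_eq_intros)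
    then have "((\<lambda>h. exp (- a * dotk m (shift d h z) (shift d h z) / 2)) has_vector_derivative - a * cmp d z * exp (- a * dotk m z z / 2)) (at 0)"
      unfolding dotk_shift_self[OF d] by (simp add: has_real_derivative_iff_has_vector_derivative)
    then have 1: "((\<lambda>h. complex_of_real (exp (- a * dotk m (shift d h z) (shift d h z) / 2))) has_vector_derivative of_real (- a * cmp d z * exp (- a * dotk m z z / 2))) (at 0)"
      by (rule bounded_linear.has_vector_derivative[OF bounded_linear_of_real])
    from has_vector_derivative_mult[OF 1 FTm_shift_deriv[OF base(1) d z]]
    show ?thesis by (simp add: algebra_simps)
  qed
  then show ?case using K by blast
next
  case (mult f e)
  then obtain f' where f': "Kc m f'" "\<And>z. z \<in> space (Mk m) \<Longrightarrow> ((\<lambda>h. f (shift d h z)) has_vector_derivative f' z) (at 0)" by blast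
  let ?x = "if e = d then 1 else 0 :: real"
  let ?f = "\<lambda>z. of_real ?x * f z + of_real (cmp e z) * f' z"
  have K: "Kc m ?f" by (intro Kc.add Kc.scale Kc.mult mult f')
  have "((\<lambda>h. of_real (cmp e (shift d h z)) * f (shift d h z)) has_vector_derivative ?f z) (at 0)" if z: "z \<in> space (Mk m)" for z
  proof -
    have "((\<lambda>h. cmp e z + h * ?x) has_vector_derivative ?x) (at 0)"
      by (auto intro!: derivative_eq_intros simp: has_real_derivative_iff_has_vector_derivative[symmetric])
    then have 1: "((\<lambda>h. complex_of_real (cmp e (shift d h z))) has_vector_derivative of_real ?x) (at 0)"
      unfolding cmp_shift by (intro bounded_linear.has_vector_derivative[OF bounded_linear_of_real]) (simp split: if_splits)
    from has_vector_derivative_mult[OF 1 f'(2)[OF z]]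
    show ?thesis by (simp add: algebra_simps)
  qed
  then show ?case using K by blast
next
  case (add f g)
  then obtain f' g' where "Kc m f'" "\<And>z. z \<in> space (Mk m) \<Longrightarrow> ((\<lambda>h. f (shift d h z)) has_vector_derivative f' z) (at 0)"
    "Kc m g'" "\<And>z. z \<in> space (Mk m) \<Longrightarrow> ((\<lambda>h. g (shift d h z)) has_vector_derivative g' z) (at 0)" by meson
  then show ?case by (intro exI[of _ "\<lambda>z. f' z + g' z"]) (auto intro!: Kc.add has_vector_derivative_add)
next
  case (scale f c)
  then obtain f' where "Kc m f'" "\<And>z. z \<in> space (Mk m) \<Longrightarrow> ((\<lambda>h. f (shift d h z)) has_vector_derivative f' z) (at 0)" by meson
  then show ?case by (intro exI[of _ "\<lambda>z. c * f' z"]) (auto intro!: Kc.scale has_vector_derivative_mult_right)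
qed

lemma Kc_schwartz:
  fixes f :: "'n::finite kernel"
  assumes f: "Kc m f"
  shows "schwartz m f"
proof -
  \<comment> \<open>For directions outside the configuration any member of the class will do; asking
    for one keeps every \<open>F ds\<close> below in \<open>Kc\<close>.\<close>
  let ?R = "\<lambda>d g g'. Kc m g' \<and> (fst (snd d) < m \<longrightarrow> (\<forall>z\<in>space (Mk m). ((\<lambda>h. g (shift d h z)) has_vector_derivative g' z) (at 0)))"
  define D :: "bool \<times> nat \<times> 'n \<Rightarrow> 'n kernel \<Rightarrow> 'n kernel" where "D = (\<lambda>d g. SOME g'. ?R d g g')"
  have D: "?R d g (D d g)" if "Kc m g" for d g
  proof -
    have "\<exists>g'. ?R d g g'"
      using Kc_deriv[OF that, of d] that by (cases "fst (snd d) < m") auto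
    then show ?thesis unfolding D_def by (rule someI_ex)
  qed
  define F where "F = (\<lambda>ds. foldr D ds f)"
  have K: "Kc m (F ds)" for ds
    by (induction ds) (use f D in \<open>auto simp: F_def\<close>)
  have "schwartz_fun m F"
  proof
    fix ds and d :: "bool \<times> nat \<times> 'n" and z :: "'n pts" assume "z \<in> space (Mk m)" "fst (snd d) < m"
    then show "((\<lambda>h. F ds (shift d h z)) has_vector_derivative F (d # ds) z) (at 0)"
      using D[OF K[of ds], of d] by (simp add: F_def)
  next
    fix ds N
    show "\<exists>C. \<forall>z\<in>space (Mk m). (1 + dotk m z z) ^ N * cmod (F ds z) \<le> C" by (rule Kc_decay[OF K])
  qed
  then show ?thesis unfolding schwartz_iff by (intro exI[of _ F]) (simp add: F_def)
qed

lemma schwartz_L12: "schwartz m f \<Longrightarrow> L12 m f"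
  unfolding schwartz_iff using schwartz_fun.F_L12 by blast

text \<open>The Gaussian makes the inverse transform of a bounded, compactly supported \<open>\<psi>\<close> decrease rapidly; on the transform side it acts as smoothing by the heat kernel.\<close>
definition sap :: "nat \<Rightarrow> real \<Rightarrow> 'n::finite kernel \<Rightarrow> 'n kernel" where
  "sap m a \<psi> z = of_real (1 / cF TYPE('n) m) * (of_real (exp (- a * dotk m z z / 2)) * FTm m \<psi> z)"

lemma sap_schwartz:
  fixes \<psi> :: "'n::finite kernel"
  assumes "PsiC m \<psi>" "a > 0"
  shows "schwartz m (sap m a \<psi>)"
proof -
  have "Kc m (\<lambda>z. of_real (1 / cF TYPE('n) m) * (of_real (exp (- a * dotk m z z / 2)) * FTm m \<psi> z))"
    by (intro Kc.scale Kc.base assms)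
  then have "Kc m (sap m a \<psi>)" by (simp add: sap_def[abs_def])
  then show ?thesis by (rule Kc_schwartz)
qed

text \<open>The same exchange of integrals as in \<open>FT_gauss\<close>: the damped integral of the
  plane waves over z is the heat kernel.\<close>

lemma FT_sap:
  fixes \<psi> :: "'n::finite kernel"
  assumes P: "PsiC m \<psi>" and a: "a > 0" and w: "w \<in> space (Mk m)"
  shows "FT m (sap m a \<psi>) w = (LINT u|Mk m. of_real (heatk m a w u) * \<psi> u)"
proof -
  let ?M = "Mk m :: 'n pts measure"
  interpret pair_sigma_finite ?M ?M by (rule psf_Mk)
  define c where "c = complex_of_real (cF TYPE('n) m)"
  have c: "c \<noteq> 0" by (simp add: c_def)
  note \<psi>i = L12D(1)[OF PsiC_L12[OF P]]
  note [measurable] = borel_measurable_integrable[OF \<psi>i]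
  have [measurable]: "(\<lambda>z. dotk m z w) \<in> borel_measurable ?M" using w by measurable
  define e where "e = (\<lambda>z::'n pts. complex_of_real (exp (- a * dotk m z z / 2)))"
  have [measurable]: "e \<in> borel_measurable ?M" unfolding e_def by measurable
  define I where "I = (\<lambda>z u. cis (- dotk m z w) * e z * (cis (dotk m z u) * \<psi> u))"
  have ie: "integrable ?M e" unfolding e_def using integrable_gauss[OF a] by (intro integrable_of_real)
  have i2: "integrable (?M \<Otimes>\<^sub>M ?M) (\<lambda>p. e (fst p) * \<psi> (snd p))" by (rule pair_prod(1)[OF psf_Mk ie \<psi>i])
  have int: "integrable (?M \<Otimes>\<^sub>M ?M) (case_prod I)"
    unfolding I_def by (rule Bochner_Integration.integrable_bound[OF i2]) (auto simp: norm_mult)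
  have "c * FT m (sap m a \<psi>) w = (LINT z|?M. (LINT u|?M. I z u))"
  proof -
    have "c * FT m (sap m a \<psi>) w = (LINT z|?M. c * (cis (- dotk m z w) * sap m a \<psi> z))"
      unfolding FT_def by (rule integral_mult_right_zero[symmetric])
    also have "\<dots> = (LINT z|?M. (LINT u|?M. I z u))"
    proof (rule Bochner_Integration.integral_cong[OF refl])
      fix z :: "'n pts"
      have "(LINT u|?M. I z u) = cis (- dotk m z w) * e z * FTm m \<psi> z" unfolding I_def FTm_def by (rule integral_mult_right_zero)
      then show "c * (cis (- dotk m z w) * sap m a \<psi> z) = (LINT u|?M. I z u)"
        using c by (simp add: sap_def e_def c_def)
    qed
    finally show ?thesis .
  qed
  also have "\<dots> = (LINT u|?M. (LINT z|?M. I z u))" by (rule Fubini_integral[OF int, symmetric])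
  also have "\<dots> = (LINT u|?M. c * (of_real (heatk m a w u) * \<psi> u))"
  proof (rule Bochner_Integration.integral_cong[OF refl])
    fix u :: "'n pts"
    have "(LINT z|?M. I z u) = (LINT z|?M. (cis (- dotk m w z) * cis (dotk m u z) * of_real (exp (- a * dotk m z z / 2))) * \<psi> u)"
      unfolding I_def e_def by (simp only: ac_simps dotk_commute[of m _ w] dotk_commute[of m _ u])
    also have "\<dots> = of_real (cF TYPE('n) m * heatk m a w u) * \<psi> u"
      unfolding integral_mult_left_zero gauss_heatk(2)[OF a] ..
    finally show "(LINT z|?M. I z u) = c * (of_real (heatk m a w u) * \<psi> u)" by (simp add: c_def)
  qed
  also have "\<dots> = c * (LINT u|?M. of_real (heatk m a w u) * \<psi> u)" by (rule integral_mult_right_zero)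
  finally show ?thesis using c by simp
qed

section \<open>Decay of the smoothed transforms, uniform in the width\<close>

definition dist2 :: "nat \<Rightarrow> 'n::finite pts \<Rightarrow> 'n pts \<Rightarrow> real" where
  "dist2 m w u = (\<Sum>j<m. (norm (fst w j - fst u j))\<^sup>2 + (norm (snd w j - snd u j))\<^sup>2)"

lemma dist2_nonneg [simp]: "dist2 m w u \<ge> 0"
  unfolding dist2_def by (intro sum_nonneg) auto

text \<open>Half of the Gaussian exponent is split off as a decay factor; the other half belongs to
  the kernel with doubled variance, which still has mass one.\<close>

lemma heatk_dist2:
  fixes w u :: "'n::finite pts"
  assumes a: "a > 0"
  shows "heatk m a w u = (2::real) ^ (CARD('n) * m) * exp (- dist2 m w u / (4 * a)) * heatk m (2 * a) w u"
proof -
  have s2: "sqrt (2 * pi * (2 * a)) = sqrt 2 * sqrt (2 * pi * a)" by (simp flip: real_sqrt_mult add: ac_simps)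
  have h: "heat a x y = sqrt 2 ^ CARD('n) * exp (- (norm (x - y))\<^sup>2 / (4 * a)) * heat (2 * a) x y" for x y :: "real^'n"
  proof -
    have e: "exp (- (norm (x - y))\<^sup>2 / (2 * a)) = exp (- (norm (x - y))\<^sup>2 / (4 * a)) * exp (- (norm (x - y))\<^sup>2 / (2 * (2 * a)))"
      using a by (simp add: exp_add[symmetric] field_simps)
    show ?thesis unfolding heat_def e s2 power_mult_distrib DIM_cart using a by simp
  qed
  have "heatk m a w u = (\<Prod>j<m. (sqrt 2 ^ CARD('n) * sqrt 2 ^ CARD('n)) * (exp (- (norm (fst w j - fst u j))\<^sup>2 / (4 * a)) * exp (- (norm (snd w j - snd u j))\<^sup>2 / (4 * a)))
      * (heat (2 * a) (fst w j) (fst u j) * heat (2 * a) (snd w j) (snd u j)))"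
    unfolding heatk_def by (intro prod.cong refl, subst (1 2) h) (simp only: ac_simps)
  also have "\<dots> = (\<Prod>j<m. sqrt 2 ^ CARD('n) * sqrt 2 ^ CARD('n)) * (\<Prod>j<m. exp (- (norm (fst w j - fst u j))\<^sup>2 / (4 * a)) * exp (- (norm (snd w j - snd u j))\<^sup>2 / (4 * a))) * heatk m (2 * a) w u"
    unfolding heatk_def prod.distrib by (simp only: ac_simps)
  also have "(\<Prod>j<m. exp (- (norm (fst w j - fst u j))\<^sup>2 / (4 * a)) * exp (- (norm (snd w j - snd u j))\<^sup>2 / (4 * a))) = exp (- dist2 m w u / (4 * a))"
    unfolding dist2_def by (simp add: exp_add[symmetric] exp_sum[symmetric] sum_negf[symmetric] sum_divide_distrib add_divide_distrib diff_divide_distrib)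
  also have "(\<Prod>j<m. sqrt 2 ^ CARD('n) * sqrt 2 ^ CARD('n)) = (2::real) ^ (CARD('n) * m)"
    by (simp add: power_mult_distrib[symmetric] power_mult)
  finally show ?thesis .
qed

lemma dotk_le_dist2:
  "dotk m w w \<le> 2 * dist2 m w u + 2 * dotk m u u"
proof -
  have n: "(norm x)\<^sup>2 \<le> 2 * (norm (x - y))\<^sup>2 + 2 * (norm y)\<^sup>2" for x y :: "real^'a"
  proof -
    have "(norm x)\<^sup>2 \<le> (norm (x - y) + norm y)\<^sup>2" using norm_triangle_ineq[of "x - y" y] by (intro power_mono) auto
    also have "\<dots> \<le> 2 * (norm (x - y))\<^sup>2 + 2 * (norm y)\<^sup>2"
      using sum_squares_bound[of "norm (x - y)" "norm y"] by (simp add: power2_sum)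
    finally show ?thesis .
  qed
  show ?thesis
    unfolding dotk_norms[symmetric] dist2_def sum_distrib_left sum.distrib[symmetric]
    by (rule sum_mono) (smt (verit) n)
qed

text \<open>A large w is far from the support of \<psi>, so a power of \<open>1 + dotk m w w\<close>
  is bounded by one of \<open>1 + D\<close>. For \<open>a \<le> 1\<close> the factor split off by
  \<open>heatk_dist2\<close> is at most \<open>exp (- D / 4)\<close>, so one constant serves all
  a.\<close>

lemma FT_sap_decay:
  fixes \<psi> :: "'n::finite kernel"
  assumes P: "PsiC m \<psi>"
  shows "\<exists>C\<ge>0. \<forall>a w. 0 < a \<and> a \<le> 1 \<and> w \<in> space (Mk m) \<longrightarrow> (1 + dotk m w w) ^ N * cmod (FT m (sap m a \<psi>) w) \<le> C"
proof -
  let ?M = "Mk m :: 'n pts measure"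
  obtain B R where B: "B \<ge> 0" "\<And>w. w \<in> space ?M \<Longrightarrow> cmod (\<psi> w) \<le> B"
    and R: "R \<ge> 0" "\<And>w. w \<in> space ?M \<Longrightarrow> dotk m w w > R \<Longrightarrow> \<psi> w = 0"
    using P unfolding PsiC_def by blast
  obtain C0 where C0: "C0 \<ge> 0" "\<And>y. y \<ge> 0 \<Longrightarrow> (1 + y) ^ N * exp (- (1/4) * y) \<le> (C0::real)"
    using poly_exp_bound[of "1/4" N] by auto
  define K where "K = (2 * (1 + R)) ^ N * (2 ^ (CARD('n) * m) * C0) * B"
  have K: "K \<ge> 0" unfolding K_def using B R C0 by simp
  have "(1 + dotk m w w) ^ N * cmod (FT m (sap m a \<psi>) w) \<le> K" if a: "0 < a" "a \<le> 1" and w: "w \<in> space ?M" for a w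
  proof -
    have a2: "2 * a > 0" using a by simp
    have le: "(1 + dotk m w w) ^ N * cmod (of_real (heatk m a w u) * \<psi> u) \<le> K * heatk m (2 * a) w u" if u: "u \<in> space ?M" for u
    proof (cases "dotk m u u > R")
      case True
      then show ?thesis using R(2)[OF u] K a2 by simp
    next
      case False
      define D where "D = dist2 m w u"
      have D: "D \<ge> 0" by (simp add: D_def)
      have "1 + dotk m w w \<le> 1 + 2 * D + 2 * R" using dotk_le_dist2[of m w u] False by (simp add: D_def)
      also have "\<dots> \<le> 2 * (1 + R) * (1 + D)" using R(1) D by (simp add: algebra_simps)
      finally have "(1 + dotk m w w) ^ N \<le> (2 * (1 + R) * (1 + D)) ^ N" by (intro power_mono) (auto intro: add_nonneg_nonneg)
      then have "(1 + dotk m w w) ^ N * (heatk m a w u * cmod (\<psi> u)) \<le> ((2 * (1 + R)) ^ N * (1 + D) ^ N) * (heatk m a w u * B)"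
        unfolding power_mult_distrib[symmetric]
        using B a D R(1) u by (intro mult_mono mult_left_mono mult_nonneg_nonneg) auto
      also have "\<dots> = (2 * (1 + R)) ^ N * (2 ^ (CARD('n) * m) * ((1 + D) ^ N * exp (- D / (4 * a)))) * B * heatk m (2 * a) w u"
        unfolding heatk_dist2[OF a(1), of m w u] D_def by (simp only: ac_simps)
      also have "\<dots> \<le> (2 * (1 + R)) ^ N * (2 ^ (CARD('n) * m) * C0) * B * heatk m (2 * a) w u"
      proof -
        have "D / 4 \<le> D / (4 * a)" using a D by (intro divide_left_mono) auto
        then have "exp (- D / (4 * a)) \<le> exp (- (1/4) * D)" by simp
        then have "(1 + D) ^ N * exp (- D / (4 * a)) \<le> (1 + D) ^ N * exp (- (1/4) * D)" using D by (intro mult_left_mono) auto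
        also have "\<dots> \<le> C0" by (rule C0(2)[OF D])
        finally show ?thesis using B R a2 by (intro mult_right_mono mult_left_mono) auto
      qed
      finally show ?thesis using a by (simp add: norm_mult K_def)
    qed
    have i: "integrable ?M (\<lambda>u. K * heatk m (2 * a) w u)" by (intro integrable_mult_right heatk_integral(1)[OF a2])
    have "(1 + dotk m w w) ^ N * cmod (FT m (sap m a \<psi>) w) \<le> (1 + dotk m w w) ^ N * (LINT u|?M. cmod (of_real (heatk m a w u) * \<psi> u))"
      unfolding FT_sap[OF P a(1) w] by (intro mult_left_mono integral_norm_bound) (auto intro!: zero_le_power add_nonneg_nonneg)
    also have "\<dots> = (LINT u|?M. (1 + dotk m w w) ^ N * cmod (of_real (heatk m a w u) * \<psi> u))" by simp
    also have "\<dots> \<le> (LINT u|?M. K * heatk m (2 * a) w u)"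
    proof (rule integral_mono_AE'[OF i])
      show "AE u in ?M. (1 + dotk m w w) ^ N * cmod (of_real (heatk m a w u) * \<psi> u) \<le> K * heatk m (2 * a) w u" using le by (intro AE_I2)
      show "AE u in ?M. 0 \<le> K * heatk m (2 * a) w u"
        using K a2 by (intro AE_I2 mult_nonneg_nonneg) auto
    qed
    also have "\<dots> = K" using heatk_integral(2)[OF a2, of m w] by simp
    finally show ?thesis .
  qed
  then show ?thesis using K by blast
qed

lemma wS_le_pow:
  assumes "\<alpha> \<ge> 0"
  shows "\<exists>N. \<forall>w. wS \<alpha> m w \<le> (1 + dotk m w w) ^ N"
proof -
  obtain N :: nat where N: "real m * \<alpha> \<le> real N" using real_arch_simple by blast
  have "wS \<alpha> m w \<le> (1 + dotk m w w) ^ N" for w :: "'a cfg \<times> 'a cfg"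
  proof -
    have p: "1 + dotk m w w \<ge> 1" using dotk_self_nonneg[of m w] by linarith
    have "wS \<alpha> m w \<le> (1 + dotk m w w) powr (real m * \<alpha>)" by (rule wS_le[OF assms])
    also have "\<dots> \<le> (1 + dotk m w w) powr (real N)" by (rule powr_mono[OF N p])
    also have "\<dots> = (1 + dotk m w w) ^ N" using p by (intro powr_realpow) linarith
    finally show ?thesis .
  qed
  then show ?thesis by blast
qed

text \<open>Interpolation: the square of the weighted norm is at most the plain L2 norm times the
  norm with doubled weight exponent. The first factor tends to 0 by Plancherel, the second is
  bounded by the uniform decay.\<close>

lemma sap_tendsto:
  fixes \<psi> :: "'n::finite kernel"
  assumes P: "PsiC m \<psi>" and \<alpha>: "\<alpha> \<ge> 0"
  defines "a \<equiv> \<lambda>i. 1 / real (Suc i)"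
  shows "(\<lambda>i. nrm (Mk m) (\<lambda>w. of_real (wS \<alpha> m w) * (FT m (sap m (a i) \<psi>) w - \<psi> w))) \<longlonglongrightarrow> 0"
proof -
  let ?M = "Mk m :: 'n pts measure"
  have a: "0 < a i" "a i \<le> 1" for i by (auto simp: a_def)
  have a0: "a \<longlonglongrightarrow> 0" unfolding a_def by (rule LIMSEQ_Suc[OF lim_1_over_n])
  define c where "c = complex_of_real (1 / cF TYPE('n) m)"
  note p12 = PsiC_L12[OF P]
  note F = is_FT_FTm[OF p12]
  note [measurable] = sqi_meas[OF F(1)] sqi_meas[OF L12D(2)[OF p12]]
  have s12: "L12 m (sap m (a i) \<psi>)" for i by (rule schwartz_L12[OF sap_schwartz[OF P a(1)]])
  have FTs: "sqi ?M (FT m (sap m (a i) \<psi>))" for i by (rule plancherel_L12[OF s12])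
  define u where "u = (\<lambda>i w. FT m (sap m (a i) \<psi>) w - \<psi> w)"
  have su: "sqi ?M (u i)" for i unfolding u_def by (intro sqi_diff FTs L12D(2)[OF p12])
  note [measurable] = sqi_meas[OF su]
  have F2: "is_FT m (\<lambda>z. c * FTm m \<psi> z) \<psi>"
    using is_FT_scale[OF F(2), of c] by (simp add: c_def)
  \<comment> \<open>In position space the Gaussian factor is at most 1 and tends to 1, so dominated
    convergence applies; Plancherel carries the limit over to the transforms.\<close>
  have lim0: "(\<lambda>i. nrm ?M (\<lambda>z. sap m (a i) \<psi> z - c * FTm m \<psi> z)) \<longlonglongrightarrow> 0"
  proof (rule sqi_dominated(3)[where c = 1])
    show "sap m (a i) \<psi> \<in> borel_measurable ?M" for i using L12D(2)[OF s12] by (rule sqi_meas)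
    show "(\<lambda>z. c * FTm m \<psi> z) \<in> borel_measurable ?M" by measurable
    show "sqi ?M (\<lambda>z. c * FTm m \<psi> z)" by (intro sqi_scale F)
    show "AE z in ?M. cmod (sap m (a i) \<psi> z) \<le> 1 * cmod (c * FTm m \<psi> z)" for i
    proof (rule AE_I2)
      fix z :: "'n pts"
      have "exp (- a i * dotk m z z / 2) \<le> 1" using a[of i] by (auto intro!: divide_nonpos_pos mult_nonpos_nonneg simp: less_imp_le)
      then have "exp (- a i * dotk m z z / 2) * cmod (c * FTm m \<psi> z) \<le> 1 * cmod (c * FTm m \<psi> z)" by (intro mult_right_mono) auto
      then show "cmod (sap m (a i) \<psi> z) \<le> 1 * cmod (c * FTm m \<psi> z)"
        by (simp add: sap_def c_def norm_mult norm_divide ac_simps)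
    qed
    show "AE z in ?M. (\<lambda>i. sap m (a i) \<psi> z) \<longlonglongrightarrow> c * FTm m \<psi> z"
    proof (rule AE_I2)
      fix z :: "'n pts"
      have "(\<lambda>i. c * (of_real (exp (- a i * dotk m z z / 2)) * FTm m \<psi> z)) \<longlonglongrightarrow> c * (of_real (exp (- 0 * dotk m z z / 2)) * FTm m \<psi> z)"
        by (intro tendsto_intros a0) auto
      then show "(\<lambda>i. sap m (a i) \<psi> z) \<longlonglongrightarrow> c * FTm m \<psi> z" by (simp add: sap_def c_def)
    qed
  qed
  have nu: "nrm ?M (u i) = sqrt (cF TYPE('n) m) * nrm ?M (\<lambda>z. sap m (a i) \<psi> z - c * FTm m \<psi> z)" for i
    unfolding u_def
    by (rule is_FT_nrm[OF is_FT_diff[OF is_FT_FT[OF s12] L12D(2)[OF s12] F2 sqi_scale[OF F(1)]] sqi_diff[OF L12D(2)[OF s12] sqi_scale[OF F(1)]]])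
  have u0: "(\<lambda>i. nrm ?M (u i)) \<longlonglongrightarrow> 0" unfolding nu using tendsto_mult_right_zero[OF lim0] by simp
  \<comment> \<open>A power that dominates the doubled weight, to be added to the power
    \<open>NW\<close> that buys integrability.\<close>
  obtain N where N: "\<And>w::'n pts. wS (2 * \<alpha>) m w \<le> (1 + dotk m w w) ^ N" using wS_le_pow[of "2 * \<alpha>" m] \<alpha> by auto
  let ?N = "NW TYPE('n) m + N"
  obtain C where C: "C \<ge> 0" "\<And>a w. 0 < a \<Longrightarrow> a \<le> 1 \<Longrightarrow> w \<in> space ?M \<Longrightarrow> (1 + dotk m w w) ^ ?N * cmod (FT m (sap m a \<psi>) w) \<le> C"
    using FT_sap_decay[OF P, of ?N] by blast
  obtain C' where C': "C' \<ge> 0" "\<And>w. w \<in> space ?M \<Longrightarrow> (1 + dotk m w w) ^ ?N * cmod (\<psi> w) \<le> C'" using PsiC_decay[OF P, of ?N] by blast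
  have wt: "sqi ?M (\<lambda>w. complex_of_real (wt m w))"
  proof -
    have "(\<lambda>w::'n pts. complex_of_real (wt m w)) \<in> borel_measurable ?M"
      using borel_measurable_integrable[OF wt_integrable] by measurable
    then show ?thesis by (rule L12D(2)[OF L12_wt[where C = 1]]) (simp add: wt_pos less_imp_le)
  qed
  have b: "cmod (of_real (wS (2 * \<alpha>) m w) * u i w) \<le> (C + C') * wt m w" if w: "w \<in> space ?M" for i w
  proof -
    have p: "1 + dotk m w w \<ge> 0" by (intro add_nonneg_nonneg) auto
    have "(1 + dotk m w w) ^ ?N * cmod (u i w) \<le> (1 + dotk m w w) ^ ?N * (cmod (FT m (sap m (a i) \<psi>) w) + cmod (\<psi> w))"
      unfolding u_def by (intro mult_left_mono norm_triangle_ineq4 zero_le_power p)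
    also have "\<dots> \<le> C + C'" unfolding distrib_left by (intro add_mono C C' a w)
    finally have "(1 + dotk m w w) ^ NW TYPE('n) m * ((1 + dotk m w w) ^ N * cmod (u i w)) \<le> C + C'" by (simp add: power_add mult.assoc)
    then have "(1 + dotk m w w) ^ N * cmod (u i w) \<le> (C + C') * wt m w" by (rule decay_wt) (intro mult_nonneg_nonneg zero_le_power p norm_ge_zero)
    moreover have "cmod (of_real (wS (2 * \<alpha>) m w) * u i w) \<le> (1 + dotk m w w) ^ N * cmod (u i w)"
      unfolding norm_mult norm_of_real using N[of w] wS_pos[of "2 * \<alpha>" m w] by (intro mult_right_mono) auto
    ultimately show ?thesis by linarith
  qed
  have m2: "(\<lambda>w. of_real (wS (2 * \<alpha>) m w) * u i w) \<in> borel_measurable ?M" for i by measurable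
  have wtn: "AE w in ?M. cmod (of_real (wS (2 * \<alpha>) m w) * u i w) \<le> (C + C') * cmod (complex_of_real (wt m w))" for i
  proof (rule AE_I2)
    fix w :: "'n pts" assume "w \<in> space ?M"
    from b[OF this, of i] show "cmod (of_real (wS (2 * \<alpha>) m w) * u i w) \<le> (C + C') * cmod (complex_of_real (wt m w))"
      unfolding norm_of_real abs_of_pos[OF wt_pos[of m w]] .
  qed
  have s2: "sqi ?M (\<lambda>w. of_real (wS (2 * \<alpha>) m w) * u i w)" for i by (rule sqi_bound[OF wt m2 wtn])
  define K where "K = (C + C') * nrm ?M (\<lambda>w. complex_of_real (wt m w))"
  have n2: "nrm ?M (\<lambda>w. of_real (wS (2 * \<alpha>) m w) * u i w) \<le> K" for i
    unfolding K_def using C(1) C'(1) by (intro nrm_bound[OF wt m2 wtn]) auto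
  have wsq: "(wS \<alpha> m w)\<^sup>2 = wS (2 * \<alpha>) m w" for w :: "'n pts"
    unfolding wS_powr using wS_pos[of \<alpha> m w] powr_realpow[of "wS \<alpha> m w" 2] by simp
  have le: "(nrm ?M (\<lambda>w. of_real (wS \<alpha> m w) * u i w))\<^sup>2 \<le> nrm ?M (u i) * K" for i
  proof -
    have "(nrm ?M (\<lambda>w. of_real (wS \<alpha> m w) * u i w))\<^sup>2 = (LINT w|?M. cmod (u i w) * cmod (of_real (wS (2 * \<alpha>) m w) * u i w))"
      unfolding nrm_sq norm_mult norm_of_real power_mult_distrib power2_abs wsq
      by (rule Bochner_Integration.integral_cong) (auto simp: power2_eq_square abs_of_pos wS_pos)
    also have "\<dots> \<le> nrm ?M (u i) * nrm ?M (\<lambda>w. of_real (wS (2 * \<alpha>) m w) * u i w)" by (rule holder2[OF su s2])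
    also have "\<dots> \<le> nrm ?M (u i) * K" by (intro mult_left_mono n2) auto
    finally show ?thesis .
  qed
  have l0: "(\<lambda>i. nrm ?M (u i) * K) \<longlonglongrightarrow> 0" using tendsto_mult_left_zero[OF u0] by simp
  have "(\<lambda>i. (nrm ?M (\<lambda>w. of_real (wS \<alpha> m w) * u i w))\<^sup>2) \<longlonglongrightarrow> 0"
    by (rule Lim_null_comparison[OF _ l0]) (use le in simp)
  from tendsto_real_sqrt[OF this] show ?thesis unfolding u_def by simp
qed

text \<open>The transform is cut off in size and support, which gives a \<open>PsiC\<close>
  function, and then smoothed; the variance is chosen after the cut-off level.\<close>

lemma schwartz_dense:
  fixes \<gamma> :: "'n::finite kernel"
  assumes \<gamma>: "inH \<alpha> m \<gamma>" and \<alpha>: "\<alpha> \<ge> 0"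
  shows "\<exists>s. (\<forall>i. schwartz m (s i)) \<and> (\<lambda>i. Hnorm \<alpha> m (\<lambda>z. s i z - \<gamma> z)) \<longlonglongrightarrow> 0"
proof -
  let ?M = "Mk m :: 'n pts measure"
  define c where "c = sqrt (cF TYPE('n) m)"
  have c: "c > 0" by (simp add: c_def)
  have [measurable]: "ft m \<gamma> \<in> borel_measurable ?M" by (rule is_FT_meas[OF is_FT_ft[OF inH_sqi[OF \<gamma>]]])
  define g where "g = (\<lambda>w. of_real (wS \<alpha> m w) * ft m \<gamma> w)"
  have sg: "sqi ?M g"
  proof -
    have "g = (\<lambda>w. of_real c * phi \<alpha> m \<gamma> w)" using c by (auto simp: g_def phi_def c_def)
    then show ?thesis using sqi_scale[OF phi_sqi[OF \<gamma>]] by simp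
  qed
  define \<psi> where "\<psi> = (\<lambda>(n::nat) w. if cmod (ft m \<gamma> w) \<le> real n \<and> dotk m w w \<le> real n then ft m \<gamma> w else 0)"
  have \<psi>m [measurable]: "\<psi> n \<in> borel_measurable ?M" for n unfolding \<psi>_def by measurable
  have P: "PsiC m (\<psi> n)" for n
    unfolding PsiC_def
  proof (intro conjI \<psi>m)
    show "\<exists>B\<ge>0. \<forall>w\<in>space (Mk m). cmod (\<psi> n w) \<le> B" by (intro exI[of _ "real n"]) (auto simp: \<psi>_def)
    show "\<exists>R\<ge>0. \<forall>w\<in>space (Mk m). dotk m w w > R \<longrightarrow> \<psi> n w = 0" by (intro exI[of _ "real n"]) (auto simp: \<psi>_def)
  qed
  have lim: "(\<lambda>n. nrm ?M (\<lambda>w. of_real (wS \<alpha> m w) * \<psi> n w - g w)) \<longlonglongrightarrow> 0"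
  proof (rule sqi_dominated(3)[OF _ sqi_meas[OF sg] sg, where c = 1])
    show "(\<lambda>w. of_real (wS \<alpha> m w) * \<psi> n w) \<in> borel_measurable ?M" for n by measurable
    show "AE z in ?M. cmod (of_real (wS \<alpha> m z) * \<psi> n z) \<le> 1 * cmod (g z)" for n by (intro AE_I2) (auto simp: \<psi>_def g_def)
    show "AE z in ?M. (\<lambda>n. of_real (wS \<alpha> m z) * \<psi> n z) \<longlonglongrightarrow> g z"
    proof (rule AE_I2)
      fix z :: "'n pts"
      obtain n :: nat where n: "cmod (ft m \<gamma> z) + dotk m z z \<le> real n" using real_arch_simple by blast
      have "of_real (wS \<alpha> m z) * \<psi> i z = g z" if "i \<ge> n" for i
      proof -
        have "real n \<le> real i" using that by simp
        then have "cmod (ft m \<gamma> z) \<le> real i" "dotk m z z \<le> real i"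
          using n norm_ge_zero[of "ft m \<gamma> z"] dotk_self_nonneg[of m z] by linarith+
        then show ?thesis by (simp add: \<psi>_def g_def)
      qed
      then show "(\<lambda>n. of_real (wS \<alpha> m z) * \<psi> n z) \<longlonglongrightarrow> g z"
        by (intro tendsto_eventually eventually_sequentiallyI[of n])
    qed
  qed
  have main: "\<exists>s. schwartz m s \<and> Hnorm \<alpha> m (\<lambda>z. s z - \<gamma> z) < e" if e: "e > 0" for e
  proof -
    obtain n where n: "nrm ?M (\<lambda>w. of_real (wS \<alpha> m w) * \<psi> n w - g w) < c * e / 2"
      using order_tendstoD(2)[OF lim, of "c * e / 2"] c e by (auto simp: eventually_sequentially)
    obtain i where i: "nrm ?M (\<lambda>w. of_real (wS \<alpha> m w) * (FT m (sap m (1 / real (Suc i)) (\<psi> n)) w - \<psi> n w)) < c * e / 2"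
      using order_tendstoD(2)[OF sap_tendsto[OF P \<alpha>], of "c * e / 2" n] c e by (auto simp: eventually_sequentially)
    define s where "s = sap m (1 / real (Suc i)) (\<psi> n)"
    have s: "schwartz m s" unfolding s_def by (rule sap_schwartz[OF P]) simp
    have sH: "inH \<alpha> m s" by (rule schwartz_inH[OF s \<alpha>])
    have s12: "L12 m s" by (rule schwartz_L12[OF s])
    have ps: "AE w in ?M. phi \<alpha> m s w = of_real (wS \<alpha> m w / c) * FT m s w"
      unfolding c_def by (rule phi_AE[OF L12D(2)[OF s12] is_FT_FT[OF s12]])
    have s\<psi>: "sqi ?M (\<lambda>w. of_real (wS \<alpha> m w) * \<psi> n w)"
      by (rule sqi_bound[OF sg, where c = 1]) (measurable, intro AE_I2, auto simp: \<psi>_def g_def)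
    have sFT: "sqi ?M (\<lambda>w. of_real (wS \<alpha> m w) * FT m s w)"
      by (rule sqi_cong_AE[OF sqi_scale[OF phi_sqi[OF sH], where c = "of_real c"]])
        (use ps c sqi_meas[OF plancherel_L12(1)[OF s12]] in \<open>auto elim!: eventually_mono\<close>)
    have "c * Hnorm \<alpha> m (\<lambda>z. s z - \<gamma> z) = nrm ?M (\<lambda>w. of_real c * (phi \<alpha> m s w - phi \<alpha> m \<gamma> w))"
      unfolding Hnorm_diff[OF sH \<gamma>] nrm_scale using c by simp
    also have "\<dots> = nrm ?M (\<lambda>w. of_real (wS \<alpha> m w) * FT m s w - g w)"
    proof (rule nrm_cong_AE)
      show "(\<lambda>w. of_real c * (phi \<alpha> m s w - phi \<alpha> m \<gamma> w)) \<in> borel_measurable ?M"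
        by (intro sqi_meas sqi_scale sqi_diff phi_sqi sH \<gamma>)
      show "(\<lambda>w. of_real (wS \<alpha> m w) * FT m s w - g w) \<in> borel_measurable ?M" by (intro sqi_meas sqi_diff sFT sg)
      show "AE w in ?M. of_real c * (phi \<alpha> m s w - phi \<alpha> m \<gamma> w) = of_real (wS \<alpha> m w) * FT m s w - g w"
        using ps
      proof eventually_elim
        case (elim w)
        have "of_real c * phi \<alpha> m \<gamma> w = g w" using c by (simp add: phi_def g_def c_def[symmetric])
        then show ?case using elim c by (simp add: right_diff_distrib)
      qed
    qed
    also have "\<dots> \<le> nrm ?M (\<lambda>w. of_real (wS \<alpha> m w) * FT m s w - of_real (wS \<alpha> m w) * \<psi> n w) + nrm ?M (\<lambda>w. of_real (wS \<alpha> m w) * \<psi> n w - g w)"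
      by (rule nrm_triangle_diff[OF sFT s\<psi> sg])
    also have "\<dots> < c * e / 2 + c * e / 2"
      using i n unfolding s_def right_diff_distrib by (rule add_strict_mono)
    finally have "Hnorm \<alpha> m (\<lambda>z. s z - \<gamma> z) < e" using c by simp
    then show ?thesis using s by blast
  qed
  have "\<forall>i. \<exists>s. schwartz m s \<and> Hnorm \<alpha> m (\<lambda>z. s z - \<gamma> z) < 1 / real (Suc i)" by (intro allI main) simp
  then obtain s where s: "\<And>i. schwartz m (s i)" "\<And>i. Hnorm \<alpha> m (\<lambda>z. s i z - \<gamma> z) < 1 / real (Suc i)" by metis
  have "(\<lambda>i. Hnorm \<alpha> m (\<lambda>z. s i z - \<gamma> z)) \<longlonglongrightarrow> 0"
  proof (rule Lim_null_comparison[OF _ LIMSEQ_Suc[OF lim_1_over_n]])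
    have "norm (Hnorm \<alpha> m (\<lambda>z. s i z - \<gamma> z)) \<le> 1 / real (Suc i)" for i
      using s(2)[of i] unfolding Hnorm_def by (simp add: less_imp_le)
    then show "\<forall>\<^sub>F i in sequentially. norm (Hnorm \<alpha> m (\<lambda>z. s i z - \<gamma> z)) \<le> 1 / real (Suc i)" by simp
  qed
  then show ?thesis using s(1) by blast
qed

text \<open>Density provides an approximating sequence, so the choice in \<open>B_ext\<close> is not
  vacuous; boundedness of \<open>Bop\<close> forces the same limit along every such sequence, so the
  choice is determined up to null sets.\<close>

lemma B_ext_phi:
  fixes \<gamma> :: "'n::finite kernel"
  assumes \<alpha>: "\<alpha> > real CARD('n) / 2" and \<gamma>: "inH \<alpha> (Suc k) \<gamma>"
  shows "inH \<alpha> k (B_ext \<alpha> k \<gamma>)" "AE w in Mk k. phi \<alpha> k (B_ext \<alpha> k \<gamma>) w = Bop \<alpha> k (phi \<alpha> (Suc k) \<gamma>) w"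
proof -
  have \<alpha>0: "\<alpha> \<ge> 0" using half_card_pos[OF \<alpha>] by simp
  let ?S = "\<lambda>h s. (\<forall>i. schwartz (Suc k) (s i)) \<and>
          (\<lambda>i. Hnorm \<alpha> (Suc k) (\<lambda>z. s i z - \<gamma> z)) \<longlonglongrightarrow> 0 \<and>
          (\<lambda>i. Hnorm \<alpha> k (\<lambda>z. B0 k (s i) z - h z)) \<longlonglongrightarrow> 0"
  let ?P = "\<lambda>h. inH \<alpha> k h \<and> (\<exists>s. ?S h s)"
  define f where "f = Bop \<alpha> k (phi \<alpha> (Suc k) \<gamma>)"
  have sf: "sqi (Mk k) f" unfolding f_def by (rule Bop_sqi(1)[OF \<alpha> phi_sqi[OF \<gamma>]])
  have s_lim: "(\<lambda>i. nrm (Mk k) (\<lambda>w. phi \<alpha> k (B0 k (s i)) w - f w)) \<longlonglongrightarrow> 0"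
    "\<And>i. inH \<alpha> k (B0 k (s i))"
    if s: "\<And>i. schwartz (Suc k) (s i)" "(\<lambda>i. Hnorm \<alpha> (Suc k) (\<lambda>z. s i z - \<gamma> z)) \<longlonglongrightarrow> 0" for s
  proof -
    have sH: "inH \<alpha> (Suc k) (s i)" for i by (rule schwartz_inH[OF s(1) \<alpha>0])
    note B = B0_phi[OF \<alpha> sH schwartz_cts[OF s(1)]]
    show "inH \<alpha> k (B0 k (s i))" for i by (rule B(1))
    have le: "nrm (Mk k) (\<lambda>w. phi \<alpha> k (B0 k (s i)) w - f w) \<le> CB TYPE('n) \<alpha> * real k * Hnorm \<alpha> (Suc k) (\<lambda>z. s i z - \<gamma> z)" for i
    proof -
      have "nrm (Mk k) (\<lambda>w. phi \<alpha> k (B0 k (s i)) w - f w) = nrm (Mk k) (\<lambda>w. Bop \<alpha> k (phi \<alpha> (Suc k) (s i)) w - f w)"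
      proof (rule nrm_cong_AE)
        show "AE w in Mk k. phi \<alpha> k (B0 k (s i)) w - f w = Bop \<alpha> k (phi \<alpha> (Suc k) (s i)) w - f w"
          using B(2)[of i] by eventually_elim simp
      qed (intro sqi_meas sqi_diff phi_sqi B(1) sf Bop_sqi(1) \<alpha> sH)+
      also have "\<dots> \<le> CB TYPE('n) \<alpha> * real k * nrm (Mk (Suc k)) (\<lambda>w. phi \<alpha> (Suc k) (s i) w - phi \<alpha> (Suc k) \<gamma> w)"
        unfolding f_def by (rule Bop_diff_nrm[OF \<alpha> phi_sqi[OF sH] phi_sqi[OF \<gamma>]])
      finally show ?thesis unfolding Hnorm_diff[OF sH \<gamma>] .
    qed
    have "(\<lambda>i. CB TYPE('n) \<alpha> * real k * Hnorm \<alpha> (Suc k) (\<lambda>z. s i z - \<gamma> z)) \<longlonglongrightarrow> 0"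
      using tendsto_mult_right_zero[OF s(2)] .
    then show "(\<lambda>i. nrm (Mk k) (\<lambda>w. phi \<alpha> k (B0 k (s i)) w - f w)) \<longlonglongrightarrow> 0"
      by (rule Lim_null_comparison[rotated]) (use le in auto)
  qed
  \<comment> \<open>The candidate limit is prescribed on the momentum side and pulled back by
    \<open>phi_surj\<close>.\<close>
  obtain h where h: "inH \<alpha> k h" "AE w in Mk k. phi \<alpha> k h w = f w" using phi_surj[OF sf \<alpha>0] by blast
  obtain s where s: "\<And>i. schwartz (Suc k) (s i)" "(\<lambda>i. Hnorm \<alpha> (Suc k) (\<lambda>z. s i z - \<gamma> z)) \<longlonglongrightarrow> 0"
    using schwartz_dense[OF \<gamma> \<alpha>0] by blast
  have "Hnorm \<alpha> k (\<lambda>z. B0 k (s i) z - h z) = nrm (Mk k) (\<lambda>w. phi \<alpha> k (B0 k (s i)) w - f w)" for i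
    unfolding Hnorm_diff[OF s_lim(2)[OF s] h(1)]
  proof (rule nrm_cong_AE)
    show "AE w in Mk k. phi \<alpha> k (B0 k (s i)) w - phi \<alpha> k h w = phi \<alpha> k (B0 k (s i)) w - f w"
      using h(2) by eventually_elim simp
  qed (intro sqi_meas sqi_diff phi_sqi s_lim(2)[OF s] sf h)+
  then have "(\<lambda>i. Hnorm \<alpha> k (\<lambda>z. B0 k (s i) z - h z)) \<longlonglongrightarrow> 0" using s_lim(1)[OF s] by simp
  then have "?P h" using h(1) s by (intro conjI exI[of _ s]) auto
  then have P: "?P (B_ext \<alpha> k \<gamma>)" unfolding B_ext_def by (rule someI[where P = ?P])
  then show iB: "inH \<alpha> k (B_ext \<alpha> k \<gamma>)" by blast
  obtain u where u: "\<And>i. schwartz (Suc k) (u i)" "(\<lambda>i. Hnorm \<alpha> (Suc k) (\<lambda>z. u i z - \<gamma> z)) \<longlonglongrightarrow> 0"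
    "(\<lambda>i. Hnorm \<alpha> k (\<lambda>z. B0 k (u i) z - B_ext \<alpha> k \<gamma> z)) \<longlonglongrightarrow> 0" using P by blast
  note l = s_lim[OF u(1,2)]
  let ?b = "phi \<alpha> k (B_ext \<alpha> k \<gamma>)"
  have sb: "sqi (Mk k) ?b" by (rule phi_sqi[OF iB])
  have "nrm (Mk k) (\<lambda>w. ?b w - f w) \<le> Hnorm \<alpha> k (\<lambda>z. B0 k (u i) z - B_ext \<alpha> k \<gamma> z) + nrm (Mk k) (\<lambda>w. phi \<alpha> k (B0 k (u i)) w - f w)" for i
    using nrm_triangle_diff[OF sb phi_sqi[OF l(2)[of i]] sf] unfolding Hnorm_diff[OF l(2) iB]
    by (simp add: nrm_minus_commute[of _ ?b])
  moreover have "(\<lambda>i. Hnorm \<alpha> k (\<lambda>z. B0 k (u i) z - B_ext \<alpha> k \<gamma> z) + nrm (Mk k) (\<lambda>w. phi \<alpha> k (B0 k (u i)) w - f w)) \<longlonglongrightarrow> 0 + 0"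
    by (intro tendsto_add u(3) l(1))
  ultimately have "nrm (Mk k) (\<lambda>w. ?b w - f w) \<le> 0 + 0" by (intro LIMSEQ_le_const) auto
  then have "nrm (Mk k) (\<lambda>w. ?b w - f w) = 0" using nrm_ge0[of "Mk k" "\<lambda>w. ?b w - f w"] by linarith
  from nrm_zero_AE[OF sqi_diff[OF sb sf] this]
  show "AE w in Mk k. ?b w = Bop \<alpha> k (phi \<alpha> (Suc k) \<gamma>) w" by (simp add: f_def)
qed

section \<open>Hierarchies of evolution equations\<close>

lemma tagged_division_points:
  assumes "p tagged_division_of {a..b::real}" "(x, K) \<in> p"
  shows "x \<in> {a..b}"
  using assms by (metis subsetD tag_in_interval)

text \<open>The tagged sums that approximate the integral lie in V, and V is closed.\<close>

lemma integral_in_closed_subspace: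
  fixes f :: "real \<Rightarrow> 'h::banach"
  assumes V: "subspace V" "closed V" and f: "f integrable_on {a..b}" "\<And>s. s \<in> {a..b} \<Longrightarrow> f s \<in> V"
  shows "integral {a..b} f \<in> V"
proof -
  have "\<exists>y\<in>V. dist y (integral {a..b} f) < e" if e: "e > 0" for e
  proof -
    have "(f has_integral integral {a..b} f) (cbox a b)" using f(1) by (simp add: integrable_integral)
    then obtain d where d: "gauge d" "\<And>p. p tagged_division_of cbox a b \<Longrightarrow> d fine p \<Longrightarrow> norm ((\<Sum>(x, K)\<in>p. measure lborel K *\<^sub>R f x) - integral {a..b} f) < e"
      using e unfolding has_integral by meson
    obtain p where "p tagged_division_of {a..b}" "d fine p" using fine_division_exists_real[OF d(1)] by blast
    then have p: "p tagged_division_of {a..b}" "norm ((\<Sum>(x, K)\<in>p. measure lborel K *\<^sub>R f x) - integral {a..b} f) < e"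
      using d(2) by auto
    have "(\<Sum>(x, K)\<in>p. measure lborel K *\<^sub>R f x) \<in> V"
      using V(1) f(2) tagged_division_points[OF p(1)] by (intro subspace_sum) (auto intro!: subspace_scale)
    then show ?thesis using p(2) by (auto simp: dist_norm)
  qed
  then have "integral {a..b} f \<in> closure V" unfolding closure_approachable by blast
  then show ?thesis using V(2) by simp
qed

section \<open>Binomial resummation of the Duhamel estimates\<close>

lemma integral_power_real: "t \<ge> 0 \<Longrightarrow> ((\<lambda>s. s ^ m) has_integral t ^ Suc m / real (Suc m)) {0..t::real}"
proof -
  assume t: "t \<ge> 0"
  have "((\<lambda>s. s ^ m) has_integral (t ^ Suc m / real (Suc m) - 0 ^ Suc m / real (Suc m))) {0..t}"
  proof (rule fundamental_theorem_of_calculus[OF t])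
    fix x :: real
    have "((\<lambda>s. s ^ Suc m / real (Suc m)) has_real_derivative x ^ m) (at x within {0..t})"
      by (rule derivative_eq_intros refl | simp del: of_nat_Suc)+
    then show "((\<lambda>s. s ^ Suc m / real (Suc m)) has_vector_derivative x ^ m) (at x within {0..t})"
      by (simp add: has_real_derivative_iff_has_vector_derivative)
  qed
  then show ?thesis by simp
qed

text \<open>Trades the factor \<open>i + 1\<close> of the interaction bound and the factor
  \<open>1 / (m + 1)\<close> of the time integral for the next binomial coefficient.\<close>

lemma choose_absorb: "real (Suc m) * real ((Suc (i + m)) choose (Suc m)) = real (Suc i) * real ((Suc i + m) choose m)"
proof -
  have "Suc m * (Suc (m + i) choose Suc m) = Suc i * (Suc (m + i) choose m)" by (rule Suc_times_binomial_add)
  then show ?thesis by (metis add.commute add_Suc of_nat_mult)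
qed

text \<open>The rectangle is enlarged to the triangle \<open>i + m < K + M\<close> and summed along
  diagonals. Since the weight is \<open>\<eta> ^ Suc i\<close>, one factor \<eta> stays outside the
  binomial theorem; it becomes the factor \<open>\<eta> / \<xi>\<close> of the existence
  result.\<close>

lemma duhamel_sum:
  fixes g :: "nat \<Rightarrow> real"
  assumes \<eta>: "\<eta> \<ge> 0" "c \<ge> 0" and g: "\<And>i. g i \<ge> 0"
  shows "(\<Sum>i<K. \<Sum>m<M. \<eta> ^ Suc i * (real ((i + m) choose m) * c ^ m * g (i + m))) \<le> (\<Sum>n<K + M. \<eta> * (\<eta> + c) ^ n * g n)"
proof -
  define a where "a = (\<lambda>i m. \<eta> ^ Suc i * (real ((i + m) choose m) * c ^ m * g (i + m)))"
  have a0: "a i m \<ge> 0" for i m using assms by (simp add: a_def)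
  have fin: "finite {(i, j). i + j < K + M}"
    by (rule finite_subset[of _ "{..<K + M} \<times> {..<K + M}"]) auto
  have "(\<Sum>i<K. \<Sum>m<M. a i m) = (\<Sum>(i, m)\<in>{..<K} \<times> {..<M}. a i m)" by (rule sum.cartesian_product)
  also have "\<dots> \<le> (\<Sum>(i, m)\<in>{(i, j). i + j < K + M}. a i m)"
    by (rule sum_mono2[OF fin]) (auto simp: a0)
  also have "\<dots> = (\<Sum>n<K + M. \<Sum>i\<le>n. a i (n - i))" by (rule sum.triangle_reindex)
  also have "\<dots> = (\<Sum>n<K + M. \<eta> * (\<eta> + c) ^ n * g n)"
  proof (rule sum.cong[OF refl])
    fix n
    have "(\<Sum>i\<le>n. a i (n - i)) = (\<Sum>i\<le>n. (\<eta> * g n) * (real (n choose i) * \<eta> ^ i * c ^ (n - i)))"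
      by (rule sum.cong) (auto simp: a_def binomial_symmetric[symmetric])
    also have "\<dots> = (\<eta> * g n) * (\<eta> + c) ^ n" by (simp add: sum_distrib_left[symmetric] binomial_ring)
    finally show "(\<Sum>i\<le>n. a i (n - i)) = \<eta> * (\<eta> + c) ^ n * g n" by (simp add: ac_simps)
  qed
  finally show ?thesis by (simp add: a_def)
qed

text \<open>The bound S is uniform in both cut-offs: with \<open>i\<close> fixed it makes each row
  summable, and letting M tend to infinity before K it bounds the sum over the rows.\<close>

lemma duhamel_series:
  fixes g :: "nat \<Rightarrow> real"
  assumes \<eta>: "\<eta> > 0" "c \<ge> 0" and g: "\<And>i. g i \<ge> 0" and sg: "summable (\<lambda>n. (\<eta> + c) ^ Suc n * g n)"
  defines "b \<equiv> \<lambda>i. (\<Sum>m. real ((i + m) choose m) * c ^ m * g (i + m))"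
  shows "summable (\<lambda>m. real ((i + m) choose m) * c ^ m * g (i + m))"
    and "summable (\<lambda>i. \<eta> ^ Suc i * b i)"
    and "(\<Sum>i. \<eta> ^ Suc i * b i) \<le> \<eta> / (\<eta> + c) * (\<Sum>n. (\<eta> + c) ^ Suc n * g n)"
proof -
  define S where "S = \<eta> / (\<eta> + c) * (\<Sum>n. (\<eta> + c) ^ Suc n * g n)"
  define h where "h = (\<lambda>i m. real ((i + m) choose m) * c ^ m * g (i + m))"
  have h0: "h i m \<ge> 0" for i m using assms by (simp add: h_def)
  have nz: "\<eta> + c > 0" using \<eta> by simp
  have e: "\<eta> * (\<eta> + c) ^ n * g n = \<eta> / (\<eta> + c) * ((\<eta> + c) ^ Suc n * g n)" for n using nz by simp
  have le: "(\<Sum>i<K. \<Sum>m<M. \<eta> ^ Suc i * h i m) \<le> S" for K M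
  proof -
    have "(\<Sum>i<K. \<Sum>m<M. \<eta> ^ Suc i * h i m) \<le> (\<Sum>n<K + M. \<eta> * (\<eta> + c) ^ n * g n)"
      unfolding h_def by (rule duhamel_sum) (use \<eta> g in auto)
    also have "\<dots> = \<eta> / (\<eta> + c) * (\<Sum>n<K + M. (\<eta> + c) ^ Suc n * g n)" unfolding e sum_distrib_left ..
    also have "\<dots> \<le> S" unfolding S_def using \<eta> nz g by (intro mult_left_mono sum_le_suminf[OF sg]) auto
    finally show ?thesis .
  qed
  have sh: "summable (h i)" for i
  proof (rule bounded_imp_summable)
    show "0 \<le> h i m" for m by (rule h0)
    fix M
    have "\<eta> ^ Suc i * (\<Sum>m\<le>M. h i m) = (\<Sum>m<Suc M. \<eta> ^ Suc i * h i m)" by (simp add: sum_distrib_left lessThan_Suc_atMost)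
    also have "\<dots> \<le> (\<Sum>j<Suc i. \<Sum>m<Suc M. \<eta> ^ Suc j * h j m)"
    proof (rule member_le_sum[of i "{..<Suc i}" "\<lambda>j. \<Sum>m<Suc M. \<eta> ^ Suc j * h j m"])
      show "0 \<le> (\<Sum>m<Suc M. \<eta> ^ Suc j * h j m)" for j
        by (intro sum_nonneg mult_nonneg_nonneg h0 zero_le_power less_imp_le[OF \<eta>(1)])
    qed auto
    also have "\<dots> \<le> S" by (rule le)
    finally show "(\<Sum>m\<le>M. h i m) \<le> S / \<eta> ^ Suc i" using \<eta> by (simp add: pos_le_divide_eq mult.commute)
  qed
  then show "summable (\<lambda>m. real ((i + m) choose m) * c ^ m * g (i + m))" by (simp add: h_def)
  have b: "b i = suminf (h i)" for i by (simp add: b_def h_def)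
  have b0: "b i \<ge> 0" for i unfolding b using h0 by (intro suminf_nonneg sh)
  have part: "(\<Sum>i<K. \<eta> ^ Suc i * b i) \<le> S" for K
  proof (rule LIMSEQ_le_const2)
    show "(\<lambda>M. \<Sum>i<K. \<Sum>m<M. \<eta> ^ Suc i * h i m) \<longlonglongrightarrow> (\<Sum>i<K. \<eta> ^ Suc i * b i)"
      unfolding sum_distrib_left[symmetric] b by (intro tendsto_sum tendsto_mult tendsto_const summable_LIMSEQ sh)
    show "\<exists>N. \<forall>n\<ge>N. (\<Sum>i<K. \<Sum>m<n. \<eta> ^ Suc i * h i m) \<le> S" using le by blast
  qed
  have nn: "0 \<le> \<eta> ^ Suc i * b i" for i using b0 \<eta> by (intro mult_nonneg_nonneg) auto
  show sb: "summable (\<lambda>i. \<eta> ^ Suc i * b i)"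
    by (rule bounded_imp_summable[where B = S]) (use nn part[of "Suc _"] in \<open>auto simp: lessThan_Suc_atMost\<close>)
  show "(\<Sum>i. \<eta> ^ Suc i * b i) \<le> \<eta> / (\<eta> + c) * (\<Sum>n. (\<eta> + c) ^ Suc n * g n)"
    unfolding S_def[symmetric] by (rule suminf_le_const[OF sb part])
qed

text \<open>One term of \<open>(q + (1 - q)) ^ (i + N) = 1\<close>, for some q between r and 1,
  bounds the coefficient by \<open>1 / ((1 - q) ^ i * q ^ N)\<close>.\<close>

lemma binomial_geometric_tendsto:
  fixes r :: real
  assumes r: "0 \<le> r" "r < 1"
  shows "(\<lambda>N. real ((i + N) choose N) * r ^ N) \<longlonglongrightarrow> 0"
proof -
  obtain q where q: "r < q" "q < 1" using dense r(2) by blast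
  have q0: "q > 0" using q r by linarith
  have le: "real ((i + N) choose N) * r ^ N \<le> (1 / (1 - q) ^ i) * (r / q) ^ N" for N
  proof -
    have "real ((i + N) choose N) * q ^ N * (1 - q) ^ (i + N - N) \<le> (\<Sum>j\<le>i + N. real ((i + N) choose j) * q ^ j * (1 - q) ^ (i + N - j))"
      using q q0 by (intro member_le_sum[of N "{..i + N}" "\<lambda>j. real ((i + N) choose j) * q ^ j * (1 - q) ^ (i + N - j)"]) auto
    also have "\<dots> = (q + (1 - q)) ^ (i + N)" by (rule binomial_ring[symmetric])
    finally have "real ((i + N) choose N) \<le> 1 / ((1 - q) ^ i * q ^ N)" using q q0 by (simp add: field_simps)
    then have "real ((i + N) choose N) * r ^ N \<le> 1 / ((1 - q) ^ i * q ^ N) * r ^ N" using r by (intro mult_right_mono) auto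
    then show ?thesis by (simp add: power_divide)
  qed
  have "(\<lambda>N. (1 / (1 - q) ^ i) * (r / q) ^ N) \<longlonglongrightarrow> (1 / (1 - q) ^ i) * 0"
    using q q0 r by (intro tendsto_mult tendsto_const LIMSEQ_power_zero) auto
  then have l: "(\<lambda>N. (1 / (1 - q) ^ i) * (r / q) ^ N) \<longlonglongrightarrow> 0" by simp
  show ?thesis by (rule Lim_null_comparison[OF _ l]) (use le r in auto)
qed

text \<open>Here \<open>f i\<close> belongs to level \<open>i + 1\<close> of the hierarchy.\<close>
lemma hierarchy_iterate:
  fixes f :: "nat \<Rightarrow> real \<Rightarrow> real" and a :: "nat \<Rightarrow> real"
  assumes C: "C \<ge> 0" and \<tau>: "0 \<le> \<tau>"
    and cont: "\<And>i. continuous_on {0..T} (f i)"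
    and a: "\<And>i. a i \<ge> 0"
    and f: "\<And>i t. \<tau> \<le> t \<Longrightarrow> t \<le> T \<Longrightarrow> f i t \<le> a i + C * real (Suc i) * integral {\<tau>..t} (f (Suc i))"
    and M: "\<And>i t. \<tau> \<le> t \<Longrightarrow> t \<le> T \<Longrightarrow> f i t \<le> M i"
  shows "\<tau> \<le> t \<Longrightarrow> t \<le> T \<Longrightarrow> f i t \<le> (\<Sum>m<N. real ((i + m) choose m) * (C * (t - \<tau>)) ^ m * a (i + m))
     + real ((i + N) choose N) * (C * (t - \<tau>)) ^ N * M (i + N)"
proof (induction N arbitrary: i t)
  case 0
  then show ?case using M by simp
next
  case (Suc N)
  define t' where "t' = t - \<tau>"
  have t': "t' \<ge> 0" using Suc.prems by (simp add: t'_def)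
  \<comment> \<open>The induction hypothesis at level \<open>Suc i\<close> as a polynomial in the
    elapsed time; I is its integral.\<close>
  define G where "G = (\<lambda>s. (\<Sum>m<N. (real ((Suc i + m) choose m) * C ^ m * a (Suc i + m)) * s ^ m) + (real ((Suc i + N) choose N) * C ^ N * M (Suc i + N)) * s ^ N)"
  define I where "I = (\<Sum>m<N. (real ((Suc i + m) choose m) * C ^ m * a (Suc i + m)) * (t' ^ Suc m / real (Suc m)))
     + (real ((Suc i + N) choose N) * C ^ N * M (Suc i + N)) * (t' ^ Suc N / real (Suc N))"
  have GI: "(G has_integral I) {0..t'}"
    unfolding G_def I_def
    by (intro has_integral_add has_integral_sum has_integral_mult_right integral_power_real t') auto
  then have "((\<lambda>s. G (s - \<tau>)) has_integral I) {\<tau>..t}"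
  proof -
    have "(\<lambda>x. (1 / 1) *\<^sub>R x + - ((1 / 1) *\<^sub>R (- \<tau>))) ` {0..t'} = {\<tau>..t}"
      using image_add_atLeastAtMost[of \<tau> 0 t'] by (simp add: t'_def add.commute)
    then show ?thesis using has_integral_affinity[of G I 0 t' 1 "- \<tau>"] GI by (simp add: t'_def)
  qed
  then have GI': "((\<lambda>s. G (s - \<tau>)) has_integral I) {\<tau>..t}" .
  have fi: "f (Suc i) integrable_on {\<tau>..t}"
    by (rule integrable_continuous_interval) (use cont[of "Suc i"] \<tau> Suc.prems in \<open>auto intro: continuous_on_subset\<close>)
  have "integral {\<tau>..t} (f (Suc i)) \<le> I"
  proof (rule has_integral_le[OF integrable_integral[OF fi] GI'])
    fix s assume "s \<in> {\<tau>..t}"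
    then have "f (Suc i) s \<le> (\<Sum>m<N. real ((Suc i + m) choose m) * (C * (s - \<tau>)) ^ m * a (Suc i + m)) + real ((Suc i + N) choose N) * (C * (s - \<tau>)) ^ N * M (Suc i + N)"
      using Suc.prems by (intro Suc.IH) auto
    also have "\<dots> = G (s - \<tau>)" unfolding G_def by (simp add: power_mult_distrib ac_simps)
    finally show "f (Suc i) s \<le> G (s - \<tau>)" .
  qed
  then have "f i t \<le> a i + C * real (Suc i) * I"
    using f[OF Suc.prems, of i] C mult_left_mono[of "integral {\<tau>..t} (f (Suc i))" I "C * real (Suc i)"] by simp
  also have "C * real (Suc i) * I = (\<Sum>m<N. real ((i + Suc m) choose Suc m) * (C * t') ^ Suc m * a (i + Suc m)) + real ((i + Suc N) choose Suc N) * (C * t') ^ Suc N * M (i + Suc N)"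
  proof -
    have step: "C * real (Suc i) * ((real ((Suc i + m) choose m) * C ^ m * x) * (t' ^ Suc m / real (Suc m))) = real ((i + Suc m) choose Suc m) * (C * t') ^ Suc m * x" for m x
    proof -
      have "real (Suc i) * real ((Suc i + m) choose m) = real (Suc m) * real ((i + Suc m) choose Suc m)" using choose_absorb[of m i] by simp
      then have "C * real (Suc i) * ((real ((Suc i + m) choose m) * C ^ m * x) * (t' ^ Suc m / real (Suc m)))
        = (real (Suc m) * real ((i + Suc m) choose Suc m)) * (C ^ Suc m * x * t' ^ Suc m) / real (Suc m)"
        by (simp add: ac_simps del: of_nat_Suc binomial_Suc_Suc)
      then show ?thesis by (simp add: power_mult_distrib ac_simps del: of_nat_Suc binomial_Suc_Suc)
    qed
    show ?thesis unfolding I_def distrib_left sum_distrib_left step by simp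
  qed
  also have "a i + ((\<Sum>m<N. real ((i + Suc m) choose Suc m) * (C * t') ^ Suc m * a (i + Suc m)) + real ((i + Suc N) choose Suc N) * (C * t') ^ Suc N * M (i + Suc N))
    = (\<Sum>m<Suc N. real ((i + m) choose m) * (C * t') ^ m * a (i + m)) + real ((i + Suc N) choose Suc N) * (C * t') ^ Suc N * M (i + Suc N)"
    unfolding sum.lessThan_Suc_shift by simp
  finally show ?case by (simp add: t'_def)
qed

text \<open>The bound \<open>M / \<eta> ^ Suc i\<close> is what membership in the weighted space
  provides; it turns the remainder into the sequence of \<open>binomial_geometric_tendsto\<close>
  with \<open>r = C * (t - \<tau>) / \<eta>\<close>. The separate c gives a majorant that can be
  kept the same for all t.\<close>

lemma hierarchy_bound:
  fixes f :: "nat \<Rightarrow> real \<Rightarrow> real" and a :: "nat \<Rightarrow> real"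
  assumes C: "C \<ge> 0" and \<tau>: "0 \<le> \<tau>" and \<eta>: "\<eta> > 0"
    and cont: "\<And>i. continuous_on {0..T} (f i)"
    and a: "\<And>i. a i \<ge> 0"
    and f: "\<And>i t. \<tau> \<le> t \<Longrightarrow> t \<le> T \<Longrightarrow> f i t \<le> a i + C * real (Suc i) * integral {\<tau>..t} (f (Suc i))"
    and M: "\<And>i t. \<tau> \<le> t \<Longrightarrow> t \<le> T \<Longrightarrow> f i t \<le> M / \<eta> ^ Suc i"
    and t: "\<tau> \<le> t" "t \<le> T" "C * (t - \<tau>) < \<eta>"
    and c: "C * (t - \<tau>) \<le> c" and s: "summable (\<lambda>m. real ((i + m) choose m) * c ^ m * a (i + m))"
  shows "f i t \<le> (\<Sum>m. real ((i + m) choose m) * c ^ m * a (i + m))"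
proof (rule LIMSEQ_le_const)
  let ?d = "C * (t - \<tau>)"
  have d0: "?d \<ge> 0" using C t by simp
  define r where "r = ?d / \<eta>"
  have r: "0 \<le> r" "r < 1" using d0 t \<eta> by (auto simp: r_def)
  let ?S = "\<Sum>m. real ((i + m) choose m) * c ^ m * a (i + m)"
  have "(\<lambda>N. ?S + (real ((i + N) choose N) * r ^ N) * (M / \<eta> ^ Suc i)) \<longlonglongrightarrow> ?S + 0 * (M / \<eta> ^ Suc i)"
    by (intro tendsto_add tendsto_const tendsto_mult binomial_geometric_tendsto r)
  then show "(\<lambda>N. ?S + (real ((i + N) choose N) * r ^ N) * (M / \<eta> ^ Suc i)) \<longlonglongrightarrow> ?S" by simp
  have "f i t \<le> ?S + (real ((i + N) choose N) * r ^ N) * (M / \<eta> ^ Suc i)" for N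
  proof -
    have "f i t \<le> (\<Sum>m<N. real ((i + m) choose m) * ?d ^ m * a (i + m)) + real ((i + N) choose N) * ?d ^ N * (M / \<eta> ^ Suc (i + N))"
      by (rule hierarchy_iterate[OF C \<tau> cont a f M t(1,2)])
    also have "(\<Sum>m<N. real ((i + m) choose m) * ?d ^ m * a (i + m)) \<le> (\<Sum>m<N. real ((i + m) choose m) * c ^ m * a (i + m))"
      using d0 c a by (intro sum_mono mult_right_mono mult_left_mono power_mono) auto
    also have "\<dots> \<le> ?S" using d0 c a by (intro sum_le_suminf s) (auto intro!: mult_nonneg_nonneg)
    also have "real ((i + N) choose N) * ?d ^ N * (M / \<eta> ^ Suc (i + N)) = (real ((i + N) choose N) * r ^ N) * (M / \<eta> ^ Suc i)"
      using \<eta> by (simp add: r_def power_divide power_add field_simps)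
    finally show ?thesis by simp
  qed
  then show "\<exists>N. \<forall>n\<ge>N. f i t \<le> ?S + (real ((i + n) choose n) * r ^ n) * (M / \<eta> ^ Suc i)" by blast
qed

text \<open>The iteration converges on time steps of length \<open>\<eta> / (2 * C)\<close>, and finitely many such steps cover the interval.\<close>
lemma hierarchy_zero:
  fixes f :: "nat \<Rightarrow> real \<Rightarrow> real"
  assumes C: "C > 0" and \<eta>: "\<eta> > 0"
    and cont: "\<And>i. continuous_on {0..T} (f i)"
    and nn: "\<And>i t. 0 \<le> t \<Longrightarrow> t \<le> T \<Longrightarrow> 0 \<le> f i t"
    and f: "\<And>i t. 0 \<le> t \<Longrightarrow> t \<le> T \<Longrightarrow> f i t \<le> C * real (Suc i) * integral {0..t} (f (Suc i))"
    and M: "\<And>i t. 0 \<le> t \<Longrightarrow> t \<le> T \<Longrightarrow> f i t \<le> M / \<eta> ^ Suc i"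
    and t: "0 \<le> t" "t \<le> T"
  shows "f i t = 0"
proof -
  define d where "d = \<eta> / (2 * C)"
  have d: "d > 0" using C \<eta> by (simp add: d_def)
  \<comment> \<open>All levels advance together, since the estimate at each level refers to the next
    higher one.\<close>
  have "\<forall>i t. 0 \<le> t \<longrightarrow> t \<le> T \<longrightarrow> t \<le> real n * d \<longrightarrow> f i t = 0" for n
  proof (induction n)
    case 0
    have "f i 0 = 0" if "0 \<le> T" for i using f[of 0 i] nn[of 0 i] that by simp
    then show ?case by (metis mult_zero_left of_nat_0 order_antisym)
  next
    case (Suc n)
    show ?case
    proof (intro allI impI)
      fix i t assume t: "0 \<le> t" "t \<le> T" "t \<le> real (Suc n) * d"
      define \<tau> where "\<tau> = real n * d"
      have \<tau>: "0 \<le> \<tau>" using d by (simp add: \<tau>_def)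
      show "f i t = 0"
      proof (cases "t \<le> \<tau>")
        case True
        then show ?thesis using Suc.IH t by (simp add: \<tau>_def)
      next
        case False
        \<comment> \<open>The previous steps make \<open>f (Suc i)\<close> vanish up to \<tau>, so
          the integral may start there.\<close>
        have f': "f i t \<le> 0 + C * real (Suc i) * integral {\<tau>..t} (f (Suc i))" if t: "\<tau> \<le> t" "t \<le> T" for i t
        proof -
          have int: "f (Suc i) integrable_on {0..t}"
            by (rule integrable_continuous_interval) (use cont[of "Suc i"] t \<tau> in \<open>auto intro: continuous_on_subset\<close>)
          have "integral {0..\<tau>} (f (Suc i)) + integral {\<tau>..t} (f (Suc i)) = integral {0..t} (f (Suc i))"
            by (rule Henstock_Kurzweil_Integration.integral_combine[OF \<tau> t(1) int])
          moreover have "integral {0..\<tau>} (f (Suc i)) = integral {0..\<tau>} (\<lambda>_. 0)"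
            by (rule Henstock_Kurzweil_Integration.integral_cong) (use Suc.IH t in \<open>auto simp: \<tau>_def\<close>)
          ultimately show ?thesis using f[of t i] t \<tau> by simp
        qed
        have "C * (t - \<tau>) \<le> C * d" using t(3) C by (intro mult_left_mono) (auto simp: \<tau>_def algebra_simps)
        also have "\<dots> = \<eta> / 2" using C by (simp add: d_def)
        also have "\<dots> < \<eta>" using \<eta> by simp
        finally have lt: "C * (t - \<tau>) < \<eta>" .
        have "f i t \<le> (\<Sum>m. real ((i + m) choose m) * (C * (t - \<tau>)) ^ m * 0)"
          by (rule hierarchy_bound[where T = T and f = f and a = "\<lambda>_. 0" and M = M, OF _ \<tau> \<eta> cont _ f' M]) (use C False t lt \<tau> in auto)
        then show ?thesis using nn[of t i] t by simp
      qed
    qed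
  qed
  moreover obtain n :: nat where "t / d \<le> real n" using real_arch_simple by blast
  then have "t \<le> real n * d" using d by (simp add: field_simps)
  ultimately show ?thesis using t by blast
qed

text \<open>The levels are closed subspaces of one Banach space, and the operators are controlled
  only on them. Hence \<open>U_integral\<close> is an assumption about integrands with values in
  \<open>V k\<close> rather than a consequence of bounded linearity on the whole space.\<close>

locale gp_hierarchy =
  fixes V :: "nat \<Rightarrow> 'h::banach set" and U :: "nat \<Rightarrow> real \<Rightarrow> 'h \<Rightarrow> 'h" and B :: "nat \<Rightarrow> 'h \<Rightarrow> 'h" and C :: real
  assumes C: "C > 0"
    and V_sub: "subspace (V k)" and V_closed: "closed (V k)"
    and U_V: "v \<in> V k \<Longrightarrow> U k t v \<in> V k"
    and U_add: "u \<in> V k \<Longrightarrow> v \<in> V k \<Longrightarrow> U k t (u + v) = U k t u + U k t v"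
    and U_scale: "v \<in> V k \<Longrightarrow> U k t (c *\<^sub>R v) = c *\<^sub>R U k t v"
    and U_norm: "v \<in> V k \<Longrightarrow> norm (U k t v) = norm v"
    and U_0: "v \<in> V k \<Longrightarrow> U k 0 v = v"
    and U_comp: "v \<in> V k \<Longrightarrow> U k s (U k t v) = U k (s + t) v"
    and U_integral: "\<And>f. f integrable_on {a..b} \<Longrightarrow> (\<And>s. s \<in> {a..b} \<Longrightarrow> f s \<in> V k) \<Longrightarrow>
      (\<lambda>s. U k t (f s)) integrable_on {a..b::real} \<Longrightarrow> U k t (integral {a..b} f) = integral {a..b} (\<lambda>s. U k t (f s))"
    and U_cont: "v \<in> V k \<Longrightarrow> continuous_on UNIV (\<lambda>t. U k t v)"
    and B_V: "v \<in> V (Suc k) \<Longrightarrow> B k v \<in> V k"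
    and B_add: "u \<in> V (Suc k) \<Longrightarrow> v \<in> V (Suc k) \<Longrightarrow> B k (u + v) = B k u + B k v"
    and B_scale: "v \<in> V (Suc k) \<Longrightarrow> B k (c *\<^sub>R v) = c *\<^sub>R B k v"
    and B_norm: "v \<in> V (Suc k) \<Longrightarrow> norm (B k v) \<le> C * real k * norm v"
begin

lemma U_diff: "u \<in> V k \<Longrightarrow> v \<in> V k \<Longrightarrow> U k t (u - v) = U k t u - U k t v"
  using U_add[of u k "- v" t] U_scale[of v k t "-1"] subspace_neg[OF V_sub, of v] by simp

lemma B_diff: "u \<in> V (Suc k) \<Longrightarrow> v \<in> V (Suc k) \<Longrightarrow> B k (u - v) = B k u - B k v"
  using B_add[of u k "- v"] B_scale[of v k "-1"] subspace_neg[OF V_sub, of v] by simp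

lemma V_diff: "u \<in> V k \<Longrightarrow> v \<in> V k \<Longrightarrow> u - v \<in> V k"
  by (rule subspace_diff[OF V_sub])

text \<open>Strong continuity in time combines with the isometry property, which is uniform in time,
  to joint continuity.\<close>

lemma cont_U:
  assumes g: "continuous_on S g" and v: "continuous_on S v" "\<And>s. s \<in> S \<Longrightarrow> v s \<in> V k"
  shows "continuous_on S (\<lambda>s. U k (g s) (v s))"
  unfolding continuous_on_def
proof
  fix s0 assume s0: "s0 \<in> S"
  have "((\<lambda>t. U k t (v s0)) \<longlongrightarrow> U k (g s0) (v s0)) (at (g s0))"
    using U_cont[OF v(2)[OF s0]] unfolding continuous_on_def by simp
  then have "isCont (\<lambda>t. U k t (v s0)) (g s0)" by (simp add: isCont_def)
  then have "((\<lambda>s. U k (g s) (v s0)) \<longlongrightarrow> U k (g s0) (v s0)) (at s0 within S)"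
    using g s0 unfolding continuous_on_def by (auto intro: isCont_tendsto_compose)
  then have 1: "((\<lambda>s. norm (U k (g s) (v s0) - U k (g s0) (v s0))) \<longlongrightarrow> 0) (at s0 within S)"
    by (intro tendsto_norm_zero LIM_zero)
  have "(v \<longlongrightarrow> v s0) (at s0 within S)" using v(1) s0 unfolding continuous_on_def by blast
  then have 2: "((\<lambda>s. norm (v s - v s0)) \<longlongrightarrow> 0) (at s0 within S)" by (intro tendsto_norm_zero LIM_zero)
  have 3: "((\<lambda>s. norm (v s - v s0) + norm (U k (g s) (v s0) - U k (g s0) (v s0))) \<longlongrightarrow> 0) (at s0 within S)"
    using tendsto_add[OF 2 1] by simp
  show "((\<lambda>s. U k (g s) (v s)) \<longlongrightarrow> U k (g s0) (v s0)) (at s0 within S)"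
  proof (rule LIM_zero_cancel, rule Lim_null_comparison[OF _ 3])
    have "norm (U k (g s) (v s) - U k (g s0) (v s0)) \<le> norm (v s - v s0) + norm (U k (g s) (v s0) - U k (g s0) (v s0))" if s: "s \<in> S" for s
    proof -
      have "norm (U k (g s) (v s) - U k (g s) (v s0)) = norm (v s - v s0)"
        unfolding U_diff[OF v(2)[OF s] v(2)[OF s0], symmetric] by (rule U_norm[OF V_diff[OF v(2)[OF s] v(2)[OF s0]]])
      then show ?thesis using norm_triangle_ineq[of "U k (g s) (v s) - U k (g s) (v s0)" "U k (g s) (v s0) - U k (g s0) (v s0)"] by simp
    qed
    then show "\<forall>\<^sub>F s in at s0 within S. norm (U k (g s) (v s) - U k (g s0) (v s0)) \<le> norm (v s - v s0) + norm (U k (g s) (v s0) - U k (g s0) (v s0))"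
      by (auto simp: eventually_at_filter)
  qed
qed

lemma cont_B:
  assumes v: "continuous_on S v" "\<And>s. s \<in> S \<Longrightarrow> v s \<in> V (Suc k)"
  shows "continuous_on S (\<lambda>s. B k (v s))"
  unfolding continuous_on_def
proof
  fix s0 assume s0: "s0 \<in> S"
  have "(v \<longlongrightarrow> v s0) (at s0 within S)" using v(1) s0 unfolding continuous_on_def by blast
  then have "((\<lambda>s. norm (v s - v s0)) \<longlongrightarrow> 0) (at s0 within S)" by (intro tendsto_norm_zero LIM_zero)
  from tendsto_mult_right_zero[OF this] have 3: "((\<lambda>s. C * real k * norm (v s - v s0)) \<longlongrightarrow> 0) (at s0 within S)" .
  show "((\<lambda>s. B k (v s)) \<longlongrightarrow> B k (v s0)) (at s0 within S)"
  proof (rule LIM_zero_cancel, rule Lim_null_comparison[OF _ 3])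
    have "norm (B k (v s) - B k (v s0)) \<le> C * real k * norm (v s - v s0)" if s: "s \<in> S" for s
      using B_norm[OF V_diff[OF v(2)[OF s] v(2)[OF s0]]] B_diff[OF v(2)[OF s] v(2)[OF s0]] by simp
    then show "\<forall>\<^sub>F s in at s0 within S. norm (B k (v s) - B k (v s0)) \<le> C * real k * norm (v s - v s0)"
      by (auto simp: eventually_at_filter)
  qed
qed

text \<open>The interaction picture: conjugation removes the free evolution from the Duhamel
  formula, and the norm bound of \<open>B\<close> is kept since \<open>U\<close> is
  isometric.\<close>

definition Bint :: "nat \<Rightarrow> real \<Rightarrow> 'h \<Rightarrow> 'h" where
  "Bint k s v = U k (- s) (B k (U (Suc k) s v))"

lemma Bint_V: "v \<in> V (Suc k) \<Longrightarrow> Bint k s v \<in> V k"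
  unfolding Bint_def by (intro U_V B_V)

lemma Bint_norm: "v \<in> V (Suc k) \<Longrightarrow> norm (Bint k s v) \<le> C * real k * norm v"
  unfolding Bint_def using B_norm[OF U_V, of v k s] by (simp add: U_norm U_V B_V)

lemma Bint_add: "u \<in> V (Suc k) \<Longrightarrow> v \<in> V (Suc k) \<Longrightarrow> Bint k s (u + v) = Bint k s u + Bint k s v"
  unfolding Bint_def by (simp add: U_add B_add U_V B_V)

lemma Bint_diff: "u \<in> V (Suc k) \<Longrightarrow> v \<in> V (Suc k) \<Longrightarrow> Bint k s (u - v) = Bint k s u - Bint k s v"
  unfolding Bint_def by (simp add: U_diff B_diff U_V B_V)

lemma cont_Bint:
  assumes v: "continuous_on S v" "\<And>s. s \<in> S \<Longrightarrow> v s \<in> V (Suc k)"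
  shows "continuous_on S (\<lambda>s. Bint k s (v s))"
  unfolding Bint_def by (intro cont_U cont_B continuous_intros v U_V B_V)

primrec duhamel :: "(nat \<Rightarrow> 'h) \<Rightarrow> nat \<Rightarrow> nat \<Rightarrow> real \<Rightarrow> 'h" where
  "duhamel \<gamma>0 0 k t = \<gamma>0 k"
| "duhamel \<gamma>0 (Suc m) k t = integral {0..t} (\<lambda>s. Bint k s (duhamel \<gamma>0 m (Suc k) s))"

text \<open>Membership, continuity and the estimate are proved together: the first two make the next
  integral meaningful, and \<open>choose_absorb\<close> propagates the third.\<close>

lemma duhamel_props:
  assumes \<gamma>0: "\<And>i. \<gamma>0 (Suc i) \<in> V (Suc i)"
  shows "(\<forall>t\<in>{0..T}. duhamel \<gamma>0 m (Suc i) t \<in> V (Suc i)) \<and> continuous_on {0..T} (duhamel \<gamma>0 m (Suc i)) \<and>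
    (\<forall>t\<in>{0..T}. norm (duhamel \<gamma>0 m (Suc i) t) \<le> real ((i + m) choose m) * (C * t) ^ m * norm (\<gamma>0 (Suc (i + m))))"
proof (induction m arbitrary: i)
  case 0
  have "duhamel \<gamma>0 0 (Suc i) = (\<lambda>t. \<gamma>0 (Suc i))" by (rule ext) simp
  then show ?case using \<gamma>0 by simp
next
  case (Suc m)
  let ?e = "duhamel \<gamma>0 m (Suc (Suc i))"
  note IH = Suc.IH[of "Suc i"]
  have ca: "continuous_on {0..T} (\<lambda>s. Bint (Suc i) s (?e s))" by (rule cont_Bint) (use IH in auto)
  have ci: "(\<lambda>s. Bint (Suc i) s (?e s)) integrable_on {0..t}" if "t \<in> {0..T}" for t
    by (rule integrable_continuous_interval[OF continuous_on_subset[OF ca]]) (use that in auto)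
  have cE: "continuous_on {0..T} (duhamel \<gamma>0 (Suc m) (Suc i))"
  proof (cases "0 \<le> T")
    case True
    have "continuous_on {0..T} (\<lambda>t. integral {0..t} (\<lambda>s. Bint (Suc i) s (?e s)))"
      by (rule indefinite_integral_continuous_1) (use ci True in auto)
    then show ?thesis by (simp add: fun_eq_iff cong: continuous_on_cong)
  qed simp
  have "duhamel \<gamma>0 (Suc m) (Suc i) t \<in> V (Suc i) \<and> norm (duhamel \<gamma>0 (Suc m) (Suc i) t) \<le> real ((i + Suc m) choose Suc m) * (C * t) ^ Suc m * norm (\<gamma>0 (Suc (i + Suc m)))" if t: "t \<in> {0..T}" for t
  proof
    show "duhamel \<gamma>0 (Suc m) (Suc i) t \<in> V (Suc i)"
      unfolding duhamel.simps
      by (rule integral_in_closed_subspace[OF V_sub V_closed ci[OF t]]) (use IH t in \<open>auto intro!: Bint_V\<close>)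
    let ?g = "norm (\<gamma>0 (Suc (i + Suc m)))"
    let ?K = "C * real (Suc i) * (real ((Suc i + m) choose m) * C ^ m * ?g)"
    have hi: "((\<lambda>s. ?K * s ^ m) has_integral ?K * (t ^ Suc m / real (Suc m))) {0..t}"
      by (intro has_integral_mult_right integral_power_real) (use t in auto)
    have "norm (duhamel \<gamma>0 (Suc m) (Suc i) t) \<le> integral {0..t} (\<lambda>s. ?K * s ^ m)"
      unfolding duhamel.simps
    proof (rule integral_norm_bound_integral[OF ci[OF t] has_integral_integrable[OF hi]])
      fix s assume s: "s \<in> {0..t}"
      then have sT: "s \<in> {0..T}" using t by auto
      have "norm (Bint (Suc i) s (?e s)) \<le> C * real (Suc i) * norm (?e s)" using IH sT by (intro Bint_norm) auto
      also have "\<dots> \<le> C * real (Suc i) * (real ((Suc i + m) choose m) * (C * s) ^ m * norm (\<gamma>0 (Suc (Suc i + m))))"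
        using IH sT C by (intro mult_left_mono) auto
      also have "\<dots> = ?K * s ^ m" by (simp add: power_mult_distrib ac_simps)
      finally show "norm (Bint (Suc i) s (?e s)) \<le> ?K * s ^ m" .
    qed
    also have "\<dots> = ?K * (t ^ Suc m / real (Suc m))" using hi by (rule integral_unique)
    also have "\<dots> = (real (Suc i) * real ((Suc i + m) choose m)) * (C ^ Suc m * ?g * t ^ Suc m) / real (Suc m)"
      by (simp add: ac_simps del: of_nat_Suc binomial_Suc_Suc)
    also have "real (Suc i) * real ((Suc i + m) choose m) = real (Suc m) * real ((i + Suc m) choose Suc m)" using choose_absorb[of m i] by simp
    also have "(real (Suc m) * real ((i + Suc m) choose Suc m)) * (C ^ Suc m * ?g * t ^ Suc m) / real (Suc m) = real ((i + Suc m) choose Suc m) * (C * t) ^ Suc m * ?g"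
      by (simp add: power_mult_distrib ac_simps del: of_nat_Suc binomial_Suc_Suc)
    finally show "norm (duhamel \<gamma>0 (Suc m) (Suc i) t) \<le> real ((i + Suc m) choose Suc m) * (C * t) ^ Suc m * ?g" .
  qed
  then show ?case using cE by blast
qed

text \<open>The Duhamel series converges uniformly in t by the Weierstrass test, with the estimates
  at time T as majorants, so its integral equation is the limit of the one for partial sums.
  Applying \<open>U\<close> afterwards returns from the interaction picture.\<close>

theorem exists_solution:
  assumes \<gamma>0: "\<And>i. \<gamma>0 (Suc i) \<in> V (Suc i)" and T: "T > 0" and \<eta>: "\<eta> > 0" "\<xi> = \<eta> + C * T"
    and s: "summable (\<lambda>i. \<xi> ^ Suc i * norm (\<gamma>0 (Suc i)))"
  shows "\<exists>\<gamma> b. (\<forall>i. \<forall>t\<in>{0..T}. \<gamma> t (Suc i) \<in> V (Suc i) \<and> norm (\<gamma> t (Suc i)) \<le> b i \<and>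
        \<gamma> t (Suc i) = U (Suc i) t (\<gamma>0 (Suc i)) + integral {0..t} (\<lambda>s. U (Suc i) (t - s) (B (Suc i) (\<gamma> s (Suc (Suc i)))))) \<and>
     (\<forall>i. continuous_on {0..T} (\<lambda>t. \<gamma> t (Suc i))) \<and>
     summable (\<lambda>i. \<eta> ^ Suc i * b i) \<and> (\<Sum>i. \<eta> ^ Suc i * b i) \<le> \<eta> / \<xi> * (\<Sum>i. \<xi> ^ Suc i * norm (\<gamma>0 (Suc i)))"
proof -
  define g where "g = (\<lambda>i. norm (\<gamma>0 (Suc i)))"
  define b where "b = (\<lambda>i. (\<Sum>m. real ((i + m) choose m) * (C * T) ^ m * g (i + m)))"
  have CT: "C * T \<ge> 0" using C T by simp
  have D: "summable (\<lambda>m. real ((i + m) choose m) * (C * T) ^ m * g (i + m))"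
    "summable (\<lambda>i. \<eta> ^ Suc i * b i)" "(\<Sum>i. \<eta> ^ Suc i * b i) \<le> \<eta> / \<xi> * (\<Sum>n. \<xi> ^ Suc n * g n)" for i
    using duhamel_series[of \<eta> "C * T" g, OF \<eta>(1) CT] s unfolding b_def \<eta>(2) by (auto simp: g_def)
  note P = duhamel_props[OF \<gamma>0, of T]
  let ?duhamel = "duhamel \<gamma>0"
  define \<beta> where "\<beta> = (\<lambda>i t. \<Sum>m. ?duhamel m (Suc i) t)"
  define S where "S = (\<lambda>n i t. \<Sum>m<n. ?duhamel m (Suc i) t)"
  have nb: "norm (?duhamel m (Suc i) t) \<le> real ((i + m) choose m) * (C * T) ^ m * g (i + m)" if t: "t \<in> {0..T}" for m i t
  proof -
    have "norm (?duhamel m (Suc i) t) \<le> real ((i + m) choose m) * (C * t) ^ m * g (i + m)" using P t by (simp add: g_def)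
    also have "\<dots> \<le> real ((i + m) choose m) * (C * T) ^ m * g (i + m)"
      using t C by (intro mult_right_mono mult_left_mono power_mono) (auto simp: g_def)
    finally show ?thesis .
  qed
  have ul: "uniform_limit {0..T} (\<lambda>n. S n i) (\<beta> i) sequentially" for i
    unfolding S_def \<beta>_def using nb D(1)[of i] by (rule Weierstrass_m_test)
  have Sc: "continuous_on {0..T} (S n i)" for n i unfolding S_def using P by (intro continuous_on_sum) auto
  have \<beta>c: "continuous_on {0..T} (\<beta> i)" for i
    by (rule uniform_limit_theorem[OF _ ul]) (use Sc in auto)
  have SV: "S n i t \<in> V (Suc i)" if "t \<in> {0..T}" for n i t unfolding S_def using P that by (intro subspace_sum[OF V_sub]) auto
  have \<beta>lim: "(\<lambda>n. S n i t) \<longlonglongrightarrow> \<beta> i t" if "t \<in> {0..T}" for i t using ul that by (rule tendsto_uniform_limitI)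
  have \<beta>V: "\<beta> i t \<in> V (Suc i)" if "t \<in> {0..T}" for i t
    by (rule closed_sequentially[OF V_closed _ \<beta>lim[OF that]]) (use SV that in auto)
  have sumE: "summable (\<lambda>m. norm (?duhamel m (Suc i) t))" if "t \<in> {0..T}" for i t
    by (rule summable_comparison_test'[OF D(1)[of i], of 0]) (use nb that in auto)
  have \<beta>b: "norm (\<beta> i t) \<le> b i" if "t \<in> {0..T}" for i t
  proof -
    have "norm (\<beta> i t) \<le> (\<Sum>m. norm (?duhamel m (Suc i) t))" unfolding \<beta>_def by (rule summable_norm[OF sumE[OF that]])
    also have "\<dots> \<le> b i" unfolding b_def by (rule suminf_le[OF nb[OF that] sumE[OF that] D(1)])
    finally show ?thesis .
  qed
  have \<beta>eq: "\<beta> i t = \<gamma>0 (Suc i) + integral {0..t} (\<lambda>s. Bint (Suc i) s (\<beta> (Suc i) s))" if t: "t \<in> {0..T}" for i t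
  proof -
    let ?f = "\<lambda>n s. Bint (Suc i) s (S n (Suc i) s)" and ?h = "\<lambda>s. Bint (Suc i) s (\<beta> (Suc i) s)"
    have ut: "uniform_limit {0..t} (\<lambda>n. S n (Suc i)) (\<beta> (Suc i)) sequentially"
      by (rule uniform_limit_on_subset[OF ul]) (use t in auto)
    have uf: "uniform_limit {0..t} ?f ?h sequentially"
    proof (rule uniform_limitI)
      fix e :: real assume e: "e > 0"
      define c where "c = C * real (Suc i)"
      have c: "c > 0" using C by (simp add: c_def)
      have "\<forall>\<^sub>F n in sequentially. \<forall>s\<in>{0..t}. dist (S n (Suc i) s) (\<beta> (Suc i) s) < e / c"
        using uniform_limitD[OF ut, of "e / c"] e c by simp
      then show "\<forall>\<^sub>F n in sequentially. \<forall>s\<in>{0..t}. dist (?f n s) (?h s) < e"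
      proof eventually_elim
        case (elim n)
        show ?case
        proof
          fix s assume s: "s \<in> {0..t}"
          then have sT: "s \<in> {0..T}" using t by auto
          have "dist (?f n s) (?h s) \<le> c * norm (S n (Suc i) s - \<beta> (Suc i) s)"
            unfolding dist_norm c_def Bint_diff[OF SV[OF sT] \<beta>V[OF sT], symmetric]
            by (rule Bint_norm[OF V_diff[OF SV[OF sT] \<beta>V[OF sT]]])
          also have "\<dots> < c * (e / c)" using elim s c by (intro mult_strict_left_mono) (auto simp: dist_norm)
          finally show "dist (?f n s) (?h s) < e" using c by simp
        qed
      qed
    qed
    have cf: "continuous_on {0..t} (?f n)" for n
      by (rule cont_Bint[OF continuous_on_subset[OF Sc]]) (use t SV in auto)
    obtain I J where I: "\<And>n. (?f n has_integral I n) {0..t}" "(?h has_integral J) {0..t}" "I \<longlonglongrightarrow> J"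
      using uniform_limit_integral[OF uf cf] by auto
    have cE: "(\<lambda>s. Bint (Suc i) s (?duhamel m (Suc (Suc i)) s)) integrable_on {0..t}" for m
    proof (rule integrable_continuous_interval, rule cont_Bint)
      show "continuous_on {0..t} (?duhamel m (Suc (Suc i)))" using P[of m "Suc i"] t by (auto intro: continuous_on_subset)
      show "?duhamel m (Suc (Suc i)) s \<in> V (Suc (Suc i))" if "s \<in> {0..t}" for s using P[of m "Suc i"] t that by auto
    qed
    have A0: "Bint k s 0 = 0" for k s using Bint_diff[of 0 k 0 s] subspace_0[OF V_sub] by simp
    have fS: "?f n s = (\<Sum>m<n. Bint (Suc i) s (?duhamel m (Suc (Suc i)) s))" if s: "s \<in> {0..t}" for n s
    proof -
      have sT: "s \<in> {0..T}" using s t by auto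
      show ?thesis
      proof (induction n)
        case 0 then show ?case by (simp add: S_def A0)
      next
        case (Suc n)
        have "S (Suc n) (Suc i) s = S n (Suc i) s + ?duhamel n (Suc (Suc i)) s" by (simp add: S_def)
        moreover have "?duhamel n (Suc (Suc i)) s \<in> V (Suc (Suc i))" using P[of n "Suc i"] sT by auto
        ultimately show ?case using Suc Bint_add[OF SV[OF sT, of n "Suc i"]] by simp
      qed
    qed
    \<comment> \<open>One more term on the left: the zeroth term is the datum, and each later term
      is the integral of its predecessor at the next level.\<close>
    have SI: "S (Suc n) i t = \<gamma>0 (Suc i) + I n" for n
    proof -
      have "I n = integral {0..t} (?f n)" by (rule integral_unique[OF I(1), symmetric])
      also have "\<dots> = integral {0..t} (\<lambda>s. \<Sum>m<n. Bint (Suc i) s (?duhamel m (Suc (Suc i)) s))"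
        by (rule Henstock_Kurzweil_Integration.integral_cong) (use fS in auto)
      also have "\<dots> = (\<Sum>m<n. integral {0..t} (\<lambda>s. Bint (Suc i) s (?duhamel m (Suc (Suc i)) s)))"
        by (rule Henstock_Kurzweil_Integration.integral_sum) (use cE in auto)
      also have "\<dots> = (\<Sum>m<n. ?duhamel (Suc m) (Suc i) t)" by simp
      finally have "I n = (\<Sum>m<n. ?duhamel (Suc m) (Suc i) t)" .
      moreover have "S (Suc n) i t = ?duhamel 0 (Suc i) t + (\<Sum>m<n. ?duhamel (Suc m) (Suc i) t)" unfolding S_def by (rule sum.lessThan_Suc_shift)
      ultimately show ?thesis by simp
    qed
    have "(\<lambda>n. S (Suc n) i t) \<longlonglongrightarrow> \<gamma>0 (Suc i) + J" unfolding SI by (intro tendsto_intros I(3))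
    then have "\<beta> i t = \<gamma>0 (Suc i) + J" using LIMSEQ_unique LIMSEQ_Suc[OF \<beta>lim[OF t]] by blast
    then show ?thesis using integral_unique[OF I(2)] by simp
  qed
  \<comment> \<open>\<beta> counts from 0 and the levels from 1, hence \<open>k - 1\<close>.\<close>
  define \<gamma> where "\<gamma> = (\<lambda>t k. U k t (\<beta> (k - 1) t))"
  have \<gamma>: "\<gamma> t (Suc i) = U (Suc i) t (\<beta> i t)" for t i by (simp add: \<gamma>_def)
  have "\<gamma> t (Suc i) \<in> V (Suc i) \<and> norm (\<gamma> t (Suc i)) \<le> b i \<and>
        \<gamma> t (Suc i) = U (Suc i) t (\<gamma>0 (Suc i)) + integral {0..t} (\<lambda>s. U (Suc i) (t - s) (B (Suc i) (\<gamma> s (Suc (Suc i)))))"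
    if t: "t \<in> {0..T}" for i t
  proof (intro conjI)
    show "\<gamma> t (Suc i) \<in> V (Suc i)" unfolding \<gamma> by (intro U_V \<beta>V t)
    show "norm (\<gamma> t (Suc i)) \<le> b i" unfolding \<gamma> U_norm[OF \<beta>V[OF t]] by (rule \<beta>b[OF t])
    let ?h = "\<lambda>s. Bint (Suc i) s (\<beta> (Suc i) s)"
    have sub: "{0..t} \<subseteq> {0..T}" using t by auto
    have ch: "continuous_on {0..t} ?h"
      by (rule cont_Bint[OF continuous_on_subset[OF \<beta>c sub]]) (use \<beta>V sub in blast)
    have hV: "?h s \<in> V (Suc i)" if "s \<in> {0..t}" for s using \<beta>V sub that by (intro Bint_V) blast
    have ih: "?h integrable_on {0..t}" by (rule integrable_continuous_interval[OF ch])
    have iU: "(\<lambda>s. U (Suc i) t (?h s)) integrable_on {0..t}"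
      by (rule integrable_continuous_interval) (intro cont_U ch hV continuous_intros)
    have IV: "integral {0..t} ?h \<in> V (Suc i)" by (rule integral_in_closed_subspace[OF V_sub V_closed ih hV])
    have "\<gamma> t (Suc i) = U (Suc i) t (\<gamma>0 (Suc i)) + U (Suc i) t (integral {0..t} ?h)"
      unfolding \<gamma> \<beta>eq[OF t] by (rule U_add[OF \<gamma>0 IV])
    also have "U (Suc i) t (integral {0..t} ?h) = integral {0..t} (\<lambda>s. U (Suc i) t (?h s))"
      by (rule U_integral[OF ih hV iU])
    also have "\<dots> = integral {0..t} (\<lambda>s. U (Suc i) (t - s) (B (Suc i) (\<gamma> s (Suc (Suc i)))))"
    proof (rule Henstock_Kurzweil_Integration.integral_cong)
      fix s assume "s \<in> {0..t}"
      then have "\<beta> (Suc i) s \<in> V (Suc (Suc i))" using \<beta>V sub by blast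
      then show "U (Suc i) t (?h s) = U (Suc i) (t - s) (B (Suc i) (\<gamma> s (Suc (Suc i))))"
        unfolding Bint_def \<gamma> by (subst U_comp) (auto intro!: B_V U_V)
    qed
    finally show "\<gamma> t (Suc i) = U (Suc i) t (\<gamma>0 (Suc i)) + integral {0..t} (\<lambda>s. U (Suc i) (t - s) (B (Suc i) (\<gamma> s (Suc (Suc i)))))" .
  qed
  moreover have "continuous_on {0..T} (\<lambda>t. \<gamma> t (Suc i))" for i
    unfolding \<gamma> by (intro cont_U \<beta>c \<beta>V continuous_intros)
  ultimately show ?thesis using D(2,3) unfolding g_def by blast
qed

text \<open>Linearity of the equation and the isometry of \<open>U\<close> give the inequality that
  \<open>hierarchy_bound\<close> and \<open>hierarchy_zero\<close> iterate.\<close>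

lemma solution_diff_bound:
  assumes v: "continuous_on {0..T} v" "\<And>t. t \<in> {0..T} \<Longrightarrow> v t \<in> V (Suc k)" and w: "continuous_on {0..T} w" "\<And>t. t \<in> {0..T} \<Longrightarrow> w t \<in> V (Suc k)"
    and t: "t \<in> {0..T}" and ab: "a \<in> V k" "a' \<in> V k"
    and x: "x = U k t a + integral {0..t} (\<lambda>s. U k (t - s) (B k (v s)))"
    and y: "y = U k t a' + integral {0..t} (\<lambda>s. U k (t - s) (B k (w s)))"
  shows "norm (x - y) \<le> norm (a - a') + C * real k * integral {0..t} (\<lambda>s. norm (v s - w s))"
proof -
  have sub: "{0..t} \<subseteq> {0..T}" using t by auto
  have i: "(\<lambda>s. U k (t - s) (B k (u s))) integrable_on {0..t}" if "continuous_on {0..T} u" "\<And>t. t \<in> {0..T} \<Longrightarrow> u t \<in> V (Suc k)" for u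
  proof (rule integrable_continuous_interval, rule cont_U)
    show "continuous_on {0..t} (\<lambda>s. B k (u s))" by (rule cont_B[OF continuous_on_subset[OF that(1) sub]]) (use that(2) sub in blast)
  qed (use that(2) sub in \<open>auto intro!: continuous_intros B_V\<close>)
  have n: "(\<lambda>s. norm (v s - w s)) integrable_on {0..t}"
    by (intro integrable_continuous_interval continuous_intros continuous_on_subset[OF v(1) sub] continuous_on_subset[OF w(1) sub])
  have "x - y = U k t (a - a') + integral {0..t} (\<lambda>s. U k (t - s) (B k (v s)) - U k (t - s) (B k (w s)))"
    using Henstock_Kurzweil_Integration.integral_diff[OF i[OF v] i[OF w]] unfolding x y U_diff[OF ab] by simp
  also have "norm (U k t (a - a') + integral {0..t} (\<lambda>s. U k (t - s) (B k (v s)) - U k (t - s) (B k (w s)))) \<le> norm (U k t (a - a')) + norm (integral {0..t} (\<lambda>s. U k (t - s) (B k (v s)) - U k (t - s) (B k (w s))))"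
    by (rule norm_triangle_ineq)
  also have "norm (U k t (a - a')) = norm (a - a')" by (rule U_norm[OF V_diff[OF ab]])
  also have "norm (integral {0..t} (\<lambda>s. U k (t - s) (B k (v s)) - U k (t - s) (B k (w s)))) \<le> integral {0..t} (\<lambda>s. (C * real k) * norm (v s - w s))"
  proof (rule integral_norm_bound_integral)
    show "(\<lambda>s. U k (t - s) (B k (v s)) - U k (t - s) (B k (w s))) integrable_on {0..t}"
      by (rule Henstock_Kurzweil_Integration.integrable_diff[OF i[OF v] i[OF w]])
    show "(\<lambda>s. C * real k * norm (v s - w s)) integrable_on {0..t}" using integrable_cmul[OF n, of "C * real k"] by simp
    fix s assume "s \<in> {0..t}"
    then have s: "v s \<in> V (Suc k)" "w s \<in> V (Suc k)" using v(2) w(2) sub by auto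
    have "U k (t - s) (B k (v s)) - U k (t - s) (B k (w s)) = U k (t - s) (B k (v s - w s))"
      unfolding B_diff[OF s] by (rule U_diff[symmetric]) (intro B_V s)+
    then show "norm (U k (t - s) (B k (v s)) - U k (t - s) (B k (w s))) \<le> C * real k * norm (v s - w s)"
      using B_norm[OF V_diff[OF s]] by (simp add: U_norm[OF B_V[OF V_diff[OF s]]])
  qed
  also have "integral {0..t} (\<lambda>s. (C * real k) * norm (v s - w s)) = C * real k * integral {0..t} (\<lambda>s. norm (v s - w s))"
    by (rule Henstock_Kurzweil_Integration.integral_mult_right)
  finally show ?thesis by simp
qed

end

instance bcontfun :: (metric_space, banach) banach ..

text \<open>With a discrete domain the bounded continuous functions are all the bounded functions,
  so boundedness alone places a function in the space used by \<open>emb\<close>.\<close>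

lemma continuous_on_discrete_type: "continuous_on UNIV (f :: 'a discrete \<Rightarrow> 'b::topological_space)"
  by (simp add: continuous_on_open_vimage open_discrete)

section \<open>One Banach space for all levels\<close>

text \<open>The levels are spaces over different measures. Pairing with the unit ball of test functions embeds each of them isometrically into the same space of bounded functions.\<close>
definition emb :: "'a measure \<Rightarrow> ('a \<Rightarrow> complex) \<Rightarrow> ('a \<Rightarrow> complex) discrete \<Rightarrow>\<^sub>C complex" where
  "emb M f = Bcontfun (\<lambda>\<phi>. if sqi M (of_discrete \<phi>) \<and> nrm M (of_discrete \<phi>) \<le> 1 then ip M f (of_discrete \<phi>) else 0)"

lemma emb_apply:
  assumes f: "sqi M f"
  shows "apply_bcontfun (emb M f) \<phi> = (if sqi M (of_discrete \<phi>) \<and> nrm M (of_discrete \<phi>) \<le> 1 then ip M f (of_discrete \<phi>) else 0)"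
proof -
  have "(\<lambda>\<phi>. if sqi M (of_discrete \<phi>) \<and> nrm M (of_discrete \<phi>) \<le> 1 then ip M f (of_discrete \<phi>) else 0) \<in> bcontfun"
  proof (rule bcontfun_normI[where b = "nrm M f"])
    fix \<phi> :: "('a \<Rightarrow> complex) discrete"
    have "cmod (ip M f (of_discrete \<phi>)) \<le> nrm M f" if "sqi M (of_discrete \<phi>)" "nrm M (of_discrete \<phi>) \<le> 1"
      using cauchy_schwarz_ip[OF f that(1)] mult_left_mono[OF that(2), of "nrm M f"] by simp
    then show "norm (if sqi M (of_discrete \<phi>) \<and> nrm M (of_discrete \<phi>) \<le> 1 then ip M f (of_discrete \<phi>) else 0) \<le> nrm M f"
      by simp
  qed (rule continuous_on_discrete_type)
  then show ?thesis unfolding emb_def by (simp add: Bcontfun_inverse)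
qed

text \<open>Cauchy-Schwarz bounds the supremum, and the test function \<open>f\<close> divided by
  its norm attains it.\<close>

lemma norm_emb:
  assumes f: "sqi M f"
  shows "norm (emb M f) = nrm M f"
proof (rule antisym)
  show "norm (emb M f) \<le> nrm M f"
  proof (rule norm_bound)
    fix \<phi>
    show "norm (apply_bcontfun (emb M f) \<phi>) \<le> nrm M f"
      unfolding emb_apply[OF f] using cauchy_schwarz_ip[OF f, of "of_discrete \<phi>"]
        mult_left_mono[of "nrm M (of_discrete \<phi>)" 1 "nrm M f"] by auto
  qed
  show "nrm M f \<le> norm (emb M f)"
  proof (cases "nrm M f = 0")
    case False
    define n where "n = nrm M f"
    have n: "n > 0" using False nrm_ge0[of M f] unfolding n_def by linarith
    define \<phi> where "\<phi> = (\<lambda>z. of_real (1 / n) * f z)"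
    have 1: "sqi M \<phi>" unfolding \<phi>_def by (rule sqi_scale[OF f])
    have 2: "nrm M \<phi> = 1" using n unfolding \<phi>_def nrm_scale by (simp add: norm_divide n_def[symmetric])
    have "ip M f \<phi> = of_real n" unfolding \<phi>_def ip_scale_right ip_self using n by (simp add: n_def[symmetric] power2_eq_square)
    then have "norm (apply_bcontfun (emb M f) (discrete \<phi>)) = n" using 1 2 n by (simp add: emb_apply[OF f] discrete_inverse)
    then show ?thesis using norm_bounded[of "emb M f" "discrete \<phi>"] by (simp add: n_def)
  qed simp
qed

lemma emb_add: "sqi M f \<Longrightarrow> sqi M g \<Longrightarrow> emb M (\<lambda>z. f z + g z) = emb M f + emb M g"
  by (rule bcontfun_eqI) (simp add: emb_apply sqi_add ip_add_left)

lemma emb_diff: "sqi M f \<Longrightarrow> sqi M g \<Longrightarrow> emb M (\<lambda>z. f z - g z) = emb M f - emb M g"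
  by (rule bcontfun_eqI) (simp add: emb_apply sqi_diff ip_diff_left)

lemma emb_scale: "sqi M f \<Longrightarrow> emb M (\<lambda>z. of_real c * f z) = c *\<^sub>R emb M f"
  by (rule bcontfun_eqI) (simp add: emb_apply sqi_scale ip_scale_left scaleR_conv_of_real)

lemma emb_cong:
  assumes "sqi M f" "sqi M g" "AE z in M. f z = g z"
  shows "emb M f = emb M g"
  by (rule bcontfun_eqI)
    (auto simp: emb_apply assms intro!: ip_cong_AE sqi_meas assms)

lemma emb_eqD:
  assumes "sqi M f" "sqi M g" "emb M f = emb M g"
  shows "AE z in M. f z = g z"
proof -
  have "nrm M (\<lambda>z. f z - g z) = norm (emb M f - emb M g)" using assms by (simp add: norm_emb[symmetric] sqi_diff emb_diff)
  then have "AE z in M. f z - g z = 0" using assms by (intro nrm_zero_AE sqi_diff) auto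
  then show ?thesis by simp
qed

definition embV :: "'a measure \<Rightarrow> (('a \<Rightarrow> complex) discrete \<Rightarrow>\<^sub>C complex) set" where
  "embV M = emb M ` {f. sqi M f}"

lemma emb_embV [intro]: "sqi M f \<Longrightarrow> emb M f \<in> embV M"
  by (simp add: embV_def)

lemma embV_cases:
  assumes "v \<in> embV M" obtains f where "sqi M f" "v = emb M f"
  using assms by (auto simp: embV_def)

lemma subspace_embV: "subspace (embV M)"
proof (rule subspaceI)
  have "emb M (\<lambda>z. 0) = 0" using norm_emb[of M "\<lambda>z. 0"] by (simp add: nrm_def)
  then show "0 \<in> embV M" using emb_embV[of M "\<lambda>z. 0"] by simp
  show "x + y \<in> embV M" if "x \<in> embV M" "y \<in> embV M" for x y
    using that by (elim embV_cases) (auto simp: emb_add[symmetric] intro: sqi_add)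
  show "c *\<^sub>R x \<in> embV M" if "x \<in> embV M" for c x
    using that by (elim embV_cases) (auto simp: emb_scale[symmetric] intro: sqi_scale)
qed

text \<open>The embedding is isometric, so a convergent sequence pulls back to a Cauchy sequence,
  which converges by \<open>sqi_complete\<close>.\<close>

lemma closed_embV: "closed (embV M)"
  unfolding closed_sequential_limits
proof (intro allI impI)
  fix x l assume xl: "(\<forall>n. x n \<in> embV M) \<and> x \<longlonglongrightarrow> l"
  then have "\<forall>n. \<exists>f. sqi M f \<and> x n = emb M f" by (auto simp: embV_def)
  then obtain f where f: "\<And>n. sqi M (f n)" "\<And>n. x n = emb M (f n)" by metis
  have d: "nrm M (\<lambda>z. f m z - f n z) = norm (x m - x n)" for m n
    using f by (simp add: norm_emb[symmetric] sqi_diff emb_diff)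
  have "Cauchy x" using xl by (auto intro: LIMSEQ_imp_Cauchy)
  then have "\<exists>N. \<forall>m\<ge>N. \<forall>n\<ge>N. nrm M (\<lambda>z. f m z - f n z) < e" if "e > 0" for e
    using that unfolding d Cauchy_def dist_norm by blast
  from sqi_complete[OF f(1) this] obtain g where g: "sqi M g" "(\<lambda>i. nrm M (\<lambda>z. f i z - g z)) \<longlonglongrightarrow> 0" by blast
  have "(\<lambda>i. norm (x i - emb M g)) \<longlonglongrightarrow> 0"
    using g by (simp add: f norm_emb[symmetric] sqi_diff emb_diff)
  then have "x \<longlonglongrightarrow> emb M g" by (rule LIM_zero_cancel[OF tendsto_norm_zero_cancel])
  then have "l = emb M g" using xl LIMSEQ_unique by blast
  then show "l \<in> embV M" using g by auto
qed

definition rep :: "'a measure \<Rightarrow> (('a \<Rightarrow> complex) discrete \<Rightarrow>\<^sub>C complex) \<Rightarrow> 'a \<Rightarrow> complex" where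
  "rep M v = (SOME f. sqi M f \<and> emb M f = v)"

lemma rep_emb:
  assumes "sqi M f"
  shows "sqi M (rep M (emb M f))" "AE z in M. rep M (emb M f) z = f z"
proof -
  have r: "sqi M (rep M (emb M f)) \<and> emb M (rep M (emb M f)) = emb M f"
    unfolding rep_def by (rule someI[of _ f]) (simp add: assms)
  then show "sqi M (rep M (emb M f))" by blast
  show "AE z in M. rep M (emb M f) z = f z" using r by (intro emb_eqD assms) auto
qed

text \<open>Rescaling removes the restriction of the embedding to the unit ball of test functions.\<close>
definition pair :: "'a measure \<Rightarrow> ('a \<Rightarrow> complex) \<Rightarrow> (('a \<Rightarrow> complex) discrete \<Rightarrow>\<^sub>C complex) \<Rightarrow> complex" where
  "pair M \<phi> v = of_real (1 + nrm M \<phi>) * apply_bcontfun v (discrete (\<lambda>z. of_real (1 / (1 + nrm M \<phi>)) * \<phi> z))"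

lemma pair_emb:
  assumes f: "sqi M f" and \<phi>: "sqi M \<phi>"
  shows "pair M \<phi> (emb M f) = ip M f \<phi>"
proof -
  define n where "n = 1 + nrm M \<phi>"
  have n: "n > 0" using nrm_ge0[of M \<phi>] by (simp add: n_def add_pos_nonneg)
  have s: "sqi M (\<lambda>z. of_real (1 / n) * \<phi> z)" by (rule sqi_scale[OF \<phi>])
  have "nrm M (\<lambda>z. of_real (1 / n) * \<phi> z) = nrm M \<phi> / n" unfolding nrm_scale using n by (simp add: norm_divide)
  also have "\<dots> \<le> 1" using n by (simp add: n_def)
  finally have l: "nrm M (\<lambda>z. of_real (1 / n) * \<phi> z) \<le> 1" .
  have "pair M \<phi> (emb M f) = of_real n * ip M f (\<lambda>z. of_real (1 / n) * \<phi> z)"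
    unfolding pair_def emb_apply[OF f] n_def[symmetric] using s l by (simp add: discrete_inverse)
  also have "\<dots> = ip M f \<phi>" unfolding ip_scale_right using n by simp
  finally show ?thesis .
qed

text \<open>Evaluation at a point is bounded and linear on the whole ambient space, not only on
  \<open>embV M\<close>; this is what lets it commute with integrals.\<close>

lemma bounded_linear_pair: "bounded_linear (pair M \<phi>)"
proof (rule bounded_linear_intro[where K = "\<bar>1 + nrm M \<phi>\<bar>"])
  show "pair M \<phi> (x + y) = pair M \<phi> x + pair M \<phi> y" for x y by (simp add: pair_def distrib_left)
  show "pair M \<phi> (r *\<^sub>R x) = r *\<^sub>R pair M \<phi> x" for r x by (simp add: pair_def scaleR_conv_of_real)
  show "norm (pair M \<phi> x) \<le> norm x * \<bar>1 + nrm M \<phi>\<bar>" for x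
    unfolding pair_def norm_mult norm_of_real by (subst mult.commute) (intro mult_right_mono norm_bounded abs_ge_zero)
qed

text \<open>It suffices to test with the function that v itself represents.\<close>

lemma pair_zeroD:
  assumes v: "v \<in> embV M" and z: "\<And>\<phi>. sqi M \<phi> \<Longrightarrow> pair M \<phi> v = 0"
  shows "v = 0"
proof -
  obtain f where f: "sqi M f" "v = emb M f" using v by (rule embV_cases)
  have "ip M f f = 0" using z[OF f(1)] pair_emb[OF f(1) f(1)] f(2) by simp
  then have "nrm M f = 0" by (simp add: ip_self)
  then show ?thesis using norm_emb[OF f(1)] f(2) by simp
qed

lemma pair_cong:
  assumes v: "v \<in> embV M" and "sqi M \<phi>" "sqi M \<psi>" "AE z in M. \<phi> z = \<psi> z"
  shows "pair M \<phi> v = pair M \<psi> v"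
  using v by (rule embV_cases) (auto simp: pair_emb assms intro!: ip_cong_AE sqi_meas assms)

text \<open>Defined through a representative, hence meaningful only on \<open>embV (Mk k)\<close>;
  \<open>Ul_emb\<close> shows independence of the representative.\<close>

definition Ul :: "nat \<Rightarrow> real \<Rightarrow> ('n::finite kernel discrete \<Rightarrow>\<^sub>C complex) \<Rightarrow> ('n kernel discrete \<Rightarrow>\<^sub>C complex)" where
  "Ul k t v = emb (Mk k) (\<lambda>w. cis (t * \<theta> k w) * rep (Mk k) v w)"

lemma sqi_phase:
  assumes f: "sqi (Mk k) f"
  shows "sqi (Mk k) (\<lambda>w. cis (t * \<theta> k w) * f w)"
proof -
  note [measurable] = sqi_meas[OF f]
  have [measurable]: "cis \<in> borel_measurable borel" by (intro borel_measurable_continuous_onI continuous_intros)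
  show ?thesis by (rule sqi_bound[OF f, where c = 1]) (auto simp: norm_mult)
qed

lemma Ul_emb:
  fixes f :: "'n::finite kernel"
  assumes f: "sqi (Mk k) f"
  shows "Ul k t (emb (Mk k) f) = emb (Mk k) (\<lambda>w. cis (t * \<theta> k w) * f w)"
  unfolding Ul_def using rep_emb[OF f] by (intro emb_cong sqi_phase f) auto

lemma pair_Ul:
  assumes v: "v \<in> embV (Mk k)" and \<phi>: "sqi (Mk k) \<phi>"
  shows "pair (Mk k) \<phi> (Ul k t v) = pair (Mk k) (\<lambda>w. cis (- t * \<theta> k w) * \<phi> w) v"
proof -
  obtain f where f: "sqi (Mk k) f" "v = emb (Mk k) f" using v by (rule embV_cases)
  show ?thesis
    unfolding f(2) Ul_emb[OF f(1)] pair_emb[OF sqi_phase[OF f(1)] \<phi>] pair_emb[OF f(1) sqi_phase[OF \<phi>]]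
    by (simp add: ip_def cis_cnj ac_simps)
qed

text \<open>Outside \<open>embV\<close> the operator \<open>Ul\<close> has no known linearity.
  Testing with \<phi> moves the phase to the test function, and the resulting functional does
  commute with integrals; such functionals separate the points of \<open>embV\<close>.\<close>

lemma Ul_integral:
  fixes f :: "real \<Rightarrow> 'n::finite kernel discrete \<Rightarrow>\<^sub>C complex"
  assumes f: "f integrable_on {a..b}" "\<And>s. s \<in> {a..b} \<Longrightarrow> f s \<in> embV (Mk k)"
    and U: "(\<lambda>s. Ul k t (f s)) integrable_on {a..b}"
  shows "Ul k t (integral {a..b} f) = integral {a..b} (\<lambda>s. Ul k t (f s))"
proof -
  have V: "Ul k t v \<in> embV (Mk k)" if "v \<in> embV (Mk k)" for v :: "'n kernel discrete \<Rightarrow>\<^sub>C complex"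
    using that by (rule embV_cases) (auto simp: Ul_emb intro: sqi_phase)
  note IV = integral_in_closed_subspace[OF subspace_embV closed_embV]
  have "Ul k t (integral {a..b} f) - integral {a..b} (\<lambda>s. Ul k t (f s)) = 0"
  proof (rule pair_zeroD)
    show "Ul k t (integral {a..b} f) - integral {a..b} (\<lambda>s. Ul k t (f s)) \<in> embV (Mk k)"
      by (intro subspace_diff[OF subspace_embV] V IV f U)
    fix \<phi> :: "'n kernel" assume \<phi>: "sqi (Mk k) \<phi>"
    let ?\<psi> = "\<lambda>w. cis (- t * \<theta> k w) * \<phi> w"
    have "pair (Mk k) \<phi> (integral {a..b} (\<lambda>s. Ul k t (f s))) = integral {a..b} (\<lambda>s. pair (Mk k) \<phi> (Ul k t (f s)))"
      using integral_linear[OF U bounded_linear_pair] by (simp add: o_def)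
    also have "\<dots> = integral {a..b} (pair (Mk k) ?\<psi> \<circ> f)"
      by (rule Henstock_Kurzweil_Integration.integral_cong) (simp add: pair_Ul[OF f(2) \<phi>])
    also have "\<dots> = pair (Mk k) \<phi> (Ul k t (integral {a..b} f))"
      by (rule trans[OF integral_linear[OF f(1) bounded_linear_pair] pair_Ul[OF IV[OF f] \<phi>, symmetric]])
    finally show "pair (Mk k) \<phi> (Ul k t (integral {a..b} f) - integral {a..b} (\<lambda>s. Ul k t (f s))) = 0"
      by (simp add: linear_diff[OF bounded_linear.linear[OF bounded_linear_pair]])
  qed
  then show ?thesis by simp
qed

definition Bl :: "real \<Rightarrow> real \<Rightarrow> nat \<Rightarrow> ('n::finite kernel discrete \<Rightarrow>\<^sub>C complex) \<Rightarrow> ('n kernel discrete \<Rightarrow>\<^sub>C complex)" where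
  "Bl \<alpha> \<mu> k v = emb (Mk k) (\<lambda>w. - \<i> * of_real \<mu> * Bop \<alpha> k (rep (Mk (Suc k)) v) w)"

text \<open>Functions equal almost everywhere have distance 0, and the operator bound
  \<open>Bop_diff_nrm\<close> carries this over to their images.\<close>

lemma Bop_cong:
  fixes f :: "'n::finite kernel"
  assumes \<alpha>: "\<alpha> > real CARD('n) / 2" and f: "sqi (Mk (Suc k)) f" "sqi (Mk (Suc k)) g"
    and e: "AE z in Mk (Suc k). f z = g z"
  shows "AE w in Mk k. Bop \<alpha> k f w = Bop \<alpha> k g w"
proof -
  have "nrm (Mk (Suc k)) (\<lambda>z. f z - g z) = nrm (Mk (Suc k)) ((\<lambda>z. 0) :: 'n kernel)"
  proof (rule nrm_cong_AE)
    show "(\<lambda>z. f z - g z) \<in> borel_measurable (Mk (Suc k))" by (intro sqi_meas sqi_diff f)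
    show "AE z in Mk (Suc k). f z - g z = 0" using e by eventually_elim simp
  qed simp
  then have "nrm (Mk k) (\<lambda>w. Bop \<alpha> k f w - Bop \<alpha> k g w) \<le> 0" using Bop_diff_nrm[OF \<alpha> f] by (simp add: nrm_def[of _ "\<lambda>z. 0"])
  then have "nrm (Mk k) (\<lambda>w. Bop \<alpha> k f w - Bop \<alpha> k g w) = 0" by (intro antisym nrm_ge0)
  then have "AE w in Mk k. Bop \<alpha> k f w - Bop \<alpha> k g w = 0" by (intro nrm_zero_AE sqi_diff Bop_sqi(1) \<alpha> f)
  then show ?thesis by simp
qed

lemma Bl_emb:
  fixes f :: "'n::finite kernel"
  assumes \<alpha>: "\<alpha> > real CARD('n) / 2" and f: "sqi (Mk (Suc k)) f"
  shows "Bl \<alpha> \<mu> k (emb (Mk (Suc k)) f) = emb (Mk k) (\<lambda>w. - \<i> * of_real \<mu> * Bop \<alpha> k f w)"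
  unfolding Bl_def using Bop_cong[OF \<alpha> rep_emb(1)[OF f] f rep_emb(2)[OF f]]
  by (intro emb_cong sqi_scale Bop_sqi(1) \<alpha> f rep_emb(1)) auto

text \<open>Dominated convergence: the phases converge pointwise and have modulus 1.\<close>

lemma Ul_cont:
  fixes f :: "'n::finite kernel"
  assumes f: "sqi (Mk k) f"
  shows "continuous_on UNIV (\<lambda>t. Ul k t (emb (Mk k) f))"
  unfolding continuous_on_sequentially
proof (intro allI ballI impI)
  fix X :: "nat \<Rightarrow> real" and t0 :: real
  assume X: "(\<forall>n. X n \<in> UNIV) \<and> X \<longlonglongrightarrow> t0"
    note [measurable] = sqi_meas[OF f]
    have "(\<lambda>i. nrm (Mk k) (\<lambda>z. cis (X i * \<theta> k z) * f z - cis (t0 * \<theta> k z) * f z)) \<longlonglongrightarrow> 0"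
      by (rule sqi_dominated(3)[OF _ _ f, where c = 1])
        (auto intro!: sqi_meas sqi_phase f tendsto_intros conjunct2[OF X] simp: norm_mult)
    then have "(\<lambda>i. norm (Ul k (X i) (emb (Mk k) f) - Ul k t0 (emb (Mk k) f))) \<longlonglongrightarrow> 0"
      unfolding Ul_emb[OF f] by (simp add: emb_diff[symmetric] norm_emb sqi_diff sqi_phase f)
    then have "(\<lambda>i. Ul k (X i) (emb (Mk k) f)) \<longlonglongrightarrow> Ul k t0 (emb (Mk k) f)" by (rule LIM_zero_cancel[OF tendsto_norm_zero_cancel])
    then show "((\<lambda>t. Ul k t (emb (Mk k) f)) \<circ> X) \<longlonglongrightarrow> Ul k t0 (emb (Mk k) f)" by (simp add: o_def)
qed

lemma gp_hierarchy_momentum: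
  assumes \<alpha>: "\<alpha> > real CARD('n::finite) / 2" and C: "C > 0" "CB TYPE('n) \<alpha> \<le> C" and \<mu>: "\<bar>\<mu>\<bar> = 1"
  shows "gp_hierarchy (\<lambda>k. embV (Mk k :: 'n pts measure)) Ul (Bl \<alpha> \<mu>) C"
proof
  fix k :: nat and s t c :: real and u v :: "'n kernel discrete \<Rightarrow>\<^sub>C complex"
  show "C > 0" by (rule C(1))
  show "subspace (embV (Mk k :: 'n pts measure))" by (rule subspace_embV)
  show "closed (embV (Mk k :: 'n pts measure))" by (rule closed_embV)
  show "Ul k t (integral {a..b} f) = integral {a..b} (\<lambda>s. Ul k t (f s))"
    if "f integrable_on {a..b}" "\<And>s. s \<in> {a..b} \<Longrightarrow> f s \<in> embV (Mk k)" "(\<lambda>s. Ul k t (f s)) integrable_on {a..b}"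
    for f :: "real \<Rightarrow> 'n kernel discrete \<Rightarrow>\<^sub>C complex" and a b :: real
    by (rule Ul_integral[OF that])
  {
    assume v: "v \<in> embV (Mk k)"
    then obtain f where f: "sqi (Mk k) f" "v = emb (Mk k) f" by (rule embV_cases)
    show "Ul k t v \<in> embV (Mk k)" unfolding f(2) Ul_emb[OF f(1)] by (intro emb_embV sqi_phase f)
    show "Ul k t (c *\<^sub>R v) = c *\<^sub>R Ul k t v"
      unfolding f(2) Ul_emb[OF f(1)] emb_scale[OF f(1), symmetric] Ul_emb[OF sqi_scale[OF f(1)]] emb_scale[OF sqi_phase[OF f(1)], symmetric]
      by (simp add: ac_simps)
    have "nrm (Mk k) (\<lambda>w. cis (t * \<theta> k w) * f w) = nrm (Mk k) f" by (simp add: nrm_def norm_mult)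
    then show "norm (Ul k t v) = norm v"
      unfolding f(2) Ul_emb[OF f(1)] norm_emb[OF f(1)] norm_emb[OF sqi_phase[OF f(1)]] .
    show "Ul k 0 v = v" unfolding f(2) Ul_emb[OF f(1)] by simp
    show "Ul k s (Ul k t v) = Ul k (s + t) v"
      unfolding f(2) Ul_emb[OF f(1)] Ul_emb[OF sqi_phase[OF f(1)]] by (simp add: mult.assoc[symmetric] cis_mult distrib_right)
    show "continuous_on UNIV (\<lambda>t. Ul k t v)" unfolding f(2) by (rule Ul_cont[OF f(1)])
    assume u: "u \<in> embV (Mk k)"
    then obtain g where g: "sqi (Mk k) g" "u = emb (Mk k) g" by (rule embV_cases)
    show "Ul k t (u + v) = Ul k t u + Ul k t v"
      unfolding f(2) g(2) emb_add[OF g(1) f(1), symmetric] Ul_emb[OF f(1)] Ul_emb[OF g(1)] Ul_emb[OF sqi_add[OF g(1) f(1)]]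
        emb_add[OF sqi_phase[OF g(1)] sqi_phase[OF f(1)], symmetric]
      by (simp add: distrib_left)
  }
  {
    assume v: "v \<in> embV (Mk (Suc k))"
    then obtain f where f: "sqi (Mk (Suc k)) f" "v = emb (Mk (Suc k)) f" by (rule embV_cases)
    note b = sqi_scale[OF Bop_sqi(1)[OF \<alpha> f(1)]]
    show "Bl \<alpha> \<mu> k v \<in> embV (Mk k)" unfolding f(2) Bl_emb[OF \<alpha> f(1)] by (rule emb_embV[OF b])
    show "Bl \<alpha> \<mu> k (c *\<^sub>R v) = c *\<^sub>R Bl \<alpha> \<mu> k v"
      unfolding f(2) Bl_emb[OF \<alpha> f(1)] emb_scale[OF f(1), symmetric] Bl_emb[OF \<alpha> sqi_scale[OF f(1)]] emb_scale[OF b, symmetric] Bop_scale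
      by (simp add: ac_simps)
    have "norm (Bl \<alpha> \<mu> k v) = nrm (Mk k) (Bop \<alpha> k f)"
      unfolding f(2) Bl_emb[OF \<alpha> f(1)] norm_emb[OF b] nrm_scale using \<mu> by (simp add: norm_mult)
    also have "\<dots> \<le> CB TYPE('n) \<alpha> * real k * nrm (Mk (Suc k)) f" by (rule Bop_sqi(2)[OF \<alpha> f(1)])
    also have "\<dots> \<le> C * real k * nrm (Mk (Suc k)) f" by (intro mult_right_mono C) auto
    finally show "norm (Bl \<alpha> \<mu> k v) \<le> C * real k * norm v" unfolding f(2) norm_emb[OF f(1)] .
    assume u: "u \<in> embV (Mk (Suc k))"
    then obtain g where g: "sqi (Mk (Suc k)) g" "u = emb (Mk (Suc k)) g" by (rule embV_cases)
    note b' = sqi_scale[OF Bop_sqi(1)[OF \<alpha> g(1)]]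
    show "Bl \<alpha> \<mu> k (u + v) = Bl \<alpha> \<mu> k u + Bl \<alpha> \<mu> k v"
      unfolding f(2) g(2) emb_add[OF g(1) f(1), symmetric] Bl_emb[OF \<alpha> f(1)] Bl_emb[OF \<alpha> g(1)] Bl_emb[OF \<alpha> sqi_add[OF g(1) f(1)]]
        emb_add[OF b' b, symmetric]
      using Bop_add[OF \<alpha> g(1) f(1)]
      by (intro emb_cong sqi_add b b' sqi_scale Bop_sqi(1) \<alpha> g f) (auto elim!: eventually_mono simp: algebra_simps)
  }
qed

section \<open>Mild solutions\<close>

text \<open>The isometric copy of the Sobolev space of level \<open>k\<close> inside the common
  Banach space.\<close>

definition Jm :: "real \<Rightarrow> nat \<Rightarrow> 'n::finite kernel \<Rightarrow> ('n kernel discrete \<Rightarrow>\<^sub>C complex)" where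
  "Jm \<alpha> k \<gamma> = emb (Mk k) (phi \<alpha> k \<gamma>)"

lemma Jm_V: "inH \<alpha> k \<gamma> \<Longrightarrow> Jm \<alpha> k \<gamma> \<in> embV (Mk k)"
  unfolding Jm_def by (intro emb_embV phi_sqi)

lemma norm_Jm: "inH \<alpha> k \<gamma> \<Longrightarrow> norm (Jm \<alpha> k \<gamma>) = Hnorm \<alpha> k \<gamma>"
  by (simp add: Jm_def norm_emb phi_sqi Hnorm_phi)

lemma Jm_diff:
  assumes "inH \<alpha> k \<gamma>" "inH \<alpha> k \<phi>"
  shows "Jm \<alpha> k (\<lambda>z. \<gamma> z - \<phi> z) = Jm \<alpha> k \<gamma> - Jm \<alpha> k \<phi>"
  unfolding Jm_def emb_diff[OF phi_sqi[OF assms(1)] phi_sqi[OF assms(2)], symmetric]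
  by (intro emb_cong phi_diff assms sqi_diff phi_sqi)

lemma Jm_Uop: "inH \<alpha> k \<gamma> \<Longrightarrow> Jm \<alpha> k (Uop k t \<gamma>) = Ul k t (Jm \<alpha> k \<gamma>)"
  unfolding Jm_def by (subst Ul_emb) (intro emb_cong Uop_phi sqi_phase phi_sqi | assumption)+

lemma Btil_phi:
  fixes \<gamma> :: "'n::finite kernel"
  assumes \<alpha>: "\<alpha> > real CARD('n) / 2" and \<gamma>: "inH \<alpha> (Suc k) \<gamma>"
  shows "inH \<alpha> k (Btil \<alpha> \<mu> k \<gamma>)" "Jm \<alpha> k (Btil \<alpha> \<mu> k \<gamma>) = Bl \<alpha> \<mu> k (Jm \<alpha> (Suc k) \<gamma>)"
proof -
  note b = B_ext_phi[OF \<alpha> \<gamma>]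
  show 1: "inH \<alpha> k (Btil \<alpha> \<mu> k \<gamma>)" unfolding Btil_def by (rule phi_scale(1)[OF b(1)])
  have "AE w in Mk k. phi \<alpha> k (Btil \<alpha> \<mu> k \<gamma>) w = - \<i> * of_real \<mu> * Bop \<alpha> k (phi \<alpha> (Suc k) \<gamma>) w"
    using phi_scale(2)[OF b(1), of "- \<i> * of_real \<mu>"] b(2) unfolding Btil_def by eventually_elim simp
  then show "Jm \<alpha> k (Btil \<alpha> \<mu> k \<gamma>) = Bl \<alpha> \<mu> k (Jm \<alpha> (Suc k) \<gamma>)"
    unfolding Jm_def Bl_emb[OF \<alpha> phi_sqi[OF \<gamma>]]
    by (intro emb_cong phi_sqi[OF 1] sqi_scale Bop_sqi(1) \<alpha> phi_sqi[OF \<gamma>])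
qed

lemma Hinner_pair: "inH \<alpha> k \<gamma> \<Longrightarrow> inH \<alpha> k \<phi> \<Longrightarrow> Hinner \<alpha> k \<gamma> \<phi> = pair (Mk k) (phi \<alpha> k \<phi>) (Jm \<alpha> k \<gamma>)"
  by (simp add: Jm_def pair_emb phi_sqi Hinner_phi)

lemma Jm_zeroD:
  fixes v :: "'n::finite kernel discrete \<Rightarrow>\<^sub>C complex"
  assumes v: "v \<in> embV (Mk k)" and \<alpha>: "\<alpha> \<ge> 0" and z: "\<And>\<phi>. inH \<alpha> k \<phi> \<Longrightarrow> pair (Mk k) (phi \<alpha> k \<phi>) v = 0"
  shows "v = 0"
proof (rule pair_zeroD[OF v])
  fix f :: "'n kernel" assume f: "sqi (Mk k) f"
  obtain \<phi> where \<phi>: "inH \<alpha> k \<phi>" "AE w in Mk k. phi \<alpha> k \<phi> w = f w" using phi_surj[OF f \<alpha>] by blast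
  show "pair (Mk k) f v = 0" using pair_cong[OF v phi_sqi[OF \<phi>(1)] f \<phi>(2)] z[OF \<phi>(1)] by simp
qed

lemma embV_Jm:
  fixes v :: "'n::finite kernel discrete \<Rightarrow>\<^sub>C complex"
  assumes "v \<in> embV (Mk k)" "\<alpha> \<ge> 0"
  shows "\<exists>\<gamma>. inH \<alpha> k \<gamma> \<and> Jm \<alpha> k \<gamma> = v"
proof -
  obtain f where f: "sqi (Mk k) f" "v = emb (Mk k) f" using assms(1) by (rule embV_cases)
  obtain \<gamma> where \<gamma>: "inH \<alpha> k \<gamma>" "AE w in Mk k. phi \<alpha> k \<gamma> w = f w" using phi_surj[OF f(1) assms(2)] by blast
  have "Jm \<alpha> k \<gamma> = v" unfolding Jm_def f(2) by (intro emb_cong phi_sqi \<gamma> f)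
  then show ?thesis using \<gamma>(1) by blast
qed

text \<open>The two sides of the weak identity differ by a functional of one element D of
  \<open>embV\<close>. Up to null sets the functions \<open>phi \<alpha> k \<phi>\<close> exhaust
  L2, so these functionals all vanish only if D is 0.\<close>

lemma mild_level_iff:
  fixes \<Gamma>0 :: "nat \<Rightarrow> 'n::finite kernel"
  assumes \<alpha>: "\<alpha> > real CARD('n) / 2" and \<mu>: "\<bar>\<mu>\<bar> = 1"
    and \<Gamma>0: "inH \<alpha> k (\<Gamma>0 k)" and t: "0 \<le> t" and \<Gamma>t: "inH \<alpha> k (\<Gamma> t k)"
    and \<Gamma>: "\<And>s. s \<in> {0..t} \<Longrightarrow> inH \<alpha> (Suc k) (\<Gamma> s (Suc k))"
    and c: "continuous_on {0..t} (\<lambda>s. Jm \<alpha> (Suc k) (\<Gamma> s (Suc k)))"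
  shows "(\<forall>\<phi>. inH \<alpha> k \<phi> \<longrightarrow> Hinner \<alpha> k (\<lambda>z. \<Gamma> t k z - Uop k t (\<Gamma>0 k) z) \<phi> =
      integral {0..t} (\<lambda>s. Hinner \<alpha> k (Uop k (t - s) (Btil \<alpha> \<mu> k (\<Gamma> s (Suc k)))) \<phi>)) \<longleftrightarrow>
    Jm \<alpha> k (\<Gamma> t k) = Ul k t (Jm \<alpha> k (\<Gamma>0 k)) + integral {0..t} (\<lambda>s. Ul k (t - s) (Bl \<alpha> \<mu> k (Jm \<alpha> (Suc k) (\<Gamma> s (Suc k)))))"
proof -
  \<comment> \<open>Any positive constant not below \<open>CB\<close> serves here; adding 1 gives
    one.\<close>
  interpret gp_hierarchy "\<lambda>k. embV (Mk k :: 'n pts measure)" Ul "Bl \<alpha> \<mu>" "CB TYPE('n) \<alpha> + 1"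
    by (rule gp_hierarchy_momentum[OF \<alpha>]) (use CB_nonneg[of "TYPE('n)" \<alpha>] \<mu> in auto)
  have \<alpha>0: "\<alpha> \<ge> 0" using half_card_pos[where 'n = 'n] \<alpha> by simp
  let ?h = "\<lambda>s. Ul k (t - s) (Bl \<alpha> \<mu> k (Jm \<alpha> (Suc k) (\<Gamma> s (Suc k))))"
  have ch: "continuous_on {0..t} ?h" by (intro cont_U cont_B continuous_intros c Jm_V \<Gamma> B_V)
  have ih: "?h integrable_on {0..t}" by (rule integrable_continuous_interval[OF ch])
  have hV: "?h s \<in> embV (Mk k)" if "s \<in> {0..t}" for s using that by (intro U_V B_V Jm_V \<Gamma>)
  have IV: "integral {0..t} ?h \<in> embV (Mk k)" by (rule integral_in_closed_subspace[OF V_sub V_closed ih hV])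
  define D where "D = Jm \<alpha> k (\<Gamma> t k) - Ul k t (Jm \<alpha> k (\<Gamma>0 k)) - integral {0..t} ?h"
  have DV: "D \<in> embV (Mk k)" unfolding D_def by (intro V_diff IV U_V Jm_V \<Gamma>0 \<Gamma>t)
  have e: "pair (Mk k) (phi \<alpha> k \<phi>) D = Hinner \<alpha> k (\<lambda>z. \<Gamma> t k z - Uop k t (\<Gamma>0 k) z) \<phi> -
      integral {0..t} (\<lambda>s. Hinner \<alpha> k (Uop k (t - s) (Btil \<alpha> \<mu> k (\<Gamma> s (Suc k)))) \<phi>)" if \<phi>: "inH \<alpha> k \<phi>" for \<phi>
  proof -
    have 1: "Hinner \<alpha> k (\<lambda>z. \<Gamma> t k z - Uop k t (\<Gamma>0 k) z) \<phi> = pair (Mk k) (phi \<alpha> k \<phi>) (Jm \<alpha> k (\<Gamma> t k) - Ul k t (Jm \<alpha> k (\<Gamma>0 k)))"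
      unfolding Hinner_pair[OF phi_diff(1)[OF \<Gamma>t Uop_phi(1)[OF \<Gamma>0]] \<phi>] Jm_diff[OF \<Gamma>t Uop_phi(1)[OF \<Gamma>0]] Jm_Uop[OF \<Gamma>0] ..
    have "integral {0..t} (\<lambda>s. Hinner \<alpha> k (Uop k (t - s) (Btil \<alpha> \<mu> k (\<Gamma> s (Suc k)))) \<phi>) = integral {0..t} (pair (Mk k) (phi \<alpha> k \<phi>) \<circ> ?h)"
    proof (rule Henstock_Kurzweil_Integration.integral_cong)
      fix s assume "s \<in> {0..t}"
      then have s: "inH \<alpha> (Suc k) (\<Gamma> s (Suc k))" by (rule \<Gamma>)
      show "Hinner \<alpha> k (Uop k (t - s) (Btil \<alpha> \<mu> k (\<Gamma> s (Suc k)))) \<phi> = (pair (Mk k) (phi \<alpha> k \<phi>) \<circ> ?h) s"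
        unfolding Hinner_pair[OF Uop_phi(1)[OF Btil_phi(1)[OF \<alpha> s]] \<phi>] Jm_Uop[OF Btil_phi(1)[OF \<alpha> s]] Btil_phi(2)[OF \<alpha> s] by simp
    qed
    also have "\<dots> = pair (Mk k) (phi \<alpha> k \<phi>) (integral {0..t} ?h)" by (rule integral_linear[OF ih bounded_linear_pair])
    finally show ?thesis unfolding 1 D_def by (simp add: bounded_linear.linear[OF bounded_linear_pair] linear_diff)
  qed
  have "(\<forall>\<phi>. inH \<alpha> k \<phi> \<longrightarrow> pair (Mk k) (phi \<alpha> k \<phi>) D = 0) \<longleftrightarrow> D = 0"
    using Jm_zeroD[OF DV \<alpha>0] linear_0[OF bounded_linear.linear[OF bounded_linear_pair]] by auto
  then show ?thesis by (simp add: e) (simp add: D_def algebra_simps)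
qed

section \<open>Weighted sequences of levels\<close>

lemma Hseq_norm_Jm:
  assumes "\<And>i. inH \<alpha> (Suc i) (\<Gamma> (Suc i))"
  shows "Hseq_norm \<alpha> \<eta> \<Gamma> = (\<Sum>i. \<eta> ^ Suc i * norm (Jm \<alpha> (Suc i) (\<Gamma> (Suc i))))"
  unfolding Hseq_norm_def by (simp add: norm_Jm assms)

lemma seq_diff_Jm:
  assumes "\<And>i. inH \<alpha> (Suc i) (\<Gamma> (Suc i))" "\<And>i. inH \<alpha> (Suc i) (\<Gamma>' (Suc i))"
  shows "inH \<alpha> (Suc i) (seq_diff \<Gamma> \<Gamma>' (Suc i))"
    "Jm \<alpha> (Suc i) (seq_diff \<Gamma> \<Gamma>' (Suc i)) = Jm \<alpha> (Suc i) (\<Gamma> (Suc i)) - Jm \<alpha> (Suc i) (\<Gamma>' (Suc i))"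
  unfolding seq_diff_def by (rule phi_diff(1) Jm_diff; rule assms)+

lemma inHseq_iff:
  "inHseq \<alpha> \<xi> \<Gamma> \<longleftrightarrow> (\<forall>i. inH \<alpha> (Suc i) (\<Gamma> (Suc i))) \<and> summable (\<lambda>i. \<xi> ^ Suc i * norm (Jm \<alpha> (Suc i) (\<Gamma> (Suc i))))"
proof -
  have "(\<forall>k\<ge>1. inH \<alpha> k (\<Gamma> k)) \<longleftrightarrow> (\<forall>i. inH \<alpha> (Suc i) (\<Gamma> (Suc i)))"
    by (metis One_nat_def Suc_le_D le_add1 plus_1_eq_Suc)
  then show ?thesis unfolding inHseq_def by (auto simp: norm_Jm simp del: power_Suc)
qed

lemma inHseq_seq_diff:
  assumes \<xi>: "\<xi> \<ge> 0" and i: "inHseq \<alpha> \<xi> \<Gamma>" "inHseq \<alpha> \<xi> \<Gamma>'"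
  shows "inHseq \<alpha> \<xi> (seq_diff \<Gamma> \<Gamma>')"
proof -
  have h: "inH \<alpha> (Suc i) (\<Gamma> (Suc i))" "inH \<alpha> (Suc i) (\<Gamma>' (Suc i))" for i using i by (auto simp: inHseq_iff)
  note d = seq_diff_Jm[where \<Gamma> = \<Gamma> and \<Gamma>' = \<Gamma>', OF h]
  have s: "summable (\<lambda>i. \<xi> ^ Suc i * norm (Jm \<alpha> (Suc i) (\<Gamma> (Suc i))) + \<xi> ^ Suc i * norm (Jm \<alpha> (Suc i) (\<Gamma>' (Suc i))))"
    using i by (intro summable_add) (auto simp: inHseq_iff)
  have "summable (\<lambda>i. \<xi> ^ Suc i * norm (Jm \<alpha> (Suc i) (seq_diff \<Gamma> \<Gamma>' (Suc i))))"
  proof (rule summable_comparison_test'[OF s, of 0])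
    fix i
    show "norm (\<xi> ^ Suc i * norm (Jm \<alpha> (Suc i) (seq_diff \<Gamma> \<Gamma>' (Suc i)))) \<le> \<xi> ^ Suc i * norm (Jm \<alpha> (Suc i) (\<Gamma> (Suc i))) + \<xi> ^ Suc i * norm (Jm \<alpha> (Suc i) (\<Gamma>' (Suc i)))"
      unfolding d distrib_left[symmetric] using \<xi> mult_left_mono[OF norm_triangle_ineq4, of "\<xi> ^ Suc i"] by (simp add: abs_mult)
  qed
  then show ?thesis using d(1) by (simp add: inHseq_iff)
qed

lemma Hseq_level_le:
  assumes \<xi>: "\<xi> > 0" and i: "inHseq \<alpha> \<xi> \<Gamma>"
  shows "norm (Jm \<alpha> (Suc i) (\<Gamma> (Suc i))) \<le> Hseq_norm \<alpha> \<xi> \<Gamma> / \<xi> ^ Suc i"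
proof -
  have h: "inH \<alpha> (Suc i) (\<Gamma> (Suc i))" for i using i by (simp add: inHseq_iff)
  have s: "summable (\<lambda>i. \<xi> ^ Suc i * norm (Jm \<alpha> (Suc i) (\<Gamma> (Suc i))))" using i by (simp add: inHseq_iff)
  have "\<xi> ^ Suc i * norm (Jm \<alpha> (Suc i) (\<Gamma> (Suc i))) \<le> Hseq_norm \<alpha> \<xi> \<Gamma>"
    unfolding Hseq_norm_Jm[OF h] using sum_le_suminf[OF s, of "{i}"] \<xi> by simp
  then show ?thesis using \<xi> by (simp add: pos_le_divide_eq mult.commute del: power_Suc)
qed

lemma Hseq_norm_le_add:
  assumes \<xi>: "\<xi> > 0" and i: "inHseq \<alpha> \<xi> \<Gamma>" "inHseq \<alpha> \<xi> \<Gamma>'"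
  shows "Hseq_norm \<alpha> \<xi> \<Gamma> \<le> Hseq_norm \<alpha> \<xi> \<Gamma>' + Hseq_norm \<alpha> \<xi> (seq_diff \<Gamma> \<Gamma>')"
proof -
  have h: "inH \<alpha> (Suc i) (\<Gamma> (Suc i))" "inH \<alpha> (Suc i) (\<Gamma>' (Suc i))" for i using i by (auto simp: inHseq_iff)
  note d = seq_diff_Jm[where \<Gamma> = \<Gamma> and \<Gamma>' = \<Gamma>', OF h]
  have id: "inHseq \<alpha> \<xi> (seq_diff \<Gamma> \<Gamma>')" using \<xi> by (intro inHseq_seq_diff i) auto
  have s: "summable (\<lambda>i. \<xi> ^ Suc i * norm (Jm \<alpha> (Suc i) (\<Gamma> (Suc i))))"
    "summable (\<lambda>i. \<xi> ^ Suc i * norm (Jm \<alpha> (Suc i) (\<Gamma>' (Suc i))))"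
    "summable (\<lambda>i. \<xi> ^ Suc i * norm (Jm \<alpha> (Suc i) (seq_diff \<Gamma> \<Gamma>' (Suc i))))"
    using i id by (auto simp: inHseq_iff)
  have "Hseq_norm \<alpha> \<xi> \<Gamma> \<le> (\<Sum>i. \<xi> ^ Suc i * norm (Jm \<alpha> (Suc i) (\<Gamma>' (Suc i))) + \<xi> ^ Suc i * norm (Jm \<alpha> (Suc i) (seq_diff \<Gamma> \<Gamma>' (Suc i))))"
    unfolding Hseq_norm_Jm[OF h(1)]
  proof (rule suminf_le[OF _ s(1) summable_add[OF s(2,3)]])
    show "\<xi> ^ Suc i * norm (Jm \<alpha> (Suc i) (\<Gamma> (Suc i))) \<le> \<xi> ^ Suc i * norm (Jm \<alpha> (Suc i) (\<Gamma>' (Suc i))) + \<xi> ^ Suc i * norm (Jm \<alpha> (Suc i) (seq_diff \<Gamma> \<Gamma>' (Suc i)))" for i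
      unfolding d distrib_left[symmetric] using \<xi> by (intro mult_left_mono norm_triangle_sub) auto
  qed
  also have "\<dots> = Hseq_norm \<alpha> \<xi> \<Gamma>' + Hseq_norm \<alpha> \<xi> (seq_diff \<Gamma> \<Gamma>')"
    unfolding Hseq_norm_Jm[where \<Gamma> = \<Gamma>', OF h(2)] Hseq_norm_Jm[where \<Gamma> = "seq_diff \<Gamma> \<Gamma>'", OF d(1)] by (rule suminf_add[OF s(2,3), symmetric])
  finally show ?thesis .
qed

lemma Hseq_norm_seq_diff_commute: "Hseq_norm \<alpha> \<xi> (seq_diff \<Gamma> \<Gamma>') = Hseq_norm \<alpha> \<xi> (seq_diff \<Gamma>' \<Gamma>)"
  if "inHseq \<alpha> \<xi> \<Gamma>" "inHseq \<alpha> \<xi> \<Gamma>'"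
proof -
  have h: "inH \<alpha> (Suc i) (\<Gamma> (Suc i))" "inH \<alpha> (Suc i) (\<Gamma>' (Suc i))" for i using that by (auto simp: inHseq_iff)
  show ?thesis
    unfolding Hseq_norm_Jm[where \<Gamma> = "seq_diff \<Gamma>' \<Gamma>", OF seq_diff_Jm(1)[OF h(2,1)]]
      Hseq_norm_Jm[where \<Gamma> = "seq_diff \<Gamma> \<Gamma>'", OF seq_diff_Jm(1)[OF h]] seq_diff_Jm(2)[where \<Gamma> = \<Gamma> and \<Gamma>' = \<Gamma>', OF h]
      seq_diff_Jm(2)[where \<Gamma> = \<Gamma>' and \<Gamma>' = \<Gamma>, OF h(2,1)]
    by (simp add: norm_minus_commute)
qed

text \<open>One level is at most the whole norm divided by its weight, which gives continuity level
  by level; compactness of \<open>{0..T}\<close> gives the uniform bound on which the iteration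
  relies.\<close>

lemma cont_H_levels:
  assumes \<eta>: "\<eta> > 0" and c: "cont_H \<alpha> \<eta> T \<Gamma>"
  shows "\<And>i t. t \<in> {0..T} \<Longrightarrow> inH \<alpha> (Suc i) (\<Gamma> t (Suc i))"
    and "\<And>i. continuous_on {0..T} (\<lambda>t. Jm \<alpha> (Suc i) (\<Gamma> t (Suc i)))"
    and "\<exists>M. \<forall>t\<in>{0..T}. \<forall>i. norm (Jm \<alpha> (Suc i) (\<Gamma> t (Suc i))) \<le> M / \<eta> ^ Suc i"
proof -
  have i: "inHseq \<alpha> \<eta> (\<Gamma> t)" if "t \<in> {0..T}" for t using c that by (auto simp: cont_H_def)
  have k: "\<exists>\<delta>>0. \<forall>t\<in>{0..T}. \<bar>t - t0\<bar> < \<delta> \<longrightarrow> Hseq_norm \<alpha> \<eta> (seq_diff (\<Gamma> t) (\<Gamma> t0)) < e" if "t0 \<in> {0..T}" "e > 0" for t0 e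
    using c that by (auto simp: cont_H_def)
  show h: "inH \<alpha> (Suc i) (\<Gamma> t (Suc i))" if "t \<in> {0..T}" for i t using i[OF that] by (simp add: inHseq_iff)
  have d: "inHseq \<alpha> \<eta> (seq_diff (\<Gamma> t) (\<Gamma> t0))" if "t \<in> {0..T}" "t0 \<in> {0..T}" for t t0
    using \<eta> that by (intro inHseq_seq_diff i) auto
  show "continuous_on {0..T} (\<lambda>t. Jm \<alpha> (Suc i) (\<Gamma> t (Suc i)))" for i
    unfolding continuous_on_iff
  proof (intro ballI allI impI)
    fix t0 e :: real assume t0: "t0 \<in> {0..T}" and e: "e > 0"
    then obtain \<delta> where \<delta>: "\<delta> > 0" "\<And>t. t \<in> {0..T} \<Longrightarrow> \<bar>t - t0\<bar> < \<delta> \<Longrightarrow> Hseq_norm \<alpha> \<eta> (seq_diff (\<Gamma> t) (\<Gamma> t0)) < \<eta> ^ Suc i * e"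
      using k[OF t0, of "\<eta> ^ Suc i * e"] \<eta> by auto
    have "dist (Jm \<alpha> (Suc i) (\<Gamma> t (Suc i))) (Jm \<alpha> (Suc i) (\<Gamma> t0 (Suc i))) < e" if t: "t \<in> {0..T}" "dist t t0 < \<delta>" for t
    proof -
      have "norm (Jm \<alpha> (Suc i) (seq_diff (\<Gamma> t) (\<Gamma> t0) (Suc i))) \<le> Hseq_norm \<alpha> \<eta> (seq_diff (\<Gamma> t) (\<Gamma> t0)) / \<eta> ^ Suc i"
        by (rule Hseq_level_le[OF \<eta> d[OF t(1) t0]])
      also have "\<dots> < e" using \<delta>(2)[OF t(1)] t(2) \<eta> by (simp add: dist_real_def pos_divide_less_eq mult.commute del: power_Suc)
      finally show ?thesis unfolding seq_diff_Jm(2)[where \<Gamma> = "\<Gamma> t" and \<Gamma>' = "\<Gamma> t0", OF h[OF t(1)] h[OF t0]] dist_norm .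
    qed
    then show "\<exists>d>0. \<forall>t\<in>{0..T}. dist t t0 < d \<longrightarrow> dist (Jm \<alpha> (Suc i) (\<Gamma> t (Suc i))) (Jm \<alpha> (Suc i) (\<Gamma> t0 (Suc i))) < e"
      using \<delta>(1) by blast
  qed
  have "continuous_on {0..T} (\<lambda>t. Hseq_norm \<alpha> \<eta> (\<Gamma> t))"
    unfolding continuous_on_iff
  proof (intro ballI allI impI)
    fix t0 e :: real assume t0: "t0 \<in> {0..T}" and e: "e > 0"
    then obtain \<delta> where \<delta>: "\<delta> > 0" "\<And>t. t \<in> {0..T} \<Longrightarrow> \<bar>t - t0\<bar> < \<delta> \<Longrightarrow> Hseq_norm \<alpha> \<eta> (seq_diff (\<Gamma> t) (\<Gamma> t0)) < e"
      using k[OF t0, of e] by auto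
    have "dist (Hseq_norm \<alpha> \<eta> (\<Gamma> t)) (Hseq_norm \<alpha> \<eta> (\<Gamma> t0)) < e" if t: "t \<in> {0..T}" "dist t t0 < \<delta>" for t
      using Hseq_norm_le_add[OF \<eta> i[OF t(1)] i[OF t0]] Hseq_norm_le_add[OF \<eta> i[OF t0] i[OF t(1)]] \<delta>(2)[OF t(1)] t(2)
        Hseq_norm_seq_diff_commute[OF i[OF t(1)] i[OF t0]] by (simp add: dist_real_def)
    then show "\<exists>d>0. \<forall>t\<in>{0..T}. dist t t0 < d \<longrightarrow> dist (Hseq_norm \<alpha> \<eta> (\<Gamma> t)) (Hseq_norm \<alpha> \<eta> (\<Gamma> t0)) < e"
      using \<delta>(1) by blast
  qed
  then have "bounded ((\<lambda>t. Hseq_norm \<alpha> \<eta> (\<Gamma> t)) ` {0..T})" by (intro compact_imp_bounded compact_continuous_image) auto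
  then obtain M where "\<forall>t\<in>{0..T}. \<bar>Hseq_norm \<alpha> \<eta> (\<Gamma> t)\<bar> \<le> M" by (auto simp: bounded_iff)
  then have M: "\<bar>Hseq_norm \<alpha> \<eta> (\<Gamma> t)\<bar> \<le> M" if "t \<in> {0..T}" for t using that by blast
  have "norm (Jm \<alpha> (Suc i) (\<Gamma> t (Suc i))) \<le> M / \<eta> ^ Suc i" if t: "t \<in> {0..T}" for t i
  proof -
    have "norm (Jm \<alpha> (Suc i) (\<Gamma> t (Suc i))) \<le> Hseq_norm \<alpha> \<eta> (\<Gamma> t) / \<eta> ^ Suc i" by (rule Hseq_level_le[OF \<eta> i[OF t]])
    also have "\<dots> \<le> M / \<eta> ^ Suc i" using M[OF t] \<eta> by (intro divide_right_mono) auto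
    finally show ?thesis .
  qed
  then show "\<exists>M. \<forall>t\<in>{0..T}. \<forall>i. norm (Jm \<alpha> (Suc i) (\<Gamma> t (Suc i))) \<le> M / \<eta> ^ Suc i" by blast
qed

text \<open>Continuity of each level becomes continuity in norm because the summable majorant b is
  independent of t: the Weierstrass test applies to the series of level differences.\<close>

lemma cont_HI:
  assumes \<eta>: "\<eta> > 0" and h: "\<And>i t. t \<in> {0..T} \<Longrightarrow> inH \<alpha> (Suc i) (\<Gamma> t (Suc i))"
    and c: "\<And>i. continuous_on {0..T} (\<lambda>t. Jm \<alpha> (Suc i) (\<Gamma> t (Suc i)))"
    and b: "\<And>i t. t \<in> {0..T} \<Longrightarrow> norm (Jm \<alpha> (Suc i) (\<Gamma> t (Suc i))) \<le> b i" and s: "summable (\<lambda>i. \<eta> ^ Suc i * b i)"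
  shows "cont_H \<alpha> \<eta> T \<Gamma>" "\<And>t. t \<in> {0..T} \<Longrightarrow> Hseq_norm \<alpha> \<eta> (\<Gamma> t) \<le> (\<Sum>i. \<eta> ^ Suc i * b i)"
proof -
  let ?v = "\<lambda>i t. Jm \<alpha> (Suc i) (\<Gamma> t (Suc i))"
  have s1: "summable (\<lambda>i. \<eta> ^ Suc i * norm (?v i t))" if t: "t \<in> {0..T}" for t
    by (rule summable_comparison_test'[OF s, of 0]) (use \<eta> b[OF t] in \<open>auto simp: abs_mult intro!: mult_left_mono\<close>)
  then have i: "inHseq \<alpha> \<eta> (\<Gamma> t)" if "t \<in> {0..T}" for t using that h by (auto simp: inHseq_iff)
  show "Hseq_norm \<alpha> \<eta> (\<Gamma> t) \<le> (\<Sum>i. \<eta> ^ Suc i * b i)" if t: "t \<in> {0..T}" for t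
    unfolding Hseq_norm_Jm[OF h[OF t]] by (rule suminf_le[OF _ s1[OF t] s]) (use \<eta> b[OF t] in \<open>auto intro!: mult_left_mono\<close>)
  have "\<exists>\<delta>>0. \<forall>t\<in>{0..T}. \<bar>t - t0\<bar> < \<delta> \<longrightarrow> Hseq_norm \<alpha> \<eta> (seq_diff (\<Gamma> t) (\<Gamma> t0)) < e" if t0: "t0 \<in> {0..T}" and e: "e > 0" for t0 e
  proof -
    let ?f = "\<lambda>i t. \<eta> ^ Suc i * norm (?v i t - ?v i t0)"
    have eq: "Hseq_norm \<alpha> \<eta> (seq_diff (\<Gamma> t) (\<Gamma> t0)) = (\<Sum>i. ?f i t)" if t: "t \<in> {0..T}" for t
      unfolding Hseq_norm_Jm[where \<Gamma> = "seq_diff (\<Gamma> t) (\<Gamma> t0)", OF seq_diff_Jm(1)[OF h[OF t] h[OF t0]]]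
        seq_diff_Jm(2)[where \<Gamma> = "\<Gamma> t" and \<Gamma>' = "\<Gamma> t0", OF h[OF t] h[OF t0]] ..
    have "uniform_limit {0..T} (\<lambda>n t. \<Sum>i<n. ?f i t) (\<lambda>t. \<Sum>i. ?f i t) sequentially"
    proof (rule Weierstrass_m_test)
      show "summable (\<lambda>i. 2 * (\<eta> ^ Suc i * b i))" by (rule summable_mult[OF s])
      fix i t assume t: "t \<in> {0..T}"
      have "norm (?v i t - ?v i t0) \<le> b i + b i" using norm_triangle_ineq4[of "?v i t" "?v i t0"] b[OF t, of i] b[OF t0, of i] by linarith
      then have "?f i t \<le> \<eta> ^ Suc i * (b i + b i)" using \<eta> by (intro mult_left_mono) auto
      then show "norm (?f i t) \<le> 2 * (\<eta> ^ Suc i * b i)" using \<eta> by (simp add: abs_mult)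
    qed
    then have "continuous_on {0..T} (\<lambda>t. \<Sum>i. ?f i t)"
      by (rule uniform_limit_theorem[rotated]) (auto intro!: continuous_intros c always_eventually)
    then obtain \<delta> where \<delta>: "\<delta> > 0" "\<And>t. t \<in> {0..T} \<Longrightarrow> dist t t0 < \<delta> \<Longrightarrow> dist (\<Sum>i. ?f i t) (\<Sum>i. ?f i t0) < e"
      using t0 e unfolding continuous_on_iff by blast
    have "Hseq_norm \<alpha> \<eta> (seq_diff (\<Gamma> t) (\<Gamma> t0)) < e" if t: "t \<in> {0..T}" "\<bar>t - t0\<bar> < \<delta>" for t
      unfolding eq[OF t(1)] using \<delta>(2)[OF t(1)] t(2) by (simp add: dist_real_def)
    then show ?thesis using \<delta>(1) by blast
  qed
  then show "cont_H \<alpha> \<eta> T \<Gamma>" unfolding cont_H_def using i by blast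
qed


section \<open>Existence, stability and uniqueness of mild solutions\<close>

lemma inHseq_summable_diff:
  fixes \<Gamma>0 \<Gamma>0' :: "nat \<Rightarrow> 'n::finite kernel"
  assumes "inHseq \<alpha> \<xi> \<Gamma>0" "inHseq \<alpha> \<xi> \<Gamma>0'" "\<xi> \<ge> 0"
  shows "summable (\<lambda>i. \<xi> ^ Suc i * norm (Jm \<alpha> (Suc i) (\<Gamma>0 (Suc i)) - Jm \<alpha> (Suc i) (\<Gamma>0' (Suc i))))"
    and "Hseq_norm \<alpha> \<xi> (seq_diff \<Gamma>0 \<Gamma>0') = (\<Sum>i. \<xi> ^ Suc i * norm (Jm \<alpha> (Suc i) (\<Gamma>0 (Suc i)) - Jm \<alpha> (Suc i) (\<Gamma>0' (Suc i))))"
proof -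
  have h: "inH \<alpha> (Suc i) (\<Gamma>0 (Suc i))" "inH \<alpha> (Suc i) (\<Gamma>0' (Suc i))" for i using assms by (auto simp: inHseq_iff)
  note d = seq_diff_Jm[where \<Gamma> = \<Gamma>0 and \<Gamma>' = \<Gamma>0', OF h]
  show "summable (\<lambda>i. \<xi> ^ Suc i * norm (Jm \<alpha> (Suc i) (\<Gamma>0 (Suc i)) - Jm \<alpha> (Suc i) (\<Gamma>0' (Suc i))))"
    using inHseq_seq_diff[OF assms(3,1,2)] unfolding inHseq_iff d(2) by blast
  show "Hseq_norm \<alpha> \<xi> (seq_diff \<Gamma>0 \<Gamma>0') = (\<Sum>i. \<xi> ^ Suc i * norm (Jm \<alpha> (Suc i) (\<Gamma>0 (Suc i)) - Jm \<alpha> (Suc i) (\<Gamma>0' (Suc i))))"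
    unfolding Hseq_norm_Jm[where \<Gamma> = "seq_diff \<Gamma>0 \<Gamma>0'", OF d(1)] d(2) ..
qed

lemma mild_existence:
  fixes \<Gamma>0 :: "nat \<Rightarrow> 'n::finite kernel"
  assumes \<alpha>: "\<alpha> > real CARD('n) / 2" and C: "C > 0" "CB TYPE('n) \<alpha> \<le> C" and \<mu>: "\<bar>\<mu>\<bar> = 1"
    and \<Gamma>0: "inHseq \<alpha> \<xi> \<Gamma>0" and T: "0 < T" "C * T < \<xi>"
  shows "\<exists>\<Gamma>. cont_H \<alpha> (\<xi> - C * T) T \<Gamma> \<and> mild \<alpha> \<mu> T \<Gamma>0 \<Gamma> \<and>
           (\<forall>t\<in>{0..T}. Hseq_norm \<alpha> (\<xi> - C * T) (\<Gamma> t) \<le> (\<xi> - C * T) / \<xi> * Hseq_norm \<alpha> \<xi> \<Gamma>0)"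
proof -
  interpret gp_hierarchy "\<lambda>k. embV (Mk k :: 'n pts measure)" Ul "Bl \<alpha> \<mu>" C
    by (rule gp_hierarchy_momentum[OF \<alpha> C \<mu>])
  have \<alpha>0: "\<alpha> \<ge> 0" using half_card_pos[where 'n = 'n] \<alpha> by simp
  define \<eta> where "\<eta> = \<xi> - C * T"
  have \<eta>: "\<eta> > 0" "\<xi> = \<eta> + C * T" using T by (auto simp: \<eta>_def)
  have h0: "inH \<alpha> (Suc i) (\<Gamma>0 (Suc i))" for i using \<Gamma>0 by (simp add: inHseq_iff)
  define g where "g = (\<lambda>k. Jm \<alpha> k (\<Gamma>0 k))"
  have g: "g (Suc i) \<in> embV (Mk (Suc i))" "summable (\<lambda>i. \<xi> ^ Suc i * norm (g (Suc i)))" for i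
    using \<Gamma>0 by (auto simp: g_def inHseq_iff intro: Jm_V)
  obtain \<gamma> b where \<gamma>: "\<And>i t. t \<in> {0..T} \<Longrightarrow> \<gamma> t (Suc i) \<in> embV (Mk (Suc i)) \<and> norm (\<gamma> t (Suc i)) \<le> b i \<and>
        \<gamma> t (Suc i) = Ul (Suc i) t (g (Suc i)) + integral {0..t} (\<lambda>s. Ul (Suc i) (t - s) (Bl \<alpha> \<mu> (Suc i) (\<gamma> s (Suc (Suc i)))))"
     "\<And>i. continuous_on {0..T} (\<lambda>t. \<gamma> t (Suc i))"
     "summable (\<lambda>i. \<eta> ^ Suc i * b i)" "(\<Sum>i. \<eta> ^ Suc i * b i) \<le> \<eta> / \<xi> * (\<Sum>i. \<xi> ^ Suc i * norm (g (Suc i)))"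
    using exists_solution[OF g(1) T(1) \<eta> g(2)] by blast
  \<comment> \<open>Any kernel with the prescribed image will do, since the mild equation and the
    norms see it only through \<open>Jm\<close>.\<close>
  define \<Gamma> where "\<Gamma> = (\<lambda>t k. SOME \<phi>. inH \<alpha> k \<phi> \<and> Jm \<alpha> k \<phi> = \<gamma> t k)"
  have \<Gamma>: "inH \<alpha> (Suc i) (\<Gamma> t (Suc i)) \<and> Jm \<alpha> (Suc i) (\<Gamma> t (Suc i)) = \<gamma> t (Suc i)" if "t \<in> {0..T}" for t i
    unfolding \<Gamma>_def using someI_ex[OF embV_Jm[OF _ \<alpha>0, of "\<gamma> t (Suc i)" "Suc i"]] \<gamma>(1)[OF that] by blast
  have cont: "continuous_on {0..T} (\<lambda>t. Jm \<alpha> (Suc i) (\<Gamma> t (Suc i)))" for i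
    by (rule continuous_on_eq[OF \<gamma>(2)[of i]]) (use \<Gamma> in auto)
  have bd: "norm (Jm \<alpha> (Suc i) (\<Gamma> t (Suc i))) \<le> b i" if "t \<in> {0..T}" for i t
    using conjunct1[OF conjunct2[OF \<gamma>(1)[OF that]]] conjunct2[OF \<Gamma>[OF that]] by metis
  note c = cont_HI[where \<Gamma> = \<Gamma> and b = b, OF \<eta>(1) _ cont _ \<gamma>(3)]
  have 1: "cont_H \<alpha> \<eta> T \<Gamma>" by (rule c(1)) (use \<Gamma> bd in blast)+
  have 2: "Hseq_norm \<alpha> \<eta> (\<Gamma> t) \<le> \<eta> / \<xi> * Hseq_norm \<alpha> \<xi> \<Gamma>0" if t: "t \<in> {0..T}" for t
  proof -
    have "Hseq_norm \<alpha> \<eta> (\<Gamma> t) \<le> (\<Sum>i. \<eta> ^ Suc i * b i)" by (rule c(2)[OF _ _ t]) (use \<Gamma> bd in blast)+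
    also have "\<dots> \<le> \<eta> / \<xi> * Hseq_norm \<alpha> \<xi> \<Gamma>0" using \<gamma>(4) unfolding Hseq_norm_Jm[OF h0] g_def .
    finally show ?thesis .
  qed
  have "mild \<alpha> \<mu> T \<Gamma>0 \<Gamma>"
    unfolding mild_def
  proof (intro allI impI ballI, goal_cases)
    case (1 k t \<phi>)
    then obtain i where k: "k = Suc i" by (cases k) auto
    have t: "0 \<le> t" "t \<in> {0..T}" and sub: "{0..t} \<subseteq> {0..T}" using 1 by auto
    have cs: "continuous_on {0..t} (\<lambda>s. Jm \<alpha> (Suc k) (\<Gamma> s (Suc k)))" unfolding k by (rule continuous_on_subset[OF cont sub])
    have "Jm \<alpha> k (\<Gamma> t k) = Ul k t (Jm \<alpha> k (\<Gamma>0 k)) + integral {0..t} (\<lambda>s. Ul k (t - s) (Bl \<alpha> \<mu> k (\<gamma> s (Suc k))))"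
      using \<gamma>(1)[OF t(2), of i] \<Gamma>[OF t(2), of i] unfolding g_def k by simp
    also have "integral {0..t} (\<lambda>s. Ul k (t - s) (Bl \<alpha> \<mu> k (\<gamma> s (Suc k)))) = integral {0..t} (\<lambda>s. Ul k (t - s) (Bl \<alpha> \<mu> k (Jm \<alpha> (Suc k) (\<Gamma> s (Suc k)))))"
      by (rule Henstock_Kurzweil_Integration.integral_cong) (use \<Gamma> sub in auto)
    finally have "\<forall>\<phi>. inH \<alpha> k \<phi> \<longrightarrow> Hinner \<alpha> k (\<lambda>z. \<Gamma> t k z - Uop k t (\<Gamma>0 k) z) \<phi> =
      integral {0..t} (\<lambda>s. Hinner \<alpha> k (Uop k (t - s) (Btil \<alpha> \<mu> k (\<Gamma> s (Suc k)))) \<phi>)"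
      by (subst mild_level_iff[OF \<alpha> \<mu> _ t(1)]) (use h0 \<Gamma> t sub cs k in auto)
    then show ?case using 1 by blast
  qed
  then show ?thesis using 1 2 unfolding \<eta>_def by blast
qed

text \<open>Collects what \<open>hierarchy_bound\<close> and \<open>hierarchy_zero\<close> need
  about the level norms of a difference; stability and uniqueness both start from it.\<close>

lemma mild_difference:
  fixes \<Gamma>0 \<Gamma>0' :: "nat \<Rightarrow> 'n::finite kernel"
  assumes \<alpha>: "\<alpha> > real CARD('n) / 2" and C: "C > 0" "CB TYPE('n) \<alpha> \<le> C" and \<mu>: "\<bar>\<mu>\<bar> = 1"
    and \<Gamma>0: "\<And>i. inH \<alpha> (Suc i) (\<Gamma>0 (Suc i))" "\<And>i. inH \<alpha> (Suc i) (\<Gamma>0' (Suc i))" and \<eta>: "\<eta> > 0"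
    and c: "cont_H \<alpha> \<eta> T \<Gamma>" "cont_H \<alpha> \<eta> T \<Gamma>'" and m: "mild \<alpha> \<mu> T \<Gamma>0 \<Gamma>" "mild \<alpha> \<mu> T \<Gamma>0' \<Gamma>'"
  defines "f \<equiv> \<lambda>i t. norm (Jm \<alpha> (Suc i) (\<Gamma> t (Suc i)) - Jm \<alpha> (Suc i) (\<Gamma>' t (Suc i)))"
  shows "\<And>i. continuous_on {0..T} (f i)"
    and "\<And>i t. t \<in> {0..T} \<Longrightarrow> f i t \<le> norm (Jm \<alpha> (Suc i) (\<Gamma>0 (Suc i)) - Jm \<alpha> (Suc i) (\<Gamma>0' (Suc i))) + C * real (Suc i) * integral {0..t} (f (Suc i))"
    and "\<exists>M. \<forall>t\<in>{0..T}. \<forall>i. f i t \<le> M / \<eta> ^ Suc i"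
    and "\<And>t. t \<in> {0..T} \<Longrightarrow> Hseq_norm \<alpha> \<eta> (seq_diff (\<Gamma> t) (\<Gamma>' t)) = (\<Sum>i. \<eta> ^ Suc i * f i t)"
    and "\<And>t. t \<in> {0..T} \<Longrightarrow> summable (\<lambda>i. \<eta> ^ Suc i * f i t)"
proof -
  interpret gp_hierarchy "\<lambda>k. embV (Mk k :: 'n pts measure)" Ul "Bl \<alpha> \<mu>" C
    by (rule gp_hierarchy_momentum[OF \<alpha> C \<mu>])
  note l = cont_H_levels[OF \<eta> c(1)] and l' = cont_H_levels[OF \<eta> c(2)]
  show "continuous_on {0..T} (f i)" for i unfolding f_def by (intro continuous_intros l l')
  have eq: "Jm \<alpha> (Suc i) (\<Gamma> t (Suc i)) = Ul (Suc i) t (Jm \<alpha> (Suc i) (\<Gamma>0 (Suc i))) + integral {0..t} (\<lambda>s. Ul (Suc i) (t - s) (Bl \<alpha> \<mu> (Suc i) (Jm \<alpha> (Suc (Suc i)) (\<Gamma> s (Suc (Suc i))))))"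
    if t: "t \<in> {0..T}" and \<Gamma>0: "\<And>i. inH \<alpha> (Suc i) (\<Gamma>0 (Suc i))" and c: "cont_H \<alpha> \<eta> T \<Gamma>" and m: "mild \<alpha> \<mu> T \<Gamma>0 \<Gamma>"
    for i t and \<Gamma> :: "real \<Rightarrow> nat \<Rightarrow> 'n kernel" and \<Gamma>0 :: "nat \<Rightarrow> 'n kernel"
  proof -
    note l = cont_H_levels[OF \<eta> c]
    have cs: "continuous_on {0..t} (\<lambda>s. Jm \<alpha> (Suc (Suc i)) (\<Gamma> s (Suc (Suc i))))" by (rule continuous_on_subset[OF l(2)]) (use t in auto)
    show ?thesis
      by (rule mild_level_iff[where \<Gamma> = \<Gamma> and ?\<Gamma>0.0 = \<Gamma>0, OF \<alpha> \<mu> \<Gamma>0 _ l(1)[OF t], THEN iffD1])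
        (use t m l(1) cs in \<open>auto simp: mild_def\<close>)
  qed
  show "f i t \<le> norm (Jm \<alpha> (Suc i) (\<Gamma>0 (Suc i)) - Jm \<alpha> (Suc i) (\<Gamma>0' (Suc i))) + C * real (Suc i) * integral {0..t} (f (Suc i))" if t: "t \<in> {0..T}" for i t
    unfolding f_def
    by (rule solution_diff_bound[OF l(2) _ l'(2) _ t _ _ eq[OF t \<Gamma>0(1) c(1) m(1)] eq[OF t \<Gamma>0(2) c(2) m(2)]]) (intro Jm_V l(1) l'(1) \<Gamma>0; assumption)+
  obtain M M' where M: "\<And>t i. t \<in> {0..T} \<Longrightarrow> norm (Jm \<alpha> (Suc i) (\<Gamma> t (Suc i))) \<le> M / \<eta> ^ Suc i"
      "\<And>t i. t \<in> {0..T} \<Longrightarrow> norm (Jm \<alpha> (Suc i) (\<Gamma>' t (Suc i))) \<le> M' / \<eta> ^ Suc i" using l(3) l'(3) by blast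
  have "f i t \<le> (M + M') / \<eta> ^ Suc i" if t: "t \<in> {0..T}" for t i
    using norm_triangle_ineq4[of "Jm \<alpha> (Suc i) (\<Gamma> t (Suc i))" "Jm \<alpha> (Suc i) (\<Gamma>' t (Suc i))"] M(1)[OF t, of i] M(2)[OF t, of i]
    unfolding f_def add_divide_distrib by linarith
  then show "\<exists>M. \<forall>t\<in>{0..T}. \<forall>i. f i t \<le> M / \<eta> ^ Suc i" by blast
  fix t assume t: "t \<in> {0..T}"
  have "inHseq \<alpha> \<eta> (\<Gamma> t)" "inHseq \<alpha> \<eta> (\<Gamma>' t)" using c t by (auto simp: cont_H_def)
  from inHseq_summable_diff[OF this less_imp_le[OF \<eta>]]
  show "Hseq_norm \<alpha> \<eta> (seq_diff (\<Gamma> t) (\<Gamma>' t)) = (\<Sum>i. \<eta> ^ Suc i * f i t)" "summable (\<lambda>i. \<eta> ^ Suc i * f i t)"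
    unfolding f_def by blast+
qed

text \<open>Here \<open>C * T = \<xi> / 5\<close> lies below \<open>\<eta> = 4/5 * \<xi>\<close>, so
  the remainder vanishes on the whole interval; resummation from \<eta> to
  \<open>\<eta> + \<xi> / 5 = \<xi>\<close> leaves the factor 4/5.\<close>

lemma mild_stability:
  fixes \<Gamma>0 \<Gamma>0' :: "nat \<Rightarrow> 'n::finite kernel"
  assumes \<alpha>: "\<alpha> > real CARD('n) / 2" and C: "C > 0" "CB TYPE('n) \<alpha> \<le> C" and \<mu>: "\<bar>\<mu>\<bar> = 1" and \<xi>: "\<xi> > 0"
    and \<Gamma>0: "inHseq \<alpha> \<xi> \<Gamma>0" "inHseq \<alpha> \<xi> \<Gamma>0'" and T: "T = \<xi> / (5 * C)"
    and c: "cont_H \<alpha> (4/5 * \<xi>) T \<Gamma>" "cont_H \<alpha> (4/5 * \<xi>) T \<Gamma>'" and m: "mild \<alpha> \<mu> T \<Gamma>0 \<Gamma>" "mild \<alpha> \<mu> T \<Gamma>0' \<Gamma>'"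
    and t: "t \<in> {0..T}"
  shows "Hseq_norm \<alpha> (4/5 * \<xi>) (seq_diff (\<Gamma> t) (\<Gamma>' t)) \<le> 4/5 * Hseq_norm \<alpha> \<xi> (seq_diff \<Gamma>0 \<Gamma>0')"
proof -
  define \<eta> where "\<eta> = 4/5 * \<xi>"
  define d where "d = \<xi> / 5"
  have \<eta>: "\<eta> > 0" "d \<ge> 0" "\<eta> + d = \<xi>" "d < \<eta>" using \<xi> by (auto simp: \<eta>_def d_def)
  have h: "inH \<alpha> (Suc i) (\<Gamma>0 (Suc i))" "inH \<alpha> (Suc i) (\<Gamma>0' (Suc i))" for i using \<Gamma>0 by (auto simp: inHseq_iff)
  note D = mild_difference[OF \<alpha> C \<mu> h \<eta>(1) c[folded \<eta>_def] m]
  define f where "f = (\<lambda>i t. norm (Jm \<alpha> (Suc i) (\<Gamma> t (Suc i)) - Jm \<alpha> (Suc i) (\<Gamma>' t (Suc i))))"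
  define a where "a = (\<lambda>i. norm (Jm \<alpha> (Suc i) (\<Gamma>0 (Suc i)) - Jm \<alpha> (Suc i) (\<Gamma>0' (Suc i))))"
  have s: "summable (\<lambda>i. \<xi> ^ Suc i * a i)" "Hseq_norm \<alpha> \<xi> (seq_diff \<Gamma>0 \<Gamma>0') = (\<Sum>i. \<xi> ^ Suc i * a i)"
    unfolding a_def by (rule inHseq_summable_diff[OF \<Gamma>0 less_imp_le[OF \<xi>]])+
  note S = duhamel_series[of \<eta> d a, OF \<eta>(1,2) _ s(1)[folded \<eta>(3)]]
  obtain M where M: "\<And>t i. t \<in> {0..T} \<Longrightarrow> f i t \<le> M / \<eta> ^ Suc i" using D(3) unfolding f_def by blast
  have a0: "a i \<ge> 0" for i by (simp add: a_def)
  have Ct: "C * t \<le> d" using t C by (simp add: T d_def field_simps)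
  have "f i t \<le> (\<Sum>m. real ((i + m) choose m) * d ^ m * a (i + m))" for i
  proof (rule hierarchy_bound[where f = f and a = a and c = d and \<tau> = 0 and T = T and C = C and \<eta> = \<eta> and M = M])
    show "f i t \<le> a i + C * real (Suc i) * integral {0..t} (f (Suc i))" if "0 \<le> t" "t \<le> T" for i t
      using D(2)[of t i] that by (simp add: f_def a_def)
    show "continuous_on {0..T} (f i)" for i unfolding f_def by (rule D(1))
    show "f i t \<le> M / \<eta> ^ Suc i" if "0 \<le> t" "t \<le> T" for i t using M that by simp
    show "summable (\<lambda>m. real ((i + m) choose m) * d ^ m * a (i + m))" by (rule S(1)[OF a0])
  qed (use C \<eta> a0 Ct t in auto)
  then have "(\<Sum>i. \<eta> ^ Suc i * f i t) \<le> (\<Sum>i. \<eta> ^ Suc i * (\<Sum>m. real ((i + m) choose m) * d ^ m * a (i + m)))"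
    using \<eta>(1) D(5)[OF t] S(2)[OF a0] by (intro suminf_le mult_left_mono) (auto simp: f_def)
  also have "\<dots> \<le> \<eta> / (\<eta> + d) * (\<Sum>n. (\<eta> + d) ^ Suc n * a n)" by (rule S(3)[OF a0])
  also have "\<dots> = 4/5 * Hseq_norm \<alpha> \<xi> (seq_diff \<Gamma>0 \<Gamma>0')" unfolding s(2) \<eta>(3) using \<xi> by (simp add: \<eta>_def)
  finally show ?thesis using D(4)[OF t] unfolding f_def \<eta>_def by simp
qed

text \<open>For T close to \<open>\<xi> / C\<close> the weight \<open>\<xi> - C * T\<close> falls
  below \<open>C * T\<close>, and a single iteration no longer covers the interval; the subdivision
  in \<open>hierarchy_zero\<close> does.\<close>

lemma mild_uniqueness:
  fixes \<Gamma>0 :: "nat \<Rightarrow> 'n::finite kernel"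
  assumes \<alpha>: "\<alpha> > real CARD('n) / 2" and C: "C > 0" "CB TYPE('n) \<alpha> \<le> C" and \<mu>: "\<bar>\<mu>\<bar> = 1" and \<eta>: "\<eta> > 0"
    and \<Gamma>0: "inHseq \<alpha> \<xi> \<Gamma>0"
    and c: "cont_H \<alpha> \<eta> T \<Gamma>" "cont_H \<alpha> \<eta> T \<Gamma>'" and m: "mild \<alpha> \<mu> T \<Gamma>0 \<Gamma>" "mild \<alpha> \<mu> T \<Gamma>0 \<Gamma>'"
    and t: "t \<in> {0..T}"
  shows "Hseq_norm \<alpha> \<eta> (seq_diff (\<Gamma> t) (\<Gamma>' t)) = 0"
proof -
  have h: "inH \<alpha> (Suc i) (\<Gamma>0 (Suc i))" for i using \<Gamma>0 by (simp add: inHseq_iff)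
  note D = mild_difference[OF \<alpha> C \<mu> h h \<eta> c m]
  obtain M where M: "\<And>t i. t \<in> {0..T} \<Longrightarrow> norm (Jm \<alpha> (Suc i) (\<Gamma> t (Suc i)) - Jm \<alpha> (Suc i) (\<Gamma>' t (Suc i))) \<le> M / \<eta> ^ Suc i"
    using D(3) by blast
  have "norm (Jm \<alpha> (Suc i) (\<Gamma> t (Suc i)) - Jm \<alpha> (Suc i) (\<Gamma>' t (Suc i))) = 0" for i
    by (rule hierarchy_zero[where f = "\<lambda>i t. norm (Jm \<alpha> (Suc i) (\<Gamma> t (Suc i)) - Jm \<alpha> (Suc i) (\<Gamma>' t (Suc i)))" and C = C and \<eta> = \<eta> and T = T and M = M])
      (use C \<eta> t M D(1) D(2)[of _ i for i] in auto)
  then show ?thesis unfolding D(4)[OF t] by simp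
qed

theorem theorem2p5:
  fixes \<alpha> :: real
  assumes "\<alpha> > real CARD('n::finite) / 2"
  shows "\<exists>C>0. \<forall>(\<mu>::real) (\<xi>::real) (\<Gamma>0 :: nat \<Rightarrow> 'n kernel).
    \<mu> \<in> {1, -1} \<and> 0 < \<xi> \<and> \<xi> < 1 \<and> inHseq \<alpha> \<xi> \<Gamma>0 \<longrightarrow>
     (\<forall>T. 0 < T \<and> T < \<xi> / C \<longrightarrow>
        (\<exists>\<Gamma>. cont_H \<alpha> (\<xi> - C * T) T \<Gamma> \<and> mild \<alpha> \<mu> T \<Gamma>0 \<Gamma> \<and>
           (\<forall>t\<in>{0..T}. Hseq_norm \<alpha> (\<xi> - C * T) (\<Gamma> t) \<le> (\<xi> - C * T) / \<xi> * Hseq_norm \<alpha> \<xi> \<Gamma>0)))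
   \<and> (\<forall>\<Gamma>0' \<Gamma> \<Gamma>'. inHseq \<alpha> \<xi> \<Gamma>0' \<and>
        cont_H \<alpha> (4/5 * \<xi>) (\<xi> / (5 * C)) \<Gamma> \<and> cont_H \<alpha> (4/5 * \<xi>) (\<xi> / (5 * C)) \<Gamma>' \<and>
        mild \<alpha> \<mu> (\<xi> / (5 * C)) \<Gamma>0 \<Gamma> \<and> mild \<alpha> \<mu> (\<xi> / (5 * C)) \<Gamma>0' \<Gamma>' \<longrightarrow>
        (\<forall>t\<in>{0..\<xi> / (5 * C)}. Hseq_norm \<alpha> (4/5 * \<xi>) (seq_diff (\<Gamma> t) (\<Gamma>' t))
            \<le> 4/5 * Hseq_norm \<alpha> \<xi> (seq_diff \<Gamma>0 \<Gamma>0')))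
   \<and> (\<forall>T \<Gamma> \<Gamma>'. 0 < T \<and> T < \<xi> / C \<and>
        cont_H \<alpha> (\<xi> - C * T) T \<Gamma> \<and> cont_H \<alpha> (\<xi> - C * T) T \<Gamma>' \<and>
        mild \<alpha> \<mu> T \<Gamma>0 \<Gamma> \<and> mild \<alpha> \<mu> T \<Gamma>0 \<Gamma>' \<longrightarrow>
        (\<forall>t\<in>{0..T}. Hseq_norm \<alpha> (\<xi> - C * T) (seq_diff (\<Gamma> t) (\<Gamma>' t)) = 0))"
proof -
  \<comment> \<open>\<open>CB\<close> depends only on the dimension and \<alpha>; adding 1 makes the
    constant positive and keeps the operator bound.\<close>
  define C where "C = CB TYPE('n) \<alpha> + 1"
  have C: "C > 0" "CB TYPE('n) \<alpha> \<le> C" using CB_nonneg[of "TYPE('n)" \<alpha>] by (auto simp: C_def)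
  show ?thesis
  proof (rule exI[of _ C], intro conjI C(1) allI impI ballI, goal_cases)
    case (1 \<mu> \<xi> \<Gamma>0 T)
    then have "\<bar>\<mu>\<bar> = 1" "C * T < \<xi>" using C(1) by (auto simp: field_simps)
    then show ?case using mild_existence[OF assms C, of \<mu> \<xi> \<Gamma>0 T] 1 by blast
  next
    case (2 \<mu> \<xi> \<Gamma>0 \<Gamma>0' \<Gamma> \<Gamma>' t)
    then have "\<bar>\<mu>\<bar> = 1" by auto
    then show ?case using mild_stability[OF assms C, of \<mu> \<xi> \<Gamma>0 \<Gamma>0' "\<xi> / (5 * C)" \<Gamma> \<Gamma>' t] 2 by blast
  next
    case (3 \<mu> \<xi> \<Gamma>0 T \<Gamma> \<Gamma>' t)
    then have "\<bar>\<mu>\<bar> = 1" "\<xi> - C * T > 0" using C(1) by (auto simp: field_simps)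
    then show ?case using mild_uniqueness[OF assms C, of \<mu> "\<xi> - C * T" \<xi> \<Gamma>0 T \<Gamma> \<Gamma>' t] 3 by blast
  qed
qed

end
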